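(* Let $\alpha>0$ and $\ell=0,\dots,h^*$. Then the functions $F^*_\ell(s,\alpha)$ are entire and $F(s,\alpha)$ satisfies the functional equation \[ F(s,\alpha) = \frac{\omega}{i\sqrt{2\pi}} \big(\frac{\sqrt{N}}{4\pi}\big)^{1-2s} \sum_{\ell=0}^{h^*} a_\ell \Gamma\big(2(1-s)-1/2- \ell\big) F^*_\ell(1-s,\alpha). \]
   Context: Let $f$ be a cusp form of half-integral weight $\kappa=k/2$ and level $N$, where $k>0$ is an odd integer and $4\mid N$, and let $L_f(s)$ be its Hecke $L$-function. It is entire and satisfies $\Lambda_f(s)=\omega\Lambda_{f^*}(\kappa-s)$ with $\Lambda_f(s)=(\sqrt{N}/2\pi)^s\Gamma(s)L_f(s)$, $\omega=i^{-\kappa}$, and $f^*(z)=(\sqrt{N}z)^{-\kappa}f(-1/Nz)$. Put $F(s)=L_f(s+\frac{\kappa-1}{2})$ and $F^*(s)=L_{f^*}(s+\frac{\kappa-1}{2})$, with Dirichlet coefficients $a(n)$ and $a^*(n)$ respectively (both series converge absolutely for $\sigma>1$). For $\alpha>0$ the standard twist is $F(s,\alpha)=\sum_{n\ge1}a(n)n^{-s}e(-\alpha\sqrt{n})$, $e(x)=e^{2\pi i x}$. Write $k=2h+1$ with $h\in\{0,1,2,\dots\}$, $\mu=(2h-1)/4$, $h^*=\max(0,h-1)$; $n_\alpha=N\alpha^2/4$, $\nu_\alpha=\sqrt{n_\alpha}$, and let $\nu$ run over $\pm\sqrt{n}$, $n=1,2,\dots$ (with $a^*(m)=0$ if $m\notin\mathbb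 N$). For $\ell=0,\dots,h^*$ define $c^*(\nu^2)=c^*_\ell(\nu^2)$ by $c^*(\nu^2)=-e^{i\pi\mu}a^*(\nu^2)$ if $\nu\ge1$; $=e^{i\pi(1/2+\ell-\mu)}a^*(\nu^2)$ if $-\nu_\alpha<\nu\le-1$; $=e^{-i\pi\mu}a^*(\nu^2)$ if $\nu<-\nu_\alpha$. Define the generalized Dirichlet series (absolutely convergent for $\sigma>1$) $F^+_\ell(s,\alpha)=\sum_{\nu>-\nu_\alpha} \frac{c^*(\nu^2)}{|\nu|^{1/2+\ell}|\nu+\nu_\alpha|^{2s-1/2-\ell}}$, $F^-_\ell(s,\alpha)=\sum_{\nu<-\nu_\alpha} \frac{c^*(\nu^2)}{|\nu|^{1/2+\ell}|\nu+\nu_\alpha|^{2s-1/2-\ell}}$, and $F^*_\ell(s,\alpha)=e^{-i\pi s}F^+_\ell(s,\alpha)+e^{i\pi s}F^-_\ell(s,\alpha)$. The coefficients $a_\ell=a_\ell(h^* )$ are defined by the polynomial identity $\prod_{1\le j\le h^*}(X+2j-1)=\sum_{\ell=0}^{h^*}a_\ell\prod_{0\le \nu\le h^*-1-\ell}(X+\nu)$ (empty products equal 1; $a_0=1$).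
   Formalization: The root number is taken as ω = i^κ instead of ω = i^{-κ}: with f*(z) = (√N z)^{-κ} f(-1/Nz), the equation Λ_f(s) = ωΛ_{f*}(κ-s) forces i^κ, e.g. for f(z) = η(24z), N = 576, κ = 1/2. *)

theory Defs
  imports
    "HOL-Complex_Analysis.Complex_Analysis"
    "HOL-Number_Theory.Number_Theory"
    "HOL-Computational_Algebra.Polynomial"
begin

section \<open>Cusp forms of half-integral weight\<close>

text \<open>
  Shimura's extension of the Jacobi symbol: for odd \<open>d\<close>, the symbol \<open>(c/d)\<close> is the Jacobi symbol
  \<open>(c/|d|)\<close>, with an extra sign if \<open>c\<close> and \<open>d\<close> are both negative; in particular \<open>(0/\<plusminus>1) = 1\<close>.
\<close>
definition shimura_symbol :: "int \<Rightarrow> int \<Rightarrow> int" where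
  "shimura_symbol c d =
     (if c < 0 \<and> d < 0 then -1 else 1) *
     prod_mset (image_mset (\<lambda>p. Legendre c (int p)) (prime_factorization (nat \<bar>d\<bar>)))"

definition eps_factor :: "int \<Rightarrow> complex" where
  "eps_factor d = (if d mod 4 = 1 then 1 else \<i>)"

text \<open>
  The theta multiplier \<open>j(\<gamma>,z) = \<theta>(\<gamma>z)/\<theta>(z)\<close> on \<open>\<Gamma>\<^sub>0(4)\<close>, where \<open>(c,d)\<close> is the lower row of \<open>\<gamma>\<close>.
\<close>
definition theta_multiplier :: "int \<Rightarrow> int \<Rightarrow> complex \<Rightarrow> complex" where
  "theta_multiplier c d z =
     of_int (shimura_symbol c d) / eps_factor d * csqrt (of_int c * z + of_int d)"

definition moebius_action :: "int \<Rightarrow> int \<Rightarrow> int \<Rightarrow> int \<Rightarrow> complex \<Rightarrow> complex" where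
  "moebius_action a b c d z = (of_int a * z + of_int b) / (of_int c * z + of_int d)"

definition dirichlet_character :: "nat \<Rightarrow> (int \<Rightarrow> complex) \<Rightarrow> bool" where
  "dirichlet_character N \<psi> \<longleftrightarrow>
     \<psi> 1 = 1 \<and> (\<forall>m n. \<psi> (m * n) = \<psi> m * \<psi> n) \<and>
     (\<forall>m. \<psi> (m + int N) = \<psi> m) \<and> (\<forall>m. \<psi> m = 0 \<longleftrightarrow> \<not> coprime m (int N))"

text \<open>
  Cusp forms of weight \<open>k/2\<close> and character \<open>\<psi>\<close> on \<open>\<Gamma>\<^sub>0(N)\<close>, for odd \<open>k\<close> and \<open>4 | N\<close>. Only the values on
  the upper half-plane matter. The last clause is vanishing at all cusps: every translate of \<open>f\<close>
  under the weight \<open>k/2\<close> action of \<open>SL\<^sub>2(\<int>)\<close> tends to \<open>0\<close>, uniformly in the real part, as the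
  imaginary part tends to infinity (the missing multipliers have absolute value 1).
\<close>
definition cusp_form :: "nat \<Rightarrow> nat \<Rightarrow> (int \<Rightarrow> complex) \<Rightarrow> (complex \<Rightarrow> complex) \<Rightarrow> bool" where
  "cusp_form k N \<psi> f \<longleftrightarrow>
     f holomorphic_on {z. Im z > 0} \<and>
     (\<forall>a b c d z. a * d - b * c = 1 \<longrightarrow> int N dvd c \<longrightarrow> Im z > 0 \<longrightarrow>
        f (moebius_action a b c d z) = \<psi> d * theta_multiplier c d z ^ k * f z) \<and>
     (\<forall>a b c d. a * d - b * c = 1 \<longrightarrow>
        ((\<lambda>z. f (moebius_action a b c d z) / csqrt (of_int c * z + of_int d) ^ k) \<longlongrightarrow> 0)
          (filtercomap Im at_top))"

text \<open>
  The dual form \<open>f\<^sup>*(z) = (\<surd>N z)\<^bsup>-\<kappa>\<^esup> f(-1/(N z))\<close>, with \<open>\<kappa> = k/2\<close> and the principal branch.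
\<close>
definition dual_form :: "nat \<Rightarrow> nat \<Rightarrow> (complex \<Rightarrow> complex) \<Rightarrow> complex \<Rightarrow> complex" where
  "dual_form k N f z =
     (of_real (sqrt (real N)) * z) powr (- of_real (real k / 2)) * f (- 1 / (of_nat N * z))"

text \<open>
  The root number \<open>\<omega>\<close> in \<open>\<Lambda>\<^sub>f(s) = \<omega> \<Lambda>\<^bsub>f*\<^esub>(\<kappa> - s)\<close>. On the imaginary axis
  \<open>f(\<i>/(\<surd>N y)) = (\<i> y)\<^sup>\<kappa> f\<^sup>*(\<i> y/\<surd>N)\<close>, so substituting \<open>y \<rightarrow> 1/y\<close> in
  \<open>\<Lambda>\<^sub>f(s) = \<integral>\<^sub>0\<^sup>\<infinity> f(\<i> y/\<surd>N) y\<^bsup>s-1\<^esup> dy\<close> gives \<open>\<omega> = \<i>\<^sup>\<kappa>\<close>. Writing \<open>\<i>\<^bsup>-\<kappa>\<^esup>\<close> instead, with the same \<open>f\<^sup>*\<close>,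
  is wrong by the factor \<open>\<i>\<^bsup>2\<kappa>\<^esup> = \<i>\<^sup>k \<noteq> 1\<close> (it belongs to the equation with \<open>f\<close> and \<open>f\<^sup>*\<close> exchanged).
\<close>
definition root_number :: "nat \<Rightarrow> complex" where
  "root_number k = \<i> powr (of_real (real k / 2))"

section \<open>Dirichlet coefficients\<close>

definition fourier_coeffs :: "(complex \<Rightarrow> complex) \<Rightarrow> nat \<Rightarrow> complex" where
  "fourier_coeffs f =
     (THE b. \<forall>z. Im z > 0 \<longrightarrow> (\<lambda>n. b n * exp (2 * of_real pi * \<i> * of_nat n * z)) sums f z)"

text \<open>
  With \<open>L\<^sub>f(s) = \<Sum> b(n) n\<^bsup>-s\<^esup>\<close>, these are the coefficients \<open>b(n) n\<^bsup>-(\<kappa>-1)/2\<^esup>\<close> of \<open>F(s) = L\<^sub>f(s + (\<kappa>-1)/2)\<close>.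
\<close>
definition norm_coeff :: "nat \<Rightarrow> (complex \<Rightarrow> complex) \<Rightarrow> nat \<Rightarrow> complex" where
  "norm_coeff k f n = fourier_coeffs f n / of_real (real n powr ((real k / 2 - 1) / 2))"

definition dual_coeff :: "nat \<Rightarrow> nat \<Rightarrow> (complex \<Rightarrow> complex) \<Rightarrow> real \<Rightarrow> complex" where
  "dual_coeff k N f x =
     (if x \<in> \<nat> \<and> x \<ge> 1 then norm_coeff k (dual_form k N f) (nat \<lfloor>x\<rfloor>) else 0)"

section \<open>The standard twist and the associated Dirichlet series\<close>

definition standard_twist :: "nat \<Rightarrow> (complex \<Rightarrow> complex) \<Rightarrow> real \<Rightarrow> complex \<Rightarrow> complex" where
  "standard_twist k f \<alpha> s =
     (\<Sum>\<^sub>\<infinity>n\<in>{1..}. norm_coeff k f n * of_nat n powr (- s) *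
        exp (- 2 * of_real pi * \<i> * of_real (\<alpha> * sqrt (real n))))"

text \<open>In the following, \<open>k = 2 h + 1\<close>; the truncated subtraction in \<open>h_star\<close> is \<open>max(0, h - 1)\<close>.\<close>

definition h_star :: "nat \<Rightarrow> nat" where
  "h_star h = h - 1"

definition mu :: "nat \<Rightarrow> real" where
  "mu h = (2 * real h - 1) / 4"

definition nu_alpha :: "nat \<Rightarrow> real \<Rightarrow> real" where
  "nu_alpha N \<alpha> = sqrt (real N * \<alpha>\<^sup>2 / 4)"

definition nu_set :: "real set" where
  "nu_set = {\<nu>. \<exists>n::nat. n \<ge> 1 \<and> (\<nu> = sqrt (real n) \<or> \<nu> = - sqrt (real n))}"

definition c_star :: "nat \<Rightarrow> nat \<Rightarrow> (complex \<Rightarrow> complex) \<Rightarrow> real \<Rightarrow> nat \<Rightarrow> real \<Rightarrow> complex" where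
  "c_star h N f \<alpha> l \<nu> =
     (if \<nu> \<ge> 1 then
        - exp (\<i> * of_real (pi * mu h)) * dual_coeff (2 * h + 1) N f (\<nu>\<^sup>2)
      else if - nu_alpha N \<alpha> < \<nu> \<and> \<nu> \<le> -1 then
        exp (\<i> * of_real (pi * (1/2 + real l - mu h))) * dual_coeff (2 * h + 1) N f (\<nu>\<^sup>2)
      else if \<nu> < - nu_alpha N \<alpha> then
        exp (- \<i> * of_real (pi * mu h)) * dual_coeff (2 * h + 1) N f (\<nu>\<^sup>2)
      else 0)"

definition F_term :: "nat \<Rightarrow> nat \<Rightarrow> (complex \<Rightarrow> complex) \<Rightarrow> real \<Rightarrow> nat \<Rightarrow> complex \<Rightarrow> real \<Rightarrow> complex" where
  "F_term h N f \<alpha> l s \<nu> =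
     c_star h N f \<alpha> l \<nu> /
       (of_real (\<bar>\<nu>\<bar> powr (1/2 + real l)) *
        of_real \<bar>\<nu> + nu_alpha N \<alpha>\<bar> powr (2 * s - 1/2 - of_nat l))"

definition F_plus :: "nat \<Rightarrow> nat \<Rightarrow> (complex \<Rightarrow> complex) \<Rightarrow> real \<Rightarrow> nat \<Rightarrow> complex \<Rightarrow> complex" where
  "F_plus h N f \<alpha> l s = (\<Sum>\<^sub>\<infinity>\<nu>\<in>{\<nu>\<in>nu_set. \<nu> > - nu_alpha N \<alpha>}. F_term h N f \<alpha> l s \<nu>)"

definition F_minus :: "nat \<Rightarrow> nat \<Rightarrow> (complex \<Rightarrow> complex) \<Rightarrow> real \<Rightarrow> nat \<Rightarrow> complex \<Rightarrow> complex" where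
  "F_minus h N f \<alpha> l s = (\<Sum>\<^sub>\<infinity>\<nu>\<in>{\<nu>\<in>nu_set. \<nu> < - nu_alpha N \<alpha>}. F_term h N f \<alpha> l s \<nu>)"

definition F_star :: "nat \<Rightarrow> nat \<Rightarrow> (complex \<Rightarrow> complex) \<Rightarrow> real \<Rightarrow> nat \<Rightarrow> complex \<Rightarrow> complex" where
  "F_star h N f \<alpha> l s =
     exp (- \<i> * of_real pi * s) * F_plus h N f \<alpha> l s +
     exp (\<i> * of_real pi * s) * F_minus h N f \<alpha> l s"

text \<open>
  The coefficients \<open>a\<^sub>l(H)\<close> with
  \<open>\<Prod>\<^bsub>1\<le>j\<le>H\<^esub> (X + 2j - 1) = \<Sum>\<^bsub>0\<le>l\<le>H\<^esub> a\<^sub>l(H) \<Prod>\<^bsub>0\<le>\<nu>\<le>H-1-l\<^esub> (X + \<nu>)\<close>, extended by \<open>0\<close> for \<open>l > H\<close> to make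
  them unique as a sequence.
\<close>
definition a_coeff :: "nat \<Rightarrow> nat \<Rightarrow> real" where
  "a_coeff H =
     (THE a. (\<forall>l>H. a l = 0) \<and>
        (\<Prod>j\<in>{1..H}. [:2 * real j - 1, 1:]) =
        (\<Sum>l\<le>H. Polynomial.smult (a l) (\<Prod>i<H - l. [:real i, 1:])))"

end

theory Submission
  imports Defs "HOL-Probability.Probability"
begin

text \<open>
  Let \<open>b\<close>, \<open>b*\<close> be the Fourier coefficients of \<open>f\<close>, \<open>f*\<close>, and put \<open>g = 4\<pi>/\<surd>N\<close>, \<open>c = 2\<pi>\<alpha>\<close>. Integrating the
  transformation law \<open>f \<leftrightarrow> f*\<close> on the imaginary axis against a Gaussian turns it into
  \<open>\<Sum> b(n) e\<^bsup>-w\<surd>n\<^esup> = K w \<Sum> b*(n) / (w\<^sup>2 + g\<^sup>2n)\<^bsup>h+1\<^esup>\<close>, first for \<open>w > 0\<close> and then for \<open>Re w > 0\<close>. Along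
  \<open>w = x + \<i>c\<close> the Mellin transform of the left side in \<open>x\<close> is \<open>\<Gamma>(S)\<close> times the standard twist. The right side
  is obtained from a series of double poles \<open>1/(x + \<i>(c + g\<nu>))\<^sup>2\<close>, \<open>\<nu> = \<plusminus>\<surd>n\<close>, by the Euler operators
  \<open>w d/dw + 2j + 1\<close>, \<open>1 \<le> j \<le> h*\<close>; on the Mellin side these act by the polynomial \<open>\<Prod> (X + 2j - 1)\<close>, whose
  expansion in rising factorials yields the \<open>a\<^sub>l\<close>. The kernel solutions \<open>w\<^bsup>-2j-1\<^esup>\<close> of these operators are
  subtracted to make the double-pole series decay rapidly; its Mellin transform then continues the series
  \<open>F\<^sup>*\<^sub>l\<close> to entire functions, the pole caused by \<open>\<nu> = -\<nu>\<^sub>\<alpha>\<close> being cancelled by \<open>1/\<Gamma>(2 - S)\<close>.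

  Absolute convergence is the mean square bound for \<open>b\<close>, \<open>b*\<close>: \<open>\<bar>f(z)\<bar>\<^sup>4 (Im z)\<^sup>k\<close> is invariant under a
  congruence subgroup and hence bounded.
\<close>


section \<open>Mellin transforms\<close>

text \<open>Exponent h + 1 would produce partial fractions of every order up to h + 1. Only w/(w^2 +
  t)^2 splits into exactly two double poles, so for h >= 1 the proof starts there: w d/dw + 2r + 3
  sends w/(w^2 + t)^(r+2) to 2(r+2) t w/(w^2 + t)^(r+3), and h - 1 steps reach exponent h + 1. After
  division by Gamma(S), w d/dw + 2j + 1 acts as X + 2j - 1 with X = \<open>mshift c\<close>; this is
  the origin of the product defining the a_l. Rising factorials fit because X + r sends E(S) Gamma(2
  + r - S) to (E(S) - ic E(S - 1)) Gamma(3 + r - S). On a series of (i delta)^(S-2) with delta = c +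
  g nu, that difference multiplies each term by g nu / delta, which produces the l-dependent powers
  of |nu| and |nu + nu_alpha| and the shift of the Gamma argument by l. The kernel solutions
  subtracted for decay leave no trace, since the same polynomial annihilates their Mellin
  transforms. The variables are linked by S = 2s + H + 1/2: replacing s by 1 - s carries Re s > 1 to
  Re S < H + 1/2, where the series over nu converges absolutely.\<close>

lemma norm_power_series_exp_le:
  fixes y :: "'a::real_normed_vector" and l t r :: real
  assumes "0 \<le> t" "t \<le> r"
  shows "t ^ k * \<bar>l\<bar> ^ k / fact k \<le> exp (r * l) + exp (- r * l)"
proof -
  have "(t * \<bar>l\<bar>) ^ k / fact k \<le> exp (t * \<bar>l\<bar>)"
    using sum_le_suminf[OF summable_exp, of "{k}" "t * \<bar>l\<bar>"] assms
    by (simp add: exp_def divide_inverse mult.commute)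
  also have "\<dots> \<le> exp (r * \<bar>l\<bar>)" using assms by (simp add: mult_right_mono)
  also have "\<dots> \<le> exp (r * l) + exp (- r * l)" by (cases "l \<ge> 0") auto
  finally show ?thesis by (simp add: power_mult_distrib)
qed

text \<open>Expand exp(s L) in powers of s - s0 and integrate term by term. Since exp(r |L|) <=
  exp(r L) + exp(-r L), the integrands at s0 + r and s0 - r together dominate all partial sums, so
  pointwise integrability on \<open>A\<close> already gives holomorphy.\<close>

lemma holomorphic_on_exp_integral:
  fixes g :: "'a \<Rightarrow> complex" and L :: "'a \<Rightarrow> real"
  assumes A: "open A"
    and [measurable]: "L \<in> borel_measurable M" "g \<in> borel_measurable M"
    and int: "\<And>s. s \<in> A \<Longrightarrow> integrable M (\<lambda>x. g x * exp (s * of_real (L x)))"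
  shows "(\<lambda>s. \<integral>x. g x * exp (s * of_real (L x)) \<partial>M) holomorphic_on A"
proof -
  have "(\<lambda>s. \<integral>x. g x * exp (s * of_real (L x)) \<partial>M) field_differentiable at s0" if "s0 \<in> A" for s0
  proof -
    obtain r where r: "r > 0" "cball s0 r \<subseteq> A"
      using A \<open>s0 \<in> A\<close> open_contains_cball by blast
    define f where "f k x = g x * exp (s0 * of_real (L x)) * of_real (L x) ^ k / fact k" for k :: nat and x
    define D where "D x = norm (g x * exp ((s0 + of_real r) * of_real (L x))) + norm (g x * exp ((s0 - of_real r) * of_real (L x)))" for x
    have D_int: "integrable M D"
      unfolding D_def using r
      by (intro Bochner_Integration.integrable_add integrable_norm int) (auto simp: dist_norm)
    have D_eq: "D x = norm (g x * exp (s0 * of_real (L x))) * (exp (r * L x) + exp (- r * L x))" for x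
      unfolding D_def norm_mult norm_exp_eq_Re by (simp add: ring_distribs exp_add[symmetric] mult.assoc)
    have fbound: "norm (f k x * h ^ k) \<le> D x" if "norm h \<le> r" for k x h
    proof -
      have "norm (f k x * h ^ k) = norm (g x * exp (s0 * of_real (L x))) * (norm h ^ k * \<bar>L x\<bar> ^ k / fact k)"
        by (simp add: f_def norm_mult norm_divide norm_power)
      also have "\<dots> \<le> D x" unfolding D_eq
        by (intro mult_left_mono norm_power_series_exp_le) (use that in auto)
      finally show ?thesis .
    qed
    have fsum: "(\<lambda>k. f k x * h ^ k) sums (g x * exp ((s0 + h) * of_real (L x)))" for x h
    proof -
      have "(\<lambda>k. (h * of_real (L x)) ^ k /\<^sub>R fact k) sums exp (h * of_real (L x))" by (rule exp_converges)
      from sums_mult[OF this, of "g x * exp (s0 * of_real (L x))"] show ?thesis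
        by (simp add: f_def ring_distribs exp_add scaleR_conv_of_real power_mult_distrib field_simps)
    qed
    have fm[measurable]: "f k \<in> borel_measurable M" for k unfolding f_def by measurable
    have fint: "integrable M (\<lambda>x. f k x * h ^ k)" if "norm h \<le> r" for k h
      by (rule Bochner_Integration.integrable_bound[OF D_int]) (use fbound[OF that] in \<open>auto simp: D_def\<close>)
    have main: "(\<lambda>k. (\<integral>x. f k x \<partial>M) * (s - s0) ^ k) sums (\<integral>x. g x * exp (s * of_real (L x)) \<partial>M)"
      if "s \<in> ball s0 r" for s
    proof -
      define h where "h = s - s0"
      have h: "norm h \<le> r" using that by (simp add: h_def dist_norm norm_minus_commute)
      have part: "(\<Sum>k<n. norm (f k x * h ^ k)) \<le> D x" for n x
      proof -
        have "(\<Sum>k<n. norm (f k x * h ^ k)) = norm (g x * exp (s0 * of_real (L x))) * (\<Sum>k<n. (norm h * \<bar>L x\<bar>) ^ k / fact k)"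
          by (simp add: f_def norm_mult norm_divide norm_power sum_distrib_left power_mult_distrib field_simps)
        also have "(\<Sum>k<n. (norm h * \<bar>L x\<bar>) ^ k / fact k) \<le> exp (norm h * \<bar>L x\<bar>)"
          using sum_le_suminf[OF summable_exp, of "{..<n}" "norm h * \<bar>L x\<bar>"]
          by (simp add: exp_def divide_inverse mult.commute)
        also have "\<dots> \<le> exp (r * \<bar>L x\<bar>)" using h by (simp add: mult_right_mono)
        also have "\<dots> \<le> exp (r * L x) + exp (- r * L x)" by (cases "L x \<ge> 0") auto
        finally show ?thesis unfolding D_eq by (simp add: mult_left_mono)
      qed
      have sumn: "summable (\<lambda>k. norm (f k x * h ^ k))" for x
        by (rule summableI_nonneg_bounded[OF _ part]) auto
      have "(\<lambda>k. \<integral>x. f k x * h ^ k \<partial>M) sums (\<integral>x. (\<Sum>k. f k x * h ^ k) \<partial>M)"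
      proof (rule sums_integral)
        show "integrable M (\<lambda>x. f k x * h ^ k)" for k by (rule fint[OF h])
        show "AE x in M. summable (\<lambda>k. norm (f k x * h ^ k))" using sumn by simp
        have "(\<Sum>k<n. \<integral>x. norm (f k x * h ^ k) \<partial>M) \<le> (\<integral>x. D x \<partial>M)" for n
        proof -
          have "(\<Sum>k<n. \<integral>x. norm (f k x * h ^ k) \<partial>M) = (\<integral>x. (\<Sum>k<n. norm (f k x * h ^ k)) \<partial>M)"
            by (rule Bochner_Integration.integral_sum[symmetric]) (use fint[OF h] in auto)
          also have "\<dots> \<le> (\<integral>x. D x \<partial>M)"
            by (intro integral_mono D_int Bochner_Integration.integrable_sum part) (use fint[OF h] in auto)
          finally show ?thesis .
        qed
        then show "summable (\<lambda>k. \<integral>x. norm (f k x * h ^ k) \<partial>M)"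
          by (intro summableI_nonneg_bounded) auto
      qed
      also have "(\<lambda>x. \<Sum>k. f k x * h ^ k) = (\<lambda>x. g x * exp (s * of_real (L x)))"
        using fsum[of _ h] by (auto simp: sums_iff h_def)
      finally show ?thesis by (simp add: h_def)
    qed
    have "(\<lambda>s. \<integral>x. g x * exp (s * of_real (L x)) \<partial>M) holomorphic_on ball s0 r"
      by (rule power_series_holomorphic[OF main])
    then show ?thesis
      using r(1) holomorphic_on_imp_differentiable_at[OF _ open_ball] by fastforce
  qed
  then show ?thesis
    by (auto simp: holomorphic_on_def intro: field_differentiable_at_within)
qed

lemma powr_complex_eq_exp_ln:
  assumes "x > 0"
  shows "complex_of_real x powr s = exp (s * of_real (ln x))"
  using assms by (simp add: powr_def Ln_of_real)

lemma holomorphic_on_mellin: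
  fixes g :: "real \<Rightarrow> complex"
  assumes "open A" "T \<in> sets borel" "T \<subseteq> {0<..}"
    and int: "\<And>s. s \<in> A \<Longrightarrow> set_integrable lborel T (\<lambda>x. of_real x powr (s - 1) * g x)"
  shows "(\<lambda>s. LBINT x:T. of_real x powr (s - 1) * g x) holomorphic_on A"
proof (cases "A = {}")
  case False
  then obtain s0 where s0: "s0 \<in> A" by blast
  define G where "G x = indicat_real T x *\<^sub>R (of_real x powr (-1) * g x)" for x
  define L where "L x = (if x \<in> T then ln x else 0)" for x
  have Lm[measurable]: "L \<in> borel_measurable lborel"
    unfolding L_def using assms(2) by measurable
  have eq: "indicat_real T x *\<^sub>R (of_real x powr (s - 1) * g x) = G x * exp (s * of_real (L x))" for x s
    using assms(3) by (auto simp: G_def L_def indicator_def powr_complex_eq_exp_ln subset_eq exp_diff exp_minus ring_distribs field_simps)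
  \<comment> \<open>Measurability of \<open>G\<close> is read off from integrability at the single
    point \<open>s0\<close>: multiplying by exp(-s0 L) undoes the exponential.\<close>
  have "(\<lambda>x. (indicat_real T x *\<^sub>R (of_real x powr (s0 - 1) * g x)) * exp (- s0 * of_real (L x))) \<in> borel_measurable lborel"
    using borel_measurable_integrable[OF int[OF s0, unfolded set_integrable_def]] by measurable
  also have "(\<lambda>x. (indicat_real T x *\<^sub>R (of_real x powr (s0 - 1) * g x)) * exp (- s0 * of_real (L x))) = G"
    unfolding eq by (auto simp: exp_minus)
  finally have Gm[measurable]: "G \<in> borel_measurable lborel" .
  have "(\<lambda>s. \<integral>x. G x * exp (s * of_real (L x)) \<partial>lborel) holomorphic_on A"
    by (rule holomorphic_on_exp_integral[OF assms(1) Lm Gm])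
       (use int in \<open>simp add: set_integrable_def eq\<close>)
  then show ?thesis by (simp add: set_lebesgue_integral_def eq)
qed (simp add: holomorphic_on_empty)

lemma set_integrable_lborel_of_absolutely_integrable:
  fixes f :: "real \<Rightarrow> 'a::{banach,second_countable_topology,euclidean_space}"
  assumes "f absolutely_integrable_on A" "A \<in> sets borel" "continuous_on A f"
  shows "set_integrable lborel A f" "(LBINT x:A. f x) = integral A f"
proof -
  have m: "(\<lambda>x. indicator A x *\<^sub>R f x) \<in> borel_measurable borel"
    using borel_measurable_continuous_on_indicator[OF assms(2,3)] by simp
  show "set_integrable lborel A f"
    using assms(1) m by (auto simp: set_integrable_def integrable_completion)
  show "(LBINT x:A. f x) = integral A f"
    using set_lebesgue_integral_eq_integral(2)[OF assms(1)] m
    by (simp add: set_lebesgue_integral_def integral_completion)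
qed

section \<open>Gamma and beta integrals with complex parameters\<close>

lemma Gamma_integral_real_scale:
  assumes "Re a > 0" "t > 0"
  shows "set_integrable lborel {0<..} (\<lambda>u. complex_of_real u powr (a - 1) * exp (- of_real t * of_real u))"
    and "(LBINT u:{0<..}. complex_of_real u powr (a - 1) * exp (- of_real t * of_real u)) = Gamma a * of_real t powr (- a)"
proof -
  have eq: "complex_of_real u powr (a - 1) * exp (- of_real s * of_real u) = of_real u powr (a - 1) / of_real (exp (s * u))" for u s :: real
    by (simp add: exp_minus field_simps exp_of_real[symmetric])
  have c: "continuous_on {0<..} (\<lambda>u. complex_of_real u powr (a - 1) / of_real (exp (s * u)))" for s :: real
    by (intro continuous_intros) auto
  show "set_integrable lborel {0<..} (\<lambda>u. complex_of_real u powr (a - 1) * exp (- of_real t * of_real u))"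
    unfolding eq by (rule set_integrable_lborel_of_absolutely_integrable(1)[OF absolutely_integrable_Gamma_integral]) (use assms c in auto)
  have *: "(LBINT u:{0<..}. complex_of_real u powr (a - 1) / of_real (exp (1 * u))) = Gamma a"
    by (subst set_integrable_lborel_of_absolutely_integrable(2)[OF absolutely_integrable_Gamma_integral])
      (use assms c[of 1] integral_unique[OF Gamma_integral_complex'[OF assms(1)]] in auto)
  have "Gamma a = (\<integral>u. indicator {0<..} u *\<^sub>R (complex_of_real u powr (a - 1) / of_real (exp u)) \<partial>lborel)"
    using * by (simp add: set_lebesgue_integral_def)
  also have "\<dots> = \<bar>t\<bar> *\<^sub>R (\<integral>u. indicator {0<..} (0 + t * u) *\<^sub>R (complex_of_real (0 + t * u) powr (a - 1) / of_real (exp (0 + t * u))) \<partial>lborel)"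
    by (rule lborel_integral_real_affine) (use assms in auto)
  also have "(\<lambda>u. indicator {0<..} (0 + t * u) *\<^sub>R (complex_of_real (0 + t * u) powr (a - 1) / of_real (exp (0 + t * u))))
      = (\<lambda>u. of_real t powr (a - 1) * (indicat_real {0<..} u *\<^sub>R (complex_of_real u powr (a - 1) * exp (- of_real t * of_real u))))"
    using assms by (intro ext) (auto simp: indicator_def eq[simplified] zero_less_mult_iff powr_times_real)
  also have "\<bar>t\<bar> *\<^sub>R (\<integral>u. (of_real t powr (a - 1) * (indicat_real {0<..} u *\<^sub>R (complex_of_real u powr (a - 1) * exp (- of_real t * of_real u)))) \<partial>lborel)
     = of_real t powr a * (LBINT u:{0<..}. complex_of_real u powr (a - 1) * exp (- of_real t * of_real u))"
  proof -
    have "\<bar>t\<bar> *\<^sub>R (of_real t powr (a - 1) * I) = of_real t powr a * I" for I :: complex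
      using assms by (simp add: scaleR_conv_of_real powr_diff)
    then show ?thesis unfolding set_lebesgue_integral_def integral_mult_right_zero .
  qed
  finally show "(LBINT u:{0<..}. complex_of_real u powr (a - 1) * exp (- of_real t * of_real u)) = Gamma a * of_real t powr (- a)"
    using assms by (simp add: powr_minus field_simps)
qed

text \<open>Identity theorem, with the positive reals accumulating at 1. It carries both the Gamma
  integral and the theta transformation from real to complex arguments.\<close>

lemma holomorphic_eq_from_positive_reals:
  assumes "f holomorphic_on {z. Re z > 0}" "g holomorphic_on {z. Re z > 0}"
    and eq: "\<And>t::real. t > 0 \<Longrightarrow> f (of_real t) = g (of_real t)" and "Re z > 0"
  shows "f z = g z"
proof -
  have "f z - g z = 0"
  proof (rule analytic_continuation[where S = "{z. Re z > 0}" and U = "of_real ` {0<..}" and \<xi> = 1 and f = "\<lambda>z. f z - g z"])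
    show "(\<lambda>z. f z - g z) holomorphic_on {z. Re z > 0}" by (intro holomorphic_intros assms)
    show "connected {z. Re z > 0}" by (intro convex_connected convex_halfspace_Re_gt)
    show "(1::complex) islimpt of_real ` {0<..}"
      unfolding islimpt_approachable
    proof (intro allI impI)
      fix e :: real assume "e > 0"
      have "dist (complex_of_real (1 + e / 2)) 1 = dist (1 + e / 2) 1"
        by (metis dist_of_real of_real_1)
      with \<open>e > 0\<close> show "\<exists>x'\<in>complex_of_real ` {0<..}. x' \<noteq> 1 \<and> dist x' 1 < e"
        by (intro bexI[of _ "of_real (1 + e / 2)"] imageI) (auto simp: dist_real_def complex_eq_iff)
    qed
  qed (use assms in \<open>auto simp: open_halfspace_Re_gt\<close>)
  then show ?thesis by simp
qed

text \<open>Both sides are holomorphic in z for Re z > 0 and agree on the positive axis by the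
  substitution u -> tu.\<close>

lemma Gamma_integral_complex_scale:
  assumes "Re a > 0" "Re z > 0"
  shows "set_integrable lborel {0<..} (\<lambda>u. complex_of_real u powr (a - 1) * exp (- z * of_real u))" (is ?th1)
    and "(LBINT u:{0<..}. complex_of_real u powr (a - 1) * exp (- z * of_real u)) = Gamma a * z powr (- a)" (is ?th2)
proof -
  have I: "set_integrable lborel {0<..} (\<lambda>u. complex_of_real u powr (a - 1) * exp (- z * of_real u))" if "Re z > 0" for z
  proof (rule set_integrable_bound[OF Gamma_integral_real_scale(1)[OF assms(1) that]])
    show "set_borel_measurable lborel {0<..} (\<lambda>u. complex_of_real u powr (a - 1) * exp (- z * of_real u))"
      unfolding set_borel_measurable_def measurable_lborel2
      by (intro borel_measurable_continuous_on_indicator continuous_intros) auto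
  qed (auto simp: norm_mult)
  show ?th1 by (rule I[OF assms(2)])
  define G where "G u = indicat_real {0<..} u *\<^sub>R (complex_of_real u powr (a - 1))" for u
  have Gm: "G \<in> borel_measurable lborel"
    unfolding G_def measurable_lborel2 
    by (intro borel_measurable_continuous_on_indicator continuous_intros) auto
  have eq: "indicat_real {0<..} u *\<^sub>R (complex_of_real u powr (a - 1) * exp (- z * of_real u)) = G u * exp (z * of_real (- u))" for u z
    by (simp add: G_def)
  have GI: "integrable lborel (\<lambda>u. G u * exp (z * of_real (- u)))" if "Re z > 0" for z
    using I[OF that] by (simp only: set_integrable_def eq)
  have "(\<lambda>z. \<integral>u. G u * exp (z * of_real (- u)) \<partial>lborel) holomorphic_on {z. Re z > 0}"
    by (rule holomorphic_on_exp_integral[OF _ _ Gm GI]) (auto simp: open_halfspace_Re_gt)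
  then have h1: "(\<lambda>z. LBINT u:{0<..}. complex_of_real u powr (a - 1) * exp (- z * of_real u)) holomorphic_on {z. Re z > 0}"
    unfolding set_lebesgue_integral_def eq .
  have h2: "(\<lambda>z. Gamma a * z powr (- a)) holomorphic_on {z. Re z > 0}"
    by (intro holomorphic_intros) (auto simp: complex_nonpos_Reals_iff)
  show ?th2
    by (rule holomorphic_eq_from_positive_reals[OF h1 h2 _ assms(2)]) (rule Gamma_integral_real_scale(2)[OF assms(1)])
qed

text \<open>Write Gamma(p)/(x + z)^p as the integral of u^(p-1) exp(-(x + z)u) and interchange. The
  x-integral gives Gamma(S) u^(-S), which leaves a Gamma integral in u with exponent p - S. The norm
  formula in \<open>inner_x\<close> supplies the absolute integrability for Fubini.\<close>

lemma beta_integral_halfplane: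
  fixes p :: nat
  assumes S: "0 < Re S" "Re S < real p" and z: "Re z > 0"
  shows "set_integrable lborel {0<..} (\<lambda>x. complex_of_real x powr (S - 1) / (of_real x + z) ^ p)"
    and "(LBINT x:{0<..}. complex_of_real x powr (S - 1) / (of_real x + z) ^ p)
           = Gamma S * Gamma (of_nat p - S) / Gamma (of_nat p) * z powr (S - of_nat p)"
proof -
  have p: "p > 0" using S by (cases p) auto
  define G1 where "G1 x = indicat_real {0<..} x *\<^sub>R (complex_of_real x powr (S - 1))" for x
  define G2 where "G2 u = indicat_real {0<..} u *\<^sub>R (complex_of_real u powr (of_nat p - 1))" for u
  have G1m[measurable]: "G1 \<in> borel_measurable borel" and G2m[measurable]: "G2 \<in> borel_measurable borel"
    unfolding G1_def G2_def by (intro borel_measurable_continuous_on_indicator continuous_intros; auto)+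
  define f where "f u x = G1 x * (G2 u * exp (- (of_real x + z) * of_real u))" for u x :: real
  have inner_x: "integrable lborel (f u)" 
      "(\<integral>x. f u x \<partial>lborel) = Gamma S * (indicat_real {0<..} u *\<^sub>R (of_real u powr (of_nat p - S - 1) * exp (- z * of_real u)))"
      "(\<integral>x. norm (f u x) \<partial>lborel) = Gamma (Re S) * norm (indicat_real {0<..} u *\<^sub>R (of_real u powr (of_nat p - S - 1) * exp (- z * of_real u)))" for u
  proof -
    have fu: "f u x = (G2 u * exp (- z * of_real u)) * (indicat_real {0<..} x *\<^sub>R (complex_of_real x powr (S - 1) * exp (- of_real u * of_real x)))" for x
      by (simp add: f_def G1_def exp_add exp_diff exp_minus ring_distribs divide_inverse mult_ac)
    have pw: "G2 u * (of_real u powr (- S)) = indicat_real {0<..} u *\<^sub>R (of_real u powr (of_nat p - S - 1))"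
      by (auto simp: G2_def indicator_def powr_diff powr_minus powr_add field_simps)
    have "integrable lborel (f u) \<and> (\<integral>x. f u x \<partial>lborel) = (G2 u * exp (- z * of_real u)) * (Gamma S * of_real u powr (- S))
        \<and> (\<integral>x. norm (f u x) \<partial>lborel) = norm (G2 u * exp (- z * of_real u)) * (Gamma (Re S) * u powr (- Re S))"
    proof (cases "u > 0")
      case True
      have n: "(LBINT x:{0<..}. complex_of_real x powr (of_real (Re S) - 1) * exp (- of_real u * of_real x)) = Gamma (of_real (Re S)) * of_real u powr (- of_real (Re S))"
        by (rule Gamma_integral_real_scale(2)) (use S True in auto)
      have "complex_of_real (\<integral>x. norm (indicat_real {0<..} x *\<^sub>R (complex_of_real x powr (S - 1) * exp (- of_real u * of_real x))) \<partial>lborel)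
        = (\<integral>x. complex_of_real (norm (indicat_real {0<..} x *\<^sub>R (complex_of_real x powr (S - 1) * exp (- of_real u * of_real x)))) \<partial>lborel)"
        by (rule integral_complex_of_real[symmetric])
      also have "\<dots> = (LBINT x:{0<..}. complex_of_real x powr (of_real (Re S) - 1) * exp (- of_real u * of_real x))"
        unfolding set_lebesgue_integral_def
        by (intro Bochner_Integration.integral_cong refl)
          (auto simp: indicator_def norm_mult norm_powr_real_powr powr_of_real[symmetric] exp_of_real[symmetric])
      also have "\<dots> = complex_of_real (Gamma (Re S) * u powr (- Re S))"
        unfolding n using True by (simp add: Gamma_complex_of_real powr_of_real[symmetric])
      finally have n': "(\<integral>x. norm (indicat_real {0<..} x *\<^sub>R (complex_of_real x powr (S - 1) * exp (- of_real u * of_real x))) \<partial>lborel) = Gamma (Re S) * u powr (- Re S)"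
        unfolding of_real_eq_iff .
      define kk where "kk = G2 u * exp (- z * of_real u)"
      define R where "R x = indicat_real {0<..} x *\<^sub>R (complex_of_real x powr (S - 1) * exp (- of_real u * of_real x))" for x
      have R: "integrable lborel R" "integral\<^sup>L lborel R = Gamma S * of_real u powr (- S)" 
         "(\<integral>x. norm (R x) \<partial>lborel) = Gamma (Re S) * u powr (- Re S)"
        using Gamma_integral_real_scale[OF S(1) True] n' unfolding R_def set_integrable_def set_lebesgue_integral_def by auto
      have fk: "f u = (\<lambda>x. kk * R x)" unfolding fu kk_def R_def by auto
      show ?thesis
        unfolding fk norm_mult integral_mult_right_zero R(2,3) kk_def[symmetric] using R(1) by auto
    next
      case False
      then show ?thesis unfolding fu by (simp add: G2_def)
    qed
    moreover have e1: "indicat_real {0<..} u *\<^sub>R (of_real u powr (of_nat p - S - 1) * exp (- z * of_real u)) = G2 u * exp (- z * of_real u) * of_real u powr (- S)"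
    proof -
      have "G2 u * exp (- z * of_real u) * of_real u powr (- S) = (G2 u * of_real u powr (- S)) * exp (- z * of_real u)" by simp
      also have "\<dots> = indicat_real {0<..} u *\<^sub>R (of_real u powr (of_nat p - S - 1) * exp (- z * of_real u))"
        unfolding pw by simp
      finally show ?thesis ..
    qed
    moreover have e2: "norm (G2 u * exp (- z * of_real u) * of_real u powr (- S)) = norm (G2 u * exp (- z * of_real u)) * u powr (- Re S)"
      by (cases "u > 0") (simp_all add: G2_def norm_mult norm_powr_real_powr)
    ultimately show "integrable lborel (f u)" 
      "(\<integral>x. f u x \<partial>lborel) = Gamma S * (indicat_real {0<..} u *\<^sub>R (of_real u powr (of_nat p - S - 1) * exp (- z * of_real u)))"
      "(\<integral>x. norm (f u x) \<partial>lborel) = Gamma (Re S) * norm (indicat_real {0<..} u *\<^sub>R (of_real u powr (of_nat p - S - 1) * exp (- z * of_real u)))"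
      unfolding e1 e2 by (simp_all only: mult_ac)
  qed
  have G: "set_integrable lborel {0<..} (\<lambda>u. complex_of_real u powr (of_nat p - S - 1) * exp (- z * of_real u))"
     "(LBINT u:{0<..}. complex_of_real u powr (of_nat p - S - 1) * exp (- z * of_real u)) = Gamma (of_nat p - S) * z powr (- (of_nat p - S))"
    using Gamma_integral_complex_scale[of "of_nat p - S" z] S z by auto
  have F: "integrable (lborel \<Otimes>\<^sub>M lborel) (case_prod f)"
  proof (rule lborel_pair.Fubini_integrable)
    show "case_prod f \<in> borel_measurable (lborel \<Otimes>\<^sub>M lborel)" 
      unfolding f_def case_prod_beta by measurable
    show "integrable lborel (\<lambda>u. \<integral>x. norm (case_prod f (u, x)) \<partial>lborel)"
      unfolding case_prod_conv inner_x(3)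
      using G(1) by (intro integrable_mult_right integrable_norm) (simp add: set_integrable_def)
    show "AE u in lborel. integrable lborel (\<lambda>x. case_prod f (u, x))" using inner_x(1) by simp
  qed
  have inner_u: "(\<integral>u. f u x \<partial>lborel) = Gamma (of_nat p) * (indicat_real {0<..} x *\<^sub>R (of_real x powr (S - 1) / (of_real x + z) ^ p))" for x
  proof (cases "x > 0")
    case True
    then have xz: "Re (of_real x + z) > 0" using z by simp
    have "(\<integral>u. f u x \<partial>lborel) = G1 x * (LBINT u:{0<..}. complex_of_real u powr (of_nat p - 1) * exp (- (of_real x + z) * of_real u))"
      unfolding f_def integral_mult_right_zero by (simp add: G2_def set_lebesgue_integral_def)
    also have "\<dots> = G1 x * (Gamma (of_nat p) * (of_real x + z) powr (- of_nat p))"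
      by (subst Gamma_integral_complex_scale) (use p xz in auto)
    also have "(of_real x + z) powr (- of_nat p) = 1 / (of_real x + z) ^ p"
      using xz p by (auto simp: powr_minus powr_nat divide_inverse)
    finally show ?thesis using True by (simp add: G1_def)
  qed (simp add: f_def G1_def)
  have Gp: "Gamma (of_nat p :: complex) \<noteq> 0"
    using p by (cases p) (auto simp: Gamma_fact)
  have "integrable lborel (\<lambda>x. inverse (Gamma (of_nat p)) * (\<integral>u. f u x \<partial>lborel))"
    using lborel_pair.integrable_snd[OF F] by (rule integrable_mult_right)
  also have "(\<lambda>x. inverse (Gamma (of_nat p)) * (\<integral>u. f u x \<partial>lborel)) = (\<lambda>x. indicat_real {0<..} x *\<^sub>R (complex_of_real x powr (S - 1) / (of_real x + z) ^ p))"
    unfolding inner_u mult.assoc[symmetric] using Gp by simp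
  finally show "set_integrable lborel {0<..} (\<lambda>x. complex_of_real x powr (S - 1) / (of_real x + z) ^ p)"
    unfolding set_integrable_def .
  have "(\<integral>x. (\<integral>u. f u x \<partial>lborel) \<partial>lborel) = (\<integral>u. (\<integral>x. f u x \<partial>lborel) \<partial>lborel)"
    by (rule lborel_pair.Fubini_integral[OF F])
  also have "\<dots> = Gamma S * (Gamma (of_nat p - S) * z powr (- (of_nat p - S)))"
    unfolding inner_x(2) integral_mult_right_zero using G(2) unfolding set_lebesgue_integral_def by simp
  also have "(\<integral>x. (\<integral>u. f u x \<partial>lborel) \<partial>lborel) = Gamma (of_nat p) * (LBINT x:{0<..}. complex_of_real x powr (S - 1) / (of_real x + z) ^ p)"
    unfolding inner_u integral_mult_right_zero set_lebesgue_integral_def ..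
  finally show "(LBINT x:{0<..}. complex_of_real x powr (S - 1) / (of_real x + z) ^ p)
           = Gamma S * Gamma (of_nat p - S) / Gamma (of_nat p) * z powr (S - of_nat p)"
    using Gp by (simp add: field_simps)
qed

lemma norm_add_imaginary_ge:
  fixes x d :: real
  shows "norm (complex_of_real x + \<i> * of_real d) \<ge> \<bar>x\<bar>" "norm (complex_of_real x + \<i> * of_real d) \<ge> \<bar>d\<bar>"
  using abs_Re_le_cmod[of "complex_of_real x + \<i> * of_real d"] abs_Im_le_cmod[of "complex_of_real x + \<i> * of_real d"] by auto

text \<open>The boundary case Re z = 0 of the half-plane formula, reached by dominated convergence
  along z = id + 1/(n + 1).\<close>

lemma beta_integral_imaginary:
  fixes p :: nat and d :: real
  assumes S: "0 < Re S" "Re S < real p" and d: "d \<noteq> 0"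
  shows "set_integrable lborel {0<..} (\<lambda>x. complex_of_real x powr (S - 1) / (of_real x + \<i> * of_real d) ^ p)"
    and "(LBINT x:{0<..}. complex_of_real x powr (S - 1) / (of_real x + \<i> * of_real d) ^ p)
           = Gamma S * Gamma (of_nat p - S) / Gamma (of_nat p) * (\<i> * of_real d) powr (S - of_nat p)"
proof -
  \<comment> \<open>The modulus m of x + e + id satisfies m >= x and m >= |d|, hence C m = m + m/|d|
    >= x + 1. So C^p times the integrand for z = 1 is a majorant.\<close>
  define C where "C = 1 + 1 / \<bar>d\<bar>"
  have C: "C > 0" by (simp add: C_def add_pos_nonneg)
  define D where "D x = C ^ p *\<^sub>R (indicat_real {0<..} x *\<^sub>R (complex_of_real x powr (S - 1) / (of_real x + 1) ^ p))" for x
  have Dint: "integrable lborel D"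
    using beta_integral_halfplane(1)[OF S, of 1] unfolding D_def set_integrable_def
    by (intro integrable_scaleR_right) auto
  define z where "z n = \<i> * of_real d + of_real (inverse (real (Suc n)))" for n
  define f where "f n x = indicat_real {0<..} x *\<^sub>R (complex_of_real x powr (S - 1) / (of_real x + z n) ^ p)" for n x
  define g where "g x = indicat_real {0<..} x *\<^sub>R (complex_of_real x powr (S - 1) / (of_real x + \<i> * of_real d) ^ p)" for x
  have lower: "norm (complex_of_real x + of_real e + \<i> * of_real d) \<ge> (x + 1) / C" if "x > 0" "e \<ge> 0" for x e
  proof -
    define m where "m = norm (complex_of_real x + of_real e + \<i> * of_real d)"
    have "m \<ge> x" "m \<ge> \<bar>d\<bar>" 
      unfolding m_def using norm_add_imaginary_ge[where x = "x + e" and d = d] that by auto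
    then have "m * C \<ge> x + 1"
      using d by (simp add: C_def ring_distribs field_simps) (use \<open>m \<ge> x\<close> in \<open>smt (verit) mult_left_mono mult.commute\<close>)
    then show ?thesis using C by (simp add: m_def field_simps)
  qed
  have bound: "norm (indicat_real {0<..} x *\<^sub>R (complex_of_real x powr (S - 1) / (of_real x + of_real e + \<i> * of_real d) ^ p)) \<le> norm (D x)" if "e \<ge> 0" for x e
  proof (cases "x > 0")
    case True
    have "((x + 1) / C) ^ p \<le> norm (complex_of_real x + of_real e + \<i> * of_real d) ^ p"
      by (rule power_mono[OF lower]) (use True that C in auto)
    moreover have "((x + 1) / C) ^ p > 0" using True C by simp
    ultimately have "norm (complex_of_real x powr (S - 1)) / norm (complex_of_real x + of_real e + \<i> * of_real d) ^ p \<le> norm (complex_of_real x powr (S - 1)) / ((x + 1) / C) ^ p"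
      by (intro divide_left_mono mult_pos_pos) auto
    moreover have "norm (complex_of_real x + 1) = x + 1"
      using True by (metis abs_of_pos add_pos_pos norm_of_real of_real_1 of_real_add zero_less_one)
    ultimately show ?thesis
      using True C by (simp add: D_def norm_divide norm_power power_divide field_simps)
  qed (simp add: D_def)
  have meas: "(\<lambda>x. indicat_real {0<..} x *\<^sub>R (complex_of_real x powr (S - 1) / (of_real x + w) ^ p)) \<in> borel_measurable lborel" if "\<And>x. x > 0 \<Longrightarrow> of_real x + w \<noteq> 0" for w
    unfolding measurable_lborel2
    by (intro borel_measurable_continuous_on_indicator continuous_intros) (use that in auto)
  have ne: "complex_of_real x + \<i> * of_real d \<noteq> 0" for x using d by (auto simp: complex_eq_iff)
  have gm: "g \<in> borel_measurable lborel" unfolding g_def by (rule meas) (use ne in auto)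
  have fm: "f n \<in> borel_measurable lborel" for n 
    unfolding f_def by (rule meas) (use d in \<open>auto simp: z_def complex_eq_iff\<close>)
  have zlim: "z \<longlonglongrightarrow> \<i> * of_real d"
    unfolding z_def using tendsto_add[OF tendsto_const tendsto_of_real[OF LIMSEQ_inverse_real_of_nat], of "\<i> * of_real d"] by (simp del: of_nat_Suc)
  have flim: "(\<lambda>n. f n x) \<longlonglongrightarrow> g x" for x
    unfolding f_def g_def by (intro tendsto_intros zlim) (use ne in auto)
  have dom: "norm (f n x) \<le> norm (D x)" for n x
    using bound[of "inverse (real (Suc n))" x] by (simp add: f_def z_def add_ac del: of_nat_Suc)
  have dc: "(\<lambda>n. integral\<^sup>L lborel (f n)) \<longlonglongrightarrow> integral\<^sup>L lborel g"
    by (rule integral_dominated_convergence[where s = f and w = "\<lambda>x. norm (D x)", OF gm fm integrable_norm[OF Dint]]) (use flim dom in auto)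
  have "integrable lborel g"
    by (rule integrable_dominated_convergence[where s = f and w = "\<lambda>x. norm (D x)", OF gm fm integrable_norm[OF Dint]]) (use flim dom in auto)
  then show "set_integrable lborel {0<..} (\<lambda>x. complex_of_real x powr (S - 1) / (of_real x + \<i> * of_real d) ^ p)"
    by (simp add: set_integrable_def g_def[abs_def])
  have "integral\<^sup>L lborel (f n) = Gamma S * Gamma (of_nat p - S) / Gamma (of_nat p) * z n powr (S - of_nat p)" for n
    using beta_integral_halfplane(2)[OF S, of "z n"]
    by (simp add: z_def f_def[abs_def] set_lebesgue_integral_def)
  moreover have "(\<lambda>n. Gamma S * Gamma (of_nat p - S) / Gamma (of_nat p) * z n powr (S - of_nat p)) \<longlonglongrightarrow> Gamma S * Gamma (of_nat p - S) / Gamma (of_nat p) * (\<i> * of_real d) powr (S - of_nat p)"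
    by (intro tendsto_intros zlim) (use d in \<open>auto simp: complex_nonpos_Reals_iff\<close>)
  ultimately have "integral\<^sup>L lborel g = Gamma S * Gamma (of_nat p - S) / Gamma (of_nat p) * (\<i> * of_real d) powr (S - of_nat p)"
    using dc LIMSEQ_unique by simp
  then show "(LBINT x:{0<..}. complex_of_real x powr (S - 1) / (of_real x + \<i> * of_real d) ^ p)
           = Gamma S * Gamma (of_nat p - S) / Gamma (of_nat p) * (\<i> * of_real d) powr (S - of_nat p)"
    by (simp add: set_lebesgue_integral_def g_def[abs_def])
qed

lemma set_integrable_lborel_powr:
  fixes a :: real
  shows "a > -1 \<Longrightarrow> set_integrable lborel {0<..1} (\<lambda>x. x powr a)"
    and "a < -1 \<Longrightarrow> set_integrable lborel {1<..} (\<lambda>x. x powr a)"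
proof -
  have *: "set_integrable lborel A (\<lambda>x. x powr a)" if "(\<lambda>x. x powr a) integrable_on A" "A \<in> sets borel" for A
  proof -
    have "(\<lambda>x. x powr a) absolutely_integrable_on A"
      using that by (intro nonnegative_absolutely_integrable_1) auto
    moreover have "(\<lambda>x. indicator A x *\<^sub>R (x powr a)) \<in> borel_measurable borel" using that by measurable
    ultimately show ?thesis by (auto simp: set_integrable_def integrable_completion)
  qed
  show "a > -1 \<Longrightarrow> set_integrable lborel {0<..1} (\<lambda>x. x powr a)"
    by (intro * integrable_on_powr_from_0') auto
  assume a: "a < -1"
  have "((\<lambda>x. x powr a) has_integral (- (1 powr (a + 1)) / (a + 1))) {1..}"
    using has_integral_powr_to_inf[of a 1] a by simp
  then have "(\<lambda>x. x powr a) integrable_on {1..}" by blast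
  then have "(\<lambda>x. x powr a) integrable_on {1<..}"
    by (rule integrable_spike_set) (auto intro: negligible_subset[of "{1}"])
  then show "set_integrable lborel {1<..} (\<lambda>x. x powr a)" by (rule *) auto
qed

section \<open>Mellin calculus for rapidly decaying functions\<close>

definition rapid_decay :: "(real \<Rightarrow> complex) \<Rightarrow> bool" where
  "rapid_decay g \<longleftrightarrow> (\<forall>q. \<exists>B. \<forall>x\<ge>1. norm (g x) \<le> B * x powr (- q))"

definition pole_order_bound :: "real \<Rightarrow> (real \<Rightarrow> complex) \<Rightarrow> bool" where
  "pole_order_bound q g \<longleftrightarrow> (\<exists>B. \<forall>x. 0 < x \<and> x \<le> 1 \<longrightarrow> norm (g x) \<le> B * x powr (- q))"

text \<open>Under these conditions the Mellin integral exists for all sufficiently large Re S; the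
  order of growth at 0 is left open because it changes along the chain of differential
  equations.\<close>

definition tame :: "(real \<Rightarrow> complex) \<Rightarrow> bool" where
  "tame g \<longleftrightarrow> continuous_on {0<..} g \<and> (\<exists>q. pole_order_bound q g) \<and> rapid_decay g"

lemma pole_order_bound_mono:
  assumes "pole_order_bound q g" "q \<le> q'"
  shows "pole_order_bound q' g"
proof -
  obtain B where B: "\<And>x. 0 < x \<Longrightarrow> x \<le> 1 \<Longrightarrow> norm (g x) \<le> B * x powr (- q)"
    using assms(1) by (auto simp: pole_order_bound_def)
  have "B \<ge> 0" using order_trans[OF norm_ge_zero B[of 1]] by simp
  then have "norm (g x) \<le> B * x powr (- q')" if "0 < x" "x \<le> 1" for x
    using B[OF that] powr_mono'[of "- q'" "- q" x] assms(2) that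
    by (smt (verit) mult_left_mono)
  then show ?thesis by (auto simp: pole_order_bound_def)
qed

lemma mellin_integrable_at_0:
  assumes "continuous_on {0<..} g" "pole_order_bound q g" "Re S > q"
  shows "set_integrable lborel {0<..1} (\<lambda>x. of_real x powr (S - 1) * g x)"
proof -
  obtain B where B: "\<And>x. 0 < x \<Longrightarrow> x \<le> 1 \<Longrightarrow> norm (g x) \<le> B * x powr (- q)"
    using assms(2) by (auto simp: pole_order_bound_def)
  have "set_integrable lborel {0<..1} (\<lambda>x. B * x powr (Re S - 1 - q))"
    by (intro set_integrable_mult_right set_integrable_lborel_powr) (use assms in auto)
  then show ?thesis
  proof (rule set_integrable_bound)
    show "set_borel_measurable lborel {0<..1} (\<lambda>x. of_real x powr (S - 1) * g x)"
      unfolding set_borel_measurable_def measurable_lborel2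
      by (intro borel_measurable_continuous_on_indicator continuous_intros continuous_on_subset[OF assms(1)]) auto
    show "AE x in lborel. x \<in> {0<..1} \<longrightarrow> norm (of_real x powr (S - 1) * g x) \<le> norm (B * x powr (Re S - 1 - q))"
    proof (intro AE_I2 impI)
      fix x :: real assume "x \<in> {0<..1}"
      then have x: "0 < x" "x \<le> 1" by auto
      have "norm (of_real x powr (S - 1) * g x) = x powr (Re S - 1) * norm (g x)"
        using x by (simp add: norm_mult norm_powr_real_powr)
      also have "\<dots> \<le> x powr (Re S - 1) * (B * x powr (- q))"
        by (intro mult_left_mono B x) auto
      also have "\<dots> = B * x powr (Re S - 1 - q)" using powr_add[of x "Re S - 1" "- q"] by simp
      finally show "norm (of_real x powr (S - 1) * g x) \<le> norm (B * x powr (Re S - 1 - q))" by simp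
    qed
  qed
qed

lemma mellin_integrable_at_top:
  assumes "continuous_on {0<..} g" "\<And>x. x \<ge> 1 \<Longrightarrow> norm (g x) \<le> B * x powr (- q)" "Re S < q"
  shows "set_integrable lborel {1<..} (\<lambda>x. of_real x powr (S - 1) * g x)"
proof -
  have "set_integrable lborel {1<..} (\<lambda>x. B * x powr (Re S - 1 - q))"
    by (intro set_integrable_mult_right set_integrable_lborel_powr) (use assms in auto)
  then show ?thesis
  proof (rule set_integrable_bound)
    show "set_borel_measurable lborel {1<..} (\<lambda>x. of_real x powr (S - 1) * g x)"
      unfolding set_borel_measurable_def measurable_lborel2
      by (intro borel_measurable_continuous_on_indicator continuous_intros continuous_on_subset[OF assms(1)]) auto
    show "AE x in lborel. x \<in> {1<..} \<longrightarrow> norm (of_real x powr (S - 1) * g x) \<le> norm (B * x powr (Re S - 1 - q))"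
    proof (intro AE_I2 impI)
      fix x :: real assume "x \<in> {1<..}"
      then have x: "x > 0" "x \<ge> 1" by auto
      have "norm (of_real x powr (S - 1) * g x) = x powr (Re S - 1) * norm (g x)"
        using x by (simp add: norm_mult norm_powr_real_powr)
      also have "\<dots> \<le> x powr (Re S - 1) * (B * x powr (- q))"
        by (intro mult_left_mono assms(2) x) auto
      also have "\<dots> = B * x powr (Re S - 1 - q)" using powr_add[of x "Re S - 1" "- q"] by simp
      finally show "norm (of_real x powr (S - 1) * g x) \<le> norm (B * x powr (Re S - 1 - q))" by simp
    qed
  qed
qed

lemma mellin_integrable_rapid:
  assumes "continuous_on {0<..} g" "rapid_decay g"
  shows "set_integrable lborel {1<..} (\<lambda>x. of_real x powr (S - 1) * g x)"
proof -
  obtain B where "\<And>x. x \<ge> 1 \<Longrightarrow> norm (g x) \<le> B * x powr (- (Re S + 1))"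
    using assms(2) unfolding rapid_decay_def by blast
  then show ?thesis by (rule mellin_integrable_at_top[OF assms(1)]) auto
qed

lemma set_integrable_Ioi_split:
  fixes f :: "real \<Rightarrow> 'a::{banach,second_countable_topology}"
  assumes "set_integrable lborel {0<..1} f" "set_integrable lborel {1<..} f"
  shows "set_integrable lborel {0<..} f"
    and "(LBINT x:{0<..}. f x) = (LBINT x:{0<..1}. f x) + (LBINT x:{1<..}. f x)"
proof -
  have eq: "{0<..} = {0<..1} \<union> {1::real<..}" by auto
  show "set_integrable lborel {0<..} f"
    unfolding eq by (rule set_integrable_Un[OF assms]) auto
  show "(LBINT x:{0<..}. f x) = (LBINT x:{0<..1}. f x) + (LBINT x:{1<..}. f x)"
    unfolding eq by (rule set_integral_Un[OF _ assms]) auto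
qed

lemma mellin_integrable:
  assumes "continuous_on {0<..} g" "pole_order_bound q g" "rapid_decay g" "Re S > q"
  shows "set_integrable lborel {0<..} (\<lambda>x. of_real x powr (S - 1) * g x)"
  by (intro set_integrable_Ioi_split mellin_integrable_at_0 mellin_integrable_rapid) (use assms in auto)

definition mellin :: "(real \<Rightarrow> complex) \<Rightarrow> complex \<Rightarrow> complex" where
  "mellin g S = (LBINT x:{0<..}. of_real x powr (S - 1) * g x)"

text \<open>Integrate the derivative of x^(S-1) (x + ic) P(x) over the half-line. The boundary term
  at 0 vanishes because Re S - 1 > q, the one at infinity by rapid decay.\<close>

lemma mellin_by_parts:
  fixes p c :: real
  assumes P: "continuous_on {0<..} P" "pole_order_bound q P" "rapid_decay P"
    and R: "continuous_on {0<..} R" "pole_order_bound q R" "rapid_decay R"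
    and der: "\<And>x. x > 0 \<Longrightarrow> (P has_vector_derivative P' x) (at x)"
    and ode: "\<And>x. x > 0 \<Longrightarrow> (of_real x + \<i> * of_real c) * P' x + of_real p * P x = R x"
    and S: "Re S > q + 1"
  shows "mellin R S = (of_real p - S) * mellin P S - \<i> * of_real c * (S - 1) * mellin P (S - 1)"
proof -
  have intR: "set_integrable lborel {0<..} (\<lambda>x. of_real x powr (S - 1) * R x)"
    by (rule mellin_integrable[OF R]) (use S in auto)
  have intP: "set_integrable lborel {0<..} (\<lambda>x. of_real x powr (S - 1) * P x)"
    by (rule mellin_integrable[OF P]) (use S in auto)
  have intP1: "set_integrable lborel {0<..} (\<lambda>x. of_real x powr ((S - 1) - 1) * P x)"
    by (rule mellin_integrable[OF P]) (use S in auto)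
  define F where "F x = (of_real x powr S + \<i> * of_real c * of_real x powr (S - 1)) * P x" for x :: real
  define f where "f x = of_real x powr (S - 1) * R x + ((S - of_real p) * (of_real x powr (S - 1) * P x)
     + (\<i> * of_real c * (S - 1)) * (of_real x powr ((S - 1) - 1) * P x))" for x :: real
  have F: "(F has_vector_derivative f x) (at x)" if "x > 0" for x
  proof -
    have d: "((\<lambda>x. complex_of_real x powr a) has_vector_derivative a * of_real x powr (a - 1)) (at x)" for a
      by (rule has_vector_derivative_real_field, rule has_field_derivative_powr) (use that in simp)
    have pw: "complex_of_real x powr S = of_real x * of_real x powr (S - 1)"
      using that by (simp add: powr_diff)
    have "(F has_vector_derivative (of_real x powr S + \<i> * of_real c * of_real x powr (S - 1)) * P' x
       + (S * of_real x powr (S - 1) + \<i> * of_real c * ((S - 1) * of_real x powr ((S - 1) - 1))) * P x) (at x)"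
      unfolding F_def by (intro derivative_intros d der that)
    also have "(of_real x powr S + \<i> * of_real c * of_real x powr (S - 1)) * P' x
       + (S * of_real x powr (S - 1) + \<i> * of_real c * ((S - 1) * of_real x powr ((S - 1) - 1))) * P x = f x"
      unfolding f_def ode[OF that, symmetric] pw by (simp only: ring_distribs) (simp add: algebra_simps)
    finally show ?thesis .
  qed
  have fc: "isCont f x" if "x > 0" for x
  proof -
    have "continuous_on {0<..} f" unfolding f_def
      by (intro continuous_intros R P) auto
    then show ?thesis using that by (simp add: continuous_on_eq_continuous_at)
  qed
  have fi: "set_integrable lborel {0<..} f"
    unfolding f_def by (intro set_integral_add set_integrable_mult_right intR intP intP1)
  have Fn: "norm (F x) \<le> (x powr Re S + \<bar>c\<bar> * x powr (Re S - 1)) * norm (P x)" if "x > 0" for x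
    unfolding F_def norm_mult using that
    by (intro mult_right_mono order_trans[OF norm_triangle_ineq]) (auto simp: norm_mult norm_powr_real_powr)
  have F0: "(F \<longlongrightarrow> 0) (at_right 0)"
  proof -
    obtain B where B: "\<And>x. 0 < x \<Longrightarrow> x \<le> 1 \<Longrightarrow> norm (P x) \<le> B * x powr (- q)"
      using P(2) by (auto simp: pole_order_bound_def)
    have ev: "\<forall>\<^sub>F x in at_right (0::real). 0 < x \<and> x \<le> 1"
      unfolding eventually_at_right_field by (intro exI[of _ 1]) auto
    show ?thesis
    proof (rule Lim_null_comparison)
      show "\<forall>\<^sub>F x in at_right 0. norm (F x) \<le> B * (x powr (Re S - q) + \<bar>c\<bar> * x powr (Re S - 1 - q))"
        using ev
      proof eventually_elim
        case (elim x)
        have "norm (F x) \<le> (x powr Re S + \<bar>c\<bar> * x powr (Re S - 1)) * (B * x powr (- q))"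
          by (intro order_trans[OF Fn] mult_left_mono B) (use elim in auto)
        also have "\<dots> = B * (x powr (Re S + - q) + \<bar>c\<bar> * x powr ((Re S - 1) + - q))"
          unfolding powr_add by (simp add: algebra_simps)
        also have "\<dots> = B * (x powr (Re S - q) + \<bar>c\<bar> * x powr (Re S - 1 - q))" by simp
        finally show ?case .
      qed
      have z: "((\<lambda>x::real. x powr a) \<longlongrightarrow> 0) (at_right 0)" if "a > 0" for a
        using that by real_asymp
      show "((\<lambda>x. B * (x powr (Re S - q) + \<bar>c\<bar> * x powr (Re S - 1 - q))) \<longlongrightarrow> 0) (at_right 0)"
      proof -
        have "((\<lambda>x. B * (x powr (Re S - q) + \<bar>c\<bar> * x powr (Re S - 1 - q))) \<longlongrightarrow> B * (0 + \<bar>c\<bar> * 0)) (at_right 0)"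
          by (intro tendsto_mult_left tendsto_add z) (use S in auto)
        then show ?thesis by simp
      qed
    qed
  qed
  have Finf: "(F \<longlongrightarrow> 0) at_top"
  proof -
    obtain B where B: "\<And>x. x \<ge> 1 \<Longrightarrow> norm (P x) \<le> B * x powr (- (Re S + 1))"
      using P(3) unfolding rapid_decay_def by blast
    show ?thesis
    proof (rule Lim_null_comparison)
      show "\<forall>\<^sub>F x in at_top. norm (F x) \<le> B * (x powr (-1) + \<bar>c\<bar> * x powr (-2))"
        using eventually_ge_at_top[of "1::real"]
      proof eventually_elim
        case (elim x)
        have "norm (F x) \<le> (x powr Re S + \<bar>c\<bar> * x powr (Re S - 1)) * (B * x powr (- (Re S + 1)))"
          by (intro order_trans[OF Fn] mult_left_mono B) (use elim in auto)
        also have "\<dots> = B * (x powr (Re S + - (Re S + 1)) + \<bar>c\<bar> * x powr ((Re S - 1) + - (Re S + 1)))"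
          unfolding powr_add by (simp add: algebra_simps)
        finally show ?case by simp
      qed
      show "((\<lambda>x. B * (x powr (-1) + \<bar>c\<bar> * x powr (-2))) \<longlongrightarrow> 0) at_top"
        by real_asymp
    qed
  qed
  have "(LBINT x=0..\<infinity>. f x) = 0 - 0"
    by (rule interval_integral_FTC_integrable[where F = F])
       (use F fc fi F0 Finf in \<open>auto simp: ereal_tendsto_simps zero_ereal_def einterval_eq_Ici simp flip: einterval_eq\<close>)
  then have "(LBINT x:{0<..}. f x) = 0"
    by (simp add: interval_lebesgue_integral_def zero_ereal_def)
  also have "(LBINT x:{0<..}. f x) = mellin R S + ((S - of_real p) * mellin P S + \<i> * of_real c * (S - 1) * mellin P (S - 1))"
    unfolding f_def mellin_def
    by (subst set_integral_add(2), intro intR, intro set_integral_add set_integrable_mult_right intP intP1,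
        subst set_integral_add(2), intro set_integrable_mult_right intP, intro set_integrable_mult_right intP1, simp)
  finally show ?thesis by (simp add: algebra_simps add_eq_0_iff)
qed

text \<open>\<open>L\<close> is the limit of \<open>G\<close> at infinity: comparing with a
  primitive of x^(-q-1) bounds increments of \<open>G\<close> beyond x by a multiple of x^(-q), for
  every q > 0, which gives both the Cauchy property and the rate.\<close>

lemma rapid_decay_antiderivative:
  assumes der: "\<And>x. x > 0 \<Longrightarrow> (G has_vector_derivative g x) (at x)" and g: "rapid_decay g"
  shows "\<exists>L. rapid_decay (\<lambda>x. G x - L :: complex)"
proof -
  have diff: "\<exists>B\<ge>0. \<forall>x y. 1 \<le> x \<longrightarrow> x \<le> y \<longrightarrow> norm (G y - G x) \<le> B * x powr (- q)" if q: "q > 0" for q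
  proof -
    obtain B where B: "\<And>x. x \<ge> 1 \<Longrightarrow> norm (g x) \<le> B * x powr (- (q + 1))"
      using g unfolding rapid_decay_def by blast
    have B0: "B \<ge> 0" using order_trans[OF norm_ge_zero B[of 1]] by simp
    have "norm (G y - G x) \<le> B / q * x powr (- q)" if xy: "1 \<le> x" "x \<le> y" for x y
    proof (cases "x < y")
      case True
      have "norm (G y - G x) \<le> (- (B / q) * y powr (- q)) - (- (B / q) * x powr (- q))"
      proof (rule differentiable_bound_general[OF True])
        show "continuous_on {x..y} G"
          by (intro continuous_at_imp_continuous_on ballI has_vector_derivative_continuous[OF der]) (use xy in auto)
        show "continuous_on {x..y} (\<lambda>t. - (B / q) * t powr - q)"
          by (intro continuous_intros) (use xy in auto)
        show "(G has_vector_derivative g t) (at t)" if "x < t" for t using der[of t] that xy by auto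
        show "((\<lambda>t. - (B / q) * t powr - q) has_vector_derivative B * t powr (- (q + 1))) (at t)" if "x < t" for t
          unfolding has_real_derivative_iff_has_vector_derivative[symmetric]
          by (rule derivative_eq_intros refl | use that xy q in \<open>simp add: powr_diff powr_add powr_minus field_simps\<close>)+
        show "norm (g t) \<le> B * t powr (- (q + 1))" if "x < t" for t using B[of t] that xy by auto
      qed
      also have "\<dots> \<le> B / q * x powr (- q)" using B0 q by simp
      finally show ?thesis .
    qed (use xy B0 q in auto)
    then show ?thesis using B0 q by (intro exI[of _ "B / q"]) auto
  qed
  obtain B1 where B1: "B1 \<ge> 0" "\<And>x y. 1 \<le> x \<Longrightarrow> x \<le> y \<Longrightarrow> norm (G y - G x) \<le> B1 * x powr (- 1)"
    using diff[of 1] by auto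
  have "Cauchy (\<lambda>n. G (real n))"
  proof (rule metric_CauchyI)
    fix e :: real assume e: "e > 0"
    define M where "M = nat \<lceil>2 * B1 / e\<rceil> + 1"
    have M: "real M > 2 * B1 / e" "M \<ge> 1" unfolding M_def by linarith+
    have "dist (G (real m)) (G (real M)) < e / 2" if "m \<ge> M" for m
    proof -
      have "dist (G (real m)) (G (real M)) \<le> B1 * real M powr (-1)"
        unfolding dist_norm by (rule B1(2)) (use M that in auto)
      also have "\<dots> < e / 2" using M e by (simp add: powr_minus field_simps)
      finally show ?thesis .
    qed
    then show "\<exists>M. \<forall>m\<ge>M. \<forall>n\<ge>M. dist (G (real m)) (G (real n)) < e"
      by (intro exI[of _ M] allI impI) (rule dist_triangle_half_l; simp)
  qed
  then obtain L where L: "(\<lambda>n. G (real n)) \<longlonglongrightarrow> L" using Cauchy_convergent convergent_def by blast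
  have "rapid_decay (\<lambda>x. G x - L)"
    unfolding rapid_decay_def
  proof
    fix q :: real
    define q' where "q' = max q 1"
    obtain B where B: "B \<ge> 0" "\<And>x y. 1 \<le> x \<Longrightarrow> x \<le> y \<Longrightarrow> norm (G y - G x) \<le> B * x powr (- q')"
      using diff[of q'] unfolding q'_def by (metis less_max_iff_disj zero_less_one)
    have "norm (G x - L) \<le> B * x powr (- q)" if "x \<ge> 1" for x
    proof -
      have "norm (L - G x) \<le> B * x powr (- q')"
      proof (rule tendsto_upperbound[of "\<lambda>n. norm (G (real n) - G x)"])
        show "(\<lambda>n. norm (G (real n) - G x)) \<longlonglongrightarrow> norm (L - G x)" by (intro tendsto_intros L)
        show "\<forall>\<^sub>F n in sequentially. norm (G (real n) - G x) \<le> B * x powr (- q')"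
          using eventually_ge_at_top[of "nat \<lceil>x\<rceil>"]
          by eventually_elim (rule B(2)[OF that], linarith)
      qed auto
      also have "\<dots> \<le> B * x powr (- q)"
        using that B(1) by (intro mult_left_mono powr_mono) (auto simp: q'_def)
      finally show ?thesis by (simp add: norm_minus_commute)
    qed
    then show "\<exists>B. \<forall>x\<ge>1. norm (G x - L) \<le> B * x powr (- q)" by blast
  qed
  then show ?thesis by blast
qed

text \<open>With w = x + ic and integrating factor w^m the equation reads (w^(m+1) P)' = w^m R. The
  right side decays rapidly, so w^(m+1) P has a limit \<open>L\<close>, and removing L/w^(m+1), a
  solution of the homogeneous equation, restores rapid decay.\<close>

lemma tame_euler_ode:
  fixes c :: real and m :: nat
  assumes c: "c > 0" and R: "tame R"
    and der: "\<And>x. x > 0 \<Longrightarrow> (P has_vector_derivative P' x) (at x)"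
    and ode: "\<And>x. x > 0 \<Longrightarrow> (of_real x + \<i> * of_real c) * P' x + of_nat (Suc m) * P x = R x"
  shows "\<exists>L. tame (\<lambda>x. P x - L / (of_real x + \<i> * of_real c) ^ Suc m)"
proof -
  define w where "w x = complex_of_real x + \<i> * of_real c" for x
  have w: "norm (w x) \<ge> \<bar>x\<bar>" "norm (w x) \<ge> c" "w x \<noteq> 0" for x
    using c abs_Re_le_cmod[of "w x"] abs_Im_le_cmod[of "w x"] by (auto simp: w_def complex_eq_iff)
  have wu: "norm (w x) \<le> x + c" if "x > 0" for x
    using norm_triangle_ineq[of "complex_of_real x" "\<i> * of_real c"] that c by (simp add: w_def norm_mult)
  define G where "G x = w x ^ Suc m * P x" for x
  have G: "(G has_vector_derivative w x ^ m * R x) (at x)" if "x > 0" for x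
  proof -
    have dw: "((\<lambda>x. w x ^ Suc m) has_vector_derivative (of_nat (Suc m) * w x ^ m)) (at x)"
      unfolding w_def
      by (rule has_vector_derivative_real_field[where f = "\<lambda>z. (z + \<i> * of_real c) ^ Suc m"])
         (auto intro!: derivative_eq_intros simp del: power_Suc)
    have "(G has_vector_derivative w x ^ Suc m * P' x + (of_nat (Suc m) * w x ^ m) * P x) (at x)"
      unfolding G_def by (rule has_vector_derivative_mult[OF dw der[OF that]])
    also have "w x ^ Suc m * P' x + (of_nat (Suc m) * w x ^ m) * P x = w x ^ m * R x"
      unfolding ode[OF that, symmetric] w_def by (simp add: algebra_simps)
    finally show ?thesis .
  qed
  have Rr: "rapid_decay R" using R by (simp add: tame_def)
  have rap: "rapid_decay (\<lambda>x. w x ^ m * R x)"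
    unfolding rapid_decay_def
  proof
    fix q
    obtain B where B: "\<And>x. x \<ge> 1 \<Longrightarrow> norm (R x) \<le> B * x powr (- (q + real m))"
      using Rr unfolding rapid_decay_def by blast
    have "norm (w x ^ m * R x) \<le> ((1 + c) ^ m * B) * x powr (- q)" if "x \<ge> 1" for x
    proof -
      have "norm (w x) \<le> (1 + c) * x" using wu[of x] that c
        by (simp add: algebra_simps) (smt (verit) mult_le_cancel_left1)
      then have "norm (w x) ^ m \<le> ((1 + c) * x) ^ m" by (intro power_mono) auto
      then have "norm (w x) ^ m * norm (R x) \<le> ((1 + c) * x) ^ m * (B * x powr (- (q + real m)))"
        using that c by (intro mult_mono B) auto
      also have "\<dots> = ((1 + c) ^ m * B) * x powr (- q)"
      proof -
        have "x ^ m * x powr (- (q + real m)) = x powr (- q)"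
          using that by (simp flip: powr_realpow powr_add)
        then show ?thesis by (simp add: power_mult_distrib)
      qed
      finally show ?thesis by (simp add: norm_mult norm_power)
    qed
    then show "\<exists>B. \<forall>x\<ge>1. norm (w x ^ m * R x) \<le> B * x powr (- q)" by blast
  qed
  obtain L where L: "rapid_decay (\<lambda>x. G x - L)" using rapid_decay_antiderivative[OF G rap] by blast
  have eq: "P x - L / w x ^ Suc m = (G x - L) / w x ^ Suc m" for x
    using w(3)[of x] by (simp add: G_def diff_divide_distrib)
  obtain q0 where q0: "pole_order_bound q0 R" using R by (auto simp: tame_def)
  \<comment> \<open>A positive exponent makes x^(-q) decreasing and at least 1 on (0,1], so bounds
    on [x,1] and additive constants can be absorbed into it.\<close>
  define q where "q = max q0 1"
  have "pole_order_bound q R" using q0 pole_order_bound_mono by (simp add: q_def)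
  then obtain B where B: "\<And>x. 0 < x \<Longrightarrow> x \<le> 1 \<Longrightarrow> norm (R x) \<le> B * x powr (- q)"
    by (auto simp: pole_order_bound_def)
  have B0: "B \<ge> 0" using order_trans[OF norm_ge_zero B[of 1]] by simp
  define K where "K = (1 + c) ^ m * B"
  have K0: "K \<ge> 0" using B0 c by (simp add: K_def)
  have Kb: "norm (w t ^ m * R t) \<le> K * x powr (- q)" if "0 < x" "x \<le> t" "t \<le> 1" for x t
  proof -
    have "norm (w t) ^ m \<le> (1 + c) ^ m" using wu[of t] that by (intro power_mono) auto
    then have "norm (w t) ^ m * norm (R t) \<le> (1 + c) ^ m * (B * t powr (- q))"
      using that c by (intro mult_mono B) auto
    also have "\<dots> \<le> K * x powr (- q)" unfolding K_def mult.assoc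
      using that c B0 by (intro mult_left_mono powr_mono2') (auto simp: q_def)
    finally show ?thesis by (simp add: norm_mult norm_power)
  qed
  have near: "norm (G x - L) \<le> (K + norm (G 1) + norm L) * x powr (- q)" if x: "0 < x" "x \<le> 1" for x
  proof -
    have 1: "norm (G 1 - G x) \<le> K * x powr (- q)"
    proof (cases "x < 1")
      case True
      have "norm (G 1 - G x) \<le> K * x powr (- q) * 1 - K * x powr (- q) * x"
      proof (rule differentiable_bound_general[OF True])
        show "continuous_on {x..1} G"
          by (intro continuous_at_imp_continuous_on ballI has_vector_derivative_continuous[OF G]) (use x in auto)
        show "continuous_on {x..1} (\<lambda>t. K * x powr (- q) * t)" by (intro continuous_intros)
        show "(G has_vector_derivative w t ^ m * R t) (at t)" if "x < t" for t using G[of t] that x by auto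
        show "((\<lambda>t. K * x powr (- q) * t) has_vector_derivative K * x powr (- q)) (at t)" for t
          unfolding has_real_derivative_iff_has_vector_derivative[symmetric]
          by (auto intro!: derivative_eq_intros)
        show "norm (w t ^ m * R t) \<le> K * x powr (- q)" if "x < t" "t < 1" for t using Kb[of x t] that x by auto
      qed
      also have "\<dots> \<le> K * x powr (- q)" using x K0 by simp
      finally show ?thesis .
    qed (use x K0 in auto)
    have 2: "x powr (- q) \<ge> 1" using x by (simp add: q_def powr_minus powr_le1 one_le_inverse_iff)
    have "norm (G x - L) \<le> norm (G 1 - G x) + norm (G 1) + norm L"
      using norm_triangle_ineq4[of "G 1 - (G 1 - G x)" L] norm_triangle_ineq4[of "G 1" "G 1 - G x"] by simp
    also have "\<dots> \<le> K * x powr (- q) + norm (G 1) * x powr (- q) + norm L * x powr (- q)"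
      using 1 2 by (intro add_mono) (auto simp: mult_le_cancel_left1)
    finally show ?thesis by (simp add: algebra_simps)
  qed
  have "tame (\<lambda>x. (G x - L) / w x ^ Suc m)"
    unfolding tame_def
  proof (intro conjI)
    have Gc: "continuous_on {0<..} G"
      by (intro continuous_at_imp_continuous_on ballI has_vector_derivative_continuous[OF G]) auto
    show "continuous_on {0<..} (\<lambda>x. (G x - L) / w x ^ Suc m)"
      by (intro continuous_intros Gc) (use w in \<open>auto simp: w_def intro!: continuous_intros\<close>)
    have "norm ((G x - L) / w x ^ Suc m) \<le> (K + norm (G 1) + norm L) / c ^ Suc m * x powr (- q)" if x: "0 < x" "x \<le> 1" for x
    proof -
      have "norm ((G x - L) / w x ^ Suc m) = norm (G x - L) / norm (w x) ^ Suc m" by (simp add: norm_divide norm_power norm_mult)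
      also have "\<dots> \<le> ((K + norm (G 1) + norm L) * x powr (- q)) / c ^ Suc m"
        by (intro frac_le near x power_mono w) (use c K0 in auto)
      finally show ?thesis by simp
    qed
    then show "\<exists>q. pole_order_bound q (\<lambda>x. (G x - L) / w x ^ Suc m)" unfolding pole_order_bound_def by blast
    show "rapid_decay (\<lambda>x. (G x - L) / w x ^ Suc m)"
      unfolding rapid_decay_def
    proof
      fix q
      obtain B where B: "\<And>x. x \<ge> 1 \<Longrightarrow> norm (G x - L) \<le> B * x powr (- q)"
        using L unfolding rapid_decay_def by blast
      have "norm ((G x - L) / w x ^ Suc m) \<le> B * x powr (- q)" if "x \<ge> 1" for x
      proof -
        have "norm ((G x - L) / w x ^ Suc m) = norm (G x - L) / norm (w x) ^ Suc m" by (simp add: norm_divide norm_power norm_mult)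
        also have "\<dots> \<le> norm (G x - L) / 1"
          using w(1)[of x] w(3)[of x] that by (intro divide_left_mono one_le_power) auto
        finally show ?thesis using B[OF that] by simp
      qed
      then show "\<exists>B. \<forall>x\<ge>1. norm ((G x - L) / w x ^ Suc m) \<le> B * x powr (- q)" by blast
    qed
  qed
  then have "tame (\<lambda>x. P x - L / w x ^ Suc m)" unfolding eq .
  then show ?thesis unfolding w_def by blast
qed

section \<open>Shift operators on the Mellin side\<close>

text \<open>
  \<open>mshift c\<close> is the action of the Euler operator \<open>w d/dw + 2\<close> with \<open>w = x + \<i>c\<close> on \<open>S \<mapsto> \<M>g(S) / \<Gamma>(S)\<close>.
\<close>
definition mshift :: "real \<Rightarrow> (complex \<Rightarrow> complex) \<Rightarrow> complex \<Rightarrow> complex" where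
  "mshift c G S = (2 - S) * G S - \<i> * of_real c * G (S - 1)"

text \<open>The polynomial \<open>p\<close> evaluated at the operator \<open>mshift c\<close>. By
  \<open>shift_op_mult\<close> this is multiplicative, so a factorization of \<open>p\<close>
  becomes a composition of first-order operators.\<close>

definition shift_op :: "real \<Rightarrow> real poly \<Rightarrow> (complex \<Rightarrow> complex) \<Rightarrow> complex \<Rightarrow> complex" where
  "shift_op c p G S = (\<Sum>i\<le>degree p. of_real (poly.coeff p i) * (mshift c ^^ i) G S)"

lemma shift_op_altdef:
  assumes "degree p \<le> n"
  shows "shift_op c p G S = (\<Sum>i\<le>n. of_real (poly.coeff p i) * (mshift c ^^ i) G S)"
  unfolding shift_op_def
  by (rule sum.mono_neutral_left) (use assms in \<open>auto simp: coeff_eq_0\<close>)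

lemma shift_op_0 [simp]: "shift_op c 0 G S = 0"
  by (simp add: shift_op_def)

lemma shift_op_pCons: "shift_op c (pCons a p) G S = of_real a * G S + shift_op c p (mshift c G) S"
proof -
  have "shift_op c (pCons a p) G S = (\<Sum>i\<le>Suc (degree p). of_real (poly.coeff (pCons a p) i) * (mshift c ^^ i) G S)"
    by (rule shift_op_altdef) (simp add: degree_pCons_le)
  also have "\<dots> = of_real a * G S + shift_op c p (mshift c G) S"
    by (simp only: sum.atMost_Suc_shift) (simp add: shift_op_def funpow_swap1)
  finally show ?thesis .
qed

lemma shift_op_1 [simp]: "shift_op c 1 G S = G S"
  by (simp add: one_pCons shift_op_pCons)

lemma shift_op_add: "shift_op c (p + q) G S = shift_op c p G S + shift_op c q G S"
  using shift_op_altdef[of "p + q" "max (degree p) (degree q)" c G S]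
        shift_op_altdef[of p "max (degree p) (degree q)" c G S] 
        shift_op_altdef[of q "max (degree p) (degree q)" c G S]
  by (simp add: degree_add_le sum.distrib ring_distribs)

lemma shift_op_smult: "shift_op c (Polynomial.smult a p) G S = of_real a * shift_op c p G S"
  using shift_op_altdef[of "Polynomial.smult a p" "degree p" c G S]
  by (simp add: degree_smult_le shift_op_def sum_distrib_left mult_ac)

lemma shift_op_sum: "shift_op c (\<Sum>x\<in>A. p x) G S = (\<Sum>x\<in>A. shift_op c (p x) G S)"
  by (induction A rule: infinite_finite_induct) (auto simp: shift_op_add)

lemma mshift_shift_op: "mshift c (shift_op c p G) S = shift_op c p (mshift c G) S"
proof (induction p arbitrary: G S)
  case 0
  then show ?case by (simp add: mshift_def)
next
  case (pCons a p)
  have "mshift c (shift_op c (pCons a p) G) S = of_real a * mshift c G S + mshift c (shift_op c p (mshift c G)) S"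
    by (simp add: mshift_def shift_op_pCons algebra_simps)
  also have "\<dots> = shift_op c (pCons a p) (mshift c G) S"
    by (simp add: pCons.IH shift_op_pCons)
  finally show ?case .
qed

lemma shift_op_mult: "shift_op c (p * q) G S = shift_op c p (shift_op c q G) S"
proof (induction p arbitrary: G S)
  case (pCons a p)
  have "mshift c (shift_op c q G) = shift_op c q (mshift c G)"
    by (rule ext) (rule mshift_shift_op)
  then show ?case
    by (simp add: mult_pCons_left shift_op_add shift_op_smult shift_op_pCons pCons.IH)
qed auto

lemma mshift_funpow_cong:
  assumes "\<And>n. n \<le> i \<Longrightarrow> G (S - of_nat n) = G' (S - of_nat n)"
  shows "(mshift c ^^ i) G S = (mshift c ^^ i) G' S"
  using assms
proof (induction i arbitrary: S)
  case (Suc i)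
  have "(mshift c ^^ i) G S = (mshift c ^^ i) G' S" using Suc by auto
  moreover have "(mshift c ^^ i) G (S - 1) = (mshift c ^^ i) G' (S - 1)"
    using Suc.prems[of "Suc _"] by (intro Suc.IH) (simp add: algebra_simps)
  ultimately show ?case
    by (simp add: mshift_def[of c "(mshift c ^^ i) G"] mshift_def[of c "(mshift c ^^ i) G'"])
qed auto

text \<open>Only the values at S, S - 1, ..., S - degree p enter. Identities known only in a right
  half-plane or off the integers can therefore be substituted under the operator.\<close>

lemma shift_op_cong:
  assumes "\<And>n. n \<le> degree p \<Longrightarrow> G (S - of_nat n) = G' (S - of_nat n)"
  shows "shift_op c p G S = shift_op c p G' S"
  unfolding shift_op_def by (intro sum.cong refl arg_cong2[of _ _ _ _ "(*)"] mshift_funpow_cong) (use assms in auto)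

lemma shift_op_linear: "shift_op c [:a, 1:] G S = of_real a * G S + mshift c G S"
  by (simp add: shift_op_pCons)

text \<open>On a series of terms C (i delta)^(S-2) with delta = c + g nu, one step multiplies each
  term by (i delta - ic)/(i delta) = g nu / delta.\<close>

fun iterated_difference :: "real \<Rightarrow> (complex \<Rightarrow> complex) \<Rightarrow> nat \<Rightarrow> complex \<Rightarrow> complex" where
  "iterated_difference c E 0 S = E S"
| "iterated_difference c E (Suc r) S = iterated_difference c E r S - \<i> * of_real c * iterated_difference c E r (S - 1)"

text \<open>In the step X + r, the two Gamma factors (2 + r - S) Gamma(2 + r - S) and Gamma(2 + r -
  (S - 1)) are the same number Gamma(3 + r - S). It factors out and leaves the difference of
  \<open>E\<close>. Non-integral S keeps all arguments away from poles.\<close>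

lemma shift_op_rising_Gamma:
  assumes "S \<notin> \<int>"
  shows "shift_op c (\<Prod>v<r. [:real v, 1:]) (\<lambda>S. E S * Gamma (2 - S)) S
      = iterated_difference c E r S * Gamma (2 + of_nat r - S)"
  using assms
proof (induction r arbitrary: S)
  case (Suc r)
  define Y where "Y = shift_op c (\<Prod>v<r. [:real v, 1:]) (\<lambda>S. E S * Gamma (2 - S))"
  have S1: "S - 1 \<notin> \<int>" using Suc.prems by simp
  have Y: "Y S = iterated_difference c E r S * Gamma (2 + of_nat r - S)"
    "Y (S - 1) = iterated_difference c E r (S - 1) * Gamma (2 + of_nat r - (S - 1))"
    unfolding Y_def using Suc.IH Suc.prems S1 by blast+
  have "2 + of_nat r - S \<notin> \<int>"
    using Suc.prems Ints_diff[of "2 + of_nat r" "2 + of_nat r - S"] by auto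
  then have "2 + of_nat r - S \<notin> \<int>\<^sub>\<le>\<^sub>0" using nonpos_Ints_Int by blast
  then have G: "Gamma (2 + of_nat (Suc r) - S) = (2 + of_nat r - S) * Gamma (2 + of_nat r - S)"
    using Gamma_plus1[of "2 + of_nat r - S"] by (simp add: algebra_simps)
  have G': "Gamma (2 + of_nat r - (S - 1)) = Gamma (2 + of_nat (Suc r) - S)" by (simp add: algebra_simps)
  have "shift_op c (\<Prod>v<Suc r. [:real v, 1:]) (\<lambda>S. E S * Gamma (2 - S)) S = shift_op c ([:real r, 1:] * (\<Prod>v<r. [:real v, 1:])) (\<lambda>S. E S * Gamma (2 - S)) S"
    by (simp only: prod.lessThan_Suc mult.commute)
  also have "\<dots> = of_nat r * Y S + mshift c Y S"
    unfolding shift_op_mult shift_op_linear Y_def by simp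
  also have "\<dots> = iterated_difference c E (Suc r) S * Gamma (2 + of_nat (Suc r) - S)"
    unfolding mshift_def Y G' unfolding G by (simp add: algebra_simps)
  finally show ?case .
qed auto

text \<open>The l-th rising factorial is monic of degree H - l, so comparing coefficients of X^(H-l)
  for increasing l is a triangular system.\<close>

lemma rising_basis_unique:
  fixes a b :: "nat \<Rightarrow> real"
  assumes "(\<Sum>l\<le>H. Polynomial.smult (a l) (\<Prod>i<H - l. [:real i, 1:])) = (\<Sum>l\<le>H. Polynomial.smult (b l) (\<Prod>i<H - l. [:real i, 1:]))"
    and "l \<le> H"
  shows "a l = b l"
proof -
  define d where "d l = a l - b l" for l
  have deg: "degree (\<Prod>i<n. [:real i, 1:]) = n" "poly.coeff (\<Prod>i<n. [:real i, 1:]) n = 1" for n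
  proof -
    show 1: "degree (\<Prod>i<n. [:real i, 1:]) = n" by (subst degree_prod_eq_sum_degree) auto
    have "lead_coeff (\<Prod>i<n. [:real i, 1:]) = 1" by (simp add: lead_coeff_prod)
    then show "poly.coeff (\<Prod>i<n. [:real i, 1:]) n = 1" using 1 by simp
  qed
  have z: "(\<Sum>l\<le>H. Polynomial.smult (d l) (\<Prod>i<H - l. [:real i, 1:])) = 0"
    using assms(1) by (simp add: d_def smult_diff_left sum_subtractf)
  have "d l = 0" if "l \<le> H" for l
    using that
  proof (induction l rule: less_induct)
    case (less l)
    have "0 = poly.coeff (\<Sum>l\<le>H. Polynomial.smult (d l) (\<Prod>i<H - l. [:real i, 1:])) (H - l)" by (simp add: z)
    also have "\<dots> = (\<Sum>j\<le>H. d j * poly.coeff (\<Prod>i<H - j. [:real i, 1:]) (H - l))" by (simp add: coeff_sum)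
    also have "\<dots> = (\<Sum>j\<in>{l}. d j * poly.coeff (\<Prod>i<H - j. [:real i, 1:]) (H - l))"
    proof (rule sum.mono_neutral_right)
      show "\<forall>j\<in>{..H} - {l}. d j * poly.coeff (\<Prod>i<H - j. [:real i, 1:]) (H - l) = 0"
      proof
        fix j assume j: "j \<in> {..H} - {l}"
        show "d j * poly.coeff (\<Prod>i<H - j. [:real i, 1:]) (H - l) = 0"
        proof (cases "j < l")
          case True
          then show ?thesis using less j by auto
        next
          case False
          then have "degree (\<Prod>i<H - j. [:real i, 1:]) < H - l" using j less.prems by (auto simp: deg)
          then show ?thesis by (simp add: coeff_eq_0)
        qed
      qed
    qed (use less in auto)
    also have "\<dots> = d l" by (simp add: deg)
    finally show ?case by simp
  qed
  with assms(2) show ?thesis by (auto simp: d_def)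
qed

lemma rising_basis_exists:
  fixes p :: "real poly"
  assumes "degree p \<le> H"
  shows "\<exists>a. p = (\<Sum>l\<le>H. Polynomial.smult (a l) (\<Prod>i<H - l. [:real i, 1:]))"
  using assms
proof (induction H arbitrary: p)
  case 0
  then obtain c where "p = [:c:]" by (auto elim: degree_eq_zeroE)
  then show ?case by (intro exI[of _ "\<lambda>_. c"]) simp
next
  case (Suc H)
  define P where "P = (\<Prod>i<Suc H. [:real i, 1:])"
  have deg: "degree P = Suc H" unfolding P_def by (subst degree_prod_eq_sum_degree) auto
  have "lead_coeff P = 1" unfolding P_def by (simp add: lead_coeff_prod del: prod.lessThan_Suc)
  with deg have lc: "poly.coeff P (Suc H) = 1" by simp
  define q where "q = p - Polynomial.smult (poly.coeff p (Suc H)) P"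
  have "degree q \<le> H"
  proof (rule degree_le, intro allI impI)
    fix i assume "H < i"
    then consider "i = Suc H" | "i > Suc H" by linarith
    then show "poly.coeff q i = 0"
      by cases (use Suc.prems deg lc in \<open>auto simp: q_def coeff_eq_0\<close>)
  qed
  then obtain a where a: "q = (\<Sum>l\<le>H. Polynomial.smult (a l) (\<Prod>i<H - l. [:real i, 1:]))" using Suc.IH by blast
  define b where "b l = (case l of 0 \<Rightarrow> poly.coeff p (Suc H) | Suc l \<Rightarrow> a l)" for l
  have "(\<Sum>l\<le>Suc H. Polynomial.smult (b l) (\<Prod>i<Suc H - l. [:real i, 1:])) = Polynomial.smult (poly.coeff p (Suc H)) P + q"
    unfolding a by (simp only: sum.atMost_Suc_shift) (simp add: b_def P_def)
  also have "\<dots> = p" by (simp add: q_def)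
  finally show ?case by metis
qed

text \<open>Existence and uniqueness discharge the definite description; beyond \<open>H\<close> the
  sequence is pinned down by its vanishing clause.\<close>

lemma a_coeff_identity:
  "(\<Prod>j\<in>{1..H}. [:2 * real j - 1, 1:]) = (\<Sum>l\<le>H. Polynomial.smult (a_coeff H l) (\<Prod>i<H - l. [:real i, 1:]))"
proof -
  have "degree (\<Prod>j\<in>{1..H}. [:2 * real j - 1, 1:]) \<le> H"
    by (subst degree_prod_eq_sum_degree) auto
  then obtain a0 where a0: "(\<Prod>j\<in>{1..H}. [:2 * real j - 1, 1:]) = (\<Sum>l\<le>H. Polynomial.smult (a0 l) (\<Prod>i<H - l. [:real i, 1:]))"
    using rising_basis_exists by blast
  define a where "a l = (if l \<le> H then a0 l else 0)" for l
  have a: "(\<forall>l>H. a l = 0) \<and> (\<Prod>j\<in>{1..H}. [:2 * real j - 1, 1:]) = (\<Sum>l\<le>H. Polynomial.smult (a l) (\<Prod>i<H - l. [:real i, 1:]))"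
    unfolding a0 by (auto simp: a_def)
  have "a_coeff H = a"
    unfolding a_coeff_def
  proof (rule the_equality[where P = "\<lambda>a. (\<forall>l>H. a l = 0) \<and> _ = (\<Sum>l\<le>H. Polynomial.smult (a l) (\<Prod>i<H - l. [:real i, 1:]))", OF a])
    fix b assume b: "(\<forall>l>H. b l = 0) \<and> (\<Prod>j\<in>{1..H}. [:2 * real j - 1, 1:]) = (\<Sum>l\<le>H. Polynomial.smult (b l) (\<Prod>i<H - l. [:real i, 1:]))"
    show "b = a"
    proof
      fix l show "b l = a l"
        using rising_basis_unique[where H = H and a = b and b = a and l = l] a b by (cases "l \<le> H") auto
    qed
  qed
  with a show ?thesis by simp
qed

text \<open>The argument of i d is sgn(d) pi/2. This sign is what later separates the factors exp(-i
  pi s) and exp(i pi s) of \<open>F_star\<close>.\<close>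

lemma imaginary_powr:
  fixes d :: real
  assumes "d \<noteq> 0"
  shows "(\<i> * of_real d) powr w = of_real \<bar>d\<bar> powr w * exp (\<i> * of_real (sgn d * pi / 2) * w)"
proof -
  have "Ln (\<i> * of_real d) = of_real (ln \<bar>d\<bar>) + \<i> * of_real (sgn d * pi / 2)"
  proof (rule Ln_unique)
    show "exp (of_real (ln \<bar>d\<bar>) + \<i> * of_real (sgn d * pi / 2)) = \<i> * complex_of_real d"
      using assms by (cases "d > 0") (auto simp: exp_add sgn_if exp_of_real complex_eq_iff Re_exp Im_exp)
  qed (auto simp: sgn_if)
  then show ?thesis using assms
    by (simp add: powr_def Ln_of_real ring_distribs exp_add mult_ac)
qed

lemma norm_imaginary_powr_le:
  fixes d :: real
  assumes "d \<noteq> 0"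
  shows "norm ((\<i> * of_real d) powr w) \<le> \<bar>d\<bar> powr Re w * exp (2 * \<bar>Im w\<bar>)"
proof -
  have "norm ((\<i> * of_real d) powr w) = \<bar>d\<bar> powr Re w * exp (- (sgn d * pi / 2) * Im w)"
    unfolding imaginary_powr[OF assms] norm_mult norm_exp_eq_Re using assms by (simp add: norm_powr_real_powr)
  also have "- (sgn d * pi / 2) * Im w \<le> \<bar>sgn d * pi / 2\<bar> * \<bar>Im w\<bar>"
    by (metis abs_ge_self abs_minus_cancel abs_mult)
  also have "\<dots> \<le> 2 * \<bar>Im w\<bar>"
    using pi_less_4 by (intro mult_right_mono) (auto simp: abs_mult sgn_if)
  finally show ?thesis by (simp add: mult_left_mono)
qed

text \<open>The modulus is at least x and at least |d|; weighting these bounds with exponents t and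
  2 - t trades decay in x against decay in d.\<close>

lemma norm_inverse_square_interpolate:
  fixes x d t :: real
  assumes "x > 0" "d \<noteq> 0" "0 \<le> t" "t \<le> 2"
  shows "norm (1 / (complex_of_real x + \<i> * of_real d) ^ 2) \<le> x powr (- t) * \<bar>d\<bar> powr (t - 2)"
proof -
  define m where "m = norm (complex_of_real x + \<i> * of_real d)"
  have m: "m \<ge> x" "m \<ge> \<bar>d\<bar>" unfolding m_def using norm_add_imaginary_ge[where x = x and d = d] assms by auto
  have "x powr t * \<bar>d\<bar> powr (2 - t) \<le> m powr t * m powr (2 - t)"
    using m assms by (intro mult_mono powr_mono2) auto
  also have "\<dots> = m ^ 2" using m assms by (simp add: powr_add[symmetric])
  finally have "1 / m ^ 2 \<le> 1 / (x powr t * \<bar>d\<bar> powr (2 - t))"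
    using assms m by (intro divide_left_mono) auto
  also have "\<dots> = x powr (- t) * \<bar>d\<bar> powr (t - 2)"
    using assms by (simp add: powr_minus powr_diff field_simps)
  finally show ?thesis by (simp add: m_def norm_divide norm_power)
qed

lemma integral_powr_complex:
  shows "Re S > 0 \<Longrightarrow> (LBINT x:{0<..1}. complex_of_real x powr (S - 1)) = 1 / S"
    and "Re S < 0 \<Longrightarrow> (LBINT x:{1<..}. complex_of_real x powr (S - 1)) = - 1 / S"
proof -
  have d: "((\<lambda>x. complex_of_real x powr S / S) has_vector_derivative of_real x powr (S - 1)) (at x)" if "x > 0" "S \<noteq> 0" for x
    by (rule has_vector_derivative_real_field[where f = "\<lambda>z. z powr S / S"])
       (use that in \<open>auto intro!: derivative_eq_intros\<close>)
  have c: "isCont (\<lambda>x. complex_of_real x powr (S - 1)) x" if "x > 0" for x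
    by (intro continuous_intros) (use that in auto)
  have p1: "pole_order_bound 0 (\<lambda>_. 1)" by (auto simp: pole_order_bound_def intro: exI[of _ 1])
  show "(LBINT x:{0<..1}. complex_of_real x powr (S - 1)) = 1 / S" if S: "Re S > 0"
  proof -
    have S0: "S \<noteq> 0" using S by auto
    have i: "set_integrable lborel {0<..1} (\<lambda>x. complex_of_real x powr (S - 1))"
      using mellin_integrable_at_0[of "\<lambda>_. 1" 0 S, OF _ p1 S] by simp
    have "(LBINT x=ereal 0..ereal 1. complex_of_real x powr (S - 1)) = 1 / S - 0"
    proof (rule interval_integral_FTC_integrable[where F = "\<lambda>x. complex_of_real x powr S / S"])
      show "set_integrable lborel (einterval (ereal 0) (ereal 1)) (\<lambda>x. complex_of_real x powr (S - 1))"
        by (rule set_integrable_subset[OF i]) (auto simp: einterval_def)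
      show "(((\<lambda>x. complex_of_real x powr S / S) \<circ> real_of_ereal) \<longlongrightarrow> 0) (at_right (ereal 0))"
        unfolding ereal_tendsto_simps
      proof (rule Lim_null_comparison)
        show "\<forall>\<^sub>F x in at_right 0. norm (complex_of_real x powr S / S) \<le> x powr Re S / norm S"
          using eventually_at_right_less[of "0::real"]
          by eventually_elim (simp add: norm_divide norm_powr_real_powr)
        have "((\<lambda>x. x powr Re S) \<longlongrightarrow> 0) (at_right 0)" using S by real_asymp
        then show "((\<lambda>x. x powr Re S / norm S) \<longlongrightarrow> 0) (at_right 0)" by (rule tendsto_divide_zero)
      qed
      have "((\<lambda>x. complex_of_real x powr S / S) \<longlongrightarrow> complex_of_real 1 powr S / S) (at_left 1)"
        by (intro tendsto_intros) (use S0 in auto)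
      then show "(((\<lambda>x. complex_of_real x powr S / S) \<circ> real_of_ereal) \<longlongrightarrow> 1 / S) (at_left (ereal 1))"
        unfolding ereal_tendsto_simps by simp
    qed (use d c S0 in auto)
    also have "(LBINT x=ereal 0..ereal 1. complex_of_real x powr (S - 1)) = (LBINT x:{0<..1}. complex_of_real x powr (S - 1))"
      by (subst interval_integral_Ioc) auto
    finally show ?thesis by simp
  qed
  show "(LBINT x:{1<..}. complex_of_real x powr (S - 1)) = - 1 / S" if S: "Re S < 0"
  proof -
    have S0: "S \<noteq> 0" using S by auto
    have i: "set_integrable lborel {1<..} (\<lambda>x. complex_of_real x powr (S - 1))"
      using mellin_integrable_at_top[of "\<lambda>_. 1" 1 0 S] S by simp
    have "(LBINT x=ereal 1..\<infinity>. complex_of_real x powr (S - 1)) = 0 - 1 / S"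
    proof (rule interval_integral_FTC_integrable[where F = "\<lambda>x. complex_of_real x powr S / S"])
      show "set_integrable lborel (einterval (ereal 1) \<infinity>) (\<lambda>x. complex_of_real x powr (S - 1))"
        by (rule set_integrable_subset[OF i]) (auto simp: einterval_def)
      have "((\<lambda>x. complex_of_real x powr S / S) \<longlongrightarrow> complex_of_real 1 powr S / S) (at_right 1)"
        by (intro tendsto_intros) (use S0 in auto)
      then show "(((\<lambda>x. complex_of_real x powr S / S) \<circ> real_of_ereal) \<longlongrightarrow> 1 / S) (at_right (ereal 1))"
        unfolding ereal_tendsto_simps by simp
      show "(((\<lambda>x. complex_of_real x powr S / S) \<circ> real_of_ereal) \<longlongrightarrow> 0) (at_left \<infinity>)"
        unfolding ereal_tendsto_simps
      proof (rule Lim_null_comparison)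
        show "\<forall>\<^sub>F x in at_top. norm (complex_of_real x powr S / S) \<le> x powr Re S / norm S"
          using eventually_gt_at_top[of "0::real"]
          by eventually_elim (simp add: norm_divide norm_powr_real_powr)
        have "((\<lambda>x. x powr Re S) \<longlongrightarrow> 0) at_top" using S by real_asymp
        then show "((\<lambda>x. x powr Re S / norm S) \<longlongrightarrow> 0) at_top" by (rule tendsto_divide_zero)
      qed
    qed (use d c S0 in auto)
    also have "(LBINT x=ereal 1..\<infinity>. complex_of_real x powr (S - 1)) = (LBINT x:{1<..}. complex_of_real x powr (S - 1))"
      by (simp add: interval_lebesgue_integral_def)
    finally show ?thesis by simp
  qed
qed

text \<open>On a disc of radius r about S0, |delta|^(Re S - 2) is at most the sum of its values for
  the two extreme exponents Re S0 + r and Re S0 - r, whether |delta| is large or small. Both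
  extremes are summable, which gives a uniform majorant.\<close>

lemma holomorphic_on_imaginary_series:
  fixes b :: "nat \<Rightarrow> complex" and \<delta> :: "nat \<Rightarrow> real"
  assumes nz: "\<And>k. b k \<noteq> 0 \<Longrightarrow> \<delta> k \<noteq> 0"
    and summ: "\<And>\<eta>. \<eta> < \<eta>0 \<Longrightarrow> summable (\<lambda>k. norm (b k) * \<bar>\<delta> k\<bar> powr (\<eta> - 2))"
  shows "(\<lambda>S. \<Sum>k. b k * (\<i> * of_real (\<delta> k)) powr (S - 2)) holomorphic_on {S. Re S < \<eta>0}"
    and "\<And>S. Re S < \<eta>0 \<Longrightarrow> summable (\<lambda>k. norm (b k * (\<i> * of_real (\<delta> k)) powr (S - 2)))"
proof -
  let ?f = "\<lambda>k S. b k * (\<i> * of_real (\<delta> k)) powr (S - 2)"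
  have bound: "norm (?f k S) \<le> (norm (b k) * \<bar>\<delta> k\<bar> powr ((Re S0 + r) - 2) + norm (b k) * \<bar>\<delta> k\<bar> powr ((Re S0 - r) - 2)) * exp (2 * (\<bar>Im S0\<bar> + r))"
    if "\<bar>Re S - Re S0\<bar> \<le> r" "\<bar>Im S - Im S0\<bar> \<le> r" for k S S0 r
  proof (cases "b k = 0")
    case False
    have d: "\<delta> k \<noteq> 0" using nz False by auto
    have "\<bar>\<delta> k\<bar> powr (Re S - 2) \<le> \<bar>\<delta> k\<bar> powr ((Re S0 + r) - 2) + \<bar>\<delta> k\<bar> powr ((Re S0 - r) - 2)"
    proof (cases "\<bar>\<delta> k\<bar> \<ge> 1")
      case True
      then have "\<bar>\<delta> k\<bar> powr (Re S - 2) \<le> \<bar>\<delta> k\<bar> powr ((Re S0 + r) - 2)" using that by (intro powr_mono) auto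
      then show ?thesis by (simp add: add_increasing2)
    next
      case False
      then have "\<bar>\<delta> k\<bar> powr (Re S - 2) \<le> \<bar>\<delta> k\<bar> powr ((Re S0 - r) - 2)" using that d by (intro powr_mono') auto
      then show ?thesis by (simp add: add_increasing)
    qed
    moreover have "exp (2 * \<bar>Im (S - 2)\<bar>) \<le> exp (2 * (\<bar>Im S0\<bar> + r))" using that by auto
    ultimately have "norm ((\<i> * of_real (\<delta> k)) powr (S - 2)) \<le> (\<bar>\<delta> k\<bar> powr ((Re S0 + r) - 2) + \<bar>\<delta> k\<bar> powr ((Re S0 - r) - 2)) * exp (2 * (\<bar>Im S0\<bar> + r))"
      by (intro order_trans[OF norm_imaginary_powr_le[OF d]] mult_mono) auto
    then have "norm (b k) * norm ((\<i> * of_real (\<delta> k)) powr (S - 2)) \<le> norm (b k) * ((\<bar>\<delta> k\<bar> powr ((Re S0 + r) - 2) + \<bar>\<delta> k\<bar> powr ((Re S0 - r) - 2)) * exp (2 * (\<bar>Im S0\<bar> + r)))"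
      by (rule mult_left_mono) simp
    then show ?thesis by (simp add: norm_mult algebra_simps)
  qed auto
  have summ': "summable (\<lambda>k. (norm (b k) * \<bar>\<delta> k\<bar> powr ((Re S0 + r) - 2) + norm (b k) * \<bar>\<delta> k\<bar> powr ((Re S0 - r) - 2)) * exp (2 * (\<bar>Im S0\<bar> + r)))"
    if "Re S0 + r < \<eta>0" "r \<ge> 0" for S0 r
    by (intro summable_mult2 summable_add summ) (use that in auto)
  show *: "summable (\<lambda>k. norm (?f k S))" if "Re S < \<eta>0" for S
    by (rule summable_comparison_test'[OF summ'[of S 0]]) (use that bound[of S S 0] in auto)
  have op: "open {S. Re S < \<eta>0}" by (simp add: open_halfspace_Re_lt)
  obtain g where g: "\<forall>S\<in>{S. Re S < \<eta>0}. (\<lambda>k. ?f k S) sums g S \<and> g field_differentiable (at S)"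
  proof (rule series_differentiable_comparison_complex[OF op, of ?f])
    show "?f k field_differentiable at S" for k S
    proof (cases "b k = 0")
      case False
      then show ?thesis using nz[OF False]
        by (intro holomorphic_on_imp_differentiable_at[of _ UNIV] holomorphic_intros) auto
    qed simp
  next
    fix S0 assume "S0 \<in> {S. Re S < \<eta>0}"
    define r where "r = (\<eta>0 - Re S0) / 2"
    have r: "r > 0" "Re S0 + r < \<eta>0" using \<open>S0 \<in> _\<close> by (auto simp: r_def field_simps)
    let ?h = "\<lambda>k. complex_of_real ((norm (b k) * \<bar>\<delta> k\<bar> powr ((Re S0 + r) - 2) + norm (b k) * \<bar>\<delta> k\<bar> powr ((Re S0 - r) - 2)) * exp (2 * (\<bar>Im S0\<bar> + r)))"
    show "\<exists>d (h :: nat \<Rightarrow> complex). 0 < d \<and> summable h \<and> range h \<subseteq> \<real>\<^sub>\<ge>\<^sub>0 \<and> (\<forall>\<^sub>F n in sequentially. \<forall>y\<in>ball S0 d \<inter> {S. Re S < \<eta>0}. norm (?f n y) \<le> norm (h n))"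
    proof (rule exI[of _ r], rule exI[of _ ?h], intro conjI)
      show "summable ?h" using summ'[of S0 r] r by (simp only: summable_of_real_iff)
      show "range ?h \<subseteq> \<real>\<^sub>\<ge>\<^sub>0" by (auto simp del: of_real_mult of_real_add)
      show "\<forall>\<^sub>F n in sequentially. \<forall>y\<in>ball S0 r \<inter> {S. Re S < \<eta>0}. norm (?f n y) \<le> norm (?h n)"
      proof (intro always_eventually allI ballI)
        fix n y assume "y \<in> ball S0 r \<inter> {S. Re S < \<eta>0}"
        then have "norm (y - S0) < r" by (simp add: dist_norm norm_minus_commute)
        then have "\<bar>Re y - Re S0\<bar> \<le> r" "\<bar>Im y - Im S0\<bar> \<le> r"
          using abs_Re_le_cmod[of "y - S0"] abs_Im_le_cmod[of "y - S0"] by auto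
        from bound[OF this, of n] show "norm (?f n y) \<le> norm (?h n)"
          unfolding norm_of_real by linarith
      qed
    qed (use r in auto)
  qed auto
  have eq: "g S = (\<Sum>k. ?f k S)" if "S \<in> {S. Re S < \<eta>0}" for S
    using g that sums_unique by blast
  have "g holomorphic_on {S. Re S < \<eta>0}"
    using g by (auto simp: holomorphic_on_def intro: field_differentiable_at_within)
  then show "(\<lambda>S. \<Sum>k. ?f k S) holomorphic_on {S. Re S < \<eta>0}"
    by (rule holomorphic_transform) (rule eq)
qed

section \<open>Continuation of series of double poles\<close>

lemma rGamma_shift: "rGamma (2 - S) = (2 - S) * rGamma (3 - S)" for S :: complex
  using rGamma_plus1[of "2 - S"] by (simp add: algebra_simps)

lemma strip_not_nonpos_Int:
  assumes "Re S > 0" shows "S \<notin> \<int>\<^sub>\<le>\<^sub>0"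
  using assms by (auto elim!: nonpos_Ints_cases)

lemma pochhammer_Gamma_shift:
  assumes "2 - S \<notin> \<int>\<^sub>\<le>\<^sub>0" "p \<ge> (2::nat)"
  shows "pochhammer (2 - S) (p - 2) = rGamma (2 - S) * Gamma (of_nat p - S :: complex)"
proof -
  have "pochhammer (2 - S) (p - 2) = Gamma (2 - S + of_nat (p - 2)) / Gamma (2 - S)"
    by (rule pochhammer_Gamma[OF assms(1)])
  also have "2 - S + of_nat (p - 2) = of_nat p - S" using assms(2) by (simp add: of_nat_diff)
  finally show ?thesis by (simp add: rGamma_inverse_Gamma divide_inverse)
qed

text \<open>Abstract form of the continuation problem: double poles at x = -i delta, corrected by
  powers of x + ic. Rapid decay is assumed for the difference \<open>\<rho>\<close> only. Finitely
  many \<open>\<delta> k\<close> may vanish; these are the singular terms C/x^2 on the path of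
  integration.\<close>

locale quadratic_pole_series =
  fixes C :: "nat \<Rightarrow> complex" and \<delta> :: "nat \<Rightarrow> real" and c \<eta>0 d :: real
    and J :: "nat set" and cf :: "nat \<Rightarrow> complex" and \<rho> :: "real \<Rightarrow> complex"
  assumes c: "c > 0" and eta0: "\<eta>0 > 0" and d: "d > 0"
    and gap: "\<And>k. \<delta> k \<noteq> 0 \<Longrightarrow> \<bar>\<delta> k\<bar> \<ge> d"
    and fin0: "finite {k. \<delta> k = 0}"
    and summ: "\<And>\<eta>. \<eta> < \<eta>0 \<Longrightarrow> summable (\<lambda>k. norm (C k) * \<bar>\<delta> k\<bar> powr (\<eta> - 2))"
    and J: "finite J" "\<And>p. p \<in> J \<Longrightarrow> p \<ge> 2"
    and rho: "continuous_on {0<..} \<rho>" "rapid_decay \<rho>"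
    and rho_eq: "\<And>x. x > 0 \<Longrightarrow> \<rho> x = (\<Sum>k. C k / (of_real x + \<i> * of_real (\<delta> k)) ^ 2)
        - (\<Sum>p\<in>J. cf p / (of_real x + \<i> * of_real c) ^ p)"
begin

definition b where "b k = (if \<delta> k = 0 then 0 else C k)"

definition A where "A = (\<Sum>k | \<delta> k = 0. C k)"

text \<open>Removing the terms with delta = 0 gives boundedness near 0, at the price of decay only
  like x^(-2) at infinity. Hence the Mellin integral is split at 1, with \<open>regular_part\<close>
  below and \<open>\<rho>\<close> above.\<close>

definition regular_part where "regular_part x = \<rho> x - A / of_real x ^ 2"

lemma b_nz: "b k \<noteq> 0 \<Longrightarrow> \<delta> k \<noteq> 0" by (auto simp: b_def split: if_splits)

lemma summ_b: "\<eta> < \<eta>0 \<Longrightarrow> summable (\<lambda>k. norm (b k) * \<bar>\<delta> k\<bar> powr (\<eta> - 2))"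
  by (rule summable_comparison_test'[OF summ[of \<eta>]]) (auto simp: b_def)

lemma regular_terms_summable:
  assumes "x > 0"
  shows "summable (\<lambda>k. norm (b k / (of_real x + \<i> * of_real (\<delta> k)) ^ 2))"
proof (rule summable_comparison_test'[OF summ_b[OF eta0]])
  fix k
  show "norm (norm (b k / (of_real x + \<i> * of_real (\<delta> k)) ^ 2)) \<le> norm (b k) * \<bar>\<delta> k\<bar> powr (0 - 2)"
  proof (cases "b k = 0")
    case False
    from norm_inverse_square_interpolate[OF assms b_nz[OF False], of 0] assms
    have "norm (b k) * norm (1 / (complex_of_real x + \<i> * of_real (\<delta> k)) ^ 2) \<le> norm (b k) * \<bar>\<delta> k\<bar> powr (0 - 2)"
      by (intro mult_left_mono) auto
    then show ?thesis by (simp add: norm_divide)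
  qed auto
qed

lemma regular_part_eq:
  assumes x: "x > 0"
  shows "regular_part x = (\<Sum>k. b k / (of_real x + \<i> * of_real (\<delta> k)) ^ 2) - (\<Sum>p\<in>J. cf p / (of_real x + \<i> * of_real c) ^ p)"
proof -
  have "(\<lambda>k. if k \<in> {k. \<delta> k = 0} then C k / of_real x ^ 2 else 0) sums (\<Sum>k | \<delta> k = 0. C k / of_real x ^ 2)"
    by (rule sums_If_finite_set[OF fin0])
  also have "(\<Sum>k | \<delta> k = 0. C k / of_real x ^ 2) = A / of_real x ^ 2" by (simp add: A_def sum_divide_distrib)
  finally have "(\<lambda>k. b k / (of_real x + \<i> * of_real (\<delta> k)) ^ 2 + (if k \<in> {k. \<delta> k = 0} then C k / of_real x ^ 2 else 0))
     sums ((\<Sum>k. b k / (of_real x + \<i> * of_real (\<delta> k)) ^ 2) + A / of_real x ^ 2)"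
    by (intro sums_add summable_sums summable_norm_cancel[OF regular_terms_summable[OF x]])
  also have "(\<lambda>k. b k / (of_real x + \<i> * of_real (\<delta> k)) ^ 2 + (if k \<in> {k. \<delta> k = 0} then C k / of_real x ^ 2 else 0))
     = (\<lambda>k. C k / (of_real x + \<i> * of_real (\<delta> k)) ^ 2)" by (auto simp: b_def)
  finally show ?thesis by (simp add: regular_part_def rho_eq[OF x] sums_iff)
qed

lemma regular_part_continuous: "continuous_on {0<..} regular_part"
  unfolding regular_part_def by (intro continuous_intros rho) auto

lemma regular_part_bounded: "pole_order_bound 0 regular_part"
proof -
  define M where "M = (\<Sum>k. norm (b k) * \<bar>\<delta> k\<bar> powr (0 - 2)) + (\<Sum>p\<in>J. norm (cf p) / c ^ p)"
  have "norm (regular_part x) \<le> M" if x: "x > 0" for x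
  proof -
    have "norm (\<Sum>k. b k / (of_real x + \<i> * of_real (\<delta> k)) ^ 2) \<le> (\<Sum>k. norm (b k) * \<bar>\<delta> k\<bar> powr (0 - 2))"
    proof (rule norm_suminf_le[OF _ summ_b[OF eta0]])
      fix k
      show "norm (b k / (of_real x + \<i> * of_real (\<delta> k)) ^ 2) \<le> norm (b k) * \<bar>\<delta> k\<bar> powr (0 - 2)"
      proof (cases "b k = 0")
        case False
        from norm_inverse_square_interpolate[OF x b_nz[OF False], of 0] x
        have "norm (b k) * norm (1 / (complex_of_real x + \<i> * of_real (\<delta> k)) ^ 2) \<le> norm (b k) * \<bar>\<delta> k\<bar> powr (0 - 2)"
          by (intro mult_left_mono) auto
        then show ?thesis by (simp add: norm_divide)
      qed auto
    qed
    moreover have "norm (\<Sum>p\<in>J. cf p / (of_real x + \<i> * of_real c) ^ p) \<le> (\<Sum>p\<in>J. norm (cf p) / c ^ p)"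
    proof (rule sum_norm_le)
      fix p
      have "c ^ p \<le> norm (complex_of_real x + \<i> * of_real c) ^ p"
        using norm_add_imaginary_ge[where x = x and d = c] c by (intro power_mono) auto
      then show "norm (cf p / (of_real x + \<i> * of_real c) ^ p) \<le> norm (cf p) / c ^ p"
        unfolding norm_divide norm_power by (intro divide_left_mono mult_pos_pos) (use c in \<open>auto intro: less_le_trans[of 0 "c ^ p"]\<close>)
    qed
    ultimately show ?thesis
      unfolding regular_part_eq[OF x] M_def by (intro order_trans[OF norm_triangle_ineq4] add_mono)
  qed
  then show ?thesis by (auto simp: pole_order_bound_def intro!: exI[of _ M])
qed

lemma rho_pole_order: "pole_order_bound 2 \<rho>"
proof -
  obtain B where B: "\<And>x. 0 < x \<Longrightarrow> x \<le> 1 \<Longrightarrow> norm (regular_part x) \<le> B * x powr (- 0)"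
    using regular_part_bounded by (auto simp: pole_order_bound_def)
  have "norm (\<rho> x) \<le> (B + norm A) * x powr (- 2)" if x: "0 < x" "x \<le> 1" for x
  proof -
    have e: "x powr (-2) = 1 / x ^ 2" using x by (simp add: powr_minus divide_inverse)
    have 1: "1 \<le> x powr (-2)" using x by (simp add: e power_le_one)
    have B0: "B \<ge> 0" using order_trans[OF norm_ge_zero B[of 1]] by simp
    have "norm (\<rho> x) \<le> norm (regular_part x) + norm (A / of_real x ^ 2)"
      using norm_triangle_ineq[of "regular_part x" "A / of_real x ^ 2"] by (simp add: regular_part_def)
    also have "norm (regular_part x) \<le> B * x powr (-2)"
      using B[OF x] x mult_left_mono[OF 1 B0] by simp
    also have "norm (A / of_real x ^ 2) = norm A * x powr (-2)"
      by (simp add: e norm_divide norm_power)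
    finally show ?thesis by (simp add: ring_distribs)
  qed
  then show ?thesis unfolding pole_order_bound_def by blast
qed

lemma regular_part_at_top: "\<exists>B. \<forall>x\<ge>1. norm (regular_part x) \<le> B * x powr (- 2)"
proof -
  obtain B where B: "\<And>x. x \<ge> 1 \<Longrightarrow> norm (\<rho> x) \<le> B * x powr (- 2)"
    using rho(2) unfolding rapid_decay_def by blast
  have "norm (regular_part x) \<le> (B + norm A) * x powr (- 2)" if x: "x \<ge> 1" for x
  proof -
    have e: "x powr (-2) = 1 / x ^ 2" using x by (simp add: powr_minus divide_inverse)
    have "norm (regular_part x) \<le> norm (\<rho> x) + norm (A / of_real x ^ 2)"
      unfolding regular_part_def by (rule norm_triangle_ineq4)
    also have "norm (A / of_real x ^ 2) = norm A * x powr (-2)"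
      by (simp add: e norm_divide norm_power)
    finally show ?thesis using B[OF x] by (simp add: ring_distribs)
  qed
  then show ?thesis by blast
qed

definition I0 where "I0 S = (LBINT x:{0<..1}. of_real x powr (S - 1) * regular_part x)"
definition I1 where "I1 S = (LBINT x:{1<..}. of_real x powr (S - 1) * \<rho> x)"

definition E_left where "E_left S = (\<Sum>k. b k * (\<i> * of_real (\<delta> k)) powr (S - 2))"

text \<open>The integral of A/x^2 over one side of 1 contributes A/(S - 2), up to sign. Multiplied
  by rGamma(2 - S) = (2 - S) rGamma(3 - S) it becomes the entire correction with rGamma(3 - S), so
  the pole at S = 2 disappears.\<close>

definition E_right where
  "E_right S = rGamma S * rGamma (2 - S) * (I0 S + I1 S) - A * rGamma S * rGamma (3 - S)
     + (\<Sum>p\<in>J. cf p * (\<i> * of_real c) powr (S - of_nat p) * pochhammer (2 - S) (p - 2) / Gamma (of_nat p))"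

lemma I0_integrable: "Re S > 0 \<Longrightarrow> set_integrable lborel {0<..1} (\<lambda>x. of_real x powr (S - 1) * regular_part x)"
  by (rule mellin_integrable_at_0[OF regular_part_continuous regular_part_bounded])

lemma I1_integrable: "set_integrable lborel {1<..} (\<lambda>x. of_real x powr (S - 1) * \<rho> x)"
  by (rule mellin_integrable_rapid[OF rho])

lemma E_right_holomorphic: "E_right holomorphic_on {S. Re S > 0}"
proof -
  have "I0 holomorphic_on {S. Re S > 0}"
    unfolding I0_def[abs_def]
    by (rule holomorphic_on_mellin) (auto simp: open_halfspace_Re_gt intro: I0_integrable)
  moreover have "I1 holomorphic_on {S. Re S > 0}"
    unfolding I1_def[abs_def]
    by (rule holomorphic_on_mellin) (auto simp: open_halfspace_Re_gt intro: I1_integrable)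
  ultimately show ?thesis
    unfolding E_right_def[abs_def] pochhammer_prod using c
    by (intro holomorphic_intros) (auto simp: complex_eq_iff Gamma_eq_zero_iff dest!: J(2) elim!: nonpos_Ints_cases)
qed

lemma E_left_holomorphic: "E_left holomorphic_on {S. Re S < \<eta>0}"
  unfolding E_left_def[abs_def] by (rule holomorphic_on_imaginary_series(1)[OF b_nz summ_b])

lemma E_left_sums: "Re S < \<eta>0 \<Longrightarrow> (\<lambda>k. b k * (\<i> * of_real (\<delta> k)) powr (S - 2)) sums E_left S"
  unfolding E_left_def
  by (intro summable_sums summable_norm_cancel[OF holomorphic_on_imaginary_series(2)[OF b_nz summ_b]])

lemma mellin_regular_sum:
  assumes S: "0 < Re S" "Re S < 2" "Re S < \<eta>0"
  shows "(LBINT x:{0<..}. of_real x powr (S - 1) * (\<Sum>k. b k / (of_real x + \<i> * of_real (\<delta> k)) ^ 2))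
            = Gamma S * Gamma (2 - S) * E_left S"
    and "set_integrable lborel {0<..} (\<lambda>x. of_real x powr (S - 1) * (\<Sum>k. b k / (of_real x + \<i> * of_real (\<delta> k)) ^ 2))"
proof -
  define \<sigma> where "\<sigma> = Re S"
  \<comment> \<open>Exponents on either side of Re S: x^(Re S - 1 - t1) is integrable at 0 and x^(Re
    S - 1 - t2) at infinity, while both stay in [0,2] and below \<open>\<eta>0\<close>, so that the
    sums over k converge too.\<close>
  define t1 t2 where "t1 = \<sigma> / 2" and "t2 = (\<sigma> + min 2 \<eta>0) / 2"
  have t: "0 \<le> t1" "t1 < \<sigma>" "\<sigma> < t2" "t2 \<le> 2" "t2 < \<eta>0" "t1 \<le> 2" "t1 < \<eta>0" "0 \<le> t2"
    using S by (auto simp: t1_def t2_def \<sigma>_def min_def field_simps)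
  define f where "f k x = indicat_real {0<..} x *\<^sub>R (of_real x powr (S - 1) * (b k / (of_real x + \<i> * of_real (\<delta> k)) ^ 2))" for k x
  define D where "D x = indicat_real {0<..1} x * x powr (\<sigma> - 1 - t1) + indicat_real {1<..} x * x powr (\<sigma> - 1 - t2)" for x :: real
  define Nk where "Nk k = norm (b k) * \<bar>\<delta> k\<bar> powr (t1 - 2) + norm (b k) * \<bar>\<delta> k\<bar> powr (t2 - 2)" for k
  have Nk0: "Nk k \<ge> 0" for k by (simp add: Nk_def)
  have Nk_summ: "summable Nk" unfolding Nk_def by (intro summable_add summ_b t)
  have D_int: "integrable lborel D"
  proof -
    have "integrable lborel (\<lambda>x. indicat_real {0<..1} x *\<^sub>R x powr (\<sigma> - 1 - t1))"
         "integrable lborel (\<lambda>x. indicat_real {1<..} x *\<^sub>R x powr (\<sigma> - 1 - t2))"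
      using set_integrable_lborel_powr t unfolding set_integrable_def by auto
    then show ?thesis unfolding D_def by simp
  qed
  have bound: "norm (f k x) \<le> Nk k * D x" for k x
  proof (cases "x > 0 \<and> b k \<noteq> 0")
    case True
    then have x: "x > 0" and dk: "\<delta> k \<noteq> 0" using b_nz by auto
    have est: "norm (f k x) \<le> norm (b k) * \<bar>\<delta> k\<bar> powr (t - 2) * x powr (\<sigma> - 1 - t)" if "0 \<le> t" "t \<le> 2" for t
    proof -
      have "norm (f k x) = x powr (\<sigma> - 1) * (norm (b k) * norm (1 / (complex_of_real x + \<i> * of_real (\<delta> k)) ^ 2))"
        using x by (simp add: f_def norm_mult norm_divide norm_powr_real_powr \<sigma>_def)
      also have "\<dots> \<le> x powr (\<sigma> - 1) * (norm (b k) * (x powr (- t) * \<bar>\<delta> k\<bar> powr (t - 2)))"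
        by (intro mult_left_mono norm_inverse_square_interpolate x dk that) auto
      also have "\<dots> = norm (b k) * \<bar>\<delta> k\<bar> powr (t - 2) * x powr ((\<sigma> - 1) + - t)"
        unfolding powr_add by simp
      finally show ?thesis by simp
    qed
    show ?thesis
    proof (cases "x \<le> 1")
      case True
      have "norm (f k x) \<le> norm (b k) * \<bar>\<delta> k\<bar> powr (t1 - 2) * x powr (\<sigma> - 1 - t1)" by (rule est) (use t in auto)
      also have "\<dots> \<le> Nk k * x powr (\<sigma> - 1 - t1)" by (intro mult_right_mono) (auto simp: Nk_def)
      finally show ?thesis using True x by (simp add: D_def)
    next
      case False
      have "norm (f k x) \<le> norm (b k) * \<bar>\<delta> k\<bar> powr (t2 - 2) * x powr (\<sigma> - 1 - t2)" by (rule est) (use t in auto)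
      also have "\<dots> \<le> Nk k * x powr (\<sigma> - 1 - t2)" by (intro mult_right_mono) (auto simp: Nk_def)
      finally show ?thesis using False x by (simp add: D_def)
    qed
  next
    case False
    have "D x \<ge> 0" by (simp add: D_def)
    with False Nk0[of k] show ?thesis by (auto simp: f_def)
  qed
  have f_int: "integrable lborel (f k)" 
    and f_val: "integral\<^sup>L lborel (f k) = Gamma S * Gamma (2 - S) * (b k * (\<i> * of_real (\<delta> k)) powr (S - 2))" for k
  proof -
    have "integrable lborel (f k) \<and> integral\<^sup>L lborel (f k) = Gamma S * Gamma (2 - S) * (b k * (\<i> * of_real (\<delta> k)) powr (S - 2))"
    proof (cases "b k = 0")
      case False
      have fe: "f k = (\<lambda>x. b k * (indicat_real {0<..} x *\<^sub>R (of_real x powr (S - 1) / (of_real x + \<i> * of_real (\<delta> k)) ^ 2)))"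
        by (auto simp: f_def)
      have G2: "Gamma (of_nat 2 :: complex) = 1" using Gamma_fact[of 1, where ?'a = complex] by simp
      have "integrable lborel (\<lambda>x. indicat_real {0<..} x *\<^sub>R (of_real x powr (S - 1) / (of_real x + \<i> * of_real (\<delta> k)) ^ 2))"
           "(\<integral>x. indicat_real {0<..} x *\<^sub>R (of_real x powr (S - 1) / (of_real x + \<i> * of_real (\<delta> k)) ^ 2) \<partial>lborel)
              = Gamma S * Gamma (2 - S) * (\<i> * of_real (\<delta> k)) powr (S - 2)"
        using beta_integral_imaginary[of S 2 "\<delta> k"] S b_nz[OF False] G2
        unfolding set_integrable_def set_lebesgue_integral_def by auto
      then show ?thesis unfolding fe integral_mult_right_zero
        by (intro conjI integrable_mult_right) auto
    qed (simp add: f_def[abs_def])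
    then show "integrable lborel (f k)" "integral\<^sup>L lborel (f k) = Gamma S * Gamma (2 - S) * (b k * (\<i> * of_real (\<delta> k)) powr (S - 2))" by auto
  qed
  have fs: "summable (\<lambda>k. norm (f k x))" for x
    by (rule summable_comparison_test'[OF summable_mult2[OF Nk_summ]]) (use bound in auto)
  have intsum: "summable (\<lambda>k. \<integral>x. norm (f k x) \<partial>lborel)"
  proof (rule summable_comparison_test'[OF summable_mult2[OF Nk_summ]])
    fix k
    have "(\<integral>x. norm (f k x) \<partial>lborel) \<le> (\<integral>x. Nk k * D x \<partial>lborel)"
      by (intro integral_mono integrable_norm f_int integrable_mult_right D_int bound)
    then show "norm (\<integral>x. norm (f k x) \<partial>lborel) \<le> Nk k * (\<integral>x. D x \<partial>lborel)" by simp
  qed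
  have fsum: "(\<lambda>x. \<Sum>k. f k x) = (\<lambda>x. indicat_real {0<..} x *\<^sub>R (of_real x powr (S - 1) * (\<Sum>k. b k / (of_real x + \<i> * of_real (\<delta> k)) ^ 2)))"
  proof
    fix x
    show "(\<Sum>k. f k x) = indicat_real {0<..} x *\<^sub>R (of_real x powr (S - 1) * (\<Sum>k. b k / (of_real x + \<i> * of_real (\<delta> k)) ^ 2))"
      using suminf_mult[OF summable_norm_cancel[OF regular_terms_summable[of x]], of "of_real x powr (S - 1)"]
      by (cases "x > 0") (simp_all add: f_def)
  qed
  have "integrable lborel (\<lambda>x. \<Sum>k. f k x)" by (rule integrable_suminf[OF f_int]) (use fs intsum in auto)
  then show "set_integrable lborel {0<..} (\<lambda>x. of_real x powr (S - 1) * (\<Sum>k. b k / (of_real x + \<i> * of_real (\<delta> k)) ^ 2))"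
    unfolding fsum set_integrable_def .
  have "(\<lambda>k. integral\<^sup>L lborel (f k)) sums (\<integral>x. (\<Sum>k. f k x) \<partial>lborel)" by (rule sums_integral[OF f_int]) (use fs intsum in auto)
  moreover have "(\<lambda>k. integral\<^sup>L lborel (f k)) sums (Gamma S * Gamma (2 - S) * E_left S)"
    unfolding f_val by (intro sums_mult E_left_sums S)
  ultimately show "(LBINT x:{0<..}. of_real x powr (S - 1) * (\<Sum>k. b k / (of_real x + \<i> * of_real (\<delta> k)) ^ 2))
            = Gamma S * Gamma (2 - S) * E_left S"
    unfolding fsum set_lebesgue_integral_def using sums_unique2 by blast
qed

text \<open>The Mellin transform of \<open>regular_part\<close> is computed twice: termwise by beta
  integrals, and by splitting at 1 and returning from \<open>regular_part\<close> to
  \<open>\<rho>\<close> on (1, infinity).\<close>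

lemma E_left_eq_right_strip:
  assumes S: "0 < Re S" "Re S < 2" "Re S < \<eta>0"
  shows "E_left S = E_right S"
proof -
  let ?w = "\<lambda>x::real. complex_of_real x + \<i> * of_real c"
  have beta: "set_integrable lborel {0<..} (\<lambda>x. of_real x powr (S - 1) / ?w x ^ p)"
     "(LBINT x:{0<..}. of_real x powr (S - 1) / ?w x ^ p) = Gamma S * Gamma (of_nat p - S) / Gamma (of_nat p) * (\<i> * of_real c) powr (S - of_nat p)"
     if "p \<in> J" for p
    using beta_integral_imaginary[of S p c] S J(2)[OF that] c by auto
  have Jint: "set_integrable lborel {0<..} (\<lambda>x. \<Sum>p\<in>J. cf p * (of_real x powr (S - 1) / ?w x ^ p))"
    using set_integrable_mult_right[OF beta(1)] unfolding set_integrable_def scaleR_sum_right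
    by (intro Bochner_Integration.integrable_sum) auto
  have eq: "indicat_real {0<..} x *\<^sub>R (of_real x powr (S - 1) * regular_part x)
     = indicat_real {0<..} x *\<^sub>R (of_real x powr (S - 1) * (\<Sum>k. b k / (of_real x + \<i> * of_real (\<delta> k)) ^ 2) - (\<Sum>p\<in>J. cf p * (of_real x powr (S - 1) / ?w x ^ p)))" for x
    by (cases "x > 0") (auto simp: regular_part_eq right_diff_distrib sum_distrib_left mult_ac)
  have "(LBINT x:{0<..}. of_real x powr (S - 1) * regular_part x)
     = (LBINT x:{0<..}. of_real x powr (S - 1) * (\<Sum>k. b k / (of_real x + \<i> * of_real (\<delta> k)) ^ 2) - (\<Sum>p\<in>J. cf p * (of_real x powr (S - 1) / ?w x ^ p)))"
    unfolding set_lebesgue_integral_def eq ..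
  also have "\<dots> = Gamma S * Gamma (2 - S) * E_left S - (LBINT x:{0<..}. \<Sum>p\<in>J. cf p * (of_real x powr (S - 1) / ?w x ^ p))"
    by (subst set_integral_diff(2)[OF mellin_regular_sum(2)[OF S] Jint]) (simp add: mellin_regular_sum(1)[OF S])
  also have "(LBINT x:{0<..}. \<Sum>p\<in>J. cf p * (of_real x powr (S - 1) / ?w x ^ p)) = (\<Sum>p\<in>J. (LBINT x:{0<..}. cf p * (of_real x powr (S - 1) / ?w x ^ p)))"
    using beta unfolding set_lebesgue_integral_def set_integrable_def scaleR_sum_right
    by (intro Bochner_Integration.integral_sum) (auto simp: mult_scaleR_right[symmetric] simp del: mult_scaleR_right times_divide_eq_right)
  also have "\<dots> = (\<Sum>p\<in>J. cf p * (Gamma S * Gamma (of_nat p - S) / Gamma (of_nat p) * (\<i> * of_real c) powr (S - of_nat p)))"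
    by (intro sum.cong refl) (simp only: set_integral_mult_right beta(2))
  finally have full: "(LBINT x:{0<..}. of_real x powr (S - 1) * regular_part x) = Gamma S * Gamma (2 - S) * E_left S
     - (\<Sum>p\<in>J. cf p * (Gamma S * Gamma (of_nat p - S) / Gamma (of_nat p) * (\<i> * of_real c) powr (S - of_nat p)))" .
  obtain B where B: "\<And>x. x \<ge> 1 \<Longrightarrow> norm (regular_part x) \<le> B * x powr (- 2)" using regular_part_at_top by blast
  have reg1: "set_integrable lborel {1<..} (\<lambda>x. of_real x powr (S - 1) * regular_part x)"
    by (rule mellin_integrable_at_top[OF regular_part_continuous B]) (use S in auto)
  have pw: "set_integrable lborel {1<..} (\<lambda>x. complex_of_real x powr ((S - 2) - 1))"
    using mellin_integrable_at_top[of "\<lambda>_. 1" 1 0 "S - 2"] S by simp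
  have eq1: "indicat_real {1<..} x *\<^sub>R (of_real x powr (S - 1) * regular_part x) = indicat_real {1<..} x *\<^sub>R (of_real x powr (S - 1) * \<rho> x - A * of_real x powr ((S - 2) - 1))" for x
    by (cases "x > 1") (auto simp: regular_part_def powr_diff right_diff_distrib power2_eq_square power3_eq_cube field_simps)
  have "(LBINT x:{1<..}. of_real x powr (S - 1) * regular_part x) = (LBINT x:{1<..}. of_real x powr (S - 1) * \<rho> x - A * of_real x powr ((S - 2) - 1))"
    unfolding set_lebesgue_integral_def eq1 ..
  also have "\<dots> = I1 S - A * (- 1 / (S - 2))"
    by (subst set_integral_diff(2)[OF I1_integrable set_integrable_mult_right[OF pw]])
       (use integral_powr_complex(2)[of "S - 2"] S in \<open>simp add: I1_def\<close>)
  finally have "(LBINT x:{0<..}. of_real x powr (S - 1) * regular_part x) = I0 S + (I1 S - A * (- 1 / (S - 2)))"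
    using set_integrable_Ioi_split(2)[OF I0_integrable[OF S(1)] reg1] by (simp add: I0_def)
  define q T where "q = - 1 / (S - 2)"
    and "T = (\<Sum>p\<in>J. cf p * (Gamma (of_nat p - S) / Gamma (of_nat p) * (\<i> * of_real c) powr (S - of_nat p)))"
  note this
  moreover have "(\<Sum>p\<in>J. cf p * (Gamma S * Gamma (of_nat p - S) / Gamma (of_nat p) * (\<i> * of_real c) powr (S - of_nat p))) = Gamma S * T"
    unfolding T_def sum_distrib_left by (intro sum.cong refl) simp
  ultimately have I01: "I0 S + I1 S = Gamma S * Gamma (2 - S) * E_left S + A * q - Gamma S * T"
    using full \<open>(LBINT x:{0<..}. of_real x powr (S - 1) * regular_part x) = I0 S + (I1 S - A * (- 1 / (S - 2)))\<close>
    by (simp only: q_def) (simp add: algebra_simps)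
  have nS: "S \<notin> \<int>\<^sub>\<le>\<^sub>0" "2 - S \<notin> \<int>\<^sub>\<le>\<^sub>0" using S by (auto intro!: strip_not_nonpos_Int)
  have rG: "rGamma S * Gamma S = 1" "rGamma (2 - S) * Gamma (2 - S) = 1"
    using nS by (auto simp: rGamma_inverse_Gamma Gamma_eq_zero_iff)
  have S2: "S - 2 \<noteq> 0" using S by auto
  have "rGamma S * rGamma (2 - S) * (I0 S + I1 S)
     = (rGamma S * Gamma S) * (rGamma (2 - S) * Gamma (2 - S)) * E_left S
      + A * rGamma S * (rGamma (2 - S) * q) - (rGamma S * Gamma S) * (rGamma (2 - S) * T)"
    unfolding I01 by (simp add: algebra_simps)
  also have "rGamma (2 - S) * q = rGamma (3 - S)"
    unfolding rGamma_shift q_def using S2 by (simp add: field_simps)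
  also have "rGamma (2 - S) * T
     = (\<Sum>p\<in>J. cf p * (\<i> * of_real c) powr (S - of_nat p) * pochhammer (2 - S) (p - 2) / Gamma (of_nat p))"
    unfolding T_def sum_distrib_left by (intro sum.cong refl) (simp add: pochhammer_Gamma_shift[OF nS(2) J(2)])
  finally show ?thesis unfolding E_right_def rG by simp
qed

text \<open>The beta integrals for double poles require Re S < 2; the identity theorem removes this
  restriction up to \<open>\<eta>0\<close>.\<close>

lemma E_left_eq_right:
  assumes S: "0 < Re S" "Re S < \<eta>0"
  shows "E_left S = E_right S"
proof (rule analytic_continuation_open[where f = E_left and g = E_right and s = "{S. 0 < Re S \<and> Re S < min 2 \<eta>0}" and s' = "{S. 0 < Re S \<and> Re S < \<eta>0}"])
  have e: "{S. 0 < Re S \<and> Re S < t} = {S. Re S > 0} \<inter> {S. Re S < t}" for t by auto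
  show "open {S. 0 < Re S \<and> Re S < min 2 \<eta>0}" "open {S. 0 < Re S \<and> Re S < \<eta>0}"
    unfolding e by (intro open_Int open_halfspace_Re_gt open_halfspace_Re_lt)+
  show "connected {S. 0 < Re S \<and> Re S < \<eta>0}"
    unfolding e by (intro convex_connected convex_Int convex_halfspace_Re_gt convex_halfspace_Re_lt)
  have "complex_of_real (min 2 \<eta>0 / 2) \<in> {S. 0 < Re S \<and> Re S < min 2 \<eta>0}" using eta0 by (auto simp: min_def)
  then show "{S. 0 < Re S \<and> Re S < min 2 \<eta>0} \<noteq> {}" by blast
  show "E_left holomorphic_on {S. 0 < Re S \<and> Re S < \<eta>0}" "E_right holomorphic_on {S. 0 < Re S \<and> Re S < \<eta>0}"
    by (auto intro: holomorphic_on_subset[OF E_left_holomorphic] holomorphic_on_subset[OF E_right_holomorphic])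
qed (use S E_left_eq_right_strip in auto)

text \<open>For Re S > 2 the function A/x^2 is Mellin integrable on (0,1], so the two halves
  recombine to the full transform of \<open>\<rho>\<close> and the correction with rGamma(3 - S)
  cancels.\<close>

lemma E_right_mellin:
  assumes S: "Re S > 2"
  shows "E_right S = rGamma S * rGamma (2 - S) * mellin \<rho> S
     + (\<Sum>p\<in>J. cf p * (\<i> * of_real c) powr (S - of_nat p) * pochhammer (2 - S) (p - 2) / Gamma (of_nat p))"
proof -
  have i0: "set_integrable lborel {0<..1} (\<lambda>x. of_real x powr (S - 1) * \<rho> x)"
    by (rule mellin_integrable_at_0[OF rho(1) rho_pole_order S])
  have pw: "set_integrable lborel {0<..1} (\<lambda>x. complex_of_real x powr ((S - 2) - 1))"
    using mellin_integrable_at_0[of "\<lambda>_. 1" 0 "S - 2"] S by (auto simp: pole_order_bound_def)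
  have eq1: "indicat_real {0<..1} x *\<^sub>R (of_real x powr (S - 1) * regular_part x) = indicat_real {0<..1} x *\<^sub>R (of_real x powr (S - 1) * \<rho> x - A * of_real x powr ((S - 2) - 1))" for x
    by (cases "x > 0") (auto simp: indicator_def regular_part_def powr_diff right_diff_distrib power2_eq_square power3_eq_cube field_simps)
  have "I0 S = (LBINT x:{0<..1}. of_real x powr (S - 1) * \<rho> x - A * of_real x powr ((S - 2) - 1))"
    unfolding I0_def set_lebesgue_integral_def eq1 ..
  also have "\<dots> = (LBINT x:{0<..1}. of_real x powr (S - 1) * \<rho> x) - A * (1 / (S - 2))"
    by (subst set_integral_diff(2)[OF i0 set_integrable_mult_right[OF pw]])
       (use integral_powr_complex(1)[of "S - 2"] S in simp)
  finally have i0v: "I0 S = (LBINT x:{0<..1}. of_real x powr (S - 1) * \<rho> x) - A * (1 / (S - 2))" .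
  define q where "q = 1 / (S - 2)"
  have "I0 S + I1 S = mellin \<rho> S - A * q"
    unfolding mellin_def set_integrable_Ioi_split(2)[OF i0 I1_integrable] i0v by (simp add: I1_def q_def)
  moreover have q: "rGamma (2 - S) * q = - rGamma (3 - S)"
  proof -
    have "S - 2 \<noteq> 0" using S by auto
    then show ?thesis unfolding rGamma_shift q_def by (simp add: field_simps)
  qed
  have "rGamma S * rGamma (2 - S) * (mellin \<rho> S - A * q) = rGamma S * rGamma (2 - S) * mellin \<rho> S - A * rGamma S * (rGamma (2 - S) * q)"
    by (simp add: algebra_simps)
  ultimately show ?thesis unfolding E_right_def q by simp
qed

text \<open>
  The Mellin transform of \<open>1/(x + \<i>\<delta>)\<^sup>2\<close> is a beta integral, so on the strip where everything converges
  \<open>E_left\<close> and \<open>E_right\<close> agree; the first is holomorphic to the left of it, the second to the right.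
\<close>
theorem entire_extension:
  "\<exists>E. E holomorphic_on UNIV
     \<and> (\<forall>S. Re S < \<eta>0 \<longrightarrow> (\<lambda>k. (if \<delta> k = 0 then 0 else C k) * (\<i> * of_real (\<delta> k)) powr (S - 2)) sums E S)
     \<and> (\<forall>S. Re S > 2 \<longrightarrow> S \<notin> \<int> \<longrightarrow> E S * Gamma (2 - S) = mellin \<rho> S / Gamma S
          + (\<Sum>p\<in>J. cf p * ((\<i> * of_real c) powr (S - of_nat p) * Gamma (of_nat p - S) / Gamma (of_nat p))))"
proof -
  define E where "E S = (if Re S < \<eta>0 then E_left S else E_right S)" for S
  have El: "E S = E_left S" if "Re S < \<eta>0" for S using that by (simp add: E_def)
  have Er: "E S = E_right S" if "Re S > 0" for S using that E_left_eq_right by (simp add: E_def)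
  have "E holomorphic_on {S. Re S < \<eta>0}"
    by (rule holomorphic_transform[OF E_left_holomorphic]) (simp add: El)
  moreover have "E holomorphic_on {S. Re S > 0}"
    by (rule holomorphic_transform[OF E_right_holomorphic]) (simp add: Er)
  ultimately have "E holomorphic_on ({S. Re S < \<eta>0} \<union> {S. Re S > 0})"
    by (intro holomorphic_on_Un open_halfspace_Re_gt open_halfspace_Re_lt)
  also have "{S. Re S < \<eta>0} \<union> {S. Re S > 0} = UNIV" using eta0 by auto
  finally have hol: "E holomorphic_on UNIV" .
  have "E S * Gamma (2 - S) = mellin \<rho> S / Gamma S
          + (\<Sum>p\<in>J. cf p * ((\<i> * of_real c) powr (S - of_nat p) * Gamma (of_nat p - S) / Gamma (of_nat p)))"
    if S: "Re S > 2" "S \<notin> \<int>" for S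
  proof -
    have "2 - S \<notin> \<int>" using S(2) Ints_diff[of 2 "2 - S"] by auto
    then have n: "2 - S \<notin> \<int>\<^sub>\<le>\<^sub>0" using nonpos_Ints_Int by blast
    have S0: "Re S > 0" using S by simp
    from n have r: "rGamma (2 - S) * Gamma (2 - S) = 1" by (auto simp: rGamma_inverse_Gamma Gamma_eq_zero_iff)
    have "E S * Gamma (2 - S) = rGamma S * (rGamma (2 - S) * Gamma (2 - S)) * mellin \<rho> S
      + (\<Sum>p\<in>J. cf p * ((\<i> * of_real c) powr (S - of_nat p) * ((rGamma (2 - S) * Gamma (2 - S)) * Gamma (of_nat p - S)) / Gamma (of_nat p)))"
      using S(1) unfolding Er[OF S0] E_right_mellin[OF S(1)]
      by (simp add: pochhammer_Gamma_shift[OF n J(2)] ring_distribs sum_distrib_right sum_distrib_left mult_ac cong: sum.cong)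
    then show ?thesis unfolding r by (simp add: rGamma_inverse_Gamma divide_inverse mult.commute)
  qed
  then show ?thesis
    using hol E_left_sums El unfolding b_def by (intro exI[of _ E]) auto
qed

end

section \<open>Inverting a chain of Euler operators\<close>

lemma has_vector_derivative_inverse_power_ray:
  fixes c :: real
  assumes "c > 0"
  shows "((\<lambda>x. a / (complex_of_real x + \<i> * of_real c) ^ k) has_vector_derivative
            (- of_nat k * a / (of_real x + \<i> * of_real c) ^ Suc k)) (at x)"
proof -
  define W where "W = complex_of_real x + \<i> * of_real c"
  have W: "W \<noteq> 0" using assms by (auto simp: W_def complex_eq_iff)
  show ?thesis
  proof (rule has_vector_derivative_real_field[where f = "\<lambda>z. a / (z + \<i> * of_real c) ^ k"])
    have "((\<lambda>z. a / (z + \<i> * of_real c) ^ k) has_field_derivative - (a * (of_nat k * W ^ (k - 1))) / (W ^ k * W ^ k)) (at (complex_of_real x))"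
      using W unfolding W_def by (auto intro!: derivative_eq_intros)
    also have "- (a * (of_nat k * W ^ (k - 1))) / (W ^ k * W ^ k) = - of_nat k * a / W ^ Suc k"
      using W by (cases k) (simp_all add: field_simps)
    finally show "((\<lambda>z. a / (z + \<i> * of_real c) ^ k) has_field_derivative - of_nat k * a / (of_real x + \<i> * of_real c) ^ Suc k) (at (complex_of_real x))"
      unfolding W_def .
  qed
qed

text \<open>Descending from the rapidly decaying top, each level solves one first-order equation.
  The new homogeneous solution is w^(-(2r+3)) = w^(-(2j+1)) with j = r + 1; corrections from higher
  levels are eigenfunctions with other eigenvalues and lift by division. By
  \<open>mellin_by_parts\<close> each level contributes one linear factor on the Mellin
  side.\<close>

lemma euler_ode_chain:
  fixes c :: real and P P' :: "nat \<Rightarrow> real \<Rightarrow> complex"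
  assumes c: "c > 0"
    and der: "\<And>r x. r < H \<Longrightarrow> x > 0 \<Longrightarrow> (P r has_vector_derivative P' r x) (at x)"
    and ode: "\<And>r x. r < H \<Longrightarrow> x > 0 \<Longrightarrow> (of_real x + \<i> * of_real c) * P' r x + of_nat (2 * r + 3) * P r x = P (Suc r) x"
    and tame: "tame (P H)"
    and r: "r \<le> H"
  shows "\<exists>cf R. tame (\<lambda>x. P r x - (\<Sum>j\<in>{Suc r..H}. cf j / (of_real x + \<i> * of_real c) ^ (2 * j + 1))) \<and>
     (\<forall>S. Re S > R \<longrightarrow> shift_op c (\<Prod>j\<in>{Suc r..H}. [:2 * real j - 1, 1:])
        (\<lambda>S. mellin (\<lambda>x. P r x - (\<Sum>j\<in>{Suc r..H}. cf j / (of_real x + \<i> * of_real c) ^ (2 * j + 1))) S / Gamma S) S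
        = mellin (P H) S / Gamma S)"
  using r
proof (induction r rule: inc_induct)
  case base
  show ?case using tame by simp
next
  case (step n)
  define w where "w x = complex_of_real x + \<i> * of_real c" for x
  have w0: "w x \<noteq> 0" for x using c by (auto simp: w_def complex_eq_iff)
  obtain cf R where IH: "tame (\<lambda>x. P (Suc n) x - (\<Sum>j\<in>{Suc (Suc n)..H}. cf j / w x ^ (2 * j + 1)))"
    "\<And>S. Re S > R \<Longrightarrow> shift_op c (\<Prod>j\<in>{Suc (Suc n)..H}. [:2 * real j - 1, 1:])
        (\<lambda>S. mellin (\<lambda>x. P (Suc n) x - (\<Sum>j\<in>{Suc (Suc n)..H}. cf j / w x ^ (2 * j + 1))) S / Gamma S) S
        = mellin (P H) S / Gamma S"
    using step.IH unfolding w_def by blast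
  define \<rho>' where "\<rho>' x = P (Suc n) x - (\<Sum>j\<in>{Suc (Suc n)..H}. cf j / w x ^ (2 * j + 1))" for x
  \<comment> \<open>The operator w d/dw + 2n + 3 multiplies w^(-(2j+1)) by (2n + 3) - (2j + 1),
    nonzero because j >= n + 2. So these terms are preimages of the old corrections.\<close>
  define e where "e j = cf j / (of_nat (2 * n + 3) - of_nat (2 * j + 1))" for j
  define P1 where "P1 x = P n x - (\<Sum>j\<in>{Suc (Suc n)..H}. e j / w x ^ (2 * j + 1))" for x
  define P1' where "P1' x = P' n x - (\<Sum>j\<in>{Suc (Suc n)..H}. - of_nat (2 * j + 1) * e j / w x ^ Suc (2 * j + 1))" for x
  have P1d: "(P1 has_vector_derivative P1' x) (at x)" if "x > 0" for x
    unfolding P1_def P1'_def w_def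
    by (intro has_vector_derivative_diff has_vector_derivative_sum has_vector_derivative_inverse_power_ray c der step that)
  have pole: "w x * (- of_nat k * a / w x ^ Suc k) = - of_nat k * (a / w x ^ k)" for a k x
    using w0[of x] by (simp add: field_simps)
  have P1o: "w x * P1' x + of_nat (2 * n + 3) * P1 x = \<rho>' x" if "x > 0" for x
  proof -
    have "w x * (\<Sum>j\<in>{Suc (Suc n)..H}. - of_nat (2 * j + 1) * e j / w x ^ Suc (2 * j + 1)) + of_nat (2 * n + 3) * (\<Sum>j\<in>{Suc (Suc n)..H}. e j / w x ^ (2 * j + 1))
        = (\<Sum>j\<in>{Suc (Suc n)..H}. cf j / w x ^ (2 * j + 1))"
      unfolding sum_distrib_left sum.distrib[symmetric]
    proof (intro sum.cong refl)
      fix j assume j: "j \<in> {Suc (Suc n)..H}"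
      have ne: "complex_of_nat (2 * n + 3) - of_nat (2 * j + 1) \<noteq> 0"
      proof
        assume "complex_of_nat (2 * n + 3) - of_nat (2 * j + 1) = 0"
        then have "2 * n + 3 = 2 * j + 1" by (metis eq_iff_diff_eq_0 of_nat_eq_iff)
        then show False using j by auto
      qed
      have "w x * (- of_nat (2 * j + 1) * e j / w x ^ Suc (2 * j + 1)) + of_nat (2 * n + 3) * (e j / w x ^ (2 * j + 1))
         = ((of_nat (2 * n + 3) - of_nat (2 * j + 1)) * e j) / w x ^ (2 * j + 1)"
        unfolding pole by (simp add: algebra_simps diff_divide_distrib add_divide_distrib del: of_nat_add of_nat_mult)
      also have "(of_nat (2 * n + 3) - of_nat (2 * j + 1)) * e j = cf j"
        using ne by (simp add: e_def)
      finally show "w x * (- of_nat (2 * j + 1) * e j / w x ^ Suc (2 * j + 1)) + of_nat (2 * n + 3) * (e j / w x ^ (2 * j + 1)) = cf j / w x ^ (2 * j + 1)" .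
    qed
    moreover have "w x * P' n x + of_nat (2 * n + 3) * P n x = P (Suc n) x"
      unfolding w_def by (rule ode) (use step that in auto)
    ultimately show ?thesis unfolding P1_def P1'_def \<rho>'_def by (simp only: right_diff_distrib) (simp add: algebra_simps)
  qed
  have e3: "2 * n + 3 = Suc (2 * n + 2)" by simp
  obtain L where L: "tame (\<lambda>x. P1 x - L / w x ^ Suc (2 * n + 2))"
    using tame_euler_ode[OF c IH(1)[folded \<rho>'_def] P1d P1o[unfolded w_def e3]] unfolding w_def by blast
  define \<rho> where "\<rho> x = P1 x - L / w x ^ Suc (2 * n + 2)" for x
  define cf' where "cf' j = (if j = Suc n then L else e j)" for j
  have ins: "{Suc n..H} = insert (Suc n) {Suc (Suc n)..H}" using step by auto
  have rho_eq: "\<rho> = (\<lambda>x. P n x - (\<Sum>j\<in>{Suc n..H}. cf' j / w x ^ (2 * j + 1)))"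
  proof
    fix x
    have "(\<Sum>j\<in>{Suc (Suc n)..H}. cf' j / w x ^ (2 * j + 1)) = (\<Sum>j\<in>{Suc (Suc n)..H}. e j / w x ^ (2 * j + 1))"
      by (intro sum.cong refl) (auto simp: cf'_def)
    then show "\<rho> x = P n x - (\<Sum>j\<in>{Suc n..H}. cf' j / w x ^ (2 * j + 1))"
      unfolding ins by (simp add: \<rho>_def P1_def cf'_def)
  qed
  have rho_tame: "tame \<rho>" using L by (simp add: \<rho>_def[abs_def])
  have rho'_tame: "tame \<rho>'" using IH(1) by (simp add: \<rho>'_def[abs_def])
  have rho_d: "(\<rho> has_vector_derivative (P1' x - (- of_nat (Suc (2 * n + 2)) * L / w x ^ Suc (Suc (2 * n + 2))))) (at x)" if "x > 0" for x
    unfolding \<rho>_def w_def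
    by (intro has_vector_derivative_diff has_vector_derivative_inverse_power_ray c) (use P1d that in \<open>auto simp: w_def\<close>)
  have rho_o: "w x * (P1' x - (- of_nat (Suc (2 * n + 2)) * L / w x ^ Suc (Suc (2 * n + 2)))) + of_real (real (2 * n + 3)) * \<rho> x = \<rho>' x" if "x > 0" for x
  proof -
    have "w x * (P1' x - (- of_nat (Suc (2 * n + 2)) * L / w x ^ Suc (Suc (2 * n + 2)))) + of_real (real (2 * n + 3)) * \<rho> x
       = w x * P1' x + of_nat (2 * n + 3) * P1 x"
    proof -
      define M where "M = L / w x ^ Suc (2 * n + 2)"
      show ?thesis unfolding right_diff_distrib pole \<rho>_def M_def[symmetric] by (simp add: algebra_simps)
    qed
    with P1o[OF that] show ?thesis by simp
  qed
  obtain q1 q2 where q: "pole_order_bound q1 \<rho>" "pole_order_bound q2 \<rho>'"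
    using rho_tame rho'_tame by (auto simp: tame_def)
  define q where "q = max q1 q2"
  have qb: "pole_order_bound q \<rho>" "pole_order_bound q \<rho>'"
    using q by (auto simp: q_def intro: pole_order_bound_mono)
  define U where "U S = mellin \<rho> S / Gamma S" for S
  define U' where "U' S = mellin \<rho>' S / Gamma S" for S
  \<comment> \<open>The constant 2 inside \<open>mshift\<close> plus 2(n + 1) - 1 gives 2n + 3, the
    coefficient in the differential equation. Dividing by Gamma(S) = (S - 1) Gamma(S - 1) absorbs
    the factor S - 1 of the shifted term.\<close>
  have UU': "shift_op c [:2 * real (Suc n) - 1, 1:] U S = U' S" if S: "Re S > max (q + 1) 1" for S
  proof -
    have G: "Gamma S = (S - 1) * Gamma (S - 1)"
      using Gamma_plus1[of "S - 1"] strip_not_nonpos_Int[of "S - 1"] S by auto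
    have G0: "Gamma S \<noteq> 0" "Gamma (S - 1) \<noteq> 0" using strip_not_nonpos_Int[of S] strip_not_nonpos_Int[of "S - 1"] S by (auto simp: Gamma_eq_zero_iff)
    have S1: "S - 1 \<noteq> 0" using S by auto
    have "mellin \<rho>' S = (of_real (real (2 * n + 3)) - S) * mellin \<rho> S - \<i> * of_real c * (S - 1) * mellin \<rho> (S - 1)"
      by (rule mellin_by_parts[where q = q, OF _ qb(1) _ _ qb(2) _ rho_d])
         (use rho_tame rho'_tame rho_o S in \<open>auto simp: tame_def w_def\<close>)
    then have "U' S = (of_real (real (2 * n + 3)) - S) * U S - \<i> * of_real c * ((S - 1) * mellin \<rho> (S - 1) / Gamma S)"
      by (simp add: U_def U'_def diff_divide_distrib mult.assoc)
    also have "(S - 1) * mellin \<rho> (S - 1) / Gamma S = U (S - 1)"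
      unfolding G U_def using S1 by simp
    finally show ?thesis unfolding shift_op_linear mshift_def by (simp add: algebra_simps)
  qed
  define Pr where "Pr = (\<Prod>j\<in>{Suc (Suc n)..H}. [:2 * real j - 1, 1:])"
  have prod: "(\<Prod>j\<in>{Suc n..H}. [:2 * real j - 1, 1:]) = Pr * [:2 * real (Suc n) - 1, 1:]"
    unfolding ins Pr_def by (subst prod.insert) (auto simp: mult.commute)
  \<comment> \<open>The operator evaluates down to S - degree, so the half-plane moves right by that
    amount.\<close>
  define R' where "R' = max R (max (q + 1) 1) + real (degree Pr)"
  have final: "shift_op c (\<Prod>j\<in>{Suc n..H}. [:2 * real j - 1, 1:]) U S = mellin (P H) S / Gamma S" if S: "Re S > R'" for S
  proof -
    have "shift_op c (\<Prod>j\<in>{Suc n..H}. [:2 * real j - 1, 1:]) U S = shift_op c Pr (shift_op c [:2 * real (Suc n) - 1, 1:] U) S"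
      unfolding prod shift_op_mult ..
    also have "\<dots> = shift_op c Pr U' S"
      by (intro shift_op_cong UU') (use S in \<open>auto simp: R'_def\<close>)
    also have "\<dots> = mellin (P H) S / Gamma S"
      unfolding Pr_def U'_def \<rho>'_def by (rule IH(2)) (use S in \<open>auto simp: R'_def\<close>)
    finally show ?thesis .
  qed
  show ?case
    by (rule exI[of _ cf'], rule exI[of _ R'])
       (use rho_tame final in \<open>simp add: U_def[abs_def] rho_eq w_def\<close>)
qed

section \<open>Gaussian integrals behind the theta transformation\<close>

lemma gaussian_primitive:
  obtains G :: "real \<Rightarrow> real" and l1 l2 where "\<And>x. (G has_real_derivative exp (- x\<^sup>2)) (at x)"
    "(G \<longlongrightarrow> l1) at_top" "(G \<longlongrightarrow> l2) at_bot" "l1 - l2 = sqrt pi"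
proof -
  have "(\<lambda>z::complex. exp (- z\<^sup>2)) holomorphic_on UNIV" by (intro holomorphic_intros)
  then obtain F where F: "\<And>z::complex. (F has_field_derivative exp (- z\<^sup>2)) (at z)"
    using holomorphic_convex_primitive'[of UNIV "\<lambda>z. exp (- z\<^sup>2)"] by auto
  define G where "G x = Re (F (of_real x))" for x
  have G: "(G has_real_derivative exp (- x\<^sup>2)) (at x)" for x
  proof -
    have "((\<lambda>x. F (of_real x)) has_vector_derivative exp (- (complex_of_real x)\<^sup>2)) (at x)"
      by (rule has_vector_derivative_real_field[OF F])
    from bounded_linear.has_vector_derivative[OF bounded_linear_Re this]
    show ?thesis
      by (simp add: G_def[abs_def] has_real_derivative_iff_has_vector_derivative Re_exp flip: of_real_power of_real_minus)
  qed
  define f where "f x = indicator {0..} x *\<^sub>R exp (- x\<^sup>2)" for x :: real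
  have f: "integrable lborel f" "integral\<^sup>L lborel f = sqrt pi / 2"
    using gaussian_moment_0 unfolding f_def has_bochner_integral_iff by auto
  have fi: "(\<integral>x. indicator {.. y} x *\<^sub>R f x \<partial>lborel) = G y - G 0" if "y \<ge> 0" for y
  proof -
    have "(\<integral>x. exp (- x\<^sup>2) * indicator {0..y} x \<partial>lborel) = G y - G 0"
      by (rule integral_FTC_Icc_real) (use that G in \<open>auto intro!: continuous_intros\<close>)
    also have "(\<lambda>x. exp (- x\<^sup>2) * indicator {0..y} x) = (\<lambda>x. indicator {.. y} x *\<^sub>R f x)"
      by (auto simp: f_def indicator_def)
    finally show ?thesis .
  qed
  have "((\<lambda>y. \<integral>x. indicator {.. y} x *\<^sub>R f x \<partial>lborel) \<longlongrightarrow> sqrt pi / 2) at_top"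
    using tendsto_integral_at_top[of lborel f] f by simp
  then have l: "((\<lambda>y. G y - G 0) \<longlongrightarrow> sqrt pi / 2) at_top"
  proof (rule Lim_transform_eventually)
    show "\<forall>\<^sub>F y in at_top. (\<integral>x. indicator {.. y} x *\<^sub>R f x \<partial>lborel) = G y - G 0"
      using eventually_ge_at_top[of "0::real"] by eventually_elim (rule fi)
  qed
  then have l1: "(G \<longlongrightarrow> sqrt pi / 2 + G 0) at_top"
    using tendsto_add[OF l tendsto_const[of "G 0"]] by simp
  have odd: "G (- x) = 2 * G 0 - G x" for x
  proof -
    have "((\<lambda>x. G x + G (- x)) has_real_derivative 0) (at x)" for x
      using DERIV_add[OF G[of x] DERIV_chain2[OF G[of "- x"] DERIV_minus[OF DERIV_ident]]] by simp
    then have "(\<lambda>x. G x + G (- x)) x = (\<lambda>x. G x + G (- x)) 0" for x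
      by (intro DERIV_isconst_all) auto
    from this[of x] show ?thesis by simp
  qed
  have "((\<lambda>x. 2 * G 0 - G x) \<longlongrightarrow> 2 * G 0 - (sqrt pi / 2 + G 0)) at_top" by (intro tendsto_intros l1)
  then have "(G \<longlongrightarrow> 2 * G 0 - (sqrt pi / 2 + G 0)) at_bot"
    unfolding filterlim_at_bot_mirror odd[symmetric] by simp
  with G l1 show ?thesis by (intro that[of G]) (auto simp: field_simps)
qed

text \<open>Completing the square as (au + b/u)^2 and (au - b/u)^2 yields the explicit primitive
  \<open>F\<close>: the inner derivatives a - b/u^2 and a + b/u^2 add up to 2a. As u -> 0 the first
  argument tends to +infinity and the second to -infinity, so only the second summand changes, by
  exp(-2ab) sqrt(pi)/(2a).\<close>

lemma integral_exp_square_inverse_square: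
  fixes a b :: real
  assumes a: "a > 0" and b: "b > 0"
  shows "set_integrable lborel {0<..} (\<lambda>u. exp (- (a\<^sup>2 * u\<^sup>2) - b\<^sup>2 / u\<^sup>2))"
    and "(LBINT u:{0<..}. exp (- (a\<^sup>2 * u\<^sup>2) - b\<^sup>2 / u\<^sup>2)) = sqrt pi / (2 * a) * exp (- 2 * a * b)"
proof -
  obtain G :: "real \<Rightarrow> real" and l1 l2 where G: "\<And>x. (G has_real_derivative exp (- x\<^sup>2)) (at x)"
    "(G \<longlongrightarrow> l1) at_top" "(G \<longlongrightarrow> l2) at_bot" "l1 - l2 = sqrt pi" using gaussian_primitive by metis
  define F where "F u = (exp (2 * a * b) * G (a * u + b / u) + exp (- 2 * a * b) * G (a * u - b / u)) / (2 * a)" for u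
  have F: "(F has_real_derivative exp (- (a\<^sup>2 * u\<^sup>2) - b\<^sup>2 / u\<^sup>2)) (at u)" if "u > 0" for u
  proof -
    have d1: "((\<lambda>u. a * u + b / u) has_real_derivative a - b / u\<^sup>2) (at u)"
      using that by (auto intro!: derivative_eq_intros simp: power2_eq_square field_simps)
    have d2: "((\<lambda>u. a * u - b / u) has_real_derivative a + b / u\<^sup>2) (at u)"
      using that by (auto intro!: derivative_eq_intros simp: power2_eq_square field_simps)
    have "(F has_real_derivative (exp (2 * a * b) * (exp (- (a * u + b / u)\<^sup>2) * (a - b / u\<^sup>2))
        + exp (- 2 * a * b) * (exp (- (a * u - b / u)\<^sup>2) * (a + b / u\<^sup>2))) / (2 * a)) (at u)"
      unfolding F_def
      by (intro DERIV_cdivide DERIV_add DERIV_cmult DERIV_chain2[OF G(1)] d1 d2)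
    also have "exp (2 * a * b) * (exp (- (a * u + b / u)\<^sup>2) * (a - b / u\<^sup>2)) = exp (2 * a * b + - (a * u + b / u)\<^sup>2) * (a - b / u\<^sup>2)"
      unfolding exp_add by simp
    also have "2 * a * b + - (a * u + b / u)\<^sup>2 = - (a\<^sup>2 * u\<^sup>2) - b\<^sup>2 / u\<^sup>2"
      using that by (simp add: power2_eq_square field_simps)
    also have "exp (- 2 * a * b) * (exp (- (a * u - b / u)\<^sup>2) * (a + b / u\<^sup>2)) = exp (- 2 * a * b + - (a * u - b / u)\<^sup>2) * (a + b / u\<^sup>2)"
      unfolding exp_add by simp
    also have "- 2 * a * b + - (a * u - b / u)\<^sup>2 = - (a\<^sup>2 * u\<^sup>2) - b\<^sup>2 / u\<^sup>2"
      using that by (simp add: power2_eq_square field_simps)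
    finally show ?thesis using a by (simp add: field_simps)
  qed
  have t1: "filterlim (\<lambda>u. a * u + b / u) at_top (at_right 0)" using a b by real_asymp
  have t2: "filterlim (\<lambda>u. a * u - b / u) at_bot (at_right 0)" using a b by real_asymp
  have t3: "filterlim (\<lambda>u. a * u + b / u) at_top at_top" using a b by real_asymp
  have t4: "filterlim (\<lambda>u. a * u - b / u) at_top at_top" using a b by real_asymp
  define A where "A = (exp (2 * a * b) * l1 + exp (- 2 * a * b) * l2) / (2 * a)"
  define B where "B = (exp (2 * a * b) * l1 + exp (- 2 * a * b) * l1) / (2 * a)"
  have A: "(F \<longlongrightarrow> A) (at_right 0)" unfolding F_def A_def
    by (intro tendsto_divide tendsto_add tendsto_mult tendsto_const filterlim_compose[OF G(2) t1] filterlim_compose[OF G(3) t2]) (use a in auto)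
  have B: "(F \<longlongrightarrow> B) at_top" unfolding F_def B_def
    by (intro tendsto_divide tendsto_add tendsto_mult tendsto_const filterlim_compose[OF G(2) t3] filterlim_compose[OF G(2) t4]) (use a in auto)
  have ein: "einterval 0 \<infinity> = {0::real<..}" by (auto simp: einterval_def)
  have nn: "(LBINT u=0..\<infinity>. exp (- (a\<^sup>2 * u\<^sup>2) - b\<^sup>2 / u\<^sup>2)) = B - A"
      "set_integrable lborel (einterval 0 \<infinity>) (\<lambda>u. exp (- (a\<^sup>2 * u\<^sup>2) - b\<^sup>2 / u\<^sup>2))"
    by (rule interval_integral_FTC_nonneg[where F = F];
        use F A B in \<open>auto simp: ereal_tendsto_simps zero_ereal_def intro!: continuous_intros\<close>)+
  show "set_integrable lborel {0<..} (\<lambda>u. exp (- (a\<^sup>2 * u\<^sup>2) - b\<^sup>2 / u\<^sup>2))"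
    using nn(2) unfolding ein .
  have "(LBINT u:{0<..}. exp (- (a\<^sup>2 * u\<^sup>2) - b\<^sup>2 / u\<^sup>2)) = B - A"
    using nn(1) by (simp add: interval_lebesgue_integral_def ein)
  also have "B - A = sqrt pi / (2 * a) * exp (- 2 * a * b)"
    unfolding A_def B_def G(4)[symmetric] by (simp add: diff_divide_distrib[symmetric] algebra_simps)
  finally show "(LBINT u:{0<..}. exp (- (a\<^sup>2 * u\<^sup>2) - b\<^sup>2 / u\<^sup>2)) = sqrt pi / (2 * a) * exp (- 2 * a * b)" .
qed

lemma integral_odd_power_gaussian:
  fixes B :: real
  assumes B: "B > 0"
  shows "set_integrable lborel {0<..} (\<lambda>u. u ^ (2 * h + 1) * exp (- (B * u\<^sup>2)))"
    and "(LBINT u:{0<..}. u ^ (2 * h + 1) * exp (- (B * u\<^sup>2))) = fact h / (2 * B ^ (h + 1))"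
proof -
  define s where "s = sqrt B"
  have s: "s > 0" "s ^ 2 = B" using B by (auto simp: s_def)
  let ?g = "\<lambda>x::real. indicator {0..} x *\<^sub>R (exp (- x\<^sup>2) * x ^ (2 * h + 1))"
  have g: "integrable lborel ?g" "integral\<^sup>L lborel ?g = fact h / 2"
    using gaussian_moment_odd_pos[of h] unfolding has_bochner_integral_iff by auto
  have eq: "?g (0 + s * u) = s ^ (2 * h + 1) * (indicator {0<..} u *\<^sub>R (u ^ (2 * h + 1) * exp (- (B * u\<^sup>2))))" for u
    using s by (auto simp: indicator_def power_mult_distrib zero_le_mult_iff simp del: power_Suc)
  have i: "integrable lborel (\<lambda>u. ?g (0 + s * u))" by (rule lborel_integrable_real_affine) (use g s in auto)
  then show "set_integrable lborel {0<..} (\<lambda>u. u ^ (2 * h + 1) * exp (- (B * u\<^sup>2)))"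
    unfolding eq set_integrable_def using s by (subst (asm) integrable_mult_left_iff) simp
  have "fact h / 2 = \<bar>s\<bar> *\<^sub>R (\<integral>u. ?g (0 + s * u) \<partial>lborel)"
    using lborel_integral_real_affine[of s ?g 0] g s by simp
  also have "\<dots> = s * s ^ (2 * h + 1) * (LBINT u:{0<..}. u ^ (2 * h + 1) * exp (- (B * u\<^sup>2)))"
    unfolding eq integral_mult_right_zero set_lebesgue_integral_def using s by simp
  also have "s * s ^ (2 * h + 1) = B ^ (h + 1)"
    by (simp flip: s(2) add: power_mult[symmetric] mult.commute power_add[symmetric] power_Suc[symmetric] del: power_Suc)
  finally show "(LBINT u:{0<..}. u ^ (2 * h + 1) * exp (- (B * u\<^sup>2))) = fact h / (2 * B ^ (h + 1))"
    using B by (simp add: field_simps)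
qed

text \<open>Conditions on \<open>g n\<close> are imposed where \<open>a n \<noteq> 0\<close>, since
  the inverse-square integral degenerates for the constant term n = 0.\<close>

lemma sums_set_integral_mult:
  fixes g :: "nat \<Rightarrow> real \<Rightarrow> real" and a :: "nat \<Rightarrow> complex"
  assumes gi: "\<And>n. a n \<noteq> 0 \<Longrightarrow> set_integrable lborel T (g n)" and gv: "\<And>n. a n \<noteq> 0 \<Longrightarrow> (LBINT u:T. g n u) = v n"
    and g0: "\<And>n u. u \<in> T \<Longrightarrow> g n u \<ge> 0"
    and s1: "\<And>u. u \<in> T \<Longrightarrow> summable (\<lambda>n. norm (a n) * g n u)"
    and s2: "summable (\<lambda>n. norm (a n) * v n)"
  shows "(\<lambda>n. a n * of_real (v n)) sums (LBINT u:T. (\<Sum>n. a n * of_real (g n u)))"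
proof -
  define f where "f n u = a n * of_real (indicator T u * g n u)" for n u
  have fi: "integrable lborel (f n)" for n
  proof (cases "a n = 0")
    case False
    then show ?thesis using gi[OF False] unfolding f_def set_integrable_def
      by (intro integrable_mult_right integrable_of_real) simp
  qed (simp add: f_def[abs_def])
  have fv: "integral\<^sup>L lborel (f n) = a n * of_real (v n)" for n
  proof (cases "a n = 0")
    case False
    have "integral\<^sup>L lborel (f n) = a n * of_real (LBINT u:T. g n u)"
      unfolding f_def integral_mult_right_zero set_lebesgue_integral_def integral_complex_of_real by simp
    then show ?thesis using gv[OF False] by simp
  qed (simp add: f_def[abs_def])
  have fn: "(\<integral>u. norm (f n u) \<partial>lborel) = norm (a n) * v n" for n
  proof (cases "a n = 0")
    case False
    have "(\<lambda>u. norm (f n u)) = (\<lambda>u. norm (a n) * (indicator T u *\<^sub>R g n u))"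
      using g0 by (auto simp: f_def norm_mult indicator_def)
    then show ?thesis using gv[OF False] unfolding set_lebesgue_integral_def by simp
  qed (simp add: f_def[abs_def])
  have "(\<lambda>n. integral\<^sup>L lborel (f n)) sums (\<integral>u. (\<Sum>n. f n u) \<partial>lborel)"
  proof (rule sums_integral[OF fi])
    show "AE u in lborel. summable (\<lambda>n. norm (f n u))"
    proof (rule AE_I2)
      fix u show "summable (\<lambda>n. norm (f n u))"
        using s1[of u] g0[of u] by (cases "u \<in> T") (auto simp: f_def norm_mult)
    qed
    show "summable (\<lambda>n. \<integral>u. norm (f n u) \<partial>lborel)" unfolding fn by (rule s2)
  qed
  also have "(\<lambda>u. \<Sum>n. f n u) = (\<lambda>u. indicator T u *\<^sub>R (\<Sum>n. a n * of_real (g n u)))"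
    by (auto simp: f_def indicator_def)
  finally show ?thesis unfolding fv set_lebesgue_integral_def .
qed

section \<open>The generating series\<close>

lemma exp_neg_sqrt_le_powr:
  fixes t \<sigma> :: real
  assumes t: "t > 0"
  shows "\<exists>C\<ge>0. \<forall>n\<ge>1. exp (- t * sqrt (real n)) \<le> C * real n powr (- \<sigma>)"
proof -
  define m where "m = nat \<lceil>2 * \<bar>\<sigma>\<bar>\<rceil>"
  have m: "real m \<ge> 2 * \<sigma>" unfolding m_def by linarith
  define C where "C = fact m / t ^ m"
  have C: "C \<ge> 0" using t by (simp add: C_def)
  have "exp (- t * sqrt (real n)) \<le> C * real n powr (- \<sigma>)" if n: "n \<ge> 1" for n
  proof -
    have sq: "sqrt (real n) > 0" using n by simp
    have "(t * sqrt (real n)) ^ m / fact m \<le> exp (t * sqrt (real n))"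
      using sum_le_suminf[OF summable_exp, of "{m}" "t * sqrt (real n)"] t sq
      by (simp add: exp_def divide_inverse mult.commute)
    then have "exp (- t * sqrt (real n)) \<le> fact m / (t * sqrt (real n)) ^ m"
      using t sq by (simp add: exp_minus field_simps)
    also have "\<dots> = C * (sqrt (real n)) powr (- real m)"
      using sq by (simp add: C_def power_mult_distrib powr_minus powr_realpow field_simps)
    also have "(sqrt (real n)) powr (- real m) = real n powr (- (real m / 2))"
      using n by (simp add: powr_half_sqrt[symmetric] powr_powr)
    also have "C * real n powr (- (real m / 2)) \<le> C * real n powr (- \<sigma>)"
      using C m n by (intro mult_left_mono powr_mono) auto
    finally show ?thesis .
  qed
  with C show ?thesis by blast
qed

text \<open>Factor into w + i beta and w - i beta. For beta <= 2M the real part bounds each factor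
  from below by r, otherwise the imaginary shift gives at least beta - M; both exceed r (1 +
  beta)/(1 + 2M).\<close>

lemma norm_sum_squares_lower_bound:
  fixes w :: complex and \<beta> r M :: real
  assumes r: "r > 0" "r \<le> Re w" and M: "norm w \<le> M" and \<beta>: "\<beta> \<ge> 0"
  shows "norm (w ^ 2 + of_real (\<beta> ^ 2)) \<ge> (r / (1 + 2 * M)) ^ 2 * (1 + \<beta>) ^ 2"
proof -
  have rM: "r \<le> M" using r M complex_Re_le_cmod[of w] by linarith
  have *: "norm (w + \<i> * of_real d) \<ge> r / (1 + 2 * M) * (1 + \<beta>)" if "\<bar>d\<bar> = \<beta>" for d
  proof (cases "\<beta> \<le> 2 * M")
    case True
    have "r / (1 + 2 * M) * (1 + \<beta>) \<le> r / (1 + 2 * M) * (1 + 2 * M)"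
      using True r rM by (intro mult_left_mono) auto
    also have "\<dots> = r" using r rM by (simp add: field_simps)
    also have "r \<le> norm (w + \<i> * of_real d)" using complex_Re_le_cmod[of "w + \<i> * of_real d"] r by simp
    finally show ?thesis .
  next
    case False
    have "r * (1 + \<beta>) \<le> M * (1 + \<beta>)" using rM \<beta> by (intro mult_right_mono) auto
    also have "\<dots> \<le> (\<beta> - M) * (1 + 2 * M)" using False r rM
      by (simp add: algebra_simps) (smt (verit) mult_left_mono mult_nonneg_nonneg mult.commute)
    finally have "r / (1 + 2 * M) * (1 + \<beta>) \<le> \<beta> - M" using r rM by (simp add: field_simps)
    also have "\<beta> - M \<le> norm (\<i> * complex_of_real d) - norm w" using M that by (simp add: norm_mult)
    also have "\<dots> \<le> norm (w + \<i> * of_real d)"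
      by (metis add.commute norm_diff_ineq)
    finally show ?thesis .
  qed
  have "w ^ 2 + of_real (\<beta> ^ 2) = (w + \<i> * of_real \<beta>) * (w + \<i> * of_real (- \<beta>))"
    by (simp add: power2_eq_square algebra_simps)
  then have "norm (w ^ 2 + of_real (\<beta> ^ 2)) = norm (w + \<i> * of_real \<beta>) * norm (w + \<i> * of_real (- \<beta>))"
    by (simp only: norm_mult)
  also have "\<dots> \<ge> (r / (1 + 2 * M) * (1 + \<beta>)) * (r / (1 + 2 * M) * (1 + \<beta>))"
    by (intro mult_mono *) (use \<beta> r rM in auto)
  finally show ?thesis by (simp add: power2_eq_square mult_ac)
qed

lemma sum_squares_nonzero:
  fixes w :: complex and t :: real
  assumes "Re w > 0" "t \<ge> 0"
  shows "w ^ 2 + of_real t \<noteq> 0"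
proof -
  have "(r / (1 + 2 * M)) ^ 2 * (1 + \<beta>) ^ 2 > 0" if "r > 0" "M \<ge> 0" "\<beta> \<ge> 0" for r M \<beta> :: real
    using that by (intro mult_pos_pos zero_less_power divide_pos_pos) auto
  from this[of "Re w" "norm w" "sqrt t"] norm_sum_squares_lower_bound[of "Re w" w "norm w" "sqrt t"] assms
  show ?thesis by auto
qed

text \<open>On a small disc the denominators are at least a constant times n^p, so the majorant is
  the given summable series. The derivative series is returned as well because the Euler operators
  act on it termwise.\<close>

lemma rational_series_derivative:
  fixes a :: "nat \<Rightarrow> complex" and g :: real
  assumes g: "g > 0" and p: "p \<ge> 1" and a0: "a 0 = 0" and sa: "summable (\<lambda>n. norm (a n) * real n powr (- real p))"
  shows "\<exists>G G'. \<forall>w\<in>{w. Re w > 0}. (\<lambda>n. a n * (w / (w ^ 2 + of_real (g ^ 2 * real n)) ^ p)) sums G w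
     \<and> (\<lambda>n. a n * (1 / (w ^ 2 + of_real (g ^ 2 * real n)) ^ p - 2 * of_nat p * w ^ 2 / (w ^ 2 + of_real (g ^ 2 * real n)) ^ Suc p)) sums G' w
     \<and> (G has_field_derivative G' w) (at w)"
proof (rule series_and_derivative_comparison_complex)
  show "open {w::complex. Re w > 0}" by (rule open_halfspace_Re_gt)
  fix n w assume w: "w \<in> {w::complex. Re w > 0}"
  define D where "D = w ^ 2 + of_real (g ^ 2 * real n)"
  have D: "D \<noteq> 0" unfolding D_def using w by (intro sum_squares_nonzero) auto
  have "((\<lambda>w. a n * (w / (w ^ 2 + of_real (g ^ 2 * real n)) ^ p)) has_field_derivative
     a n * ((1 * D ^ p - w * (of_nat p * (2 * w) * D ^ (p - 1))) / (D ^ p * D ^ p))) (at w)"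
    using D unfolding D_def by (auto intro!: derivative_eq_intros simp: algebra_simps)
  also have "(1 * D ^ p - w * (of_nat p * (2 * w) * D ^ (p - 1))) / (D ^ p * D ^ p) = 1 / D ^ p - 2 * of_nat p * w ^ 2 / D ^ Suc p"
    using D p by (cases p) (simp_all add: field_simps power2_eq_square)
  finally show "((\<lambda>w. a n * (w / (w ^ 2 + of_real (g ^ 2 * real n)) ^ p)) has_field_derivative a n * (1 / (w ^ 2 + of_real (g ^ 2 * real n)) ^ p - 2 * of_nat p * w ^ 2 / (w ^ 2 + of_real (g ^ 2 * real n)) ^ Suc p)) (at w)"
    unfolding D_def .
next
  fix w0 assume w0: "w0 \<in> {w::complex. Re w > 0}"
  define r where "r = Re w0 / 2"
  define M where "M = norm w0 + r"
  have r: "r > 0" using w0 by (simp add: r_def)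
  have M: "M > 0" unfolding M_def using r by (simp add: add_nonneg_pos)
  define e where "e = (r / (1 + 2 * M)) ^ 2 * g ^ 2"
  have e: "e > 0" unfolding e_def using r M g by simp
  define hh where "hh n = complex_of_real (M / e ^ p * (norm (a n) * real n powr (- real p)))" for n
  show "\<exists>d (h :: nat \<Rightarrow> complex). 0 < d \<and> summable h \<and> range h \<subseteq> \<real>\<^sub>\<ge>\<^sub>0 \<and>
     (\<forall>\<^sub>F n in sequentially. \<forall>y\<in>ball w0 d \<inter> {w. Re w > 0}. norm (a n * (y / (y ^ 2 + of_real (g ^ 2 * real n)) ^ p)) \<le> norm (h n))"
  proof (intro exI[of _ r] exI[of _ hh] conjI)
    show "summable hh" unfolding hh_def by (intro summable_of_real summable_mult sa)
    show "range hh \<subseteq> \<real>\<^sub>\<ge>\<^sub>0" unfolding hh_def using M e by (auto simp del: of_real_mult of_real_divide)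
    show "\<forall>\<^sub>F n in sequentially. \<forall>y\<in>ball w0 r \<inter> {w. Re w > 0}. norm (a n * (y / (y ^ 2 + of_real (g ^ 2 * real n)) ^ p)) \<le> norm (hh n)"
      using eventually_ge_at_top[of "1::nat"]
    proof (eventually_elim, intro ballI)
      fix n y assume n: "(n::nat) \<ge> 1" and y: "y \<in> ball w0 r \<inter> {w. Re w > 0}"
      have d: "norm (y - w0) < r" using y by (simp add: dist_norm norm_minus_commute)
      have Rey: "Re y \<ge> r" using d abs_Re_le_cmod[of "y - w0"] unfolding r_def by auto
      have ny: "norm y \<le> M" using d norm_triangle_sub[of y w0] unfolding M_def by linarith
      have "e * real n \<le> (r / (1 + 2 * M)) ^ 2 * (1 + g * sqrt (real n)) ^ 2"
      proof -
        have "(g * sqrt (real n)) ^ 2 \<le> (1 + g * sqrt (real n)) ^ 2" using g by (intro power_mono) auto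
        then have "(r / (1 + 2 * M)) ^ 2 * (g * sqrt (real n)) ^ 2 \<le> (r / (1 + 2 * M)) ^ 2 * (1 + g * sqrt (real n)) ^ 2"
          by (intro mult_left_mono) auto
        then show ?thesis by (simp add: e_def power_mult_distrib)
      qed
      also have "\<dots> \<le> norm (y ^ 2 + of_real ((g * sqrt (real n)) ^ 2))"
        by (rule norm_sum_squares_lower_bound[OF r Rey ny]) (use g in auto)
      finally have "e * real n \<le> norm (y ^ 2 + of_real (g ^ 2 * real n))" by (simp add: power_mult_distrib)
      then have "norm y / norm (y ^ 2 + of_real (g ^ 2 * real n)) ^ p \<le> M / (e * real n) ^ p"
        using e n M ny by (intro frac_le power_mono) auto
      also have "\<dots> = M / e ^ p * real n powr (- real p)"
        using n by (simp add: power_mult_distrib powr_minus powr_realpow field_simps)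
      finally have "norm (a n) * (norm y / norm (y ^ 2 + of_real (g ^ 2 * real n)) ^ p) \<le> norm (a n) * (M / e ^ p * real n powr (- real p))"
        by (rule mult_left_mono) simp
      then show "norm (a n * (y / (y ^ 2 + of_real (g ^ 2 * real n)) ^ p)) \<le> norm (hh n)"
        unfolding hh_def norm_of_real using M e by (simp add: norm_mult norm_divide norm_power abs_mult mult_ac)
    qed
  qed (use r in auto)
qed

text \<open>All that is used of a cusp form and its dual from here on. The threshold h/2 + 3/4 is
  (kappa + 1)/2 for kappa = h + 1/2. The variable u is an inverse square root of the height, so that
  Gaussian integrals in u turn exponentials in n into exponentials in sqrt n.\<close>

locale theta_pair =
  fixes b bs :: "nat \<Rightarrow> complex" and h :: nat and g :: real and K0 :: complex
  assumes g: "g > 0" and K0: "K0 \<noteq> 0" and b0: "b 0 = 0" and bs0: "bs 0 = 0"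
    and sb: "\<And>\<sigma>. \<sigma> > real h / 2 + 3 / 4 \<Longrightarrow> summable (\<lambda>n. norm (b n) * real n powr (- \<sigma>))"
    and sbs: "\<And>\<sigma>. \<sigma> > real h / 2 + 3 / 4 \<Longrightarrow> summable (\<lambda>n. norm (bs n) * real n powr (- \<sigma>))"
    and theta: "\<And>u. u > 0 \<Longrightarrow> (\<Sum>n. b n * of_real (exp (- (real n / u ^ 2))))
        = K0 * of_real (u ^ (2 * h + 1)) * (\<Sum>n. bs n * of_real (exp (- (g ^ 2 / 4 * real n * u ^ 2))))"
begin

text \<open>The factor 1/sqrt(pi) comes from the Gaussian kernel, and h! 4^(h+1)/2 from the moment
  h!/(2 B^(h+1)) at B = (w^2 + g^2 n)/4.\<close>

definition K where "K = K0 * of_real (fact h * 4 ^ (h + 1) / (2 * sqrt pi))"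

lemma summable_exp_sqrt:
  fixes a :: "nat \<Rightarrow> complex"
  assumes "a 0 = 0" "summable (\<lambda>n. norm (a n) * real n powr (- \<sigma>))" "t > 0"
  shows "summable (\<lambda>n. norm (a n) * exp (- t * sqrt (real n)))"
proof -
  obtain C where C: "C \<ge> 0" "\<And>n. n \<ge> 1 \<Longrightarrow> exp (- t * sqrt (real n)) \<le> C * real n powr (- \<sigma>)"
    using exp_neg_sqrt_le_powr[OF assms(3)] by blast
  show ?thesis
  proof (rule summable_comparison_test'[OF summable_mult[OF assms(2), of C]])
    fix n
    show "norm (norm (a n) * exp (- t * sqrt (real n))) \<le> C * (norm (a n) * real n powr (- \<sigma>))"
      using C(2)[of n] assms(1) mult_left_mono[OF C(2)[of n], of "norm (a n)"] by (cases "n = 0") (auto simp: mult_ac)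
  qed
qed

lemma summable_exp_linear:
  fixes a :: "nat \<Rightarrow> complex"
  assumes "a 0 = 0" "summable (\<lambda>n. norm (a n) * real n powr (- \<sigma>))" "t > 0"
  shows "summable (\<lambda>n. norm (a n) * exp (- (t * real n)))"
proof (rule summable_comparison_test'[OF summable_exp_sqrt[OF assms]])
  fix n :: nat
  have "sqrt (real n) \<le> real n"
    using le_square[of n] by (intro real_le_lsqrt) (simp_all add: power2_eq_square flip: of_nat_mult)
  then show "norm (norm (a n) * exp (- (t * real n))) \<le> norm (a n) * exp (- t * sqrt (real n))"
    using assms(3) by (auto intro!: mult_left_mono)
qed

text \<open>Integrate \<open>theta\<close> against (w/sqrt(pi)) exp(-w^2 u^2/4) du. On the left each
  term becomes exp(-w sqrt n). On the right the odd power u^(2h+1) makes every term an odd Gaussian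
  moment, hence rational in w; this is where half-integral weight enters.\<close>

lemma theta_transform_real:
  fixes w :: real
  assumes w: "w > 0"
  shows "(\<Sum>n. b n * of_real (exp (- (w * sqrt (real n))))) = K * of_real w * (\<Sum>n. bs n * of_real (1 / (w ^ 2 + g ^ 2 * real n) ^ (h + 1)))"
proof -
  define \<sigma> where "\<sigma> = real h / 2 + 1"
  have sb': "summable (\<lambda>n. norm (b n) * real n powr (- \<sigma>))" and sbs': "summable (\<lambda>n. norm (bs n) * real n powr (- \<sigma>))"
    by (intro sb sbs; simp add: \<sigma>_def)+
  define g1 where "g1 n u = w / sqrt pi * exp (- ((w / 2)\<^sup>2 * u\<^sup>2) - (sqrt (real n))\<^sup>2 / u\<^sup>2)" for n u
  have g1_split: "g1 n u = w / sqrt pi * exp (- ((w / 2)\<^sup>2 * u\<^sup>2)) * exp (- (real n / u\<^sup>2))" for n u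
    unfolding g1_def mult.assoc exp_add[symmetric] by simp
  have 1: "(\<lambda>n. b n * of_real (exp (- (w * sqrt (real n))))) sums (LBINT u:{0<..}. (\<Sum>n. b n * of_real (g1 n u)))"
  proof (rule sums_set_integral_mult)
    fix n assume "b n \<noteq> 0"
    then have n: "sqrt (real n) > 0" using b0 by (cases "n = 0") auto
    show "set_integrable lborel {0<..} (g1 n)" unfolding g1_def
      by (intro set_integrable_mult_right integral_exp_square_inverse_square) (use n w in auto)
    have "(LBINT u:{0<..}. g1 n u) = w / sqrt pi * (sqrt pi / (2 * (w / 2)) * exp (- 2 * (w / 2) * sqrt (real n)))"
      unfolding g1_def set_integral_mult_right
      by (subst integral_exp_square_inverse_square(2)) (use n w in auto)
    then show "(LBINT u:{0<..}. g1 n u) = exp (- (w * sqrt (real n)))" using w by simp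
  next
    fix n u show "g1 n u \<ge> 0" using w by (simp add: g1_def)
  next
    fix u :: real assume u: "u \<in> {0<..}"
    have "summable (\<lambda>n. w / sqrt pi * exp (- ((w / 2)\<^sup>2 * u\<^sup>2)) * (norm (b n) * exp (- (1 / u\<^sup>2 * real n))))"
      by (intro summable_mult summable_exp_linear[OF b0 sb']) (use u in auto)
    then show "summable (\<lambda>n. norm (b n) * g1 n u)"
      by (simp add: g1_split mult_ac)
  next
    show "summable (\<lambda>n. norm (b n) * exp (- (w * sqrt (real n))))"
      using summable_exp_sqrt[OF b0 sb' w] by simp
  qed
  define g2 where "g2 n u = u ^ (2 * h + 1) * exp (- ((w ^ 2 + g ^ 2 * real n) / 4 * u\<^sup>2))" for n u
  have le: "(w ^ 2 + g ^ 2 * real n) / 4 > 0" for n using w g by (intro divide_pos_pos add_pos_nonneg) auto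
  define v2 where "v2 n = fact h / (2 * ((w ^ 2 + g ^ 2 * real n) / 4) ^ (h + 1))" for n
  have 2: "(\<lambda>n. bs n * of_real (v2 n)) sums (LBINT u:{0<..}. (\<Sum>n. bs n * of_real (g2 n u)))"
  proof (rule sums_set_integral_mult)
    fix n
    show "set_integrable lborel {0<..} (g2 n)" "(LBINT u:{0<..}. g2 n u) = v2 n"
      unfolding g2_def v2_def by (rule integral_odd_power_gaussian[OF le])+
  next
    fix n and u :: real assume "u \<in> {0<..}" then show "g2 n u \<ge> 0" by (simp add: g2_def)
  next
    fix u :: real assume u: "u \<in> {0<..}"
    have "summable (\<lambda>n. u ^ (2 * h + 1) * exp (- (w ^ 2 / 4 * u\<^sup>2)) * (norm (bs n) * exp (- (g ^ 2 / 4 * u\<^sup>2 * real n))))"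
      by (intro summable_mult summable_exp_linear[OF bs0 sbs']) (use u g in auto)
    also have "(\<lambda>n. u ^ (2 * h + 1) * exp (- (w ^ 2 / 4 * u\<^sup>2)) * (norm (bs n) * exp (- (g ^ 2 / 4 * u\<^sup>2 * real n)))) = (\<lambda>n. norm (bs n) * g2 n u)"
    proof
      fix n
      have "exp (- ((w ^ 2 + g ^ 2 * real n) / 4 * u\<^sup>2)) = exp (- (w ^ 2 / 4 * u\<^sup>2)) * exp (- (g ^ 2 / 4 * u\<^sup>2 * real n))"
        unfolding exp_add[symmetric] by (simp add: field_simps)
      then show "u ^ (2 * h + 1) * exp (- (w ^ 2 / 4 * u\<^sup>2)) * (norm (bs n) * exp (- (g ^ 2 / 4 * u\<^sup>2 * real n))) = norm (bs n) * g2 n u"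
        by (simp add: g2_def)
    qed
    finally show "summable (\<lambda>n. norm (bs n) * g2 n u)" .
  next
    have "summable (\<lambda>n. norm (bs n) * real n powr (- real (h + 1)))" by (intro sbs) simp
    then have "summable (\<lambda>n. (fact h / (2 * (g ^ 2 / 4) ^ (h + 1))) * (norm (bs n) * real n powr (- real (h + 1))))"
      by (rule summable_mult)
    then show "summable (\<lambda>n. norm (bs n) * v2 n)"
    proof (rule summable_comparison_test')
      fix n :: nat
      show "norm (norm (bs n) * v2 n) \<le> (fact h / (2 * (g ^ 2 / 4) ^ (h + 1))) * (norm (bs n) * real n powr (- real (h + 1)))"
      proof (cases "n = 0")
        case False
        have "(g ^ 2 * real n / 4) ^ (h + 1) \<le> ((w ^ 2 + g ^ 2 * real n) / 4) ^ (h + 1)"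
          using g w by (intro power_mono) (auto simp: field_simps)
        moreover have "(g ^ 2 * real n / 4) ^ (h + 1) > 0" using False g by simp
        ultimately have "v2 n \<le> fact h / (2 * (g ^ 2 * real n / 4) ^ (h + 1))"
          unfolding v2_def by (intro divide_left_mono mult_left_mono mult_pos_pos) (use le in auto)
        also have "\<dots> = (fact h / (2 * (g ^ 2 / 4) ^ (h + 1))) * real n powr (- real (h + 1))"
          using False g unfolding powr_minus by (subst powr_realpow) (auto simp: power_mult_distrib power_divide divide_simps)
        finally have "norm (bs n) * v2 n \<le> norm (bs n) * ((fact h / (2 * (g ^ 2 / 4) ^ (h + 1))) * real n powr (- real (h + 1)))"
          by (rule mult_left_mono) simp
        moreover have "v2 n \<ge> 0" unfolding v2_def using le[of n] by (intro divide_nonneg_nonneg mult_nonneg_nonneg zero_le_power) auto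
        ultimately show ?thesis by (simp add: mult_ac abs_mult)
      qed (use bs0 in simp)
    qed
  qed
  have eq: "(\<Sum>n. b n * of_real (g1 n u)) = (of_real (w / sqrt pi) * K0) * (\<Sum>n. bs n * of_real (g2 n u))" if u: "u > 0" for u
  proof -
    have "(\<Sum>n. b n * of_real (g1 n u)) = (\<Sum>n. of_real (w / sqrt pi * exp (- ((w / 2)\<^sup>2 * u\<^sup>2))) * (b n * of_real (exp (- (real n / u ^ 2)))))"
      by (intro arg_cong[where f = suminf] ext) (simp add: g1_split mult_ac)
    also have "\<dots> = of_real (w / sqrt pi * exp (- ((w / 2)\<^sup>2 * u\<^sup>2))) * (\<Sum>n. b n * of_real (exp (- (real n / u ^ 2))))"
    proof (rule suminf_mult)
      have "summable (\<lambda>n. norm (b n) * exp (- (1 / u\<^sup>2 * real n)))" by (rule summable_exp_linear[OF b0 sb']) (use u in auto)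
      then have "summable (\<lambda>n. norm (b n * of_real (exp (- (real n / u ^ 2)))))" by (simp add: norm_mult)
      then show "summable (\<lambda>n. b n * of_real (exp (- (real n / u ^ 2))))" by (rule summable_norm_cancel)
    qed
    also have "\<dots> = (of_real (w / sqrt pi) * K0) * (of_real (exp (- ((w / 2)\<^sup>2 * u\<^sup>2)) * u ^ (2 * h + 1)) * (\<Sum>n. bs n * of_real (exp (- (g ^ 2 / 4 * real n * u ^ 2)))))"
      unfolding theta[OF u] by (simp add: mult_ac)
    also have "of_real (exp (- ((w / 2)\<^sup>2 * u\<^sup>2)) * u ^ (2 * h + 1)) * (\<Sum>n. bs n * of_real (exp (- (g ^ 2 / 4 * real n * u ^ 2)))) = (\<Sum>n. of_real (exp (- ((w / 2)\<^sup>2 * u\<^sup>2)) * u ^ (2 * h + 1)) * (bs n * of_real (exp (- (g ^ 2 / 4 * real n * u ^ 2)))))"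
    proof (rule suminf_mult[symmetric])
      have "summable (\<lambda>n. norm (bs n) * exp (- (g ^ 2 / 4 * u ^ 2 * real n)))" by (rule summable_exp_linear[OF bs0 sbs']) (use u g in auto)
      then have "summable (\<lambda>n. norm (bs n * of_real (exp (- (g ^ 2 / 4 * real n * u ^ 2)))))" by (simp add: norm_mult mult_ac)
      then show "summable (\<lambda>n. bs n * of_real (exp (- (g ^ 2 / 4 * real n * u ^ 2))))" by (rule summable_norm_cancel)
    qed
    also have "\<dots> = (\<Sum>n. bs n * of_real (g2 n u))"
    proof (intro arg_cong[where f = suminf] ext)
      fix n
      have "exp (- ((w ^ 2 + g ^ 2 * real n) / 4 * u\<^sup>2)) = exp (- ((w / 2)\<^sup>2 * u\<^sup>2)) * exp (- (g ^ 2 / 4 * real n * u ^ 2))"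
        unfolding exp_add[symmetric] by (simp add: field_simps power2_eq_square)
      then have "g2 n u = exp (- ((w / 2)\<^sup>2 * u\<^sup>2)) * u ^ (2 * h + 1) * exp (- (g ^ 2 / 4 * real n * u ^ 2))" by (simp add: g2_def)
      then show "of_real (exp (- ((w / 2)\<^sup>2 * u\<^sup>2)) * u ^ (2 * h + 1)) * (bs n * of_real (exp (- (g ^ 2 / 4 * real n * u ^ 2)))) = bs n * of_real (g2 n u)"
        by (simp only: of_real_mult mult_ac)
    qed
    finally show ?thesis .
  qed
  have "(\<Sum>n. b n * of_real (exp (- (w * sqrt (real n))))) = (LBINT u:{0<..}. (\<Sum>n. b n * of_real (g1 n u)))"
    using 1 by (simp add: sums_iff)
  also have "\<dots> = (LBINT u:{0<..}. (of_real (w / sqrt pi) * K0) * (\<Sum>n. bs n * of_real (g2 n u)))"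
    by (rule set_lebesgue_integral_cong) (use eq in auto)
  also have "\<dots> = (of_real (w / sqrt pi) * K0) * (\<Sum>n. bs n * of_real (v2 n))"
    using 2 by (simp add: sums_iff)
  also have "(\<Sum>n. bs n * of_real (v2 n)) = (\<Sum>n. of_real (fact h * 4 ^ (h + 1) / 2) * (bs n * of_real (1 / (w ^ 2 + g ^ 2 * real n) ^ (h + 1))))"
    by (intro arg_cong[where f = suminf] ext) (simp add: v2_def power_divide del: power_Suc)
  also have "\<dots> = of_real (fact h * 4 ^ (h + 1) / 2) * (\<Sum>n. bs n * of_real (1 / (w ^ 2 + g ^ 2 * real n) ^ (h + 1)))"
  proof (rule suminf_mult)
    have "summable (\<lambda>n. of_real (2 / (fact h * 4 ^ (h + 1))) * (bs n * of_real (v2 n)))"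
      using 2 by (intro summable_mult) (simp add: sums_iff)
    also have "(\<lambda>n. of_real (2 / (fact h * 4 ^ (h + 1))) * (bs n * of_real (v2 n))) = (\<lambda>n. bs n * of_real (1 / (w ^ 2 + g ^ 2 * real n) ^ (h + 1)))"
      by (rule ext) (simp add: v2_def power_divide del: power_Suc)
    finally show "summable (\<lambda>n. bs n * of_real (1 / (w ^ 2 + g ^ 2 * real n) ^ (h + 1)))" .
  qed
  also have "of_real (w / sqrt pi) * K0 * (of_real (fact h * 4 ^ (h + 1) / 2) * (\<Sum>n. bs n * of_real (1 / (w ^ 2 + g ^ 2 * real n) ^ (h + 1))))
     = K * of_real w * (\<Sum>n. bs n * of_real (1 / (w ^ 2 + g ^ 2 * real n) ^ (h + 1)))"
    by (simp add: K_def)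
  finally show ?thesis .
qed

end

context theta_pair
begin

text \<open>Truncated subtraction: the chain is empty both for h = 0 and for h = 1.\<close>

definition H where "H = h - 1"

text \<open>
  For \<open>h = 0\<close> the transformed series does not converge absolutely; one derivative in \<open>w\<close> repairs this and
  accounts for the factor \<open>\<surd>n\<close>.
\<close>
definition D where "D n = (if h = 0 then b n * of_real (sqrt (real n)) else b n)"

text \<open>The divisor is the product of 2(r + 2) for r < H, accumulated by the H Euler steps from
  \<open>om\<close> to the transformed series.\<close>

definition Kp where "Kp = K / of_real (2 ^ H * fact (H + 1))"

text \<open>The summand at the bottom of the chain. For h > 0 the factor (g^2 n)^(-H) compensates
  the g^2 n produced by each Euler step; for h = 0 it is minus the w-derivative of w/(w^2 + g^2 n),
  whose poles are double instead of simple.\<close>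

definition om where "om n w = (if h = 0 then bs n * ((w ^ 2 - of_real (g ^ 2 * real n)) / (w ^ 2 + of_real (g ^ 2 * real n)) ^ 2)
    else bs n / of_real ((g ^ 2 * real n) ^ H) * (w / (w ^ 2 + of_real (g ^ 2 * real n)) ^ 2))" for w :: complex

lemma K_nz: "K \<noteq> 0" using K0 by (simp add: K_def)

lemma Kp_nz: "Kp \<noteq> 0" using K_nz by (simp add: Kp_def del: fact_Suc of_nat_Suc)

lemma exp_series_derivative:
  "\<exists>G G'. \<forall>w\<in>{w. Re w > 0}. (\<lambda>n. b n * exp (- w * of_real (sqrt (real n)))) sums G w
     \<and> (\<lambda>n. - of_real (sqrt (real n)) * b n * exp (- w * of_real (sqrt (real n)))) sums G' w
     \<and> (G has_field_derivative G' w) (at w)"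
proof (rule series_and_derivative_comparison_complex)
  show "open {w::complex. Re w > 0}" by (rule open_halfspace_Re_gt)
  fix n w
  show "((\<lambda>w. b n * exp (- w * of_real (sqrt (real n)))) has_field_derivative - of_real (sqrt (real n)) * b n * exp (- w * of_real (sqrt (real n)))) (at w)"
    by (auto intro!: derivative_eq_intros)
next
  fix w0 assume w0: "w0 \<in> {w::complex. Re w > 0}"
  define r where "r = Re w0 / 2"
  have r: "r > 0" using w0 by (simp add: r_def)
  show "\<exists>d (h :: nat \<Rightarrow> complex). 0 < d \<and> summable h \<and> range h \<subseteq> \<real>\<^sub>\<ge>\<^sub>0 \<and>
     (\<forall>\<^sub>F n in sequentially. \<forall>y\<in>ball w0 d \<inter> {w. Re w > 0}. norm (b n * exp (- y * of_real (sqrt (real n)))) \<le> norm (h n))"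
  proof (intro exI[of _ r] exI[of _ "\<lambda>n. complex_of_real (norm (b n) * exp (- r * sqrt (real n)))"] conjI)
    show "summable (\<lambda>n. complex_of_real (norm (b n) * exp (- r * sqrt (real n))))"
      by (intro summable_of_real summable_exp_sqrt[OF b0 sb[of "real h / 2 + 1"]] r) simp
    show "\<forall>\<^sub>F n in sequentially. \<forall>y\<in>ball w0 r \<inter> {w. Re w > 0}. norm (b n * exp (- y * of_real (sqrt (real n)))) \<le> norm (complex_of_real (norm (b n) * exp (- r * sqrt (real n))))"
    proof (intro always_eventually allI ballI)
      fix n y assume y: "y \<in> ball w0 r \<inter> {w. Re w > 0}"
      have "norm (y - w0) < r" using y by (simp add: dist_norm norm_minus_commute)
      then have "Re y \<ge> r" using abs_Re_le_cmod[of "y - w0"] unfolding r_def by auto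
      then have "Re (- y * of_real (sqrt (real n))) \<le> - r * sqrt (real n)" by (simp add: mult_right_mono)
      then show "norm (b n * exp (- y * of_real (sqrt (real n)))) \<le> norm (complex_of_real (norm (b n) * exp (- r * sqrt (real n))))"
        by (simp add: norm_mult mult_left_mono del: of_real_mult)
    qed
  qed (use r in auto)
qed

lemma theta_transform_complex:
  assumes w: "Re w > 0"
  shows "(\<Sum>n. b n * exp (- w * of_real (sqrt (real n)))) = K * (\<Sum>n. bs n * (w / (w ^ 2 + of_real (g ^ 2 * real n)) ^ (h + 1)))"
proof -
  obtain G G' where G: "\<And>w. Re w > 0 \<Longrightarrow> (\<lambda>n. b n * exp (- w * of_real (sqrt (real n)))) sums G w"
      "\<And>w. Re w > 0 \<Longrightarrow> (G has_field_derivative G' w) (at w)"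
    using exp_series_derivative by auto
  obtain R R' where R: "\<And>w. Re w > 0 \<Longrightarrow> (\<lambda>n. bs n * (w / (w ^ 2 + of_real (g ^ 2 * real n)) ^ (h + 1))) sums R w"
      "\<And>w. Re w > 0 \<Longrightarrow> (R has_field_derivative R' w) (at w)"
    using rational_series_derivative[OF g, of "h + 1" bs, OF _ bs0 sbs] by auto
  have "G w = K * R w"
  proof (rule holomorphic_eq_from_positive_reals[of G "\<lambda>w. K * R w"])
    have op: "open {w::complex. Re w > 0}" by (rule open_halfspace_Re_gt)
    show "G holomorphic_on {w. Re w > 0}" using G(2) holomorphic_on_open[OF op] by blast
    have "R holomorphic_on {w. Re w > 0}" using R(2) holomorphic_on_open[OF op] by blast
    then show "(\<lambda>w. K * R w) holomorphic_on {w. Re w > 0}" by (intro holomorphic_intros)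
    fix t :: real assume t: "t > 0"
    have e: "bs n * (of_real t / ((of_real t) ^ 2 + of_real (g ^ 2 * real n)) ^ (h + 1)) = of_real t * (bs n * of_real (1 / (t ^ 2 + g ^ 2 * real n) ^ (h + 1)))" for n
      by (simp del: power_Suc)
    have sm: "summable (\<lambda>n. bs n * of_real (1 / (t ^ 2 + g ^ 2 * real n) ^ (h + 1)))"
    proof -
      have "summable (\<lambda>n. complex_of_real t * (bs n * of_real (1 / (t ^ 2 + g ^ 2 * real n) ^ (h + 1))))"
        using R(1)[of "of_real t"] t unfolding e by (auto simp only: sums_iff Re_complex_of_real)
      then show ?thesis using t unfolding summable_cmult_iff by simp
    qed
    have "G (of_real t) = (\<Sum>n. b n * of_real (exp (- (t * sqrt (real n)))))"
      using G(1)[of "of_real t"] t by (simp add: sums_iff exp_of_real[symmetric])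
    also have "\<dots> = K * of_real t * (\<Sum>n. bs n * of_real (1 / (t ^ 2 + g ^ 2 * real n) ^ (h + 1)))"
      by (rule theta_transform_real[OF t])
    also have "\<dots> = K * (of_real t * (\<Sum>n. bs n * of_real (1 / (t ^ 2 + g ^ 2 * real n) ^ (h + 1))))"
      by (simp only: mult.assoc)
    also have "of_real t * (\<Sum>n. bs n * of_real (1 / (t ^ 2 + g ^ 2 * real n) ^ (h + 1))) = R (of_real t)"
      using R(1)[of "of_real t"] t suminf_mult[OF sm, of "of_real t"] unfolding e by (simp add: sums_iff)
    finally show "G (of_real t) = K * R (of_real t)" .
  qed (use w in auto)
  then show ?thesis using G(1)[OF w] R(1)[OF w] by (simp add: sums_iff)
qed

text \<open>The threshold exceeds that of \<open>sb\<close> by 1/2 to absorb the factor sqrt n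
  present for h = 0. \<open>D_summable_sharp\<close> later distinguishes the cases.\<close>

lemma D_summable: "\<sigma> > real h / 2 + 5 / 4 \<Longrightarrow> summable (\<lambda>n. norm (D n) * real n powr (- \<sigma>))"
proof -
  assume \<sigma>: "\<sigma> > real h / 2 + 5 / 4"
  have "summable (\<lambda>n. norm (b n) * real n powr (- (\<sigma> - 1 / 2)))" by (rule sb) (use \<sigma> in simp)
  then show ?thesis
  proof (rule summable_comparison_test')
    fix n :: nat
    have "sqrt (real n) * real n powr (- \<sigma>) = real n powr (- (\<sigma> - 1 / 2))" if "n > 0"
      using that powr_add[of "real n" "1 / 2" "- \<sigma>"] by (simp add: powr_half_sqrt)
    moreover have "real n powr (- \<sigma>) \<le> real n powr (- (\<sigma> - 1 / 2))" if "n > 0" using that by (intro powr_mono) auto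
    ultimately show "norm (norm (D n) * real n powr (- \<sigma>)) \<le> norm (b n) * real n powr (- (\<sigma> - 1 / 2))"
      by (cases "n = 0") (auto simp: D_def norm_mult b0 mult.assoc intro: mult_left_mono)
  qed
qed

lemma D0: "D 0 = 0" by (simp add: D_def b0)

lemma D_exp_bound:
  assumes "x > 0"
  shows "summable (\<lambda>n. norm (D n * exp (- (of_real x + \<i> * of_real c) * of_real (sqrt (real n)))))"
    and "norm (D n * exp (- (of_real x + \<i> * of_real c) * of_real (sqrt (real n)))) = norm (D n) * exp (- x * sqrt (real n))"
proof -
  show e: "norm (D n * exp (- (of_real x + \<i> * of_real c) * of_real (sqrt (real n)))) = norm (D n) * exp (- x * sqrt (real n))" for n
    by (simp add: norm_mult)
  show "summable (\<lambda>n. norm (D n * exp (- (of_real x + \<i> * of_real c) * of_real (sqrt (real n)))))"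
    unfolding e by (intro summable_exp_sqrt[OF D0 D_summable[of "real h / 2 + 2"]] assms) simp
qed

lemma D_exp_summable: "x > 0 \<Longrightarrow> summable (\<lambda>n. norm (D n) * exp (- x * sqrt (real n)))"
  by (intro summable_exp_sqrt[OF D0 D_summable[of "real h / 2 + 2"]]) simp_all

definition Psi where "Psi c x = (\<Sum>n. D n * exp (- (of_real x + \<i> * of_real c) * of_real (sqrt (real n))))"

text \<open>For h = 0 the complex theta transformation is differentiated once: the left side gains
  -sqrt n, the right side becomes minus the sum of the \<open>om n\<close>, and \<open>Kp\<close>
  reduces to \<open>K\<close>.\<close>

lemma Psi_eq:
  assumes x: "x > 0"
  shows "h = 0 \<Longrightarrow> (\<lambda>n. om n (of_real x + \<i> * of_real c)) sums (Psi c x / Kp)"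
    and "h > 0 \<Longrightarrow> Psi c x = K * (\<Sum>n. bs n * ((of_real x + \<i> * of_real c) / ((of_real x + \<i> * of_real c) ^ 2 + of_real (g ^ 2 * real n)) ^ (h + 1)))"
proof -
  define w where "w = complex_of_real x + \<i> * of_real c"
  have w: "Re w > 0" using x by (simp add: w_def)
  show "h > 0 \<Longrightarrow> Psi c x = K * (\<Sum>n. bs n * ((of_real x + \<i> * of_real c) / ((of_real x + \<i> * of_real c) ^ 2 + of_real (g ^ 2 * real n)) ^ (h + 1)))"
    unfolding Psi_def D_def using theta_transform_complex[OF w] by (simp add: w_def)
  assume h0: "h = 0"
  obtain G G' where G: "\<And>w. Re w > 0 \<Longrightarrow> (\<lambda>n. b n * exp (- w * of_real (sqrt (real n)))) sums G w"
      "\<And>w. Re w > 0 \<Longrightarrow> (\<lambda>n. - of_real (sqrt (real n)) * b n * exp (- w * of_real (sqrt (real n)))) sums G' w"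
      "\<And>w. Re w > 0 \<Longrightarrow> (G has_field_derivative G' w) (at w)"
    using exp_series_derivative by auto
  obtain R R' where R: "\<And>w. Re w > 0 \<Longrightarrow> (\<lambda>n. bs n * (w / (w ^ 2 + of_real (g ^ 2 * real n)) ^ (h + 1))) sums R w"
     "\<And>w. Re w > 0 \<Longrightarrow> (\<lambda>n. bs n * (1 / (w ^ 2 + of_real (g ^ 2 * real n)) ^ (h + 1) - 2 * of_nat (h + 1) * w ^ 2 / (w ^ 2 + of_real (g ^ 2 * real n)) ^ Suc (h + 1))) sums R' w"
      "\<And>w. Re w > 0 \<Longrightarrow> (R has_field_derivative R' w) (at w)"
    using rational_series_derivative[OF g, of "h + 1" bs, OF _ bs0 sbs] by auto
  have eq: "G w = K * R w" if "Re w > 0" for w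
    using theta_transform_complex[OF that] G(1)[OF that] R(1)[OF that] by (simp add: sums_iff)
  have "((\<lambda>w. K * R w) has_field_derivative G' w) (at w)"
    by (rule has_field_derivative_transform_within_open[OF G(3)[OF w] open_halfspace_Re_gt[of 0]]) (use w eq in auto)
  moreover have "((\<lambda>w. K * R w) has_field_derivative K * R' w) (at w)" by (intro DERIV_cmult R w)
  ultimately have GR: "G' w = K * R' w" by (rule DERIV_unique)
  have "(\<lambda>n. - (- of_real (sqrt (real n)) * b n * exp (- w * of_real (sqrt (real n))))) sums - G' w"
    by (intro sums_minus G w)
  then have P: "Psi c x = - G' w" unfolding Psi_def D_def w_def using h0 by (simp add: sums_iff mult_ac)
  have "(\<lambda>n. - (bs n * (1 / (w ^ 2 + of_real (g ^ 2 * real n)) ^ (h + 1) - 2 * of_nat (h + 1) * w ^ 2 / (w ^ 2 + of_real (g ^ 2 * real n)) ^ Suc (h + 1)))) sums - R' w"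
    by (intro sums_minus R w)
  also have "(\<lambda>n. - (bs n * (1 / (w ^ 2 + of_real (g ^ 2 * real n)) ^ (h + 1) - 2 * of_nat (h + 1) * w ^ 2 / (w ^ 2 + of_real (g ^ 2 * real n)) ^ Suc (h + 1)))) = (\<lambda>n. om n w)"
  proof
    fix n
    define t where "t = complex_of_real (g ^ 2 * real n)"
    define Dd where "Dd = w ^ 2 + t"
    have "Dd \<noteq> 0" unfolding t_def Dd_def by (rule sum_squares_nonzero[OF w]) auto
    then have "1 / Dd - 2 * w ^ 2 / Dd ^ 2 = (Dd - 2 * w ^ 2) / Dd ^ 2"
      by (simp add: diff_divide_distrib power2_eq_square)
    also have "Dd - 2 * w ^ 2 = - (w ^ 2 - t)" by (simp add: Dd_def)
    finally have "1 / (w ^ 2 + t) - 2 * w ^ 2 / (w ^ 2 + t) ^ 2 = - ((w ^ 2 - t) / (w ^ 2 + t) ^ 2)"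
      unfolding Dd_def minus_divide_left .
    then show "- (bs n * (1 / (w ^ 2 + of_real (g ^ 2 * real n)) ^ (h + 1) - 2 * of_nat (h + 1) * w ^ 2 / (w ^ 2 + of_real (g ^ 2 * real n)) ^ Suc (h + 1))) = om n w"
      unfolding om_def t_def[symmetric] using h0 by (simp add: power2_eq_square)
  qed
  moreover have KpK: "Kp = K" unfolding Kp_def H_def using h0 by simp
  ultimately show "(\<lambda>n. om n (of_real x + \<i> * of_real c)) sums (Psi c x / Kp)"
    unfolding P GR w_def[symmetric] KpK using K_nz by simp
qed

text \<open>Near 0, exp(-y) <= m!/y^m with m = h + 4 leaves n^(-(h/2+2)), which is summable against
  \<open>D\<close>. At infinity the vanishing constant term gives exponential decay, because sqrt n
  >= 1 in every remaining term.\<close>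

lemma Psi_tame: "tame (Psi c)"
proof -
  define Z where "Z = (\<Sum>n. norm (D n) * real n powr (- (real h / 2 + 2)))"
  have sD: "summable (\<lambda>n. norm (D n) * real n powr (- (real h / 2 + 2)))" by (rule D_summable) simp
  have Psi_norm: "norm (Psi c x) \<le> (\<Sum>n. norm (D n) * exp (- x * sqrt (real n)))" if "x > 0" for x
    unfolding Psi_def by (rule order_trans[OF summable_norm[OF D_exp_bound(1)[OF that]]]) (simp only: D_exp_bound(2)[OF that] order_refl)
  show ?thesis unfolding tame_def
  proof (intro conjI)
    obtain G G' where G: "\<And>w. Re w > 0 \<Longrightarrow> (\<lambda>n. b n * exp (- w * of_real (sqrt (real n)))) sums G w"
      "\<And>w. Re w > 0 \<Longrightarrow> (\<lambda>n. - of_real (sqrt (real n)) * b n * exp (- w * of_real (sqrt (real n)))) sums G' w"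
      "\<And>w. Re w > 0 \<Longrightarrow> (G has_field_derivative G' w) (at w)"
      using exp_series_derivative by auto
    have op: "open {w::complex. Re w > 0}" by (rule open_halfspace_Re_gt)
    have hG: "G holomorphic_on {w. Re w > 0}" using G(3) holomorphic_on_open[OF op] by blast
    have "deriv G holomorphic_on {w. Re w > 0}" by (rule holomorphic_deriv[OF hG op])
    then have hG': "G' holomorphic_on {w. Re w > 0}"
      by (rule holomorphic_transform) (use G(3) DERIV_imp_deriv in auto)
    have img: "(\<lambda>x. complex_of_real x + \<i> * of_real c) ` {0<..} \<subseteq> {w. Re w > 0}" by auto
    have P: "Psi c x = (if h = 0 then - G' (of_real x + \<i> * of_real c) else G (of_real x + \<i> * of_real c))" if "x > 0" for x
    proof (cases "h = 0")
      case True
      have "(\<lambda>n. - (- of_real (sqrt (real n)) * b n * exp (- (of_real x + \<i> * of_real c) * of_real (sqrt (real n))))) sums - G' (of_real x + \<i> * of_real c)"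
        by (intro sums_minus G) (use that in simp)
      then show ?thesis unfolding Psi_def D_def using True by (simp add: sums_iff mult_ac)
    next
      case False
      then show ?thesis using G(1)[of "of_real x + \<i> * of_real c"] that unfolding Psi_def D_def by (simp add: sums_iff)
    qed
    have "continuous_on {0<..} (\<lambda>x. G' (complex_of_real x + \<i> * of_real c))" "continuous_on {0<..} (\<lambda>x. G (complex_of_real x + \<i> * of_real c))"
      by (intro continuous_on_compose2[OF holomorphic_on_imp_continuous_on[OF hG'] _ img] continuous_on_compose2[OF holomorphic_on_imp_continuous_on[OF hG] _ img] continuous_intros)+
    then have "continuous_on {0<..} (\<lambda>x. if h = 0 then - G' (complex_of_real x + \<i> * of_real c) else G (of_real x + \<i> * of_real c))"
      by (cases "h = 0") (auto intro: continuous_intros)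
    then show "continuous_on {0<..} (Psi c)" by (rule continuous_on_eq) (simp add: P)
  next
    define m where "m = h + 4"
    have "norm (Psi c x) \<le> fact m * Z * x powr (- real m)" if x: "0 < x" "x \<le> 1" for x
    proof -
      have "(\<Sum>n. norm (D n) * exp (- x * sqrt (real n))) \<le> (\<Sum>n. fact m * x powr (- real m) * (norm (D n) * real n powr (- (real h / 2 + 2))))"
      proof (rule suminf_le)
        show "summable (\<lambda>n. norm (D n) * exp (- x * sqrt (real n)))" by (rule D_exp_summable[OF x(1)])
        show "summable (\<lambda>n. fact m * x powr (- real m) * (norm (D n) * real n powr (- (real h / 2 + 2))))" by (intro summable_mult sD)
        fix n
        show "norm (D n) * exp (- x * sqrt (real n)) \<le> fact m * x powr (- real m) * (norm (D n) * real n powr (- (real h / 2 + 2)))"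
        proof (cases "n = 0")
          case False
          have sq: "sqrt (real n) > 0" using False by simp
          have "(x * sqrt (real n)) ^ m / fact m \<le> exp (x * sqrt (real n))"
            using sum_le_suminf[OF summable_exp, of "{m}" "x * sqrt (real n)"] x sq
            by (simp add: exp_def divide_inverse mult.commute)
          then have "exp (- x * sqrt (real n)) \<le> fact m / (x * sqrt (real n)) ^ m"
            using x sq by (simp add: exp_minus field_simps)
          also have "\<dots> = fact m * x powr (- real m) * (sqrt (real n)) powr (- real m)"
            using sq x by (simp add: power_mult_distrib powr_minus powr_realpow field_simps)
          also have "(sqrt (real n)) powr (- real m) = real n powr (- (real h / 2 + 2))"
            using False by (simp add: powr_half_sqrt[symmetric] powr_powr m_def add_divide_distrib diff_divide_distrib)
          finally have "norm (D n) * exp (- x * sqrt (real n)) \<le> norm (D n) * (fact m * x powr (- real m) * real n powr (- (real h / 2 + 2)))"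
            by (rule mult_left_mono) simp
          then show ?thesis by (simp add: mult_ac)
        qed (simp add: D0)
      qed
      also have "\<dots> = fact m * Z * x powr (- real m)" unfolding Z_def by (subst suminf_mult[OF sD]) simp
      finally show ?thesis using Psi_norm[OF x(1)] by linarith
    qed
    then show "\<exists>q. pole_order_bound q (Psi c)" unfolding pole_order_bound_def by blast
  next
    define Y where "Y = (\<Sum>n. norm (D n) * exp (- (1 / 2) * sqrt (real n)))"
    have sY: "summable (\<lambda>n. norm (D n) * exp (- (1 / 2) * sqrt (real n)))" by (rule D_exp_summable) simp
    have bnd: "norm (Psi c x) \<le> exp (- (x - 1 / 2)) * Y" if x: "x \<ge> 1" for x
    proof -
      have "(\<Sum>n. norm (D n) * exp (- x * sqrt (real n))) \<le> (\<Sum>n. exp (- (x - 1 / 2)) * (norm (D n) * exp (- (1 / 2) * sqrt (real n))))"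
      proof (rule suminf_le)
        show "summable (\<lambda>n. norm (D n) * exp (- x * sqrt (real n)))" by (rule D_exp_summable) (use x in simp)
        show "summable (\<lambda>n. exp (- (x - 1 / 2)) * (norm (D n) * exp (- (1 / 2) * sqrt (real n))))" by (intro summable_mult sY)
        fix n
        show "norm (D n) * exp (- x * sqrt (real n)) \<le> exp (- (x - 1 / 2)) * (norm (D n) * exp (- (1 / 2) * sqrt (real n)))"
        proof (cases "n = 0")
          case False
          then have sq: "sqrt (real n) \<ge> 1" by simp
          have "(x - 1 / 2) * 1 \<le> (x - 1 / 2) * sqrt (real n)" using sq x by (intro mult_left_mono) auto
          then have "exp (- x * sqrt (real n)) \<le> exp (- (x - 1 / 2) + - (1 / 2) * sqrt (real n))" by (simp add: algebra_simps)
          then have "norm (D n) * exp (- x * sqrt (real n)) \<le> norm (D n) * (exp (- (x - 1 / 2)) * exp (- (1 / 2) * sqrt (real n)))"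
            unfolding exp_add by (intro mult_left_mono) auto
          then show ?thesis by (simp add: mult_ac)
        qed (simp add: D0)
      qed
      also have "\<dots> = exp (- (x - 1 / 2)) * Y" unfolding Y_def by (rule suminf_mult[OF sY])
      finally show ?thesis using Psi_norm[of x] x by linarith
    qed
    show "rapid_decay (Psi c)" unfolding rapid_decay_def
    proof
      fix q :: real
      define m where "m = nat \<lceil>q\<rceil>"
      have m: "real m \<ge> q" unfolding m_def by linarith
      have Y0: "Y \<ge> 0" unfolding Y_def by (rule suminf_nonneg[OF sY]) auto
      have "norm (Psi c x) \<le> exp (1/2) * fact m * Y * x powr (- q)" if x: "x \<ge> 1" for x
      proof -
        have "x ^ m / fact m \<le> exp x"
          using sum_le_suminf[OF summable_exp, of "{m}" x] x by (simp add: exp_def divide_inverse mult.commute)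
        then have "exp (- x) \<le> fact m * x powr (- real m)" using x by (simp add: exp_minus powr_minus powr_realpow field_simps)
        also have "\<dots> \<le> fact m * x powr (- q)" using m x by (intro mult_left_mono powr_mono) auto
        finally have "exp (1/2) * Y * exp (- x) \<le> exp (1/2) * Y * (fact m * x powr (- q))" using Y0 by (intro mult_left_mono) auto
        moreover have "exp (- (x - 1 / 2)) * Y = exp (1/2) * Y * exp (- x)"
        proof -
          have "exp (- (x - 1 / 2)) = exp (1/2) * exp (- x)" unfolding exp_add[symmetric] by simp
          then show ?thesis by simp
        qed
        ultimately have "norm (Psi c x) \<le> exp (1/2) * Y * (fact m * x powr (- q))" using bnd[OF x] by linarith
        then show ?thesis by (simp only: mult_ac)
      qed
      then show "\<exists>B. \<forall>x\<ge>1. norm (Psi c x) \<le> B * x powr (- q)" by blast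
    qed
  qed
qed

end

lemma tame_divide: "tame f \<Longrightarrow> tame (\<lambda>x. f x / k)"
  unfolding tame_def
proof (elim conjE exE, intro conjI)
  fix q assume f: "continuous_on {0<..} f" "pole_order_bound q f" "rapid_decay f"
  show "continuous_on {0<..} (\<lambda>x. f x / k)" unfolding divide_inverse by (intro continuous_intros f)
  obtain B where B: "\<And>x. 0 < x \<Longrightarrow> x \<le> 1 \<Longrightarrow> norm (f x) \<le> B * x powr (- q)"
    using f(2) by (auto simp: pole_order_bound_def)
  have "norm (f x / k) \<le> B / norm k * x powr (- q)" if "0 < x" "x \<le> 1" for x
    using divide_right_mono[OF B[OF that], of "norm k"] by (simp add: norm_divide)
  then show "\<exists>q. pole_order_bound q (\<lambda>x. f x / k)" unfolding pole_order_bound_def by blast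
  show "rapid_decay (\<lambda>x. f x / k)" unfolding rapid_decay_def
  proof
    fix q
    obtain B where B: "\<And>x. x \<ge> 1 \<Longrightarrow> norm (f x) \<le> B * x powr (- q)"
      using f(3) unfolding rapid_decay_def by blast
    have "norm (f x / k) \<le> B / norm k * x powr (- q)" if "x \<ge> 1" for x
      using divide_right_mono[OF B[OF that], of "norm k"] by (simp add: norm_divide)
    then show "\<exists>B. \<forall>x\<ge>1. norm (f x / k) \<le> B * x powr (- q)" by blast
  qed
qed

lemma mellin_divide: "mellin (\<lambda>x. f x / k) S = mellin f S / k"
  unfolding mellin_def times_divide_eq_right set_integral_divide_zero ..

context theta_pair
begin

lemma om_0: "om 0 w = 0"
  by (simp add: om_def bs0)

definition residual where
  "residual c cf x = (\<Sum>n. om n (of_real x + \<i> * of_real c)) - (\<Sum>j\<in>{1..H}. cf j / (of_real x + \<i> * of_real c) ^ (2 * j + 1))"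

text \<open>Substituting w^2 = (w^2 + t) - t in the derivative of w/(w^2 + t)^(r+2) cancels the
  lower power: w d/dw + 2r + 3 maps it to 2(r+2) t w/(w^2 + t)^(r+3). So the series for r = 0
  (\<open>om\<close>) and r = H (\<open>Psi\<close> up to \<open>Kp\<close>) are the two ends of an
  Euler chain.\<close>

lemma om_sum_chain_pos:
  assumes h: "h > 0" and c: "c > 0"
  shows "\<exists>cf R. tame (residual c cf) \<and>
     (\<forall>S. Re S > R \<longrightarrow> shift_op c (\<Prod>j\<in>{1..H}. [:2 * real j - 1, 1:]) (\<lambda>S. mellin (residual c cf) S / Gamma S) S
        = mellin (\<lambda>x. Psi c x / Kp) S / Gamma S)"
proof -
  have Hh: "H + 1 = h" using h by (simp add: H_def)
  \<comment> \<open>Solves a (r + 1) n = 2(r + 2) g^2 n a r n, normalized so that no power of n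
    remains at r = H. For n = 0 the quotient is harmless because \<open>bs 0 = 0\<close>.\<close>
  define a where "a r n = bs n * of_real (2 ^ r * fact (r + 1) / (g ^ 2 * real n) ^ (H - r))" for r n
  define Dn where "Dn w n = w ^ 2 + of_real (g ^ 2 * real n)" for w :: complex and n :: nat
  have Dn0: "Dn w n \<noteq> 0" if "Re w > 0" for w n unfolding Dn_def by (rule sum_squares_nonzero[OF that]) auto
  define Qp where "Qp r G G' \<longleftrightarrow> (\<forall>w\<in>{w. Re w > 0}. (\<lambda>n. a r n * (w / Dn w n ^ (r + 2))) sums G w
     \<and> (\<lambda>n. a r n * (1 / Dn w n ^ (r + 2) - 2 * of_nat (r + 2) * w ^ 2 / Dn w n ^ Suc (r + 2))) sums G' w
     \<and> (G has_field_derivative G' w) (at w))" for r G G'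
  have ex: "\<exists>G G'. Qp r G G'" if "r \<le> H" for r
    unfolding Qp_def Dn_def
  proof (rule rational_series_derivative[OF g])
    show "a r 0 = 0" by (simp add: a_def bs0)
    have "summable (\<lambda>n. (2 ^ r * fact (r + 1) / (g ^ 2) ^ (H - r)) * (norm (bs n) * real n powr (- real (h + 1))))"
      by (intro summable_mult sbs) simp
    also have "(\<lambda>n. (2 ^ r * fact (r + 1) / (g ^ 2) ^ (H - r)) * (norm (bs n) * real n powr (- real (h + 1)))) = (\<lambda>n. norm (a r n) * real n powr (- real (r + 2)))"
    proof
      fix n :: nat
      show "(2 ^ r * fact (r + 1) / (g ^ 2) ^ (H - r)) * (norm (bs n) * real n powr (- real (h + 1))) = norm (a r n) * real n powr (- real (r + 2))"
      proof (cases "n = 0")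
        case False
        have e: "- real (h + 1) = - real (H - r) + - real (r + 2)" using that Hh by (simp add: of_nat_diff)
        have "real n powr (- real (h + 1)) = real n powr (- real (H - r)) * real n powr (- real (r + 2))"
          unfolding e powr_add ..
        also have "real n powr (- real (H - r)) = 1 / real n ^ (H - r)" using False by (simp add: powr_minus powr_realpow divide_inverse)
        finally show ?thesis using g False
          by (simp add: a_def norm_mult norm_divide norm_power power_mult_distrib abs_mult del: fact_Suc of_nat_Suc)
      qed (simp add: bs0 a_def)
    qed
    finally show "summable (\<lambda>n. norm (a r n) * real n powr (- real (r + 2)))" .
  qed simp
  then obtain G G' where GG: "\<And>r. r \<le> H \<Longrightarrow> Qp r (G r) (G' r)" by metis
  have G1: "(\<lambda>n. a r n * (w / Dn w n ^ (r + 2))) sums G r w"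
    and G2: "(\<lambda>n. a r n * (1 / Dn w n ^ (r + 2) - 2 * of_nat (r + 2) * w ^ 2 / Dn w n ^ Suc (r + 2))) sums G' r w"
    and G3: "(G r has_field_derivative G' r w) (at w)" if "r \<le> H" "Re w > 0" for r w
    using GG[OF that(1)] that(2) unfolding Qp_def by auto
  define P where "P r x = G r (complex_of_real x + \<i> * of_real c)" for r x
  define P' where "P' r x = G' r (complex_of_real x + \<i> * of_real c)" for r x
  have ode: "w * G' r w + of_nat (2 * r + 3) * G r w = G (Suc r) w" if r: "r < H" and w: "Re w > 0" for r w
  proof -
    have "(\<lambda>n. w * (a r n * (1 / Dn w n ^ (r + 2) - 2 * of_nat (r + 2) * w ^ 2 / Dn w n ^ Suc (r + 2))) + of_nat (2 * r + 3) * (a r n * (w / Dn w n ^ (r + 2))))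
        sums (w * G' r w + of_nat (2 * r + 3) * G r w)"
      by (intro sums_add sums_mult G1 G2) (use r w in auto)
    also have "(\<lambda>n. w * (a r n * (1 / Dn w n ^ (r + 2) - 2 * of_nat (r + 2) * w ^ 2 / Dn w n ^ Suc (r + 2))) + of_nat (2 * r + 3) * (a r n * (w / Dn w n ^ (r + 2))))
       = (\<lambda>n. a (Suc r) n * (w / Dn w n ^ (Suc r + 2)))"
    proof
      fix n
      define E where "E = Dn w n"
      have E0: "E \<noteq> 0" using Dn0[OF w] by (simp add: E_def)
      have w2: "w ^ 2 = E - of_real (g ^ 2 * real n)" by (simp add: E_def Dn_def)
      have "w * (a r n * (1 / E ^ (r + 2) - 2 * of_nat (r + 2) * w ^ 2 / E ^ Suc (r + 2))) + of_nat (2 * r + 3) * (a r n * (w / E ^ (r + 2)))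
         = a r n * w * ((of_nat (2 * r + 4) * E - 2 * of_nat (r + 2) * w ^ 2) / E ^ Suc (r + 2))"
        using E0 by (simp add: field_simps)
      also have "of_nat (2 * r + 4) * E - 2 * of_nat (r + 2) * w ^ 2 = 2 * of_nat (r + 2) * of_real (g ^ 2 * real n)"
        unfolding w2 by (simp add: algebra_simps)
      also have "a r n * w * (2 * of_nat (r + 2) * of_real (g ^ 2 * real n) / E ^ Suc (r + 2)) = (a r n * (2 * of_nat (r + 2) * of_real (g ^ 2 * real n))) * (w / E ^ (Suc r + 2))"
        by simp
      also have "a r n * (2 * of_nat (r + 2) * of_real (g ^ 2 * real n)) = a (Suc r) n"
      proof (cases "n = 0")
        case False
        have e: "H - r = Suc (H - Suc r)" using r by simp
        have "2 ^ r * fact (r + 1) / (g ^ 2 * real n) ^ (H - r) * (2 * real (r + 2) * (g ^ 2 * real n)) = 2 ^ Suc r * fact (Suc r + 1) / (g ^ 2 * real n) ^ (H - Suc r)"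
          unfolding e using False g by (simp add: field_simps)
        note eqr = this
        have "complex_of_real (2 ^ r * fact (r + 1) / (g ^ 2 * real n) ^ (H - r)) * (2 * of_nat (r + 2) * of_real (g ^ 2 * real n))
            = of_real (2 ^ r * fact (r + 1) / (g ^ 2 * real n) ^ (H - r) * (2 * real (r + 2) * (g ^ 2 * real n)))"
          by (simp only: of_real_mult of_real_of_nat_eq of_real_numeral)
        then have "bs n * (complex_of_real (2 ^ r * fact (r + 1) / (g ^ 2 * real n) ^ (H - r)) * (2 * of_nat (r + 2) * of_real (g ^ 2 * real n))) = a (Suc r) n"
          unfolding eqr a_def by (rule arg_cong)
        then show ?thesis unfolding a_def by (simp only: mult.assoc)
      qed (simp add: a_def bs0)
      finally show "w * (a r n * (1 / Dn w n ^ (r + 2) - 2 * of_nat (r + 2) * w ^ 2 / Dn w n ^ Suc (r + 2))) + of_nat (2 * r + 3) * (a r n * (w / Dn w n ^ (r + 2)))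
        = a (Suc r) n * (w / Dn w n ^ (Suc r + 2))" unfolding E_def .
    qed
    finally show ?thesis using G1[of "Suc r" w] r w sums_unique2 by fastforce
  qed
  have PH: "P H x = Psi c x / Kp" if x: "x > 0" for x
  proof -
    define w where "w = complex_of_real x + \<i> * of_real c"
    have w: "Re w > 0" using x by (simp add: w_def)
    have "a H n * (w / Dn w n ^ (H + 2)) = of_real (2 ^ H * fact (H + 1)) * (bs n * (w / Dn w n ^ (h + 1)))" for n
    proof -
      have e2: "H + 2 = h + 1" using Hh by simp
      show ?thesis unfolding a_def e2 by (simp del: fact_Suc)
    qed
    then have "G H w = (\<Sum>n. of_real (2 ^ H * fact (H + 1)) * (bs n * (w / Dn w n ^ (h + 1))))"
      using G1[OF order_refl w] by (simp add: sums_iff)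
    also have "\<dots> = of_real (2 ^ H * fact (H + 1)) * (\<Sum>n. bs n * (w / Dn w n ^ (h + 1)))"
    proof (rule suminf_mult)
      have "\<exists>G G'. \<forall>w\<in>{w. Re w > 0}. (\<lambda>n. bs n * (w / (w ^ 2 + of_real (g ^ 2 * real n)) ^ (h + 1))) sums G w
     \<and> (\<lambda>n. bs n * (1 / (w ^ 2 + of_real (g ^ 2 * real n)) ^ (h + 1) - 2 * of_nat (h + 1) * w ^ 2 / (w ^ 2 + of_real (g ^ 2 * real n)) ^ Suc (h + 1))) sums G' w
     \<and> (G has_field_derivative G' w) (at w)"
        by (rule rational_series_derivative[OF g _ bs0 sbs]) auto
      then show "summable (\<lambda>n. bs n * (w / Dn w n ^ (h + 1)))" using w unfolding Dn_def by (auto simp: sums_iff)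
    qed
    also have "(\<Sum>n. bs n * (w / Dn w n ^ (h + 1))) = Psi c x / K"
      using Psi_eq(2)[OF x h, of c] K_nz unfolding Dn_def w_def by simp
    finally show ?thesis by (simp add: P_def w_def Kp_def mult.commute)
  qed
  have P0: "P 0 x = (\<Sum>n. om n (of_real x + \<i> * of_real c))" if x: "x > 0" for x
  proof -
    define w where "w = complex_of_real x + \<i> * of_real c"
    have w: "Re w > 0" using x by (simp add: w_def)
    have "a 0 n * (w / Dn w n ^ (0 + 2)) = om n w" for n
      using h by (simp add: a_def om_def Dn_def power2_eq_square)
    then show ?thesis using G1[of 0 w] w by (simp add: sums_iff P_def w_def)
  qed
  have "tame (P H)"
  proof -
    have t: "tame (\<lambda>x. Psi c x / Kp)" by (rule tame_divide[OF Psi_tame])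
    have "continuous_on {0<..} (P H)"
      by (rule continuous_on_eq[where f = "\<lambda>x. Psi c x / Kp"]) (use t PH in \<open>auto simp: tame_def\<close>)
    then show ?thesis using t PH unfolding tame_def pole_order_bound_def rapid_decay_def by simp
  qed
  moreover have "(P r has_vector_derivative P' r x) (at x)" if "r < H" "x > 0" for r x
  proof -
    have "(((\<lambda>z. G r (z + \<i> * of_real c))) has_field_derivative G' r (complex_of_real x + \<i> * of_real c)) (at (complex_of_real x))"
      using DERIV_shift[of "G r" "G' r (complex_of_real x + \<i> * of_real c)" "complex_of_real x" "\<i> * of_real c"] G3[of r "complex_of_real x + \<i> * of_real c"] that by simp
    from has_vector_derivative_real_field[OF this] show ?thesis unfolding P_def P'_def .
  qed
  moreover have "(of_real x + \<i> * of_real c) * P' r x + of_nat (2 * r + 3) * P r x = P (Suc r) x" if "r < H" "x > 0" for r x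
    unfolding P_def P'_def by (rule ode) (use that in auto)
  ultimately obtain cf R where cf: "tame (\<lambda>x. P 0 x - (\<Sum>j\<in>{Suc 0..H}. cf j / (of_real x + \<i> * of_real c) ^ (2 * j + 1)))"
     "\<And>S. Re S > R \<Longrightarrow> shift_op c (\<Prod>j\<in>{Suc 0..H}. [:2 * real j - 1, 1:])
        (\<lambda>S. mellin (\<lambda>x. P 0 x - (\<Sum>j\<in>{Suc 0..H}. cf j / (of_real x + \<i> * of_real c) ^ (2 * j + 1))) S / Gamma S) S
        = mellin (P H) S / Gamma S"
    using euler_ode_chain[OF c, of H P P' 0] by blast
  define Q where "Q x = P 0 x - (\<Sum>j\<in>{Suc 0..H}. cf j / (of_real x + \<i> * of_real c) ^ (2 * j + 1))" for x
  have Q: "Q x = residual c cf x" if "x > 0" for x using P0[OF that] by (simp add: Q_def residual_def)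
  have tQ: "tame Q" using cf(1) by (simp add: Q_def[abs_def])
  have "continuous_on {0<..} (residual c cf)"
    by (rule continuous_on_eq[where f = Q]) (use tQ Q in \<open>auto simp: tame_def\<close>)
  then have "tame (residual c cf)" using tQ Q unfolding tame_def pole_order_bound_def rapid_decay_def by simp
  moreover have "mellin Q = mellin (residual c cf)"
    unfolding mellin_def by (rule ext, rule set_lebesgue_integral_cong) (use Q in auto)
  moreover have "mellin (P H) = mellin (\<lambda>x. Psi c x / Kp)"
    unfolding mellin_def by (rule ext, rule set_lebesgue_integral_cong) (use PH in auto)
  ultimately show ?thesis using cf(2) unfolding Q_def[symmetric] by (intro exI[of _ cf] exI[of _ R]) simp
qed

lemma om_sum_chain:
  assumes c: "c > 0"
  shows "\<exists>cf R. tame (residual c cf) \<and>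
     (\<forall>S. Re S > R \<longrightarrow> shift_op c (\<Prod>j\<in>{1..H}. [:2 * real j - 1, 1:]) (\<lambda>S. mellin (residual c cf) S / Gamma S) S
        = mellin (\<lambda>x. Psi c x / Kp) S / Gamma S)"
proof (cases "h = 0")
  case True
  have HH: "{1..H} = {}" unfolding H_def using True by simp
  have Q: "residual c (\<lambda>_. 0) x = Psi c x / Kp" if "x > 0" for x
    using Psi_eq(1)[OF that True, of c] by (simp add: residual_def HH sums_iff)
  have t: "tame (\<lambda>x. Psi c x / Kp)" by (rule tame_divide[OF Psi_tame])
  have "continuous_on {0<..} (residual c (\<lambda>_. 0))"
    by (rule continuous_on_eq[where f = "\<lambda>x. Psi c x / Kp"]) (use t Q in \<open>auto simp: tame_def\<close>)
  then have "tame (residual c (\<lambda>_. 0))" using t Q unfolding tame_def pole_order_bound_def rapid_decay_def by simp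
  moreover have "mellin (residual c (\<lambda>_. 0)) = mellin (\<lambda>x. Psi c x / Kp)"
    unfolding mellin_def by (rule ext, rule set_lebesgue_integral_cong) (use Q in auto)
  ultimately show ?thesis unfolding HH by (intro exI[of _ "\<lambda>_. 0"] exI[of _ 0]) simp
next
  case False
  then show ?thesis using om_sum_chain_pos[OF _ c] by auto
qed

text \<open>Termwise Gamma integral with parameter sqrt n, whose power -S is n^(-S/2). The bound h +
  5/2 is twice the exponent of \<open>D_summable\<close>.\<close>

lemma mellin_Psi:
  assumes S: "Re S > real h + 5 / 2"
  shows "mellin (Psi c) S = Gamma S * (\<Sum>n. D n * exp (- (\<i> * of_real (c * sqrt (real n)))) * of_nat n powr (- S / 2))"
    and "summable (\<lambda>n. norm (D n * exp (- (\<i> * of_real (c * sqrt (real n)))) * of_nat n powr (- S / 2)))"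
proof -
  let ?t = "\<lambda>n. D n * exp (- (\<i> * of_real (c * sqrt (real n)))) * of_nat n powr (- S / 2)"
  have S0: "Re S > 0" using S by (rule order.strict_trans[rotated]) (simp add: add_nonneg_pos)
  have nt: "norm (?t n) = norm (D n) * real n powr (- (Re S / 2))" for n
    using norm_powr_real_powr[of "of_nat n" "- S / 2"] by (cases "n = 0") (simp_all add: D0 norm_mult)
  have sn: "summable (\<lambda>n. norm (D n) * real n powr (- (Re S / 2)))" by (rule D_summable) (use S in simp)
  then show sm: "summable (\<lambda>n. norm (?t n))" unfolding nt .
  define f where "f n x = indicat_real {0<..} x *\<^sub>R (of_real x powr (S - 1) * (D n * exp (- (of_real x + \<i> * of_real c) * of_real (sqrt (real n)))))" for n x
  have props: "integrable lborel (f n) \<and> integral\<^sup>L lborel (f n) = Gamma S * ?t n \<and> (\<integral>x. norm (f n x) \<partial>lborel) = Gamma (Re S) * norm (?t n)" for n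
  proof (cases "n = 0")
    case True
    then show ?thesis by (simp add: f_def[abs_def] D0)
  next
    case False
    then have sq: "sqrt (real n) > 0" by simp
    define k where "k = D n * exp (- (\<i> * of_real (c * sqrt (real n))))"
    define R where "R x = indicat_real {0<..} x *\<^sub>R (of_real x powr (S - 1) * exp (- of_real (sqrt (real n)) * of_real x))" for x
    have fk: "f n = (\<lambda>x. k * R x)"
      unfolding f_def R_def k_def by (rule ext) (simp add: ring_distribs exp_add exp_diff exp_minus field_simps)
    have pw: "of_real (sqrt (real n)) powr (- s) = of_nat n powr (- s / 2)" for s :: complex
    proof -
      have "complex_of_real (sqrt (real n)) powr (- s) = exp (- s * of_real (ln (real n) / 2))"
        using False by (simp add: powr_def Ln_of_real ln_sqrt)
      also have "\<dots> = of_nat n powr (- s / 2)" using False by (simp add: powr_def Ln_of_nat)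
      finally show ?thesis .
    qed
    have R1: "integrable lborel R" "integral\<^sup>L lborel R = Gamma S * of_nat n powr (- S / 2)"
      using Gamma_integral_real_scale[OF S0 sq] unfolding R_def set_integrable_def set_lebesgue_integral_def pw by auto
    have "complex_of_real (\<integral>x. norm (R x) \<partial>lborel) = (\<integral>x. complex_of_real (norm (R x)) \<partial>lborel)"
      by (rule integral_complex_of_real[symmetric])
    also have "\<dots> = (LBINT x:{0<..}. complex_of_real x powr (of_real (Re S) - 1) * exp (- of_real (sqrt (real n)) * of_real x))"
      unfolding set_lebesgue_integral_def
      by (intro Bochner_Integration.integral_cong refl)
          (auto simp: R_def indicator_def norm_mult norm_powr_real_powr powr_of_real[symmetric] exp_of_real[symmetric])
    also have "\<dots> = Gamma (of_real (Re S)) * of_nat n powr (- of_real (Re S) / 2)"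
      by (subst Gamma_integral_real_scale(2)) (use S0 sq pw in auto)
    also have "\<dots> = complex_of_real (Gamma (Re S) * real n powr (- (Re S / 2)))"
      by (simp add: Gamma_complex_of_real powr_of_real[symmetric])
    finally have R2: "(\<integral>x. norm (R x) \<partial>lborel) = Gamma (Re S) * real n powr (- (Re S / 2))"
      unfolding of_real_eq_iff .
    show ?thesis unfolding fk norm_mult[of k] integral_mult_right_zero R1(2) R2 nt
      using R1(1) by (auto simp: k_def norm_mult)
  qed
  have "(\<lambda>n. integral\<^sup>L lborel (f n)) sums (\<integral>x. (\<Sum>n. f n x) \<partial>lborel)"
  proof (rule sums_integral)
    show "integrable lborel (f n)" for n using props by blast
    show "summable (\<lambda>n. \<integral>x. norm (f n x) \<partial>lborel)" using props sm by (simp add: summable_mult)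
    show "AE x in lborel. summable (\<lambda>n. norm (f n x))"
    proof (rule AE_I2)
      fix x
      show "summable (\<lambda>n. norm (f n x))"
      proof (cases "x > 0")
        case True
        have "summable (\<lambda>n. norm (complex_of_real x powr (S - 1)) * norm (D n * exp (- (of_real x + \<i> * of_real c) * of_real (sqrt (real n)))))"
          by (intro summable_mult D_exp_bound True)
        then show ?thesis using True by (simp add: f_def norm_mult)
      qed (simp add: f_def)
    qed
  qed
  also have "(\<lambda>x. \<Sum>n. f n x) = (\<lambda>x. indicat_real {0<..} x *\<^sub>R (of_real x powr (S - 1) * Psi c x))"
  proof
    fix x
    show "(\<Sum>n. f n x) = indicat_real {0<..} x *\<^sub>R (of_real x powr (S - 1) * Psi c x)"
    proof (cases "x > 0")
      case True
      then show ?thesis unfolding Psi_def f_def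
        using suminf_mult[OF summable_norm_cancel[OF D_exp_bound(1)[OF True, of c]], of "of_real x powr (S - 1)"] by simp
    qed (simp add: f_def)
  qed
  finally have "(\<lambda>n. Gamma S * ?t n) sums mellin (Psi c) S"
    using props by (simp add: mellin_def set_lebesgue_integral_def)
  moreover have "(\<lambda>n. Gamma S * ?t n) sums (Gamma S * (\<Sum>n. ?t n))"
    by (intro sums_mult summable_sums summable_norm_cancel[OF sm])
  ultimately show "mellin (Psi c) S = Gamma S * (\<Sum>n. ?t n)" using sums_unique2 by blast
qed

end

section \<open>Analytic continuation of the twist\<close>

lemma shift_op_add_fun: "shift_op c p (\<lambda>S. G S + G' S) S = shift_op c p G S + shift_op c p G' S"
proof (induction p arbitrary: G G' S)
  case (pCons a p)
  have "mshift c (\<lambda>S. G S + G' S) = (\<lambda>S. mshift c G S + mshift c G' S)"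
    by (rule ext) (simp add: mshift_def algebra_simps)
  then show ?case by (simp add: shift_op_pCons pCons.IH algebra_simps)
qed simp

lemma shift_op_zero_fun: "shift_op c p (\<lambda>S. 0) S = 0"
proof (induction p arbitrary: S)
  case (pCons a p)
  have "mshift c (\<lambda>S. 0) = (\<lambda>S. 0)" by (rule ext) (simp add: mshift_def)
  then show ?case by (simp add: shift_op_pCons pCons.IH)
qed simp

lemma shift_op_sum_fun: "shift_op c p (\<lambda>S. \<Sum>j\<in>A. G j S) S = (\<Sum>j\<in>A. shift_op c p (G j) S)"
  by (induction A arbitrary: S rule: infinite_finite_induct) (auto simp: shift_op_zero_fun shift_op_add_fun)

lemma not_Ints_diff_nat: "S \<notin> \<int> \<Longrightarrow> S - of_nat n \<notin> \<int>" for S :: complex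
  using Ints_add[of "S - of_nat n" "of_nat n"] by auto

text \<open>The function is, up to a constant, the Mellin transform of (x + ic)^(-(2j+1)) divided by
  Gamma(S), continued beyond its strip. The factor X + 2j - 1 kills it because Gamma(2j + 2 - T) =
  (2j + 1 - T) Gamma(2j + 1 - T).\<close>

lemma shift_op_annihilates_power:
  fixes c :: real
  assumes c: "c > 0" and j: "j \<in> {1..H}" and S: "S \<notin> \<int>"
  shows "shift_op c (\<Prod>j\<in>{1..H}. [:2 * real j - 1, 1:])
     (\<lambda>S. a * ((\<i> * of_real c) powr (S - of_nat (2 * j + 1)) * Gamma (of_nat (2 * j + 1) - S) / q)) S = 0"
proof -
  define Y where "Y S = a * ((\<i> * of_real c) powr (S - of_nat (2 * j + 1)) * Gamma (of_nat (2 * j + 1) - S) / q)" for S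
  define Pr where "Pr = (\<Prod>i\<in>{1..H} - {j}. [:2 * real i - 1, 1:])"
  have pr: "(\<Prod>j\<in>{1..H}. [:2 * real j - 1, 1:]) = Pr * [:2 * real j - 1, 1:]"
    unfolding Pr_def using j by (subst prod.remove[of _ j]) (auto simp: mult.commute)
  have z: "shift_op c [:2 * real j - 1, 1:] Y T = 0" if T: "T \<notin> \<int>" for T
  proof -
    have "of_nat (2 * j + 1) - T \<notin> \<int>" using T Ints_diff[of "of_nat (2 * j + 1)" "of_nat (2 * j + 1) - T"] by auto
    then have n: "of_nat (2 * j + 1) - T \<notin> \<int>\<^sub>\<le>\<^sub>0" using nonpos_Ints_Int by blast
    have G: "Gamma (of_nat (2 * j + 1) - (T - 1)) = (of_nat (2 * j + 1) - T) * Gamma (of_nat (2 * j + 1) - T)"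
      using Gamma_plus1[OF n] by (simp add: algebra_simps)
    have P: "\<i> * of_real c * (\<i> * of_real c) powr (T - 1 - of_nat (2 * j + 1)) = (\<i> * of_real c) powr (T - of_nat (2 * j + 1))"
    proof -
      have "T - of_nat (2 * j + 1) = 1 + (T - 1 - of_nat (2 * j + 1))" by simp
      then have "(\<i> * of_real c) powr (T - of_nat (2 * j + 1)) = (\<i> * of_real c) powr 1 * (\<i> * of_real c) powr (T - 1 - of_nat (2 * j + 1))"
        by (metis powr_add)
      then show ?thesis using c by simp
    qed
    have "\<i> * of_real c * Y (T - 1) = a * ((\<i> * of_real c * (\<i> * of_real c) powr (T - 1 - of_nat (2 * j + 1))) * Gamma (of_nat (2 * j + 1) - (T - 1)) / q)"
      unfolding Y_def by simp
    also have "\<dots> = (of_nat (2 * j + 1) - T) * Y T"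
      unfolding P G Y_def by simp
    finally show ?thesis
      unfolding shift_op_linear mshift_def by (simp add: algebra_simps)
  qed
  have "shift_op c (\<Prod>j\<in>{1..H}. [:2 * real j - 1, 1:]) Y S = shift_op c Pr (shift_op c [:2 * real j - 1, 1:] Y) S"
    unfolding pr shift_op_mult ..
  also have "\<dots> = shift_op c Pr (\<lambda>_. 0) S"
    by (rule shift_op_cong) (intro z not_Ints_diff_nat S)
  finally show ?thesis unfolding Y_def shift_op_zero_fun .
qed

section \<open>Partial fractions indexed by nu\<close>

lemma summable_even_odd:
  fixes f :: "nat \<Rightarrow> real"
  assumes "\<And>k. f k \<ge> 0" and "summable (\<lambda>j. f (2 * j))" "summable (\<lambda>j. f (2 * j + 1))"
  shows "summable f"
proof (rule summableI_nonneg_bounded)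
  have s: "summable (\<lambda>j. f (2 * j) + f (2 * j + 1))" by (intro summable_add assms)
  fix n
  have "(\<Sum>k<n. f k) \<le> (\<Sum>k<n * 2. f k)" by (intro sum_mono2) (use assms in auto)
  also have "\<dots> = (\<Sum>j<n. sum f {j * 2..<j * 2 + 2})" by (rule sum.nat_group[symmetric])
  also have "\<dots> = (\<Sum>j<n. f (2 * j) + f (2 * j + 1))"
    by (intro sum.cong refl) (simp add: mult.commute numeral_2_eq_2)
  also have "\<dots> \<le> (\<Sum>j. f (2 * j) + f (2 * j + 1))" by (rule sum_le_suminf[OF s]) (use assms in auto)
  finally show "(\<Sum>k<n. f k) \<le> (\<Sum>j. f (2 * j) + f (2 * j + 1))" .
qed (use assms in auto)

lemma powr_le_of_ratio:
  fixes x y t :: real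
  assumes "y > 0" "y / 2 \<le> x" "x \<le> 2 * y"
  shows "x powr t \<le> 2 powr \<bar>t\<bar> * y powr t"
proof -
  have x: "x > 0" using assms by linarith
  have "(x / y) powr t \<le> 2 powr \<bar>t\<bar>"
  proof (cases "t \<ge> 0")
    case True
    then show ?thesis using assms x powr_mono2[of t "x / y" 2] by (simp add: field_simps)
  next
    case False
    have "(x / y) powr t \<le> (1 / 2) powr t"
      using assms x False by (intro powr_mono2') (auto simp: field_simps)
    also have "(1 / 2 :: real) powr t = 2 powr (- t)" by (simp add: powr_divide powr_minus_divide)
    finally show ?thesis using False by simp
  qed
  then have "(x / y) powr t * y powr t \<le> 2 powr \<bar>t\<bar> * y powr t" by (rule mult_right_mono) simp
  then show ?thesis using assms x by (simp add: powr_divide)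
qed

text \<open>Enumerates the \<open>\<nu>\<close> of the paper as \<open>\<surd>1, -\<surd>1, \<surd>2, -\<surd>2, \<dots>\<close>.\<close>
definition nu_enum :: "nat \<Rightarrow> real" where
  "nu_enum k = (if even k then 1 else - 1) * sqrt (real (k div 2 + 1))"

lemma abs_nu_enum: "\<bar>nu_enum k\<bar> = sqrt (real (k div 2 + 1))"
  by (simp add: nu_enum_def abs_mult)

context theta_pair
begin

text \<open>Partial fractions with beta = g sqrt n: w/(w^2 + beta^2)^2 = (i/(4 beta)) (1/(w + i
  beta)^2 - 1/(w - i beta)^2), the sign being carried by \<open>nu_enum\<close>. For h = 0, (w^2 -
  beta^2)/(w^2 + beta^2)^2 is half the sum of the two double poles.\<close>

definition Ck where "Ck k = (if h = 0 then bs (k div 2 + 1) / 2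
    else \<i> / (4 * of_real (g * nu_enum k)) * bs (k div 2 + 1) / of_real ((g ^ 2 * real (k div 2 + 1)) ^ H))"

text \<open>With w = x + ic, the number w + i g nu equals x + i delta. It meets the path of
  integration at nu = -c/g, which for c = 2 pi \<alpha> and g = 4 pi/sqrt N is minus
  \<open>nu_alpha\<close>.\<close>

definition delta where "delta c k = c + g * nu_enum k"

lemma om_pair:
  assumes w: "Re w > 0"
  shows "om (Suc j) w = Ck (2 * j) / (w + \<i> * of_real (g * nu_enum (2 * j))) ^ 2
     + Ck (2 * j + 1) / (w + \<i> * of_real (g * nu_enum (2 * j + 1))) ^ 2"
proof -
  define \<beta> where "\<beta> = g * sqrt (real (Suc j))"
  have \<beta>: "\<beta> > 0" using g by (simp add: \<beta>_def)
  define W1 W2 where "W1 = w + \<i> * of_real \<beta>" and "W2 = w - \<i> * of_real \<beta>"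
  have W: "W1 \<noteq> 0" "W2 \<noteq> 0" using w by (auto simp: W1_def W2_def complex_eq_iff)
  have e1: "g * nu_enum (2 * j) = \<beta>" "g * nu_enum (2 * j + 1) = - \<beta>"
    by (simp_all add: nu_enum_def \<beta>_def)
  have t: "of_real (g ^ 2 * real (Suc j)) = complex_of_real \<beta> ^ 2"
    by (simp add: \<beta>_def power_mult_distrib flip: of_real_power)
  have D: "w ^ 2 + of_real (g ^ 2 * real (Suc j)) = W1 * W2"
    unfolding t W1_def W2_def by (simp add: power2_eq_square algebra_simps)
  have k: "(2 * j) div 2 + 1 = Suc j" "(2 * j + 1) div 2 + 1 = Suc j" by simp_all
  have w2: "w + \<i> * of_real (- \<beta>) = W2" by (simp add: W2_def)
  show ?thesis
  proof (cases "h = 0")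
    case True
    have "w ^ 2 - of_real (g ^ 2 * real (Suc j)) = (W1 ^ 2 + W2 ^ 2) / 2"
      unfolding t W1_def W2_def by (simp add: power2_eq_square algebra_simps)
    then have "(w ^ 2 - of_real (g ^ 2 * real (Suc j))) / (W1 * W2) ^ 2 = ((W1 ^ 2 + W2 ^ 2) / 2) / (W1 * W2) ^ 2"
      by (rule arg_cong)
    also have "\<dots> = (1 / W1 ^ 2 + 1 / W2 ^ 2) / 2" using W by (simp add: field_simps)
    finally have "(w ^ 2 - of_real (g ^ 2 * real (Suc j))) / (W1 * W2) ^ 2 = (1 / W1 ^ 2 + 1 / W2 ^ 2) / 2" .
    note q = this
    have "bs (Suc j) * ((w ^ 2 - of_real (g ^ 2 * real (Suc j))) / (W1 * W2) ^ 2) = bs (Suc j) / 2 / W1 ^ 2 + bs (Suc j) / 2 / W2 ^ 2"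
      unfolding q by (simp add: algebra_simps add_divide_distrib)
    then show ?thesis using True unfolding om_def Ck_def e1 D k w2 W1_def[symmetric] by simp
  next
    case False
    have "w = \<i> / (4 * of_real \<beta>) * (W2 ^ 2 - W1 ^ 2)"
      unfolding W1_def W2_def using \<beta> by (simp add: power2_eq_square field_simps)
    then have eq: "w / (W1 * W2) ^ 2 = \<i> / (4 * of_real \<beta>) * (1 / W1 ^ 2) + \<i> / (4 * of_real (- \<beta>)) * (1 / W2 ^ 2)"
    proof -
      assume a: "w = \<i> / (4 * of_real \<beta>) * (W2 ^ 2 - W1 ^ 2)"
      have "w / (W1 * W2) ^ 2 = \<i> / (4 * of_real \<beta>) * ((W2 ^ 2 - W1 ^ 2) / (W1 * W2) ^ 2)"
        using a by (metis times_divide_eq_right)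
      also have "(W2 ^ 2 - W1 ^ 2) / (W1 * W2) ^ 2 = 1 / W1 ^ 2 - 1 / W2 ^ 2" using W by (simp add: field_simps)
      finally show ?thesis by (simp add: right_diff_distrib)
    qed
    define A where "A = bs (Suc j) / of_real ((g ^ 2 * real (Suc j)) ^ H)"
    have "om (Suc j) w = A * (w / (W1 * W2) ^ 2)" using False unfolding om_def D A_def by simp
    also have "\<dots> = (\<i> / (4 * of_real \<beta>) * A) / W1 ^ 2 + (\<i> / (4 * of_real (- \<beta>)) * A) / W2 ^ 2"
      unfolding eq by (simp add: algebra_simps)
    finally show ?thesis using False unfolding Ck_def e1 k w2 W1_def[symmetric] A_def by simp
  qed
qed

lemma norm_Ck:
  "\<exists>Z\<ge>0. \<forall>k. norm (Ck k) = Z * norm (bs (k div 2 + 1)) * real (k div 2 + 1) powr (- (if h = 0 then 0 else real H + 1 / 2))"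
proof (cases "h = 0")
  case True
  show ?thesis unfolding Ck_def using True by (intro exI[of _ "1/2"]) (simp add: norm_divide)
next
  case False
  have "norm (Ck k) = 1 / (4 * g * g ^ (2 * H)) * norm (bs (k div 2 + 1)) * real (k div 2 + 1) powr (- (real H + 1 / 2))" for k
  proof -
    define m where "m = real (k div 2 + 1)"
    have m: "m > 0" by (simp add: m_def)
    have nu: "\<bar>g * nu_enum k\<bar> = g * sqrt m" using g by (simp add: abs_mult abs_nu_enum m_def)
    have "norm (Ck k) = 1 / (4 * \<bar>g * nu_enum k\<bar>) * norm (bs (k div 2 + 1)) / (g ^ 2 * m) ^ H"
      unfolding Ck_def m_def[symmetric] using False m g
      by (simp add: norm_mult norm_divide abs_mult power_abs del: of_real_mult of_real_power)
    also have "\<dots> = 1 / (4 * g * g ^ (2 * H)) * norm (bs (k div 2 + 1)) * (1 / (m ^ H * sqrt m))"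
      unfolding nu by (simp add: power_mult_distrib power_mult)
    also have "1 / (m ^ H * sqrt m) = m powr (- (real H + 1 / 2))"
      unfolding powr_minus powr_add powr_realpow[OF m] powr_half_sqrt[OF less_imp_le[OF m]] by (rule inverse_eq_divide[symmetric])
    finally show ?thesis by (simp add: m_def)
  qed
  then show ?thesis using False g by (intro exI[of _ "1 / (4 * g * g ^ (2 * H))"]) auto
qed

lemma delta_lower: "\<bar>delta c k\<bar> \<ge> g * sqrt (real (k div 2 + 1)) - c" if "c > 0"
  using abs_triangle_ineq2[of "g * nu_enum k" "- c"] that g by (simp add: delta_def abs_mult abs_nu_enum add.commute)

lemma delta_upper: "\<bar>delta c k\<bar> \<le> g * sqrt (real (k div 2 + 1)) + c" if "c > 0"
  using abs_triangle_ineq[of "c" "g * nu_enum k"] that g by (simp add: delta_def abs_mult abs_nu_enum add.commute)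

lemma eventually_nu_large: "\<forall>\<^sub>F k in sequentially. B \<le> g * sqrt (real (k div 2 + 1))"
proof -
  have "filterlim (\<lambda>k. g * sqrt (real k / 2)) at_top sequentially" using g by real_asymp
  then have "\<forall>\<^sub>F k in sequentially. B \<le> g * sqrt (real k / 2)" by (simp add: filterlim_at_top)
  then show ?thesis
  proof eventually_elim
    case (elim k)
    have "real k / 2 \<le> real (k div 2 + 1)" by linarith
    then have "g * sqrt (real k / 2) \<le> g * sqrt (real (k div 2 + 1))" using g by (intro mult_left_mono real_sqrt_le_mono) auto
    with elim show ?case by linarith
  qed
qed

lemma finite_delta_small:
  assumes c: "c > 0" shows "finite {k. \<bar>delta c k\<bar> \<le> B}"
proof -
  obtain M where M: "\<And>k. k \<ge> M \<Longrightarrow> B + c + 1 \<le> g * sqrt (real (k div 2 + 1))"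
    using eventually_nu_large[of "B + c + 1"] by (auto simp: eventually_sequentially)
  have "{k. \<bar>delta c k\<bar> \<le> B} \<subseteq> {..<M}"
  proof
    fix k assume "k \<in> {k. \<bar>delta c k\<bar> \<le> B}"
    then show "k \<in> {..<M}" using M[of k] delta_lower[OF c, of k] by (cases "k < M") auto
  qed
  then show ?thesis by (rule finite_subset) auto
qed

text \<open>Origin of the abscissa H + 1/2: |delta| is comparable to g sqrt n for large n, so the
  terms are bounded by multiples of |bs n| n^(-\<sigma>), and \<sigma> > h/2 + 3/4 is exactly
  \<open>\<eta> < real H + 1 / 2\<close>, both for h = 0 and for h > 0.\<close>

lemma Ck_delta_summable:
  assumes c: "c > 0" and \<eta>: "\<eta> < real H + 1 / 2"
  shows "summable (\<lambda>k. norm (Ck k) * \<bar>delta c k\<bar> powr (\<eta> - 2))"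
proof -
  obtain Z where Z: "Z \<ge> 0" "\<And>k. norm (Ck k) = Z * norm (bs (k div 2 + 1)) * real (k div 2 + 1) powr (- (if h = 0 then 0 else real H + 1 / 2))"
    using norm_Ck by blast
  define e where "e = (if h = 0 then 0 else real H + 1 / 2)"
  define \<sigma> where "\<sigma> = e + 1 - \<eta> / 2"
  have \<sigma>: "\<sigma> > real h / 2 + 3 / 4"
  proof (cases "h = 0")
    case True
    have "H = 0" unfolding H_def using True by simp
    then show ?thesis using True \<eta> by (simp add: \<sigma>_def e_def)
  next
    case False
    have "real H = real h - 1" unfolding H_def using False by (simp add: of_nat_diff)
    then show ?thesis using False \<eta> by (simp add: \<sigma>_def e_def)
  qed
  define \<phi> where "\<phi> n = norm (bs n) * real n powr (- \<sigma>)" for n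
  have s\<phi>: "summable (\<lambda>j. \<phi> (Suc j))" using sbs[OF \<sigma>] by (subst summable_Suc_iff) (simp add: \<phi>_def[abs_def])
  have s: "summable (\<lambda>k. \<phi> (k div 2 + 1))"
    by (rule summable_even_odd) (use s\<phi> in \<open>simp_all add: \<phi>_def\<close>)
  show ?thesis
  proof (rule summable_comparison_test_ev[OF _ summable_mult[OF s, of "Z * 2 powr \<bar>\<eta> - 2\<bar> * g powr (\<eta> - 2)"]])
    show "\<forall>\<^sub>F k in sequentially. norm (norm (Ck k) * \<bar>delta c k\<bar> powr (\<eta> - 2)) \<le> Z * 2 powr \<bar>\<eta> - 2\<bar> * g powr (\<eta> - 2) * \<phi> (k div 2 + 1)"
      using eventually_nu_large[of "2 * c"]
    proof eventually_elim
      case (elim k)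
      define m where "m = real (k div 2 + 1)"
      have m: "m > 0" by (simp add: m_def)
      have "\<bar>delta c k\<bar> powr (\<eta> - 2) \<le> 2 powr \<bar>\<eta> - 2\<bar> * (g * sqrt m) powr (\<eta> - 2)"
      proof (rule powr_le_of_ratio)
        show "g * sqrt m > 0" using g m by simp
        have "2 * c \<le> g * sqrt m" "g * sqrt m - c \<le> \<bar>delta c k\<bar>" "\<bar>delta c k\<bar> \<le> g * sqrt m + c"
          unfolding m_def by (fact elim delta_lower[OF c] delta_upper[OF c])+
        then show "g * sqrt m / 2 \<le> \<bar>delta c k\<bar>" "\<bar>delta c k\<bar> \<le> 2 * (g * sqrt m)" using c by linarith+
      qed
      also have "(g * sqrt m) powr (\<eta> - 2) = g powr (\<eta> - 2) * m powr ((\<eta> - 2) / 2)"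
        using g m by (simp add: powr_mult powr_half_sqrt[symmetric] powr_powr)
      finally have "norm (Ck k) * \<bar>delta c k\<bar> powr (\<eta> - 2) \<le> norm (Ck k) * (2 powr \<bar>\<eta> - 2\<bar> * (g powr (\<eta> - 2) * m powr ((\<eta> - 2) / 2)))"
        by (rule mult_left_mono) simp
      also have "\<dots> = Z * 2 powr \<bar>\<eta> - 2\<bar> * g powr (\<eta> - 2) * (norm (bs (k div 2 + 1)) * (m powr (- e) * m powr ((\<eta> - 2) / 2)))"
        unfolding Z(2) e_def[symmetric] m_def[symmetric] by simp
      also have "m powr (- e) * m powr ((\<eta> - 2) / 2) = m powr (- \<sigma>)"
      proof -
        have "- e + (\<eta> - 2) / 2 = - \<sigma>" by (simp add: \<sigma>_def field_simps)
        then show ?thesis unfolding powr_add[symmetric] by (rule arg_cong)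
      qed
      finally show ?case by (simp add: \<phi>_def m_def)
    qed
  qed
qed

text \<open>Absolute convergence allows consecutive poles to be grouped in pairs; the index shift
  between the two series costs nothing because \<open>om 0\<close> vanishes.\<close>

lemma om_sum_eq_Ck_sum:
  assumes c: "c > 0" and x: "x > 0"
  shows "(\<Sum>n. om n (of_real x + \<i> * of_real c)) = (\<Sum>k. Ck k / (of_real x + \<i> * of_real (delta c k)) ^ 2)"
proof -
  define w where "w = complex_of_real x + \<i> * of_real c"
  have w: "Re w > 0" using x by (simp add: w_def)
  define T where "T k = Ck k / (of_real x + \<i> * of_real (delta c k)) ^ 2" for k
  have T: "T k = Ck k / (w + \<i> * of_real (g * nu_enum k)) ^ 2" for k
    by (simp add: T_def w_def delta_def algebra_simps)
  have "summable (\<lambda>k. norm (T k))"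
  proof (rule summable_comparison_test_ev[OF _ Ck_delta_summable[OF c, of 0]])
    show "\<forall>\<^sub>F k in sequentially. norm (norm (T k)) \<le> norm (Ck k) * \<bar>delta c k\<bar> powr (0 - 2)"
      using eventually_nu_large[of "2 * c"]
    proof eventually_elim
      case (elim k)
      then have "delta c k \<noteq> 0" using delta_lower[OF c, of k] c by auto
      from norm_inverse_square_interpolate[OF x this, of 0] x
      have "norm (Ck k) * norm (1 / (complex_of_real x + \<i> * of_real (delta c k)) ^ 2) \<le> norm (Ck k) * \<bar>delta c k\<bar> powr (0 - 2)"
        by (intro mult_left_mono) auto
      then show ?case by (simp add: T_def norm_divide)
    qed
  qed simp
  then have "T sums (\<Sum>k. T k)" by (rule summable_sums[OF summable_norm_cancel])
  from sums_group[OF this pos2] have "(\<lambda>j. sum T {j * 2..<j * 2 + 2}) sums (\<Sum>k. T k)" .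
  also have "(\<lambda>j. sum T {j * 2..<j * 2 + 2}) = (\<lambda>j. om (Suc j) w)"
  proof
    fix j
    have "sum T {j * 2..<j * 2 + 2} = T (j * 2) + T (Suc (j * 2))"
      by (simp only: add_2_eq_Suc' sum.op_ivl_Suc) simp
    then have "sum T {j * 2..<j * 2 + 2} = T (2 * j) + T (2 * j + 1)" by (simp only: mult.commute[of j 2] Suc_eq_plus1)
    then show "sum T {j * 2..<j * 2 + 2} = om (Suc j) w" unfolding om_pair[OF w] T .
  qed
  finally have "(\<lambda>n. om n w) sums (\<Sum>k. T k)" by (subst (asm) sums_Suc_iff) (simp add: om_0)
  then show ?thesis by (simp add: sums_iff w_def T_def)
qed

text \<open>The operator \<open>Pr\<close> is applied to E(S) Gamma(2 - S) in two ways. Expanded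
  into rising factorials it gives the sum with the a_l; applied to the Mellin representation it
  annihilates the kernel terms and turns the residual into \<open>Psi\<close>.\<close>

theorem twist_continuation:
  assumes c: "c > 0"
  shows "\<exists>E R. E holomorphic_on UNIV
     \<and> (\<forall>S. Re S < real H + 1 / 2 \<longrightarrow> (\<lambda>k. (if delta c k = 0 then 0 else Ck k) * (\<i> * of_real (delta c k)) powr (S - 2)) sums E S)
     \<and> (\<forall>S. Re S > R \<longrightarrow> S \<notin> \<int> \<longrightarrow>
          Kp * (\<Sum>l\<le>H. of_real (a_coeff H l) * (iterated_difference c E (H - l) S * Gamma (2 + of_nat (H - l) - S)))
            = (\<Sum>n. D n * exp (- (\<i> * of_real (c * sqrt (real n)))) * of_nat n powr (- S / 2)))"
proof -
  obtain cf R where cf: "tame (residual c cf)"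
     "\<And>S. Re S > R \<Longrightarrow> shift_op c (\<Prod>j\<in>{1..H}. [:2 * real j - 1, 1:]) (\<lambda>S. mellin (residual c cf) S / Gamma S) S
        = mellin (\<lambda>x. Psi c x / Kp) S / Gamma S"
    using om_sum_chain[OF c] by blast
  \<comment> \<open>The kernel exponents p = 2j + 1; halving p - 1 in \<open>cf'\<close> recovers
    j.\<close>
  define J where "J = (\<lambda>j::nat. 2 * j + 1) ` {1..H}"
  define cf' where "cf' p = cf ((p - 1) div 2)" for p :: nat
  have Jsum: "(\<Sum>p\<in>J. F (cf' p) p) = (\<Sum>j\<in>{1..H}. F (cf j) (2 * j + 1))" for F :: "complex \<Rightarrow> nat \<Rightarrow> complex"
    unfolding J_def by (subst sum.reindex) (auto simp: inj_on_def cf'_def)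
  define d where "d = Min (insert 1 ((\<lambda>k. \<bar>delta c k\<bar>) ` {k. delta c k \<noteq> 0 \<and> \<bar>delta c k\<bar> \<le> 1}))"
  have fin: "finite ((\<lambda>k. \<bar>delta c k\<bar>) ` {k. delta c k \<noteq> 0 \<and> \<bar>delta c k\<bar> \<le> 1})"
    by (intro finite_imageI finite_subset[OF _ finite_delta_small[OF c, of 1]]) auto
  interpret Q: quadratic_pole_series Ck "delta c" c "real H + 1 / 2" d J cf' "residual c cf"
  proof
    show "c > 0" "real H + 1 / 2 > 0" using c by auto
    show "d > 0" unfolding d_def using fin by (subst Min_gr_iff) auto
    show "d \<le> \<bar>delta c k\<bar>" if "delta c k \<noteq> 0" for k
    proof (cases "\<bar>delta c k\<bar> \<le> 1")
      case True
      then show ?thesis unfolding d_def using fin that by (intro Min_le) auto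
    next
      case False
      moreover have "d \<le> 1" unfolding d_def using fin by (intro Min_le) auto
      ultimately show ?thesis by simp
    qed
    show "finite {k. delta c k = 0}" by (rule finite_subset[OF _ finite_delta_small[OF c, of 1]]) auto
    show "summable (\<lambda>k. norm (Ck k) * \<bar>delta c k\<bar> powr (\<eta> - 2))" if "\<eta> < real H + 1 / 2" for \<eta>
      by (rule Ck_delta_summable[OF c that])
    show "finite J" "\<And>p. p \<in> J \<Longrightarrow> p \<ge> 2" by (auto simp: J_def)
    show "continuous_on {0<..} (residual c cf)" "rapid_decay (residual c cf)" using cf(1) by (auto simp: tame_def)
    fix x :: real assume x: "x > 0"
    show "residual c cf x = (\<Sum>k. Ck k / (of_real x + \<i> * of_real (delta c k)) ^ 2) - (\<Sum>p\<in>J. cf' p / (of_real x + \<i> * of_real c) ^ p)"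
      unfolding residual_def om_sum_eq_Ck_sum[OF c x] Jsum[of "\<lambda>a p. a / (of_real x + \<i> * of_real c) ^ p"] ..
  qed
  obtain E where E: "E holomorphic_on UNIV"
     "\<And>S. Re S < real H + 1 / 2 \<Longrightarrow> (\<lambda>k. (if delta c k = 0 then 0 else Ck k) * (\<i> * of_real (delta c k)) powr (S - 2)) sums E S"
     "\<And>S. Re S > 2 \<Longrightarrow> S \<notin> \<int> \<Longrightarrow> E S * Gamma (2 - S) = mellin (residual c cf) S / Gamma S
          + (\<Sum>p\<in>J. cf' p * ((\<i> * of_real c) powr (S - of_nat p) * Gamma (of_nat p - S) / Gamma (of_nat p)))"
    using Q.entire_extension by blast
  define Pr where "Pr = (\<Prod>j\<in>{1..H}. [:2 * real j - 1, 1:])"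
  \<comment> \<open>Three demands: the Euler chain, convergence of the transform of
    \<open>Psi\<close>, and the formula for E on Re S > 2, which is used at all points down to S -
    degree.\<close>
  define R' where "R' = max (max R (real h + 5 / 2)) (2 + real (degree Pr))"
  have "Kp * (\<Sum>l\<le>H. of_real (a_coeff H l) * (iterated_difference c E (H - l) S * Gamma (2 + of_nat (H - l) - S)))
            = (\<Sum>n. D n * exp (- (\<i> * of_real (c * sqrt (real n)))) * of_nat n powr (- S / 2))"
    if S: "Re S > R'" "S \<notin> \<int>" for S
  proof -
    have "(\<Sum>l\<le>H. of_real (a_coeff H l) * (iterated_difference c E (H - l) S * Gamma (2 + of_nat (H - l) - S)))
       = shift_op c Pr (\<lambda>S. E S * Gamma (2 - S)) S"
      unfolding Pr_def a_coeff_identity shift_op_sum shift_op_smult shift_op_rising_Gamma[OF S(2)] ..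
    also have "\<dots> = shift_op c Pr (\<lambda>S. mellin (residual c cf) S / Gamma S
          + (\<Sum>p\<in>J. cf' p * ((\<i> * of_real c) powr (S - of_nat p) * Gamma (of_nat p - S) / Gamma (of_nat p)))) S"
      by (rule shift_op_cong, rule E(3)) (use S in \<open>auto simp: R'_def intro: not_Ints_diff_nat\<close>)
    also have "\<dots> = shift_op c Pr (\<lambda>S. mellin (residual c cf) S / Gamma S) S
          + (\<Sum>j\<in>{1..H}. shift_op c Pr (\<lambda>S. cf j * ((\<i> * of_real c) powr (S - of_nat (2 * j + 1)) * Gamma (of_nat (2 * j + 1) - S) / Gamma (of_nat (2 * j + 1)))) S)"
      unfolding shift_op_add_fun Jsum[of "\<lambda>a p. a * ((\<i> * of_real c) powr (_ - of_nat p) * Gamma (of_nat p - _) / Gamma (of_nat p))"] shift_op_sum_fun ..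
    also have "(\<Sum>j\<in>{1..H}. shift_op c Pr (\<lambda>S. cf j * ((\<i> * of_real c) powr (S - of_nat (2 * j + 1)) * Gamma (of_nat (2 * j + 1) - S) / Gamma (of_nat (2 * j + 1)))) S) = 0"
      unfolding Pr_def by (intro sum.neutral ballI shift_op_annihilates_power c S)
    also have "shift_op c Pr (\<lambda>S. mellin (residual c cf) S / Gamma S) S + 0 = mellin (Psi c) S / Kp / Gamma S"
      unfolding Pr_def using cf(2)[of S] S(1) by (simp add: R'_def mellin_divide)
    finally have "Kp * (\<Sum>l\<le>H. of_real (a_coeff H l) * (iterated_difference c E (H - l) S * Gamma (2 + of_nat (H - l) - S))) = mellin (Psi c) S / Gamma S"
      using Kp_nz by simp
    moreover have "Gamma S \<noteq> 0" using S(2) nonpos_Ints_Int by (auto simp: Gamma_eq_zero_iff)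
    ultimately show ?thesis using mellin_Psi(1)[of S c] S(1) by (simp add: R'_def)
  qed
  then show ?thesis using E(1,2) by (intro exI[of _ E] exI[of _ R']) auto
qed

end

section \<open>The identity in the variable s\<close>

lemma iterated_difference_holomorphic:
  assumes "E holomorphic_on UNIV"
  shows "iterated_difference c E r holomorphic_on UNIV"
proof (induction r)
  case 0
  then show ?case using assms by simp
next
  case (Suc r)
  have "(iterated_difference c E r \<circ> (\<lambda>S. S - 1)) holomorphic_on UNIV"
    by (rule holomorphic_on_compose_gen[where t = UNIV]) (auto intro!: holomorphic_intros Suc)
  then show ?case
    using Suc by (auto intro!: holomorphic_intros simp: o_def)
qed

lemma holomorphic_on_dirichlet_series:
  fixes a :: "nat \<Rightarrow> complex"
  assumes a0: "a 0 = 0" and s: "\<And>\<sigma>. \<sigma> > \<sigma>0 \<Longrightarrow> summable (\<lambda>n. norm (a n) * real n powr (- \<sigma>))"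
  shows "(\<lambda>s. \<Sum>n. a n * of_nat n powr (- s)) holomorphic_on {s. Re s > \<sigma>0}"
    and "\<And>s. Re s > \<sigma>0 \<Longrightarrow> summable (\<lambda>n. norm (a n * of_nat n powr (- s)))"
proof -
  have nt: "norm (a n * of_nat n powr (- s)) = norm (a n) * real n powr (- Re s)" for n s
    using norm_powr_real_powr[of "of_nat n" "- s"] by (cases "n = 0") (simp_all add: a0 norm_mult)
  show "summable (\<lambda>n. norm (a n * of_nat n powr (- s)))" if "Re s > \<sigma>0" for s
    unfolding nt by (rule s[OF that])
  have op: "open {s. Re s > \<sigma>0}" by (rule open_halfspace_Re_gt)
  let ?f = "\<lambda>n s. a n * of_nat n powr (- s)"
  obtain G where G: "\<forall>s\<in>{s. Re s > \<sigma>0}. (\<lambda>n. ?f n s) sums G s \<and> G field_differentiable (at s)"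
  proof (rule series_differentiable_comparison_complex[OF op, of ?f])
    show "?f n field_differentiable at s" for n s
      by (cases "n = 0") (auto simp: a0 intro!: holomorphic_on_imp_differentiable_at[of _ UNIV] holomorphic_intros)
  next
    fix s0 assume s0: "s0 \<in> {s. Re s > \<sigma>0}"
    define r where "r = (Re s0 - \<sigma>0) / 2"
    have r: "r > 0" "Re s0 - r > \<sigma>0" using s0 by (auto simp: r_def field_simps)
    show "\<exists>d (h :: nat \<Rightarrow> complex). 0 < d \<and> summable h \<and> range h \<subseteq> \<real>\<^sub>\<ge>\<^sub>0 \<and> (\<forall>\<^sub>F n in sequentially. \<forall>y\<in>ball s0 d \<inter> {s. Re s > \<sigma>0}. norm (?f n y) \<le> norm (h n))"
    proof (intro exI[of _ r] exI[of _ "\<lambda>n. complex_of_real (norm (a n) * real n powr (- (Re s0 - r)))"] conjI)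
      show "summable (\<lambda>n. complex_of_real (norm (a n) * real n powr (- (Re s0 - r))))"
        by (intro summable_of_real s r)
      show "\<forall>\<^sub>F n in sequentially. \<forall>y\<in>ball s0 r \<inter> {s. Re s > \<sigma>0}. norm (?f n y) \<le> norm (complex_of_real (norm (a n) * real n powr (- (Re s0 - r))))"
        using eventually_ge_at_top[of "1::nat"]
      proof (eventually_elim, intro ballI)
        fix n y assume n: "(n::nat) \<ge> 1" and y: "y \<in> ball s0 r \<inter> {s. Re s > \<sigma>0}"
        have "norm (y - s0) < r" using y by (simp add: dist_norm norm_minus_commute)
        then have "Re y \<ge> Re s0 - r" using abs_Re_le_cmod[of "y - s0"] by auto
        then have "real n powr (- Re y) \<le> real n powr (- (Re s0 - r))" using n by (intro powr_mono) auto
        then show "norm (?f n y) \<le> norm (complex_of_real (norm (a n) * real n powr (- (Re s0 - r))))"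
          unfolding nt norm_of_real by (simp add: abs_mult mult_left_mono)
      qed
    qed (use r in auto)
  qed auto
  have eq: "G s = (\<Sum>n. ?f n s)" if "s \<in> {s. Re s > \<sigma>0}" for s
    using G that sums_unique by blast
  have "G holomorphic_on {s. Re s > \<sigma>0}"
    using G by (auto simp: holomorphic_on_def intro: field_differentiable_at_within)
  then show "(\<lambda>s. \<Sum>n. ?f n s) holomorphic_on {s. Re s > \<sigma>0}"
    by (rule holomorphic_transform) (rule eq)
qed

context theta_pair
begin

text \<open>Chosen so that D(n) n^(-S/2) is b(n) n^(-(kappa-1)/2) n^(-s), for h = 0 as well because
  of the extra sqrt n. At 1 - s with Re s > 1 the real part is below H + 1/2, the region of
  convergence of the dual series.\<close>

definition Sarg where "Sarg s = 2 * s + of_nat H + 1 / 2" for s :: complex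

definition twist_series where
  "twist_series c s = (\<Sum>n. D n * exp (- (\<i> * of_real (c * sqrt (real n)))) * of_nat n powr (- Sarg s / 2))"

text \<open>Without the loss of \<open>D_summable\<close>, so that the twist converges absolutely in
  the full half-plane Re s > 1.\<close>

lemma D_summable_sharp:
  assumes "\<sigma> > 1"
  shows "summable (\<lambda>n. norm (D n) * real n powr (- (\<sigma> + real H / 2 + 1 / 4)))"
proof -
  define e where "e = (if h = 0 then \<sigma> - 1 / 4 else \<sigma> + real H / 2 + 1 / 4)"
  have e: "e > real h / 2 + 3 / 4"
  proof (cases "h = 0")
    case True then show ?thesis using assms by (simp add: e_def)
  next
    case False
    then have "real H = real h - 1" unfolding H_def by (simp add: of_nat_diff)
    then show ?thesis using assms False by (simp add: e_def field_simps)
  qed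
  have "norm (D n) * real n powr (- (\<sigma> + real H / 2 + 1 / 4)) = norm (b n) * real n powr (- e)" for n
  proof (cases "h = 0 \<and> n > 0")
    case True
    then have "H = 0" unfolding H_def by simp
    moreover have "sqrt (real n) * real n powr (- (\<sigma> + 1 / 4)) = real n powr (- (\<sigma> - 1 / 4))"
      using True powr_add[of "real n" "1 / 2" "- (\<sigma> + 1 / 4)"] by (simp add: powr_half_sqrt)
    ultimately show ?thesis unfolding D_def e_def using True by (simp add: norm_mult mult.assoc)
  next
    case False
    then show ?thesis by (cases "n = 0") (auto simp: D_def e_def b0)
  qed
  then show ?thesis using sb[OF e] by simp
qed

lemma twist_series_props:
  shows "twist_series c holomorphic_on {s. Re s > 1}"
    and "\<And>s. Re s > 1 \<Longrightarrow> summable (\<lambda>n. norm (D n * exp (- (\<i> * of_real (c * sqrt (real n)))) * of_nat n powr (- Sarg s / 2)))"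
proof -
  define t where "t = complex_of_real (real H / 2 + 1 / 4)"
  define a where "a n = D n * exp (- (\<i> * of_real (c * sqrt (real n)))) * of_nat n powr (- t)" for n
  have a: "D n * exp (- (\<i> * of_real (c * sqrt (real n)))) * of_nat n powr (- Sarg s / 2) = a n * of_nat n powr (- s)" for n s
  proof -
    have "- Sarg s / 2 = - t + - s" by (simp add: Sarg_def t_def add_divide_distrib)
    then have "complex_of_nat n powr (- Sarg s / 2) = of_nat n powr (- t) * of_nat n powr (- s)"
      by (simp only: powr_add)
    then show ?thesis unfolding a_def by simp
  qed
  have a0: "a 0 = 0" by (simp add: a_def D0)
  have sa: "summable (\<lambda>n. norm (a n) * real n powr (- \<sigma>))" if "\<sigma> > 1" for \<sigma>
  proof -
    have "norm (a n) * real n powr (- \<sigma>) = norm (D n) * real n powr (- (\<sigma> + real H / 2 + 1 / 4))" for n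
    proof (cases "n = 0")
      case False
      have "norm (a n) = norm (D n) * real n powr (- (real H / 2 + 1 / 4))"
        using norm_powr_real_powr[of "of_nat n" "- t"] by (simp add: a_def norm_mult t_def)
      moreover have "real n powr (- (real H / 2 + 1 / 4)) * real n powr (- \<sigma>) = real n powr (- (\<sigma> + real H / 2 + 1 / 4))"
        by (simp add: powr_add[symmetric] algebra_simps)
      ultimately show ?thesis by simp
    qed (simp add: a0 D0)
    then show ?thesis using D_summable_sharp[OF that] by simp
  qed
  show "twist_series c holomorphic_on {s. Re s > 1}"
    unfolding twist_series_def[abs_def] a
    by (rule holomorphic_on_dirichlet_series(1)[where a = a, OF a0]) (rule sa)
  show "summable (\<lambda>n. norm (D n * exp (- (\<i> * of_real (c * sqrt (real n)))) * of_nat n powr (- Sarg s / 2)))" if "Re s > 1" for s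
    unfolding a by (rule holomorphic_on_dirichlet_series(2)[where a = a and ?\<sigma>0.0 = 1, OF a0 _ that]) (rule sa)
qed

lemma iterated_difference_sums:
  assumes c: "c > 0"
    and E: "\<And>S. Re S < t \<Longrightarrow> (\<lambda>k. (if delta c k = 0 then 0 else Ck k) * (\<i> * of_real (delta c k)) powr (S - 2)) sums E S"
    and S: "Re S < t"
  shows "(\<lambda>k. (if delta c k = 0 then 0 else Ck k) * (\<i> * of_real (g * nu_enum k)) ^ r * (\<i> * of_real (delta c k)) powr (S - 2 - of_nat r))
     sums iterated_difference c E r S"
  using S
proof (induction r arbitrary: S)
  case 0
  then show ?case using E[of S] by simp
next
  case (Suc r)
  let ?f = "\<lambda>r S k. (if delta c k = 0 then 0 else Ck k) * (\<i> * of_real (g * nu_enum k)) ^ r * (\<i> * of_real (delta c k)) powr (S - 2 - of_nat r)"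
  have "(\<lambda>k. ?f r S k - \<i> * of_real c * ?f r (S - 1) k) sums (iterated_difference c E r S - \<i> * of_real c * iterated_difference c E r (S - 1))"
    by (intro sums_diff sums_mult Suc.IH) (use Suc.prems in auto)
  also have "(\<lambda>k. ?f r S k - \<i> * of_real c * ?f r (S - 1) k) = ?f (Suc r) S"
  proof
    fix k
    show "?f r S k - \<i> * of_real c * ?f r (S - 1) k = ?f (Suc r) S k"
    proof (cases "delta c k = 0")
      case False
      define z where "z = \<i> * complex_of_real (delta c k)"
      have z: "z \<noteq> 0" using False by (simp add: z_def)
      have 1: "z powr (S - 2 - of_nat r) = z * z powr (S - 2 - of_nat (Suc r))"
      proof -
        have "S - 2 - of_nat r = 1 + (S - 2 - of_nat (Suc r))" by simp
        then have "z powr (S - 2 - of_nat r) = z powr 1 * z powr (S - 2 - of_nat (Suc r))" by (metis powr_add)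
        then show ?thesis using z by simp
      qed
      have 2: "S - 1 - 2 - of_nat r = S - 2 - of_nat (Suc r)" by simp
      have 3: "z - \<i> * of_real c = \<i> * of_real (g * nu_enum k)" by (simp add: z_def delta_def algebra_simps)
      have "?f r S k - \<i> * of_real c * ?f r (S - 1) k = Ck k * (\<i> * of_real (g * nu_enum k)) ^ r * z powr (S - 2 - of_nat (Suc r)) * (z - \<i> * of_real c)"
        using False unfolding z_def[symmetric] 1 2 by (simp add: algebra_simps)
      then show ?thesis using False unfolding 3 z_def[symmetric] by (simp add: mult_ac)
    qed simp
  qed
  finally show ?case by simp
qed

text \<open>Multiplication by rGamma(2 - S) replaces the Gamma factors by Pochhammer polynomials.
  Both sides are then holomorphic on Re s > 1, and it suffices to compare them far to the right with
  Im s > 0, where S is never an integer.\<close>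

theorem twist_identity:
  assumes c: "c > 0"
  shows "\<exists>E. E holomorphic_on UNIV
     \<and> (\<forall>r S. Re S < real H + 1 / 2 \<longrightarrow> (\<lambda>k. (if delta c k = 0 then 0 else Ck k) * (\<i> * of_real (g * nu_enum k)) ^ r
            * (\<i> * of_real (delta c k)) powr (S - 2 - of_nat r)) sums iterated_difference c E r S)
     \<and> (\<forall>s. Re s > 1 \<longrightarrow> twist_series c s * rGamma (2 - Sarg s) =
           Kp * (\<Sum>l\<le>H. of_real (a_coeff H l) * (iterated_difference c E (H - l) (Sarg s) * pochhammer (2 - Sarg s) (H - l))))"
proof -
  obtain E R where E: "E holomorphic_on UNIV"
     "\<And>S. Re S < real H + 1 / 2 \<Longrightarrow> (\<lambda>k. (if delta c k = 0 then 0 else Ck k) * (\<i> * of_real (delta c k)) powr (S - 2)) sums E S"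
     "\<And>S. Re S > R \<Longrightarrow> S \<notin> \<int> \<Longrightarrow>
          Kp * (\<Sum>l\<le>H. of_real (a_coeff H l) * (iterated_difference c E (H - l) S * Gamma (2 + of_nat (H - l) - S)))
            = (\<Sum>n. D n * exp (- (\<i> * of_real (c * sqrt (real n)))) * of_nat n powr (- S / 2))"
    using twist_continuation[OF c] by blast
  define R1 where "R1 = max 1 R"
  let ?L = "\<lambda>s. twist_series c s * rGamma (2 - Sarg s)"
  let ?Rh = "\<lambda>s. Kp * (\<Sum>l\<le>H. of_real (a_coeff H l) * (iterated_difference c E (H - l) (Sarg s) * pochhammer (2 - Sarg s) (H - l)))"
  have U: "?L s = ?Rh s" if s: "Re s > R1" "Im s > 0" for s
  proof -
    have S: "Sarg s \<notin> \<int>" using s by (auto simp: Sarg_def complex_is_Int_iff)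
    have "2 - Sarg s \<notin> \<int>" using S Ints_diff[of 2 "2 - Sarg s"] by auto
    then have n: "2 - Sarg s \<notin> \<int>\<^sub>\<le>\<^sub>0" using nonpos_Ints_Int by blast
    have R: "Re (Sarg s) > R" using s by (simp add: Sarg_def R1_def)
    have P: "pochhammer (2 - Sarg s) m = rGamma (2 - Sarg s) * Gamma (2 + of_nat m - Sarg s)" for m
      by (simp add: pochhammer_Gamma[OF n] rGamma_inverse_Gamma divide_inverse algebra_simps)
    have "?L s = rGamma (2 - Sarg s) * (Kp * (\<Sum>l\<le>H. of_real (a_coeff H l) * (iterated_difference c E (H - l) (Sarg s) * Gamma (2 + of_nat (H - l) - Sarg s))))"
      unfolding E(3)[OF R S] twist_series_def by (rule mult.commute)
    also have "\<dots> = ?Rh s" unfolding P by (simp add: sum_distrib_left mult_ac)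
    finally show ?thesis .
  qed
  have "?L s = ?Rh s" if "Re s > 1" for s
  proof (rule analytic_continuation_open[where f = ?L and g = ?Rh and s = "{s. Re s > R1} \<inter> {s. Im s > 0}" and s' = "{s. Re s > 1}"])
    show "open ({s. Re s > R1} \<inter> {s. Im s > 0})" "open {s. Re s > 1}"
      by (intro open_Int open_halfspace_Re_gt open_halfspace_Im_gt)+
    have "Complex (R1 + 1) 1 \<in> {s. Re s > R1} \<inter> {s. Im s > 0}" by simp
    then show "{s. Re s > R1} \<inter> {s. Im s > 0} \<noteq> {}" by blast
    show "connected {s. Re s > 1}" by (intro convex_connected convex_halfspace_Re_gt)
    show "?L holomorphic_on {s. Re s > 1}" unfolding Sarg_def
      by (intro holomorphic_intros twist_series_props(1))
    have "(iterated_difference c E m \<circ> Sarg) holomorphic_on {s. Re s > 1}" for m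
      unfolding Sarg_def
      by (rule holomorphic_on_compose_gen[OF _ iterated_difference_holomorphic[OF E(1)]]) (auto intro!: holomorphic_intros)
    then have it: "(\<lambda>s. iterated_difference c E m (Sarg s)) holomorphic_on {s. Re s > 1}" for m by (simp add: o_def)
    show "?Rh holomorphic_on {s. Re s > 1}"
      unfolding pochhammer_prod by (intro holomorphic_intros it) (auto simp: Sarg_def intro!: holomorphic_intros)
    show "{s. Re s > R1} \<inter> {s. Im s > 0} \<subseteq> {s. Re s > 1}" by (auto simp: R1_def)
  qed (use U that in auto)
  moreover have "\<forall>r S. Re S < real H + 1 / 2 \<longrightarrow> (\<lambda>k. (if delta c k = 0 then 0 else Ck k) * (\<i> * of_real (g * nu_enum k)) ^ r
            * (\<i> * of_real (delta c k)) powr (S - 2 - of_nat r)) sums iterated_difference c E r S"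
    using iterated_difference_sums[OF c E(2)] by blast
  ultimately show ?thesis using E(1) by blast
qed

end

text \<open>The sums in \<open>F_plus\<close> and \<open>F_minus\<close> are unconditional, so
  convergence along the enumeration is not enough. The recursion of
  \<open>iterated_difference_sums\<close> is repeated with the triangle inequality.\<close>

lemma (in theta_pair) iterated_terms_abs_summable:
  assumes c: "c > 0" and S: "Re S < real H + 1 / 2"
  shows "summable (\<lambda>k. norm ((if delta c k = 0 then 0 else Ck k) * (\<i> * of_real (g * nu_enum k)) ^ r * (\<i> * of_real (delta c k)) powr (S - 2 - of_nat r)))"
  using S
proof (induction r arbitrary: S)
  case 0
  define bb where "bb k = (if delta c k = 0 then 0 else Ck k)" for k
  have "summable (\<lambda>k. norm (bb k * (\<i> * of_real (delta c k)) powr (S - 2)))"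
  proof (rule holomorphic_on_imaginary_series(2)[where ?\<eta>0.0 = "real H + 1 / 2"])
    show "bb k \<noteq> 0 \<Longrightarrow> delta c k \<noteq> 0" for k by (auto simp: bb_def split: if_splits)
    show "summable (\<lambda>k. norm (bb k) * \<bar>delta c k\<bar> powr (\<eta> - 2))" if "\<eta> < real H + 1 / 2" for \<eta>
      by (rule summable_comparison_test'[OF Ck_delta_summable[OF c that]]) (auto simp: bb_def)
  qed (use 0 in auto)
  then show ?case by (simp add: bb_def)
next
  case (Suc r)
  let ?f = "\<lambda>r S k. (if delta c k = 0 then 0 else Ck k) * (\<i> * of_real (g * nu_enum k)) ^ r * (\<i> * of_real (delta c k)) powr (S - 2 - of_nat r)"
  have 1: "summable (\<lambda>k. norm (?f r S k) + norm (\<i> * of_real c * ?f r (S - 1) k))"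
    unfolding norm_mult[of "\<i> * of_real c"]
    by (intro summable_add summable_mult Suc.IH) (use Suc.prems in auto)
  have eq: "?f (Suc r) S k = ?f r S k - \<i> * of_real c * ?f r (S - 1) k" for k
  proof (cases "delta c k = 0")
    case False
    define z where "z = \<i> * complex_of_real (delta c k)"
    have z: "z \<noteq> 0" using False by (simp add: z_def)
    have 1: "z powr (S - 2 - of_nat r) = z * z powr (S - 2 - of_nat (Suc r))"
    proof -
      have "S - 2 - of_nat r = 1 + (S - 2 - of_nat (Suc r))" by simp
      then have "z powr (S - 2 - of_nat r) = z powr 1 * z powr (S - 2 - of_nat (Suc r))" by (metis powr_add)
      then show ?thesis using z by simp
    qed
    have 2: "S - 1 - 2 - of_nat r = S - 2 - of_nat (Suc r)" by simp
    have 3: "z - \<i> * of_real c = \<i> * of_real (g * nu_enum k)" by (simp add: z_def delta_def algebra_simps)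
    have "?f r S k - \<i> * of_real c * ?f r (S - 1) k = Ck k * (\<i> * of_real (g * nu_enum k)) ^ r * z powr (S - 2 - of_nat (Suc r)) * (z - \<i> * of_real c)"
      using False unfolding z_def[symmetric] 1 2 by (simp add: algebra_simps)
    then show ?thesis using False unfolding 3 z_def[symmetric] by (simp add: mult_ac)
  qed simp
  show ?case
    by (rule summable_comparison_test'[OF 1]) (subst eq, simp only: real_norm_def abs_norm_cancel, rule norm_triangle_ineq4)
qed

section \<open>Matching phases and constants\<close>

lemma imaginary_unit_power_exp:
  shows "\<i> ^ m = exp (\<i> * of_real (pi * (real m / 2)))"
    and "(- \<i>) ^ m = exp (\<i> * of_real (- (pi * (real m / 2))))"
proof -
  have 1: "\<i> = exp (\<i> * of_real (pi / 2))" by (simp add: exp_eq_polar cis_pi_half)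
  have 2: "- \<i> = exp (- (\<i> * of_real (pi / 2)))" unfolding exp_minus 1[symmetric] by simp
  show "\<i> ^ m = exp (\<i> * of_real (pi * (real m / 2)))"
    by (subst 1) (simp add: exp_of_nat_mult[symmetric] mult_ac)
  show "(- \<i>) ^ m = exp (\<i> * of_real (- (pi * (real m / 2))))"
    by (subst 2) (simp add: exp_of_nat_mult[symmetric] mult_ac)
qed

text \<open>The three cases of \<open>c_star\<close>: nu > 0; nu < 0 with nu + nu_alpha > 0; both
  negative. The power of i or -i carries the sign of nu, the exponential is the phase of the power
  of i delta, and the last factor i clears the 1/i in front of the functional equation.\<close>

lemma phase_identities:
  assumes "l \<le> h"
  shows "\<i> ^ (h - l) * exp (\<i> * of_real (pi / 2 * (real l + 1 / 2))) * \<i> = - exp (\<i> * of_real (pi * mu h))"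
    and "(- \<i>) ^ (h - l) * exp (\<i> * of_real (pi / 2 * (real l + 1 / 2))) * \<i> = exp (\<i> * of_real (pi * (1 / 2 + real l - mu h)))"
    and "(- \<i>) ^ (h - l) * exp (\<i> * of_real (- (pi / 2 * (real l + 1 / 2)))) * \<i> = exp (- \<i> * of_real (pi * mu h))"
proof -
  have i: "\<i> = exp (\<i> * of_real (pi / 2))" by (simp add: exp_eq_polar cis_pi_half)
  have m: "-1 = exp (\<i> * of_real pi)" by (simp add: exp_eq_polar)
  have c: "exp (\<i> * of_real a) * exp (\<i> * of_real b) = exp (\<i> * of_real (a + b))" for a b
    by (simp add: exp_add[symmetric] ring_distribs)
  have hl: "real (h - l) = real h - real l" using assms by (simp add: of_nat_diff)
  have "\<i> ^ (h - l) * exp (\<i> * of_real (pi / 2 * (real l + 1 / 2))) * exp (\<i> * of_real (pi / 2)) = exp (\<i> * of_real pi) * exp (\<i> * of_real (pi * mu h))"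
    unfolding imaginary_unit_power_exp c hl by (intro arg_cong[where f = exp] arg_cong[where f = "\<lambda>x. \<i> * of_real x"]) (simp add: mu_def field_simps)
  then show "\<i> ^ (h - l) * exp (\<i> * of_real (pi / 2 * (real l + 1 / 2))) * \<i> = - exp (\<i> * of_real (pi * mu h))"
    unfolding i[symmetric] m[symmetric] by simp
  have "(- \<i>) ^ (h - l) * exp (\<i> * of_real (pi / 2 * (real l + 1 / 2))) * exp (\<i> * of_real (pi / 2)) = exp (\<i> * of_real (pi * (1 / 2 + real l - mu h)))"
    unfolding imaginary_unit_power_exp c hl by (intro arg_cong[where f = exp] arg_cong[where f = "\<lambda>x. \<i> * of_real x"]) (simp add: mu_def field_simps)
  then show "(- \<i>) ^ (h - l) * exp (\<i> * of_real (pi / 2 * (real l + 1 / 2))) * \<i> = exp (\<i> * of_real (pi * (1 / 2 + real l - mu h)))"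
    unfolding i[symmetric] .
  have "(- \<i>) ^ (h - l) * exp (\<i> * of_real (- (pi / 2 * (real l + 1 / 2)))) * exp (\<i> * of_real (pi / 2)) = exp (\<i> * of_real (- (pi * mu h)))"
    unfolding imaginary_unit_power_exp c hl by (intro arg_cong[where f = exp] arg_cong[where f = "\<lambda>x. \<i> * of_real x"]) (simp add: mu_def field_simps)
  then show "(- \<i>) ^ (h - l) * exp (\<i> * of_real (- (pi / 2 * (real l + 1 / 2)))) * \<i> = exp (- \<i> * of_real (pi * mu h))"
    unfolding i[symmetric] by simp
qed

text \<open>After cancelling the factorial, both sides are positive products of powers of g, n, 2
  and pi, so logarithms reduce the claim to linear arithmetic. It is the absolute value of the
  coefficient comparison for h = H + 1.\<close>

lemma magnitude_identity:
  fixes g n :: real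
  assumes g: "g > 0" and n: "n > 0" and l: "l \<le> H"
  shows "(g / 2) powr (real (2 * (H + 1) + 1) / 2) * (fact (H + 1) * 4 ^ (H + 1 + 1) / (2 * sqrt pi)) / (2 ^ H * fact (H + 1))
      * (1 / (4 * g * sqrt n)) / (g ^ 2 * n) ^ H * (g * sqrt n) ^ (H - l) * g powr (real l - 1 / 2)
    = 1 / sqrt (2 * pi) * (1 / n powr ((real (2 * (H + 1) + 1) / 2 - 1) / 2)) * sqrt n powr (- (1 / 2 + real l))"
    (is "?L = ?R")
proof -
  have rl: "real (H - l) = real H - real l" using l by (simp add: of_nat_diff)
  have F: "fact (H + 1) * 4 ^ (H + 1 + 1) / (2 * sqrt pi) / (2 ^ H * fact (H + 1)) = 4 ^ (H + 1 + 1) / (2 * sqrt pi * 2 ^ H)"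
    by (simp del: fact_Suc)
  have pos: "?L > 0" "?R > 0" using g n by (auto intro!: mult_pos_pos divide_pos_pos)
  have ln4: "ln (4::real) = 2 * ln 2" using ln_realpow[of 2 2] by simp
  have ln8: "ln (8::real) = 3 * ln 2" using ln_realpow[of 2 3] by simp
  have "ln ?L = ln ((g / 2) powr (real (2 * (H + 1) + 1) / 2) * (4 ^ (H + 1 + 1) / (2 * sqrt pi * 2 ^ H))
      * (1 / (4 * g * sqrt n)) / (g ^ 2 * n) ^ H * (g * sqrt n) ^ (H - l) * g powr (real l - 1 / 2))"
    unfolding F[symmetric] by simp
  also have "\<dots> = ln ?R"
    using g n by (simp add: ln_mult ln_div ln_powr ln_realpow ln_sqrt rl ln4 del: power_Suc fact_Suc) (simp add: field_simps ln8)
  finally show ?thesis using pos by (simp add: ln_inj_iff)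
qed

lemma bij_betw_nu_enum: "bij_betw nu_enum UNIV nu_set"
proof (rule bij_betwI')
  fix x y :: nat
  show "nu_enum x = nu_enum y \<longleftrightarrow> x = y"
  proof
    assume eq: "nu_enum x = nu_enum y"
    then have "\<bar>nu_enum x\<bar> = \<bar>nu_enum y\<bar>" by simp
    then have d: "x div 2 = y div 2" by (simp add: abs_nu_enum)
    have pos: "even z \<longleftrightarrow> nu_enum z > 0" for z by (auto simp: nu_enum_def)
    have "even x \<longleftrightarrow> even y" unfolding pos eq ..
    with d show "x = y" by (metis div_mult_mod_eq parity_cases)
  qed simp
  show "nu_enum x \<in> nu_set"
    unfolding nu_set_def nu_enum_def by (auto intro!: exI[of _ "x div 2 + 1"])
next
  fix y assume "y \<in> nu_set"
  then obtain n where n: "n \<ge> 1" "y = sqrt (real n) \<or> y = - sqrt (real n)" by (auto simp: nu_set_def)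
  define j where "j = n - 1"
  have nj: "n = j + 1" using n by (simp add: j_def)
  from n(2) show "\<exists>x\<in>UNIV. y = nu_enum x"
  proof
    assume "y = sqrt (real n)" then show ?thesis by (intro bexI[of _ "2 * j"]) (auto simp: nu_enum_def nj)
  next
    assume "y = - sqrt (real n)" then show ?thesis by (intro bexI[of _ "2 * j + 1"]) (auto simp: nu_enum_def nj)
  qed
qed

section \<open>Comparison with the series of the statement\<close>

locale twist_setup = theta_pair "fourier_coeffs f" "fourier_coeffs (dual_form (2 * h + 1) N f)" h "4 * pi / sqrt (real N)"
      "root_number (2 * h + 1) * of_real ((2 * pi / sqrt (real N)) powr (real (2 * h + 1) / 2))"
  for f :: "complex \<Rightarrow> complex" and h N :: nat +
  fixes \<alpha> :: real
  assumes N: "N > 0" and alpha: "\<alpha> > 0"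
begin

abbreviation "gg \<equiv> 4 * pi / sqrt (real N)"
abbreviation "cc \<equiv> 2 * pi * \<alpha>"
abbreviation "bd \<equiv> fourier_coeffs (dual_form (2 * h + 1) N f)"
abbreviation "na \<equiv> nu_alpha N \<alpha>"
abbreviation "\<omega> \<equiv> root_number (2 * h + 1)"

lemma H_star: "H = h_star h" by (simp add: H_def h_star_def)

lemma nu_alpha_pos: "na > 0" using N alpha by (simp add: nu_alpha_def)

lemma cc_eq: "cc = gg * na"
  using N alpha by (simp add: nu_alpha_def real_sqrt_mult real_sqrt_divide)

lemma cc_pos: "cc > 0" using alpha by simp

lemma delta_eq: "delta cc k = gg * (nu_enum k + na)"
  unfolding delta_def by (subst cc_eq) (simp add: ring_distribs)

lemma dual_coeff_nu: "dual_coeff (2 * h + 1) N f ((nu_enum k)\<^sup>2)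
   = bd (k div 2 + 1) / of_real (real (k div 2 + 1) powr ((real (2 * h + 1) / 2 - 1) / 2))"
proof -
  have e: "(nu_enum k)\<^sup>2 = real (k div 2 + 1)"
    by (metis abs_nu_enum of_nat_0_le_iff power2_abs real_sqrt_pow2)
  have "real (k div 2 + 1) \<in> \<nat>" by (rule of_nat_in_Nats)
  moreover have fl: "nat \<lfloor>real (k div 2 + 1)\<rfloor> = k div 2 + 1" by (simp only: floor_of_nat nat_int)
  ultimately show ?thesis unfolding dual_coeff_def e norm_coeff_def fl by simp
qed

text \<open>Separates sign from magnitude. For h > 0 the factor i sgn(nu) occurs H - l times in the
  iterated difference and once more in \<open>Ck\<close>, together h - l times; for h = 0 it is
  absent, matching h - l = 0.\<close>

lemma coefficient_identity:
  assumes l: "l \<le> H"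
  shows "Kp * Ck k * (\<i> * of_real (gg * nu_enum k)) ^ (H - l) * of_real (gg powr (real l - 1 / 2))
     = \<omega> / of_real (sqrt (2 * pi)) * (if even k then \<i> else - \<i>) ^ (h - l) * dual_coeff (2 * h + 1) N f ((nu_enum k)\<^sup>2)
       / of_real (\<bar>nu_enum k\<bar> powr (1 / 2 + real l))"
proof -
  define n where "n = k div 2 + 1"
  have n: "real n > 0" by (simp add: n_def)
  define s where "s = (if even k then 1 else - 1 :: real)"
  have nu: "nu_enum k = s * sqrt (real n)" by (simp add: nu_enum_def s_def n_def)
  have s: "s * s = 1" "1 / s = s" "s \<noteq> 0" by (auto simp: s_def)
  have an: "\<bar>nu_enum k\<bar> = sqrt (real n)" by (simp add: abs_nu_enum n_def)
  have isg: "(if even k then \<i> else - \<i>) = \<i> * of_real s" by (simp add: s_def)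
  have half: "2 * pi / sqrt (real N) = gg / 2" by simp
  have gp: "gg > 0" using g .
  show ?thesis
  proof (cases "h = 0")
    case True
    have H0: "H = 0" unfolding H_def using True by simp
    with l have l0: "l = 0" by simp
    have Kp0: "Kp = \<omega> * of_real ((gg / 2) powr (1 / 2)) * of_real (2 / sqrt pi)"
      unfolding Kp_def K_def H0 unfolding half using True by simp
    have r: "(gg / 2) powr (1 / 2) * (2 / sqrt pi) / 2 * gg powr (- (1 / 2)) = 1 / sqrt (2 * pi)"
    proof -
      have "(G / 2) powr (1 / 2) * (2 / sqrt pi) / 2 * G powr (- (1 / 2)) = 1 / sqrt (2 * pi)" if G: "G > 0" for G :: real
      proof -
        have "(G / 2) powr (1 / 2) = G powr (1 / 2) / sqrt 2" using G by (simp add: powr_divide powr_half_sqrt real_sqrt_divide)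
        moreover have "G powr (1 / 2) * G powr (- (1 / 2)) = 1" using G by (simp add: powr_add[symmetric] del: powr_half_sqrt)
        ultimately show ?thesis using G by (simp add: real_sqrt_mult powr_minus field_simps)
      qed
      from this[OF gp] show ?thesis .
    qed
    have nn: "real n powr ((real (2 * h + 1) / 2 - 1) / 2) * sqrt (real n) powr (1 / 2 + real l) = 1"
      using n True l0 by (simp add: powr_half_sqrt[symmetric] powr_powr powr_add[symmetric])
    have "Kp * Ck k * (\<i> * of_real (gg * nu_enum k)) ^ (H - l) * of_real (gg powr (real l - 1 / 2))
        = \<omega> * of_real ((gg / 2) powr (1 / 2) * (2 / sqrt pi) / 2 * gg powr (- (1 / 2))) * bd n"
      unfolding Kp0 Ck_def H0 n_def[symmetric] using True l0 by simp
    also have "\<dots> = \<omega> / of_real (sqrt (2 * pi)) * bd n" unfolding r by simp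
    also have "\<dots> = \<omega> / of_real (sqrt (2 * pi)) * (bd n / of_real (real n powr ((real (2 * h + 1) / 2 - 1) / 2) * sqrt (real n) powr (1 / 2 + real l)))"
      unfolding nn by simp
    also have "\<dots> = \<omega> / of_real (sqrt (2 * pi)) * (if even k then \<i> else - \<i>) ^ (h - l) * dual_coeff (2 * h + 1) N f ((nu_enum k)\<^sup>2)
       / of_real (\<bar>nu_enum k\<bar> powr (1 / 2 + real l))"
      unfolding dual_coeff_nu an n_def[symmetric] using True by simp
    finally show ?thesis .
  next
    case False
    have hH: "h = H + 1" using False by (simp add: H_def)
    define X where "X = (gg / 2) powr (real (2 * h + 1) / 2) * (fact h * 4 ^ (h + 1) / (2 * sqrt pi)) / (2 ^ H * fact (H + 1))"
    have KpX: "Kp = \<omega> * of_real X"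
      unfolding Kp_def K_def X_def unfolding half by simp
    have "Ck k = \<i> / (4 * of_real (gg * nu_enum k)) * bd n / of_real ((gg ^ 2 * real n) ^ H)"
      using False unfolding Ck_def n_def by simp
    also have "\<i> / (4 * of_real (gg * nu_enum k)) = \<i> * of_real s * of_real (1 / (4 * gg * sqrt (real n)))"
    proof -
      have "1 / (4 * (gg * nu_enum k)) = s * (1 / (4 * gg * sqrt (real n)))"
      proof -
        have "1 / (4 * (G * (s * R))) = s * (1 / (4 * G * R))" for G R :: real by (simp add: s_def)
        then show ?thesis unfolding nu .
      qed
      note eq1 = this
      have eq2: "\<i> / (4 * of_real X) = \<i> * of_real (1 / (4 * X))" for X by simp
      show ?thesis unfolding eq2 eq1 of_real_mult[of s] by (rule mult.assoc[symmetric])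
    qed
    finally have Ckx: "Ck k = \<i> * of_real s * of_real (1 / (4 * gg * sqrt (real n)) / (gg ^ 2 * real n) ^ H) * bd n"
      by simp
    have pw: "(\<i> * of_real (gg * nu_enum k)) ^ (H - l) = (\<i> * of_real s) ^ (H - l) * of_real ((gg * sqrt (real n)) ^ (H - l))"
    proof -
      have "(\<i> * of_real (G * (s * R))) ^ m = (\<i> * of_real s) ^ m * of_real ((G * R) ^ m)" for G R :: real and m
        by (simp add: power_mult_distrib)
      then show ?thesis unfolding nu .
    qed
    have hl: "h - l = Suc (H - l)" using hH l by simp
    define Y where "Y = X * (1 / (4 * gg * sqrt (real n))) / (gg ^ 2 * real n) ^ H * (gg * sqrt (real n)) ^ (H - l) * gg powr (real l - 1 / 2)"
    have Y: "Y = 1 / sqrt (2 * pi) * (1 / real n powr ((real (2 * h + 1) / 2 - 1) / 2)) * sqrt (real n) powr (- (1 / 2 + real l))"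
    proof -
      have fh: "fact h = fact (H + 1)" "4 ^ (h + 1) = (4 ^ (H + 1 + 1) :: real)" "real (2 * h + 1) = real (2 * (H + 1) + 1)" using hH by simp_all
      show ?thesis unfolding Y_def X_def fh by (rule magnitude_identity[OF gp n l])
    qed
    have "Kp * Ck k * (\<i> * of_real (gg * nu_enum k)) ^ (H - l) * of_real (gg powr (real l - 1 / 2))
       = \<omega> * (\<i> * of_real s) ^ (h - l) * bd n * of_real Y"
      unfolding KpX Ckx pw hl power_Suc Y_def by simp
    also have "\<dots> = \<omega> / of_real (sqrt (2 * pi)) * (if even k then \<i> else - \<i>) ^ (h - l) * dual_coeff (2 * h + 1) N f ((nu_enum k)\<^sup>2)
       / of_real (\<bar>nu_enum k\<bar> powr (1 / 2 + real l))"
    proof -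
      have "A * P * B * of_real (1 / y * (1 / u) * inverse v) = A / of_real y * P * (B / of_real u) / of_real v"
        for A P B :: complex and y u v :: real
        by (simp add: divide_inverse)
      then show ?thesis unfolding Y isg an dual_coeff_nu n_def[symmetric] powr_minus .
    qed
    finally show ?thesis .
  qed
qed

text \<open>The prefactor of the functional equation evaluated at 1 - s, since 4 pi/sqrt N is the
  reciprocal of its base.\<close>

definition cst where "cst s = \<omega> / (\<i> * of_real (sqrt (2 * pi))) * of_real gg powr (1 - 2 * s)" for s :: complex

text \<open>Here the exponent of i delta is l + 1/2 - 2s, minus the exponent in
  \<open>F_term\<close>, and the sign of nu + nu_alpha selects exp(-i pi s) or exp(i pi s). The
  index with delta = 0 is nu = -nu_alpha, which neither \<open>F_plus\<close> nor
  \<open>F_minus\<close> contains.\<close>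

lemma term_identity:
  assumes l: "l \<le> H"
  shows "Kp * ((if delta cc k = 0 then 0 else Ck k) * (\<i> * of_real (gg * nu_enum k)) ^ (H - l)
       * (\<i> * of_real (delta cc k)) powr (Sarg (1 - s) - 2 - of_nat (H - l)))
   = cst s * (exp (- \<i> * of_real pi * s) * (if nu_enum k > - na then F_term h N f \<alpha> l s (nu_enum k) else 0)
        + exp (\<i> * of_real pi * s) * (if nu_enum k < - na then F_term h N f \<alpha> l s (nu_enum k) else 0))"
proof (cases "delta cc k = 0")
  case True
  then have "nu_enum k + na = 0" using g N by (simp add: delta_eq)
  then have "nu_enum k = - na" by simp
  then show ?thesis using True by simp
next
  case False
  define q where "q = \<bar>nu_enum k + na\<bar>"
  have q: "q > 0" using False g by (auto simp: delta_eq q_def)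
  define sg where "sg = sgn (nu_enum k + na)"
  have gp: "gg > 0" using g .
  have ad: "\<bar>delta cc k\<bar> = gg * q" "sgn (delta cc k) = sg" using gp N unfolding delta_eq q_def sg_def by (simp_all add: abs_mult sgn_mult)
  define w where "w = of_nat l + 1 / 2 - 2 * s"
  have wS: "Sarg (1 - s) - 2 - of_nat (H - l) = w"
    using l by (simp add: Sarg_def w_def of_nat_diff algebra_simps)
  have A: "(\<i> * of_real (delta cc k)) powr w = of_real gg powr w * of_real q powr w * exp (\<i> * of_real (sg * pi / 2) * w)"
  proof -
    have "of_real (G * q) powr w = of_real G powr w * of_real q powr w" if "G > 0" for G :: real
      using that q by (simp add: powr_times_real)
    from this[OF gp] show ?thesis unfolding imaginary_powr[OF False] ad by simp
  qed
  have B: "of_real gg powr w = of_real (gg powr (real l - 1 / 2)) * of_real gg powr (1 - 2 * s)"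
  proof -
    have "w = of_real (real l - 1 / 2) + (1 - 2 * s)" by (simp add: w_def)
    then have "of_real gg powr w = of_real gg powr (of_real (real l - 1 / 2)) * of_real gg powr (1 - 2 * s)" by (simp only: powr_add)
    also have "of_real gg powr (complex_of_real (real l - 1 / 2)) = of_real (gg powr (real l - 1 / 2))"
      using gp by (intro powr_of_real) simp
    finally show ?thesis .
  qed
  have C: "exp (\<i> * of_real (sg * pi / 2) * w) = exp (\<i> * of_real (sg * (pi / 2 * (real l + 1 / 2)))) * exp (- (of_real sg * (\<i> * of_real pi * s)))"
    unfolding exp_add[symmetric] by (intro arg_cong[where f = exp]) (simp add: w_def algebra_simps)
  define ph where "ph = (if even k then \<i> else - \<i>) ^ (h - l) * exp (\<i> * of_real (sg * (pi / 2 * (real l + 1 / 2)))) * \<i>"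
  have lh: "l \<le> h" using l by (simp add: H_def)
  have cst_star: "c_star h N f \<alpha> l (nu_enum k) = ph * dual_coeff (2 * h + 1) N f ((nu_enum k)\<^sup>2)"
  proof (cases "even k")
    case True
    then have nu: "nu_enum k \<ge> 1" by (simp add: nu_enum_def)
    then have "sg = 1" using nu_alpha_pos by (simp add: sg_def)
    then show ?thesis using True nu phase_identities(1)[OF lh] by (simp add: c_star_def ph_def)
  next
    case odd: False
    then have nu: "nu_enum k \<le> - 1" by (simp add: nu_enum_def)
    show ?thesis
    proof (cases "nu_enum k > - na")
      case True
      then have "sg = 1" by (simp add: sg_def)
      then show ?thesis using True odd nu phase_identities(2)[OF lh] by (simp add: c_star_def ph_def)
    next
      case F2: False
      then have lt: "nu_enum k < - na" using q by (auto simp: q_def)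
      then have "sg = - 1" by (simp add: sg_def)
      then show ?thesis using lt odd nu phase_identities(3)[OF lh] by (simp add: c_star_def ph_def)
    qed
  qed
  have qq: "of_real q powr w = 1 / of_real q powr (2 * s - 1 / 2 - of_nat l)"
  proof -
    have "w = - (2 * s - 1 / 2 - of_nat l)" by (simp add: w_def)
    then show ?thesis by (simp only: powr_minus_divide)
  qed
  have "Kp * (Ck k * (\<i> * of_real (gg * nu_enum k)) ^ (H - l) * (\<i> * of_real (delta cc k)) powr w)
     = (Kp * Ck k * (\<i> * of_real (gg * nu_enum k)) ^ (H - l) * of_real (gg powr (real l - 1 / 2))) * of_real gg powr (1 - 2 * s) * of_real q powr w
       * (exp (\<i> * of_real (sg * (pi / 2 * (real l + 1 / 2)))) * exp (- (of_real sg * (\<i> * of_real pi * s))))"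
    unfolding A B C by (simp only: mult_ac)
  also have "\<dots> = cst s * exp (- (of_real sg * (\<i> * of_real pi * s))) * F_term h N f \<alpha> l s (nu_enum k)"
  proof -
    define dc where "dc = dual_coeff (2 * h + 1) N f ((nu_enum k)\<^sup>2)"
    define ie where "ie = (if even k then \<i> else - \<i>) ^ (h - l)"
    have Ft: "F_term h N f \<alpha> l s (nu_enum k) = ph * dc / (of_real (\<bar>nu_enum k\<bar> powr (1 / 2 + real l)) * of_real q powr (2 * s - 1 / 2 - of_nat l))"
      unfolding F_term_def cst_star q_def dc_def ..
    have re: "(a / r * ie * dc / v) * G * (1 / Q) * (e1 * e2) = a / (\<i> * r) * G * e2 * (ie * e1 * \<i> * dc / (v * Q))"
      for a r v G Q e1 e2 :: complex
      by (cases "r = 0"; cases "v = 0"; cases "Q = 0") (simp_all add: field_simps)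
    show ?thesis unfolding coefficient_identity[OF l] Ft qq cst_def dc_def[symmetric] ph_def ie_def[symmetric]
      by (rule re)
  qed
  finally have main: "Kp * (Ck k * (\<i> * of_real (gg * nu_enum k)) ^ (H - l) * (\<i> * of_real (delta cc k)) powr w)
     = cst s * exp (- (of_real sg * (\<i> * of_real pi * s))) * F_term h N f \<alpha> l s (nu_enum k)" .
  show ?thesis
  proof (cases "nu_enum k > - na")
    case True
    then have "sg = 1" by (simp add: sg_def)
    then show ?thesis using main True False unfolding wS by simp
  next
    case F2: False
    then have lt: "nu_enum k < - na" using q by (auto simp: q_def)
    then have "sg = - 1" by (simp add: sg_def)
    then show ?thesis using main lt False unfolding wS by simp
  qed
qed

lemma infsum_nu:
  assumes "summable (\<lambda>k. norm (if P (nu_enum k) then F (nu_enum k) else 0 :: complex))"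
  shows "(\<Sum>\<^sub>\<infinity>\<nu>\<in>{\<nu>\<in>nu_set. P \<nu>}. F \<nu>) = (\<Sum>k. if P (nu_enum k) then F (nu_enum k) else 0)"
proof -
  have bij: "bij_betw nu_enum {k. P (nu_enum k)} {\<nu>\<in>nu_set. P \<nu>}"
  proof (rule bij_betw_subset[OF bij_betw_nu_enum])
    have "nu_set = range nu_enum" using bij_betw_nu_enum by (simp add: bij_betw_def)
    then show "nu_enum ` {k. P (nu_enum k)} = {\<nu>\<in>nu_set. P \<nu>}" by auto
  qed simp
  let ?f = "\<lambda>k. if P (nu_enum k) then F (nu_enum k) else 0"
  have "(\<Sum>\<^sub>\<infinity>\<nu>\<in>{\<nu>\<in>nu_set. P \<nu>}. F \<nu>) = (\<Sum>\<^sub>\<infinity>k\<in>{k. P (nu_enum k)}. F (nu_enum k))"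
    by (rule infsum_reindex_bij_betw[OF bij, symmetric])
  also have "\<dots> = (\<Sum>\<^sub>\<infinity>k\<in>UNIV. ?f k)" by (rule infsum_cong_neutral) auto
  also have "\<dots> = (\<Sum>k. ?f k)"
    by (intro infsumI norm_summable_imp_has_sum assms summable_sums summable_norm_cancel[OF assms])
  finally show ?thesis .
qed

lemma F_star_link:
  assumes l: "l \<le> H" and s: "Re s > 1"
    and E: "(\<lambda>k. (if delta cc k = 0 then 0 else Ck k) * (\<i> * of_real (gg * nu_enum k)) ^ (H - l)
            * (\<i> * of_real (delta cc k)) powr (Sarg (1 - s) - 2 - of_nat (H - l))) sums EE"
  shows "Kp * EE = cst s * F_star h N f \<alpha> l s"
proof -
  let ?t = "\<lambda>k. (if delta cc k = 0 then 0 else Ck k) * (\<i> * of_real (gg * nu_enum k)) ^ (H - l)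
            * (\<i> * of_real (delta cc k)) powr (Sarg (1 - s) - 2 - of_nat (H - l))"
  let ?p = "\<lambda>k. if nu_enum k > - na then F_term h N f \<alpha> l s (nu_enum k) else 0"
  let ?m = "\<lambda>k. if nu_enum k < - na then F_term h N f \<alpha> l s (nu_enum k) else 0"
  have om0: "\<omega> \<noteq> 0" by (simp add: root_number_def)
  have c0: "cst s \<noteq> 0" unfolding cst_def using om0 g N by simp
  have st: "summable (\<lambda>k. norm (?t k))"
    by (rule iterated_terms_abs_summable[OF cc_pos]) (use s in \<open>simp add: Sarg_def\<close>)
  have sKt: "summable (\<lambda>k. norm (Kp / cst s * ?t k))"
    unfolding norm_mult[of "Kp / cst s"] by (intro summable_mult st)
  have eq: "Kp / cst s * ?t k = exp (- \<i> * of_real pi * s) * ?p k + exp (\<i> * of_real pi * s) * ?m k" for k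
  proof -
    have "Kp / cst s * ?t k = (Kp * ?t k) / cst s" by (rule times_divide_eq_left)
    then show ?thesis unfolding term_identity[OF l] nonzero_mult_div_cancel_left[OF c0] .
  qed
  \<comment> \<open>Where \<open>?p\<close> is nonzero \<open>?m\<close> vanishes, so multiplying
    the combined term by the opposite exponential recovers this half; its absolute convergence
    follows, and likewise for \<open>?m\<close>.\<close>
  have sp: "summable (\<lambda>k. norm (?p k))"
  proof (rule summable_comparison_test'[OF summable_mult[OF sKt, of "norm (exp (\<i> * of_real pi * s))"]])
    fix k
    have "?p k = exp (\<i> * of_real pi * s) * (Kp / cst s * ?t k)" if "nu_enum k > - na"
      unfolding eq using that by (simp add: exp_minus)
    then show "norm (norm (?p k)) \<le> norm (exp (\<i> * of_real pi * s)) * norm (Kp / cst s * ?t k)"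
    proof (cases "nu_enum k > - na")
      case True
      note e = \<open>nu_enum k > - na \<Longrightarrow> _\<close>[OF True]
      show ?thesis unfolding e norm_mult[of "exp _"] by (simp only: real_norm_def abs_mult abs_norm_cancel order_refl)
    next
      case False
      then show ?thesis by (simp only: if_False norm_zero real_norm_def abs_zero) (intro mult_nonneg_nonneg norm_ge_zero)
    qed
  qed
  have sm: "summable (\<lambda>k. norm (?m k))"
  proof (rule summable_comparison_test'[OF summable_mult[OF sKt, of "norm (exp (- \<i> * of_real pi * s))"]])
    fix k
    have "?m k = exp (- \<i> * of_real pi * s) * (Kp / cst s * ?t k)" if "nu_enum k < - na"
      unfolding eq using that by (simp add: exp_minus)
    then show "norm (norm (?m k)) \<le> norm (exp (- \<i> * of_real pi * s)) * norm (Kp / cst s * ?t k)"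
    proof (cases "nu_enum k < - na")
      case True
      note e = \<open>nu_enum k < - na \<Longrightarrow> _\<close>[OF True]
      show ?thesis unfolding e norm_mult[of "exp _"] by (simp only: real_norm_def abs_mult abs_norm_cancel order_refl)
    next
      case False
      then show ?thesis by (simp only: if_False norm_zero real_norm_def abs_zero) (intro mult_nonneg_nonneg norm_ge_zero)
    qed
  qed
  have "(\<lambda>k. exp (- \<i> * of_real pi * s) * ?p k + exp (\<i> * of_real pi * s) * ?m k) sums F_star h N f \<alpha> l s"
    unfolding F_star_def F_plus_def F_minus_def infsum_nu[of "\<lambda>\<nu>. \<nu> > - na", OF sp] infsum_nu[of "\<lambda>\<nu>. \<nu> < - na", OF sm]
    by (intro sums_add sums_mult summable_sums summable_norm_cancel[OF sp] summable_norm_cancel[OF sm])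
  moreover have "(\<lambda>k. exp (- \<i> * of_real pi * s) * ?p k + exp (\<i> * of_real pi * s) * ?m k) sums (Kp / cst s * EE)"
    unfolding eq[symmetric] by (intro sums_mult E)
  ultimately have "Kp / cst s * EE = F_star h N f \<alpha> l s" by (rule sums_unique2[rotated])
  then show ?thesis using c0 by (simp add: field_simps)
qed

lemma standard_twist_link:
  assumes s: "Re s > 1"
  shows "standard_twist (2 * h + 1) f \<alpha> s = twist_series cc s"
proof -
  let ?t = "\<lambda>n. D n * exp (- (\<i> * of_real (cc * sqrt (real n)))) * of_nat n powr (- Sarg s / 2)"
  have eq: "norm_coeff (2 * h + 1) f n * of_nat n powr (- s) * exp (- 2 * of_real pi * \<i> * of_real (\<alpha> * sqrt (real n))) = ?t n" if n: "n \<ge> 1" for n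
  proof -
    have e: "exp (- 2 * of_real pi * \<i> * of_real (\<alpha> * sqrt (real n))) = exp (- (\<i> * of_real (cc * sqrt (real n))))"
      by (intro arg_cong[where f = exp]) simp
    define m where "m = (real (2 * h + 1) / 2 - 1) / 2"
    have m: "of_real (real n powr m) = complex_of_real (real n) powr (of_real m)" by (intro powr_of_real[symmetric]) simp
    have D: "D n = fourier_coeffs f n * of_nat n powr (if h = 0 then 1 / 2 else 0)"
    proof (cases "h = 0")
      case True
      have "complex_of_real (sqrt (real n)) = of_real (real n powr (1 / 2))" by (simp add: powr_half_sqrt)
      also have "\<dots> = of_nat n powr (of_real (1 / 2))" by (subst powr_of_real[symmetric]) auto
      finally show ?thesis unfolding D_def using True by simp
    qed (use n in \<open>simp add: D_def\<close>)
    have ex: "- s - of_real m = (if h = 0 then 1 / 2 else 0) + - Sarg s / 2"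
    proof (cases "h = 0")
      case True
      then have "H = 0" unfolding H_def by simp
      then show ?thesis unfolding Sarg_def m_def using True by (simp add: field_simps)
    next
      case False
      then have "complex_of_nat h = of_nat H + 1" unfolding H_def by (simp add: of_nat_diff)
      then show ?thesis unfolding Sarg_def m_def using False by (simp add: field_simps)
    qed
    have "of_nat n powr (- s) / complex_of_real (real n powr m) = of_nat n powr (- s - of_real m)"
      unfolding m by (simp add: powr_diff)
    also have "\<dots> = of_nat n powr (if h = 0 then 1 / 2 else 0) * of_nat n powr (- Sarg s / 2)"
      unfolding ex powr_add ..
    finally have "fourier_coeffs f n * (of_nat n powr (- s) / complex_of_real (real n powr m)) = D n * of_nat n powr (- Sarg s / 2)"
      unfolding D by simp
    then show ?thesis unfolding e norm_coeff_def m_def[symmetric] by (simp add: mult_ac)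
  qed
  have "standard_twist (2 * h + 1) f \<alpha> s = (\<Sum>\<^sub>\<infinity>n\<in>UNIV. ?t n)"
    unfolding standard_twist_def
  proof (rule infsum_cong_neutral)
    fix n assume "n \<in> UNIV - {1::nat..}"
    then have "n = 0" by simp
    then show "?t n = 0" by (simp add: D0)
  qed (use eq in auto)
  also have "\<dots> = (\<Sum>n. ?t n)"
    by (intro infsumI norm_summable_imp_has_sum twist_series_props(2) s summable_sums summable_norm_cancel[OF twist_series_props(2)[OF s]])
  finally show ?thesis unfolding twist_series_def .
qed

text \<open>Both continuations come from the one entire function E: \<open>Fst\<close> is an
  iterated difference of it divided by the nonvanishing prefactor, and the right-hand side then
  defines the continuation of the twist. \<open>twist_identity\<close> identifies it with the
  Dirichlet series.\<close>

theorem twist_functional_equation: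
  "\<exists>(Fst :: nat \<Rightarrow> complex \<Rightarrow> complex) (Ftw :: complex \<Rightarrow> complex).
    (\<forall>l\<le>h_star h. Fst l holomorphic_on UNIV \<and>
       (\<forall>s. Re s > 1 \<longrightarrow> Fst l s = F_star h N f \<alpha> l s)) \<and>
    Ftw meromorphic_on UNIV \<and>
    (\<forall>s. Re s > 1 \<longrightarrow> Ftw s = standard_twist (2 * h + 1) f \<alpha> s) \<and>
    (\<forall>s. (\<forall>l\<le>h_star h. 2 * (1 - s) - 1/2 - of_nat l \<notin> \<int>\<^sub>\<le>\<^sub>0) \<longrightarrow>
       Ftw s =
         root_number (2 * h + 1) / (\<i> * of_real (sqrt (2 * pi))) *
         of_real (sqrt (real N) / (4 * pi)) powr (1 - 2 * s) *
         (\<Sum>l\<le>h_star h. of_real (a_coeff (h_star h) l) *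
            Gamma (2 * (1 - s) - 1/2 - of_nat l) * Fst l (1 - s)))"
proof -
  obtain E where E: "E holomorphic_on UNIV"
     "\<And>r S. Re S < real H + 1 / 2 \<Longrightarrow> (\<lambda>k. (if delta cc k = 0 then 0 else Ck k) * (\<i> * of_real (gg * nu_enum k)) ^ r
            * (\<i> * of_real (delta cc k)) powr (S - 2 - of_nat r)) sums iterated_difference cc E r S"
     "\<And>s. Re s > 1 \<Longrightarrow> twist_series cc s * rGamma (2 - Sarg s) =
           Kp * (\<Sum>l\<le>H. of_real (a_coeff H l) * (iterated_difference cc E (H - l) (Sarg s) * pochhammer (2 - Sarg s) (H - l)))"
    using twist_identity[OF cc_pos] by blast
  have om0: "\<omega> \<noteq> 0" by (simp add: root_number_def)
  have gp: "gg > 0" using g .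
  have c0: "cst s \<noteq> 0" for s unfolding cst_def using om0 g N by simp
  define Fst where "Fst l s = Kp / cst s * iterated_difference cc E (H - l) (Sarg (1 - s))" for l s
  define RHS where "RHS s = root_number (2 * h + 1) / (\<i> * of_real (sqrt (2 * pi))) *
         of_real (sqrt (real N) / (4 * pi)) powr (1 - 2 * s) *
         (\<Sum>l\<le>H. of_real (a_coeff H l) * Gamma (2 * (1 - s) - 1/2 - of_nat l) * Fst l (1 - s))" for s
  define good where "good s \<longleftrightarrow> (\<forall>l\<le>H. 2 * (1 - s) - 1/2 - of_nat l \<notin> \<int>\<^sub>\<le>\<^sub>0)" for s :: complex
  \<comment> \<open>Where some Gamma argument is a pole the right-hand side has no meaning. The
    default there keeps the equality with the twist at every point of Re s > 1; such points are
    isolated, so meromorphy is unaffected.\<close>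
  define Ftw where "Ftw s = (if good s then RHS s else standard_twist (2 * h + 1) f \<alpha> s)" for s
  have itS: "(\<lambda>s. iterated_difference cc E m (Sarg (1 - s))) holomorphic_on UNIV" for m
  proof -
    have "(iterated_difference cc E m \<circ> (\<lambda>s. Sarg (1 - s))) holomorphic_on UNIV"
      unfolding Sarg_def
      by (rule holomorphic_on_compose_gen[OF _ iterated_difference_holomorphic[OF E(1)]]) (auto intro!: holomorphic_intros)
    then show ?thesis by (simp add: o_def)
  qed
  have Fst_hol: "Fst l holomorphic_on UNIV" for l
    unfolding Fst_def[abs_def] using c0 by (intro holomorphic_intros itS) (auto simp: cst_def intro!: holomorphic_intros)
  have Fst_eq: "Fst l s = F_star h N f \<alpha> l s" if l: "l \<le> H" and s: "Re s > 1" for l s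
  proof -
    have "Kp * iterated_difference cc E (H - l) (Sarg (1 - s)) = cst s * F_star h N f \<alpha> l s"
      by (rule F_star_link[OF l s E(2)]) (use s in \<open>simp add: Sarg_def\<close>)
    then show ?thesis using c0[of s] by (simp add: Fst_def field_simps)
  qed
  have pw: "of_real (sqrt (real N) / (4 * pi)) powr (1 - 2 * s) = of_real gg powr (1 - 2 * (1 - s))" for s :: complex
  proof -
    have "complex_of_real (sqrt (real N) / (4 * pi)) powr (1 - 2 * s) = exp ((1 - 2 * s) * of_real (ln (sqrt (real N) / (4 * pi))))"
      using N by (intro powr_complex_eq_exp_ln) simp
    also have "ln (sqrt (real N) / (4 * pi)) = - ln gg" using N by (simp add: ln_div)
    also have "exp ((1 - 2 * s) * of_real (- ln gg)) = exp ((1 - 2 * (1 - s)) * of_real (ln gg))"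
      by (intro arg_cong[where f = exp]) (simp add: algebra_simps)
    also have "\<dots> = of_real gg powr (1 - 2 * (1 - s))" by (rule powr_complex_eq_exp_ln[OF gp, symmetric])
    finally show ?thesis .
  qed
  have RHS_eq: "RHS s = Kp * (\<Sum>l\<le>H. of_real (a_coeff H l) * (iterated_difference cc E (H - l) (Sarg s) * Gamma (2 * (1 - s) - 1/2 - of_nat l)))" for s
  proof -
    have "RHS s = cst (1 - s) * (\<Sum>l\<le>H. of_real (a_coeff H l) * Gamma (2 * (1 - s) - 1/2 - of_nat l) * (Kp / cst (1 - s) * iterated_difference cc E (H - l) (Sarg s)))"
      unfolding RHS_def pw cst_def[symmetric] Fst_def by simp
    then show ?thesis using c0[of "1 - s"] by (simp add: sum_distrib_left field_simps)
  qed
  have twist: "RHS s = standard_twist (2 * h + 1) f \<alpha> s" if s: "Re s > 1" and gs: "good s" for s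
  proof -
    have arg: "2 * (1 - s) - 1/2 - of_nat l = 2 - Sarg s + of_nat (H - l)" if "l \<le> H" for l
      using that by (simp add: Sarg_def of_nat_diff algebra_simps)
    have n: "2 - Sarg s \<notin> \<int>\<^sub>\<le>\<^sub>0" using gs arg[of H] unfolding good_def by auto
    have P: "Gamma (2 * (1 - s) - 1/2 - of_nat l) = Gamma (2 - Sarg s) * pochhammer (2 - Sarg s) (H - l)" if "l \<le> H" for l
    proof -
      have "Gamma (2 - Sarg s) \<noteq> 0" using n by (simp add: Gamma_eq_zero_iff)
      then show ?thesis unfolding arg[OF that] by (simp add: pochhammer_Gamma[OF n])
    qed
    have "RHS s = Gamma (2 - Sarg s) * (Kp * (\<Sum>l\<le>H. of_real (a_coeff H l) * (iterated_difference cc E (H - l) (Sarg s) * pochhammer (2 - Sarg s) (H - l))))"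
    proof -
      have "(\<Sum>l\<le>H. of_real (a_coeff H l) * (iterated_difference cc E (H - l) (Sarg s) * Gamma (2 * (1 - s) - 1/2 - of_nat l)))
         = (\<Sum>l\<le>H. Gamma (2 - Sarg s) * (of_real (a_coeff H l) * (iterated_difference cc E (H - l) (Sarg s) * pochhammer (2 - Sarg s) (H - l))))"
      proof (rule sum.cong[OF refl])
        fix l assume "l \<in> {..H}"
        then have l: "l \<le> H" by simp
        show "of_real (a_coeff H l) * (iterated_difference cc E (H - l) (Sarg s) * Gamma (2 * (1 - s) - 1/2 - of_nat l))
          = Gamma (2 - Sarg s) * (of_real (a_coeff H l) * (iterated_difference cc E (H - l) (Sarg s) * pochhammer (2 - Sarg s) (H - l)))"
          unfolding P[OF l] by (simp only: mult_ac)
      qed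
      then show ?thesis unfolding RHS_eq sum_distrib_left[symmetric] by (simp only: mult_ac)
    qed
    also have "\<dots> = Gamma (2 - Sarg s) * (twist_series cc s * rGamma (2 - Sarg s))" unfolding E(3)[OF s] ..
    also have "\<dots> = twist_series cc s" using n by (simp add: rGamma_inverse_Gamma Gamma_eq_zero_iff)
    finally show ?thesis using standard_twist_link[OF s] by simp
  qed
  have Ftw_tw: "Ftw s = standard_twist (2 * h + 1) f \<alpha> s" if "Re s > 1" for s
    using twist that by (simp add: Ftw_def)
  \<comment> \<open>Every set of nonpositive integers is closed, so after removing the value at z
    itself the remaining exceptional points stay away from z.\<close>
  have ev_good: "\<forall>\<^sub>F s in at z. good s" for z
  proof -
    have "\<forall>\<^sub>F s in at z. 2 * (1 - s) - 1/2 - of_nat l \<notin> \<int>\<^sub>\<le>\<^sub>0" for l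
    proof -
      define Z where "Z = (\<lambda>u. (3 / 2 - of_nat l - u) / 2) ` (\<int>\<^sub>\<le>\<^sub>0 :: complex set)"
      have "closed ((\<lambda>s. 2 * (1 - s) - 1/2 - of_nat l) -` (\<int>\<^sub>\<le>\<^sub>0 - {2 * (1 - z) - 1/2 - of_nat l :: complex}))"
        by (intro continuous_closed_vimage closed_subset_Ints continuous_intros) (auto dest: nonpos_Ints_Int)
      then have "open (- ((\<lambda>s. 2 * (1 - s) - 1/2 - of_nat l) -` (\<int>\<^sub>\<le>\<^sub>0 - {2 * (1 - z) - 1/2 - of_nat l :: complex})))" by auto
      then have "\<forall>\<^sub>F s in nhds z. s \<in> - ((\<lambda>s. 2 * (1 - s) - 1/2 - of_nat l) -` (\<int>\<^sub>\<le>\<^sub>0 - {2 * (1 - z) - 1/2 - of_nat l :: complex}))"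
        by (rule eventually_nhds_in_open) auto
      then show ?thesis unfolding eventually_at_filter by eventually_elim auto
    qed
    then show ?thesis unfolding good_def
      using eventually_ball_finite[of "{..H}" "\<lambda>s l. 2 * (1 - s) - 1/2 - of_nat l \<notin> \<int>\<^sub>\<le>\<^sub>0" "at z"] by (simp add: Ball_def)
  qed
  have Gamma_mero: "(\<lambda>s. Gamma (2 * (1 - s) - 1/2 - of_nat l)) meromorphic_on UNIV" for l
  proof -
    have "(\<lambda>s. inverse (rGamma (2 * (1 - s) - 1/2 - of_nat l :: complex))) meromorphic_on UNIV"
      by (intro meromorphic_intros analytic_on_imp_meromorphic_on) (auto simp: analytic_on_open intro!: holomorphic_intros)
    then show ?thesis by (simp add: rGamma_inverse_Gamma)
  qed
  have "RHS meromorphic_on UNIV"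
  proof -
    have h1: "Fst l meromorphic_on UNIV" for l
      using Fst_hol by (intro analytic_on_imp_meromorphic_on) (simp add: analytic_on_open)
    have "(Fst l \<circ> (\<lambda>s. 1 - s)) holomorphic_on UNIV" for l
      by (rule holomorphic_on_compose_gen[OF _ Fst_hol]) (auto intro!: holomorphic_intros)
    then have h2: "(\<lambda>s. Fst l (1 - s)) meromorphic_on UNIV" for l
      by (intro analytic_on_imp_meromorphic_on) (simp add: analytic_on_open o_def)
    have "(\<lambda>s. complex_of_real (sqrt (real N) / (4 * pi)) powr (1 - 2 * s)) holomorphic_on UNIV"
      by (intro holomorphic_intros)
    then have h3: "(\<lambda>s. complex_of_real (sqrt (real N) / (4 * pi)) powr (1 - 2 * s)) meromorphic_on UNIV"
      by (intro analytic_on_imp_meromorphic_on) (simp add: analytic_on_open)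
    show ?thesis unfolding RHS_def[abs_def] by (intro meromorphic_intros h2 h3 Gamma_mero)
  qed
  then have mero: "Ftw meromorphic_on UNIV"
  proof (rule meromorphic_on_cong[THEN iffD1, rotated 2])
    fix z :: complex
    show "\<forall>\<^sub>F w in at z. RHS w = Ftw w" using ev_good by eventually_elim (simp add: Ftw_def)
  qed auto
  show ?thesis
  proof (rule exI[of _ Fst], rule exI[of _ Ftw], intro conjI allI impI)
    fix s :: complex assume "\<forall>l\<le>h_star h. 2 * (1 - s) - 1/2 - of_nat l \<notin> \<int>\<^sub>\<le>\<^sub>0"
    then have "good s" by (simp add: good_def H_star)
    then show "Ftw s = root_number (2 * h + 1) / (\<i> * of_real (sqrt (2 * pi))) *
         of_real (sqrt (real N) / (4 * pi)) powr (1 - 2 * s) *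
         (\<Sum>l\<le>h_star h. of_real (a_coeff (h_star h) l) *
            Gamma (2 * (1 - s) - 1/2 - of_nat l) * Fst l (1 - s))"
      by (simp add: Ftw_def RHS_def H_star)
  qed (use Fst_hol Fst_eq Ftw_tw mero H_star in auto)
qed

end

section \<open>Fourier expansions\<close>

text \<open>The predicate inside the definite description of \<open>fourier_coeffs\<close>, named so
  that existence and uniqueness can be stated separately.\<close>

definition q_expansion :: "(nat \<Rightarrow> complex) \<Rightarrow> (complex \<Rightarrow> complex) \<Rightarrow> bool" where
  "q_expansion b F \<longleftrightarrow> (\<forall>z. Im z > 0 \<longrightarrow> (\<lambda>n. b n * exp (2 * of_real pi * \<i> * of_nat n * z)) sums F z)"

lemma exp_q_power: "exp (2 * of_real pi * \<i> * of_nat n * z) = exp (2 * of_real pi * \<i> * z) ^ n"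
  by (simp add: exp_of_nat_mult[symmetric] mult_ac)

lemma norm_exp_q: "norm (exp (2 * of_real pi * \<i> * z)) = exp (- 2 * pi * Im z)"
  by (simp add: norm_exp_eq_Re)

lemma exp_q_surj:
  assumes "w \<noteq> 0" "norm w < 1"
  defines "z \<equiv> Ln w / (2 * of_real pi * \<i>)"
  shows "exp (2 * of_real pi * \<i> * z) = w" "Im z > 0" "Im z = - ln (norm w) / (2 * pi)"
proof -
  show "exp (2 * of_real pi * \<i> * z) = w" using assms by simp
  show im: "Im z = - ln (norm w) / (2 * pi)"
    using assms(1) by (simp add: z_def Im_divide power2_eq_square)
  have "ln (norm w) < 0" using assms by (simp add: ln_less_zero)
  then show "Im z > 0" unfolding im by (simp add: divide_neg_pos)
qed

lemma periodic_int:
  assumes per: "\<And>z. Im z > 0 \<Longrightarrow> F (z + 1) = F z" and "Im z > 0"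
  shows "F (z + of_int m) = F z"
proof -
  have nat: "F (z + of_nat n) = F z" if "Im z > 0" for n z
    using that
  proof (induction n)
    case (Suc n)
    have "F (z + of_nat (Suc n)) = F ((z + of_nat n) + 1)" by (simp add: algebra_simps)
    also have "\<dots> = F (z + of_nat n)" by (rule per) (use Suc in simp)
    finally show ?case using Suc by simp
  qed simp
  show ?thesis
  proof (cases "m \<ge> 0")
    case True
    then show ?thesis using nat[OF assms(2), of "nat m"] by (simp add: of_nat_nat)
  next
    case False
    have "F (z + of_int m + of_nat (nat (- m))) = F (z + of_int m)" by (rule nat) (use assms in simp)
    moreover have "z + of_int m + of_nat (nat (- m)) = z" using False by (simp add: of_nat_nat)
    ultimately show ?thesis by simp
  qed
qed

text \<open>Periodicity makes F a function G of q = exp(2 pi i z) on the punctured disc. Holomorphy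
  is checked with two branches of the logarithm, one cut along each half of the real axis; decay at
  i infinity makes 0 a removable singularity with value 0.\<close>

lemma fourier_expansion_exists:
  assumes hol: "F holomorphic_on {z. Im z > 0}"
    and per: "\<And>z. Im z > 0 \<Longrightarrow> F (z + 1) = F z"
    and lim: "(F \<longlongrightarrow> 0) (filtercomap Im at_top)"
  shows "\<exists>b. b 0 = 0 \<and> q_expansion b F"
proof -
  define G where "G w = (if w = 0 then 0 else F (Ln w / (2 * of_real pi * \<i>)))" for w
  have GF: "G (exp (2 * of_real pi * \<i> * z)) = F z" if z: "Im z > 0" for z
  proof -
    define w where "w = exp (2 * of_real pi * \<i> * z)"
    have w: "w \<noteq> 0" "norm w < 1" using z by (auto simp: w_def norm_exp_q)
    define z' where "z' = Ln w / (2 * of_real pi * \<i>)"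
    have e: "exp (2 * of_real pi * \<i> * z') = w" and im: "Im z' > 0"
      using exp_q_surj[OF w] by (simp_all add: z'_def)
    then have "exp (2 * of_real pi * \<i> * z') = exp (2 * of_real pi * \<i> * z)" by (simp add: w_def)
    then obtain m :: int where "2 * of_real pi * \<i> * z' = 2 * of_real pi * \<i> * z + of_real (real_of_int (2 * m) * pi) * \<i>"
      unfolding exp_eq by blast
    then have "2 * of_real pi * \<i> * z' = 2 * of_real pi * \<i> * (z + of_int m)" by (simp add: algebra_simps)
    then have "z' = z + of_int m" by simp
    then have "F z' = F z" using periodic_int[where F = F, OF per z] by simp
    then show ?thesis using w by (simp add: G_def z'_def w_def)
  qed
  have hol1: "G holomorphic_on {w. w \<notin> \<real>\<^sub>\<le>\<^sub>0 \<and> norm w < 1}"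
  proof (rule holomorphic_transform)
    show "(F \<circ> (\<lambda>w. Ln w / (2 * of_real pi * \<i>))) holomorphic_on {w. w \<notin> \<real>\<^sub>\<le>\<^sub>0 \<and> norm w < 1}"
      by (rule holomorphic_on_compose_gen[OF _ hol]) (auto intro!: holomorphic_intros exp_q_surj(2))
  qed (auto simp: G_def)
  have hol2: "G holomorphic_on {w. - w \<notin> \<real>\<^sub>\<le>\<^sub>0 \<and> norm w < 1}"
  proof (rule holomorphic_transform)
    have im: "Im ((Ln (- w) + \<i> * of_real pi) / (2 * of_real pi * \<i>)) > 0" if "- w \<notin> \<real>\<^sub>\<le>\<^sub>0" "norm w < 1" for w :: complex
    proof -
      have "w \<noteq> 0" using that by auto
      then have "Im ((Ln (- w) + \<i> * of_real pi) / (2 * of_real pi * \<i>)) = - ln (norm w) / (2 * pi)"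
        by (simp add: Im_divide power2_eq_square)
      moreover have "ln (norm w) < 0" using that \<open>w \<noteq> 0\<close> by (simp add: ln_less_zero)
      ultimately show ?thesis by (simp add: divide_neg_pos)
    qed
    show "(F \<circ> (\<lambda>w. (Ln (- w) + \<i> * of_real pi) / (2 * of_real pi * \<i>))) holomorphic_on {w. - w \<notin> \<real>\<^sub>\<le>\<^sub>0 \<and> norm w < 1}"
      by (rule holomorphic_on_compose_gen[OF _ hol]) (use im in \<open>auto intro!: holomorphic_intros\<close>)
    fix w :: complex assume w: "w \<in> {w. - w \<notin> \<real>\<^sub>\<le>\<^sub>0 \<and> norm w < 1}"
    then have w0: "w \<noteq> 0" by auto
    have "exp (2 * of_real pi * \<i> * ((Ln (- w) + \<i> * of_real pi) / (2 * of_real pi * \<i>))) = exp (Ln (- w) + \<i> * of_real pi)"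
      by simp
    also have "\<dots> = w" proof -
      have "exp (\<i> * of_real pi) = (-1 :: complex)" by (simp add: exp_eq_polar)
      then show ?thesis unfolding exp_add using w0 by simp
    qed
    finally show "(F \<circ> (\<lambda>w. (Ln (- w) + \<i> * of_real pi) / (2 * of_real pi * \<i>))) w = G w"
      using GF[OF im[of w]] w by simp
  qed
  have o: "open {w::complex. w \<notin> \<real>\<^sub>\<le>\<^sub>0 \<and> norm w < 1}" "open {w::complex. - w \<notin> \<real>\<^sub>\<le>\<^sub>0 \<and> norm w < 1}"
  proof -
    have "open (- \<real>\<^sub>\<le>\<^sub>0 \<inter> ball (0::complex) 1)" by (intro open_Int open_Compl closed_nonpos_Reals_complex open_ball)
    also have "- \<real>\<^sub>\<le>\<^sub>0 \<inter> ball (0::complex) 1 = {w. w \<notin> \<real>\<^sub>\<le>\<^sub>0 \<and> norm w < 1}" by auto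
    finally show 1: "open {w::complex. w \<notin> \<real>\<^sub>\<le>\<^sub>0 \<and> norm w < 1}" .
    have "open (uminus -` {w::complex. w \<notin> \<real>\<^sub>\<le>\<^sub>0 \<and> norm w < 1})" by (intro open_vimage 1 continuous_intros)
    then show "open {w::complex. - w \<notin> \<real>\<^sub>\<le>\<^sub>0 \<and> norm w < 1}" by (simp add: vimage_def)
  qed
  have "G holomorphic_on ({w. w \<notin> \<real>\<^sub>\<le>\<^sub>0 \<and> norm w < 1} \<union> {w. - w \<notin> \<real>\<^sub>\<le>\<^sub>0 \<and> norm w < 1})"
    by (rule holomorphic_on_Un[OF hol1 hol2 o])
  moreover have "ball 0 1 - {0} \<subseteq> {w::complex. w \<notin> \<real>\<^sub>\<le>\<^sub>0 \<and> norm w < 1} \<union> {w. - w \<notin> \<real>\<^sub>\<le>\<^sub>0 \<and> norm w < 1}"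
    by (auto simp: complex_nonpos_Reals_iff complex_eq_iff)
  ultimately have punct: "G holomorphic_on (ball 0 1 - {0})" by (rule holomorphic_on_subset)
  have "(G \<longlongrightarrow> 0) (at 0)"
  proof -
    have f: "filterlim (\<lambda>w::complex. Ln w / (2 * of_real pi * \<i>)) (filtercomap Im at_top) (at 0)"
      unfolding filterlim_filtercomap_iff o_def
    proof -
      have 1: "filterlim (\<lambda>x::real. - ln x / (2 * pi)) at_top (at_right 0)" by real_asymp
      have 2: "filterlim norm (at_right 0) (at (0::complex))"
        by (auto simp: filterlim_at tendsto_norm_zero_iff eventually_at_filter intro!: tendsto_norm_zero tendsto_ident_at)
      have "filterlim (\<lambda>w::complex. - ln (norm w) / (2 * pi)) at_top (at 0)" by (rule filterlim_compose[OF 1 2])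
      moreover have "\<forall>\<^sub>F w::complex in at 0. - ln (norm w) / (2 * pi) = Im (Ln w / (2 * of_real pi * \<i>))"
        unfolding eventually_at by (intro exI[of _ 1]) (auto simp: exp_q_surj(3))
      ultimately show "filterlim (\<lambda>w::complex. Im (Ln w / (2 * of_real pi * \<i>))) at_top (at 0)"
        by (rule filterlim_cong[OF refl refl, THEN iffD1, rotated])
    qed
    have "((\<lambda>w. F (Ln w / (2 * of_real pi * \<i>))) \<longlongrightarrow> 0) (at 0)" by (rule filterlim_compose[OF lim f])
    then show ?thesis
      by (rule Lim_transform_eventually) (auto simp: eventually_at_filter G_def)
  qed
  then have "G holomorphic_on ball 0 1"
    by (intro no_isolated_singularity'[of "{0}" G "ball 0 1"] punct) (auto simp: G_def at_within_open[of 0 "ball 0 1"])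
  then have ps: "(\<lambda>n. (deriv ^^ n) G 0 / fact n * (w - 0) ^ n) sums G w" if "w \<in> ball 0 1" for w
    by (rule holomorphic_power_series) (use that in auto)
  define b where "b n = (deriv ^^ n) G 0 / fact n" for n
  have "b 0 = 0" by (simp add: b_def G_def)
  moreover have "q_expansion b F" unfolding q_expansion_def
  proof (intro allI impI)
    fix z assume z: "Im z > 0"
    have "exp (2 * of_real pi * \<i> * z) \<in> ball 0 1" using z by (simp add: norm_exp_q)
    from ps[OF this] show "(\<lambda>n. b n * exp (2 * of_real pi * \<i> * of_nat n * z)) sums F z"
      unfolding GF[OF z] exp_q_power by (simp add: b_def)
  qed
  ultimately show ?thesis by blast
qed

text \<open>The difference is a power series vanishing on the punctured unit disc. Continuity forces
  its constant term to vanish, and a nonzero later coefficient would isolate the zero at 0.\<close>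

lemma q_expansion_unique:
  assumes "q_expansion b F" "q_expansion b' F"
  shows "b = b'"
proof (rule ccontr)
  define d where "d n = b n - b' n" for n
  have s0: "(\<lambda>n. d n * w ^ n) sums 0" if "w \<noteq> 0" "norm w < 1" for w
  proof -
    define z where "z = Ln w / (2 * of_real pi * \<i>)"
    have z: "exp (2 * of_real pi * \<i> * z) = w" "Im z > 0" using exp_q_surj[OF that] by (simp_all add: z_def)
    have "(\<lambda>n. b n * w ^ n - b' n * w ^ n) sums (F z - F z)"
      using assms z by (intro sums_diff) (auto simp: q_expansion_def exp_q_power)
    then show ?thesis by (simp add: d_def left_diff_distrib)
  qed
  define e where "e w = (if w = 0 then d 0 else 0)" for w :: complex
  have se: "(\<lambda>n. d n * (w - 0) ^ n) sums e w" if "w \<in> ball 0 1" for w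
  proof (cases "w = 0")
    case True
    show ?thesis unfolding True using powser_sums_zero[of d] by (simp add: e_def)
  qed (use s0 that in \<open>auto simp: e_def\<close>)
  have "e holomorphic_on ball 0 1" by (rule power_series_holomorphic[OF se])
  then have "isCont e 0" using holomorphic_on_imp_continuous_on[of e "ball 0 1"] continuous_on_eq_continuous_at[of "ball (0::complex) 1" e] by auto
  then have "(e \<longlongrightarrow> d 0) (at 0)" by (simp add: isCont_def e_def)
  moreover have "(e \<longlongrightarrow> 0) (at 0)"
    by (rule Lim_transform_eventually[OF tendsto_const]) (auto simp: eventually_at_filter e_def)
  ultimately have d0: "d 0 = 0" by (rule LIM_unique)
  then have e0: "e w = 0" for w by (simp add: e_def)
  assume "b \<noteq> b'"
  then obtain m where m: "d m \<noteq> 0" by (auto simp: d_def)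
  with d0 have "m > 0" by (cases m) auto
  obtain s where s: "s > 0" "\<And>z. z \<in> cball 0 s - {0} \<Longrightarrow> e z \<noteq> 0"
    using powser_0_nonzero[of 1 0 d e m] se e0 m \<open>m > 0\<close> by (auto simp: dist_norm)
  have "complex_of_real s \<in> cball 0 s - {0}" using s(1) by simp
  from s(2)[OF this] show False by (simp add: e0)
qed

lemma fourier_coeffs_eqI:
  assumes "q_expansion b F" shows "fourier_coeffs F = b"
  unfolding fourier_coeffs_def q_expansion_def[symmetric]
  by (rule the_equality[where P = "\<lambda>b. q_expansion b F", OF assms]) (rule q_expansion_unique[OF _ assms])

text \<open>Plain convergence at height y/2 means a strictly larger q-radius, hence absolute
  convergence at height y.\<close>

lemma q_expansion_abs_summable:
  assumes "q_expansion b F" "y > 0"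
  shows "summable (\<lambda>n. norm (b n) * exp (- 2 * pi * y) ^ n)"
proof -
  define r where "r = exp (- 2 * pi * y)"
  define r' where "r' = exp (- 2 * pi * (y / 2))"
  have r: "r < r'" "r > 0" "r' > 0" using assms by (auto simp: r_def r'_def)
  have "(\<lambda>n. b n * exp (2 * of_real pi * \<i> * of_nat n * (\<i> * of_real (y / 2)))) sums F (\<i> * of_real (y / 2))"
    using assms unfolding q_expansion_def by (elim allE[of _ "\<i> * of_real (y / 2)"]) auto
  moreover have "exp (2 * of_real pi * \<i> * (\<i> * of_real (y / 2))) = complex_of_real r'"
    by (simp add: r'_def exp_of_real[symmetric])
  ultimately have "summable (\<lambda>n. b n * complex_of_real r' ^ n)"
    unfolding exp_q_power by (auto simp: sums_iff)
  from powser_insidea[OF this, of "complex_of_real r"] r have "summable (\<lambda>n. norm (b n * complex_of_real r ^ n))" by simp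
  then show ?thesis using r by (simp add: norm_mult norm_power r_def)
qed

text \<open>A vanishing constant term lets one factor |q| be pulled out of the absolutely convergent
  series at the lowest height \<open>y0\<close>.\<close>

lemma q_expansion_exp_decay:
  assumes q: "q_expansion b F" and b0: "b 0 = 0" and y0: "y0 > 0"
  shows "\<exists>C. \<forall>z. Im z \<ge> y0 \<longrightarrow> norm (F z) \<le> C * exp (- 2 * pi * Im z)"
proof -
  define r where "r = exp (- 2 * pi * y0)"
  have r: "r > 0" by (simp add: r_def)
  have s: "summable (\<lambda>n. norm (b n) * r ^ n)" unfolding r_def by (rule q_expansion_abs_summable[OF q y0])
  have "norm (F z) \<le> (suminf (\<lambda>n. norm (b n) * r ^ n) / r) * exp (- 2 * pi * Im z)" if z: "Im z \<ge> y0" for z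
  proof -
    define t where "t = exp (- 2 * pi * Im z)"
    have t: "t > 0" "t \<le> r" using z by (auto simp: t_def r_def)
    have "(\<lambda>n. b n * exp (2 * of_real pi * \<i> * of_nat n * z)) sums F z" using q z y0 by (simp add: q_expansion_def)
    then have "norm (F z) = norm (\<Sum>n. b n * exp (2 * of_real pi * \<i> * z) ^ n)" by (simp add: sums_iff exp_q_power)
    also have "\<dots> \<le> (\<Sum>n. (t / r) * (norm (b n) * r ^ n))"
    proof (rule norm_suminf_le)
      show "summable (\<lambda>n. (t / r) * (norm (b n) * r ^ n))" by (intro summable_mult s)
      fix n
      show "norm (b n * exp (2 * of_real pi * \<i> * z) ^ n) \<le> (t / r) * (norm (b n) * r ^ n)"
      proof (cases n)
        case (Suc m)
        have "t ^ n \<le> t * r ^ m" unfolding Suc power_Suc using t by (intro mult_left_mono power_mono) auto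
        then have "norm (b n) * t ^ n \<le> norm (b n) * (t * r ^ m)" by (rule mult_left_mono) simp
        also have "\<dots> = (t / r) * (norm (b n) * r ^ n)" using r by (simp add: Suc)
        finally show ?thesis by (simp add: norm_mult norm_power norm_exp_q t_def)
      qed (simp add: b0)
    qed
    also have "\<dots> = (t / r) * (\<Sum>n. norm (b n) * r ^ n)" by (rule suminf_mult[OF s])
    finally show ?thesis by (simp add: t_def mult_ac)
  qed
  then show ?thesis by blast
qed

section \<open>Bounds for cusp forms\<close>

lemma moebius_action_denom_nonzero:
  assumes "a * d - b * c = (1::int)" "Im z > 0"
  shows "of_int c * z + of_int d \<noteq> 0"
proof
  assume 0: "of_int c * z + of_int d = 0"
  then have "Im (of_int c * z + of_int d) = 0" by simp
  then have c: "c = 0" using assms by simp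
  then have "d = 0" using 0 by simp
  then show False using assms c by simp
qed

lemma Im_moebius_action:
  assumes "a * d - b * c = (1::int)"
  shows "Im (moebius_action a b c d z) = Im z / (norm (of_int c * z + of_int d))\<^sup>2"
proof -
  have r: "real_of_int a * real_of_int d - real_of_int b * real_of_int c = 1"
    using assms by (metis of_int_1 of_int_diff of_int_mult)
  have "Im (moebius_action a b c d z) = (Im z * (real_of_int a * real_of_int d - real_of_int b * real_of_int c)) / (norm (of_int c * z + of_int d))\<^sup>2"
    unfolding moebius_action_def Im_divide cmod_power2
    by (simp add: algebra_simps)
  then show ?thesis unfolding r by simp
qed

lemma moebius_action_upper:
  assumes "a * d - b * c = (1::int)" "Im z > 0"
  shows "Im (moebius_action a b c d z) > 0"
  unfolding Im_moebius_action[OF assms(1)]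
  using moebius_action_denom_nonzero[OF assms] assms by simp

lemma moebius_action_compose:
  assumes "of_int c2 * z + of_int d2 \<noteq> 0"
  shows "moebius_action a b c d (moebius_action a2 b2 c2 d2 z) =
    moebius_action (a * a2 + b * c2) (a * b2 + b * d2) (c * a2 + d * c2) (c * b2 + d * d2) z"
proof -
  define p where "p = of_int a2 * z + of_int b2"
  define q where "q = of_int c2 * z + of_int d2"
  have q: "q \<noteq> 0" using assms by (simp add: q_def)
  have "moebius_action a b c d (moebius_action a2 b2 c2 d2 z) = (of_int a * (p / q) + of_int b) / (of_int c * (p / q) + of_int d)"
    by (simp add: moebius_action_def p_def q_def)
  also have "\<dots> = ((of_int a * (p / q) + of_int b) * q) / ((of_int c * (p / q) + of_int d) * q)" using q by simp
  also have "\<dots> = (of_int a * p + of_int b * q) / (of_int c * p + of_int d * q)" using q by (simp add: distrib_right)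
  also have "\<dots> = moebius_action (a * a2 + b * c2) (a * b2 + b * d2) (c * a2 + d * c2) (c * b2 + d * d2) z"
    by (simp add: moebius_action_def p_def q_def algebra_simps)
  finally show ?thesis .
qed

text \<open>Coprimality excludes the value 0 of each Legendre symbol, leaving only signs.\<close>

lemma shimura_symbol_square:
  assumes "coprime c d"
  shows "(shimura_symbol c d)\<^sup>2 = 1"
proof -
  have P: "(prod_mset (image_mset (\<lambda>p. Legendre c (int p)) M))\<^sup>2 = 1" if "\<forall>p\<in>#M. (Legendre c (int p))\<^sup>2 = 1" for M
    using that by (induction M) (auto simp: power_mult_distrib)
  have "(Legendre c (int p))\<^sup>2 = 1" if p: "p \<in># prime_factorization (nat \<bar>d\<bar>)" for p
  proof -
    have pp: "prime p" "p dvd nat \<bar>d\<bar>" using p by auto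
    then have "int p dvd d" by (metis int_dvd_int_iff dvd_abs_iff int_nat_eq abs_ge_zero nat_0_le)
    then have "\<not> int p dvd c"
      using assms pp(1) by (metis coprime_common_divisor prime_nat_int_transfer not_prime_unit)
    then show ?thesis by (simp add: Legendre_def cong_0_iff)
  qed
  then show ?thesis by (simp add: shimura_symbol_def power_mult_distrib P)
qed

lemma theta_multiplier_power4:
  assumes "coprime c d"
  shows "theta_multiplier c d z ^ 4 = (of_int c * z + of_int d)\<^sup>2"
proof -
  have "(of_int (shimura_symbol c d) :: complex) ^ 4 = of_int ((shimura_symbol c d)\<^sup>2 ^ 2)" by simp
  also have "\<dots> = 1" unfolding shimura_symbol_square[OF assms] by simp
  finally have 1: "(of_int (shimura_symbol c d) :: complex) ^ 4 = 1" .
  have 2: "eps_factor d ^ 4 = 1" by (simp add: eps_factor_def)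
  have "csqrt u ^ 4 = (csqrt u ^ 2) ^ 2" for u by (simp only: power_mult[symmetric]) simp
  then have 3: "csqrt u ^ 4 = u\<^sup>2" for u by (simp only: power2_csqrt)
  show ?thesis by (simp add: theta_multiplier_def power_mult_distrib power_divide 1 2 3)
qed

lemma dirichlet_character_eq_1:
  assumes "dirichlet_character N \<psi>" "int N dvd d - 1"
  shows "\<psi> d = 1"
proof -
  have per: "\<psi> (m + int N) = \<psi> m" for m using assms by (simp add: dirichlet_character_def)
  have nat: "\<psi> (m + int N * int n) = \<psi> m" for m n
  proof (induction n)
    case (Suc n)
    have "\<psi> (m + int N * int (Suc n)) = \<psi> ((m + int N * int n) + int N)" by (simp add: algebra_simps)
    then show ?case using per Suc by simp
  qed simp
  obtain j where j: "d = 1 + int N * j" using assms(2) by (metis dvd_def add.commute diff_add_cancel)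
  have "\<psi> d = \<psi> 1"
  proof (cases "j \<ge> 0")
    case True
    then show ?thesis using nat[of 1 "nat j"] j by simp
  next
    case False
    then show ?thesis using nat[of d "nat (- j)"] j by simp
  qed
  then show ?thesis using assms by (simp add: dirichlet_character_def)
qed

lemma power_times_exp_bounded:
  fixes c :: real
  assumes "c > 0" "k > 0"
  shows "\<exists>K. \<forall>y\<ge>0. y ^ k * exp (- (c * y)) \<le> K"
proof (intro exI allI impI)
  fix y :: real assume y: "y \<ge> 0"
  have "(c * y / real k) ^ k \<le> (1 + c * y / real k) ^ k" using assms y by (intro power_mono) auto
  also have "\<dots> \<le> exp (c * y)" 
    by (rule exp_ge_one_plus_x_over_n_power_n) (use assms y in \<open>auto intro: order_trans[of _ 0]\<close>)
  finally have "y ^ k * (c / real k) ^ k \<le> exp (c * y)" by (simp add: power_mult_distrib power_divide mult_ac)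
  then have "y ^ k \<le> exp (c * y) / (c / real k) ^ k" using assms by (simp add: pos_le_divide_eq)
  then have "y ^ k * exp (- (c * y)) \<le> exp (c * y) / (c / real k) ^ k * exp (- (c * y))"
    by (rule mult_right_mono) simp
  also have "\<dots> = 1 / (c / real k) ^ k" by (simp add: exp_minus field_simps)
  finally show "y ^ k * exp (- (c * y)) \<le> 1 / (c / real k) ^ k" .
qed

text \<open>Dirichlet approximation of the real part replaces the fundamental domain.\<close>
lemma exists_SL2_translate_high:
  assumes y: "Im z > 0"
  shows "\<exists>a b c d. a * d - b * c = (1::int) \<and> Im (moebius_action a b c d z) \<ge> 1 / 5"
proof (cases "Im z \<ge> 1 / 5")
  case True
  then show ?thesis by (intro exI[of _ 1] exI[of _ 0]) (simp add: moebius_action_def)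
next
  case False
  \<comment> \<open>With y = Im z and denominators k up to Q, the floor of y^(-1/2), approximation
    gives |k x - h|^2 <= (2/r)^2 = 4y and (k y)^2 <= y. Hence |kz - h|^2 <= 5y, the source of 1/5;
    Bezout completes the lower row (k, -h) to a matrix of determinant 1.\<close>
  define r where "r = 1 / sqrt (Im z)"
  have rr: "r\<^sup>2 = 1 / Im z" using y by (simp add: r_def power_divide)
  have r2: "r \<ge> 2"
  proof (rule power2_le_imp_le)
    show "2\<^sup>2 \<le> r\<^sup>2" unfolding rr using False y by (simp add: field_simps)
  qed (use y in \<open>simp add: r_def\<close>)
  define Q where "Q = nat \<lfloor>r\<rfloor>"
  have Q: "real Q \<le> r" "real Q > r - 1" using r2 unfolding Q_def by (auto simp: of_nat_nat)
  have Q0: "Q > 0" using Q r2 by (cases Q) auto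
  obtain h k where hk: "coprime h k" "0 < k" "k \<le> int Q" "\<bar>of_int k * Re z - of_int h\<bar> < 1 / Q"
    using Dirichlet_approx_coprime[OF Q0] by metis
  obtain u v where uv: "u * k + v * h = 1" using hk(1) bezout_int[of k h] by (metis coprime_commute coprime_imp_gcd_eq_1)
  have det': "(- v) * (- h) - (- u) * k = 1" using uv by (simp add: algebra_simps)
  have "(norm (of_int k * z + of_int (- h)))\<^sup>2 = (of_int k * Re z - of_int h)\<^sup>2 + (of_int k * Im z)\<^sup>2"
    by (simp add: cmod_power2)
  also have "(of_int k * Re z - of_int h)\<^sup>2 \<le> (2 / r)\<^sup>2"
  proof -
    have "\<bar>of_int k * Re z - of_int h\<bar> \<le> 1 / Q" using hk by simp
    also have "\<dots> \<le> 2 / r" using Q r2 Q0 by (simp add: field_simps)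
    finally have "\<bar>of_int k * Re z - of_int h\<bar> \<le> \<bar>2 / r\<bar>" using r2 by simp
    then show ?thesis by (rule abs_le_square_iff[THEN iffD1])
  qed
  also have "(2 / r)\<^sup>2 = 4 * Im z" by (simp add: power_divide rr)
  also have "(of_int k * Im z)\<^sup>2 \<le> (r * Im z)\<^sup>2"
  proof (rule power_mono)
    have "real_of_int k \<le> r" using hk Q by linarith
    then show "of_int k * Im z \<le> r * Im z" using y by (intro mult_right_mono) auto
  qed (use hk y in simp)
  also have "(r * Im z)\<^sup>2 = Im z" unfolding power_mult_distrib rr using y by (simp add: power2_eq_square)
  finally have n: "(norm (of_int k * z + of_int (- h)))\<^sup>2 \<le> 5 * Im z" by simp
  have "of_int k * z + of_int (- h) \<noteq> 0" by (rule moebius_action_denom_nonzero[OF det' y])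
  then have "1 / 5 \<le> Im z / (norm (of_int k * z + of_int (- h)))\<^sup>2"
    using n y by (simp add: field_simps)
  then have "Im (moebius_action (- v) (- u) k (- h) z) \<ge> 1 / 5" unfolding Im_moebius_action[OF det'] .
  then show ?thesis using det' by blast
qed

lemma filterlim_of_nat_mult_Im:
  assumes "N > 0"
  shows "filterlim (\<lambda>z. of_nat N * z) (filtercomap Im at_top) (filtercomap Im at_top)"
  unfolding filterlim_filtercomap_iff o_def
  by (rule filterlim_cong[OF refl refl, THEN iffD2, rotated],
      rule filterlim_tendsto_pos_mult_at_top[OF tendsto_const[of "real N"] _ filterlim_filtercomap])
    (use assms in auto)

locale half_integral_cusp_form =
  fixes k N :: nat and \<psi> :: "int \<Rightarrow> complex" and f :: "complex \<Rightarrow> complex"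
  assumes cusp: "cusp_form k N \<psi> f" and chr: "dirichlet_character N \<psi>" and N0: "N > 0" and k0: "k > 0"
begin

lemma hol: "f holomorphic_on {z. Im z > 0}"
  and law: "\<lbrakk>a * d - b * c = 1; int N dvd c; Im z > 0\<rbrakk> \<Longrightarrow> f (moebius_action a b c d z) = \<psi> d * theta_multiplier c d z ^ k * f z"
  and vanishes_at_cusps: "a * d - b * c = 1 \<Longrightarrow>
    ((\<lambda>z. f (moebius_action a b c d z) / csqrt (of_int c * z + of_int d) ^ k) \<longlongrightarrow> 0) (filtercomap Im at_top)"
  using cusp unfolding cusp_form_def by blast+

text \<open>The fourth power removes the character values, the theta multipliers and the branch of the square root.\<close>
definition slash4 :: "int \<Rightarrow> int \<Rightarrow> int \<Rightarrow> int \<Rightarrow> complex \<Rightarrow> complex" where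
  "slash4 a b c d z = f (moebius_action a b c d z) ^ 4 / (of_int c * z + of_int d) ^ (2 * k)"

lemma law_power4:
  assumes "a * d - b * c = 1" "int N dvd c" "int N dvd d - 1" "Im z > 0"
  shows "f (moebius_action a b c d z) ^ 4 = (of_int c * z + of_int d) ^ (2 * k) * f z ^ 4"
proof -
  have "coprime c d"
  proof (rule coprimeI)
    fix e assume "e dvd c" "e dvd d"
    then have "e dvd a * d - b * c" by simp
    then show "is_unit e" using assms(1) by simp
  qed
  then have "(theta_multiplier c d z ^ k) ^ 4 = (of_int c * z + of_int d) ^ (2 * k)"
    by (metis theta_multiplier_power4 power_mult mult.commute)
  then show ?thesis
    using law[OF assms(1,2,4)] dirichlet_character_eq_1[OF chr assms(3)] by (simp add: power_mult_distrib)
qed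

text \<open>Matrices congruent modulo N differ by a left factor congruent to the identity, under
  which the fourth power transforms without any multiplier. So \<open>slash4\<close> takes only
  finitely many values as a function of the matrix.\<close>

lemma slash4_cong:
  assumes d1: "a * d - b * c = 1" and d2: "a' * d' - b' * c' = 1" and z: "Im z > 0"
    and cg: "a mod int N = a' mod int N" "b mod int N = b' mod int N" "c mod int N = c' mod int N" "d mod int N = d' mod int N"
  shows "slash4 a' b' c' d' z = slash4 a b c d z"
proof -
  \<comment> \<open>The entries of the primed matrix times the inverse of the unprimed one.\<close>
  define A B C D where "A = a' * d - b' * c" and "B = b' * a - a' * b" and "C = c' * d - d' * c" and "D = d' * a - c' * b"
  have mod: "[a = a'] (mod int N)" "[b = b'] (mod int N)" "[c = c'] (mod int N)" "[d = d'] (mod int N)" using cg by (simp_all add: cong_def)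
  have "[c' * d - d' * c = c * d - d * c] (mod int N)"
    by (intro cong_diff cong_mult mod cong_refl mod[THEN cong_sym])
  then have C: "int N dvd C" by (simp add: C_def cong_0_iff)
  have "[d' * a - c' * b = d * a - c * b] (mod int N)"
    by (intro cong_diff cong_mult mod cong_refl mod[THEN cong_sym])
  moreover have "d * a - c * b = 1" using d1 by (simp add: mult.commute)
  ultimately have D: "int N dvd D - 1" by (simp add: D_def cong_iff_dvd_diff)
  have "A * D - B * C = (a' * d' - b' * c') * (a * d - b * c)"
    unfolding A_def B_def C_def D_def by (simp add: algebra_simps)
  then have det: "A * D - B * C = 1" using d1 d2 by simp
  define w where "w = moebius_action a b c d z"
  have w: "Im w > 0" unfolding w_def by (rule moebius_action_upper[OF d1 z])
  have nz: "of_int c * z + of_int d \<noteq> 0" by (rule moebius_action_denom_nonzero[OF d1 z])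
  have nz': "of_int c' * z + of_int d' \<noteq> 0" by (rule moebius_action_denom_nonzero[OF d2 z])
  have e: "A * a + B * c = a' * (a * d - b * c)" "A * b + B * d = b' * (a * d - b * c)"
    "C * a + D * c = c' * (a * d - b * c)" "C * b + D * d = d' * (a * d - b * c)"
    unfolding A_def B_def C_def D_def by (simp_all add: algebra_simps)
  have e1: "A * a + B * c = a'" "A * b + B * d = b'" "C * a + D * c = c'" "C * b + D * d = d'"
    unfolding e d1 by simp_all
  have m: "moebius_action A B C D w = moebius_action a' b' c' d' z"
    unfolding w_def moebius_action_compose[OF nz] e1 ..
  have "(of_int C * w + of_int D) * (of_int c * z + of_int d) = of_int C * (of_int a * z + of_int b) + of_int D * (of_int c * z + of_int d)"
    unfolding w_def moebius_action_def using nz by (simp add: distrib_right)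
  also have "\<dots> = of_int (C * a + D * c) * z + of_int (C * b + D * d)" by (simp add: algebra_simps)
  also have "\<dots> = of_int c' * z + of_int d'" unfolding e1 ..
  finally have j: "of_int C * w + of_int D = (of_int c' * z + of_int d') / (of_int c * z + of_int d)"
    using nz by (simp add: field_simps)
  have "f (moebius_action a' b' c' d' z) ^ 4 = ((of_int c' * z + of_int d') / (of_int c * z + of_int d)) ^ (2 * k) * f w ^ 4"
    using law_power4[OF det C D w] unfolding m j .
  then show ?thesis using nz nz' unfolding slash4_def w_def[symmetric]
    by (simp add: power_divide)
qed

text \<open>Translation by N fixes the class of the matrix modulo N, so z -> Nz yields period 1.
  Vanishing at the cusp then gives a Fourier expansion without constant term, and its exponential
  decay beats the power of Im z.\<close>

lemma slash4_bound:
  assumes det: "a * d - b * c = 1"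
  shows "\<exists>B. \<forall>z. Im z \<ge> 1 / 5 \<longrightarrow> norm (slash4 a b c d z) * Im z ^ k \<le> B"
proof -
  define F where "F z = slash4 a b c d (of_nat N * z)" for z
  have up: "Im (of_nat N * z) > 0" if "Im z > 0" for z using that N0 by simp
  have "F holomorphic_on {z. Im z > 0}"
  proof -
    have "(f \<circ> (\<lambda>z. moebius_action a b c d (of_nat N * z))) holomorphic_on {z. Im z > 0}"
    proof (rule holomorphic_on_compose_gen[OF _ hol])
      show "(\<lambda>z. moebius_action a b c d (of_nat N * z)) holomorphic_on {z. Im z > 0}"
        unfolding moebius_action_def using moebius_action_denom_nonzero[OF det up] by (intro holomorphic_intros) auto
    qed (use moebius_action_upper[OF det up] in auto)
    then show ?thesis unfolding F_def slash4_def o_def using moebius_action_denom_nonzero[OF det up]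
      by (intro holomorphic_intros) auto
  qed
  moreover have "F (z + 1) = F z" if z: "Im z > 0" for z
  proof -
    have 1: "moebius_action a b c d (of_nat N * (z + 1)) = moebius_action a (b + a * int N) c (d + c * int N) (of_nat N * z)"
      by (simp add: moebius_action_def algebra_simps)
    have 2: "of_int c * (of_nat N * (z + 1)) + of_int d = of_int c * (of_nat N * z) + of_int (d + c * int N)"
      by (simp add: algebra_simps)
    have "F (z + 1) = slash4 a (b + a * int N) c (d + c * int N) (of_nat N * z)"
      unfolding F_def slash4_def 1 2 ..
    also have "\<dots> = F z" unfolding F_def
      by (rule slash4_cong[OF det _ up[OF z]]) (use det in \<open>auto simp: algebra_simps\<close>)
    finally show ?thesis .
  qed
  moreover have "(F \<longlongrightarrow> 0) (filtercomap Im at_top)"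
  proof -
    have "((\<lambda>z. (f (moebius_action a b c d z) / csqrt (of_int c * z + of_int d) ^ k) ^ 4) \<longlongrightarrow> 0 ^ 4) (filtercomap Im at_top)"
      by (intro tendsto_power vanishes_at_cusps det)
    moreover have "(f (moebius_action a b c d z) / csqrt (of_int c * z + of_int d) ^ k) ^ 4 = slash4 a b c d z" for z
    proof -
      have "(csqrt u ^ k) ^ 4 = ((csqrt u ^ 2) ^ 2) ^ k" for u by (simp only: power_mult[symmetric]) (simp add: mult.commute)
      then have "(csqrt u ^ k) ^ 4 = u ^ (2 * k)" for u by (simp add: power_mult)
      then show ?thesis by (simp add: slash4_def power_divide)
    qed
    ultimately have "(slash4 a b c d \<longlongrightarrow> 0) (filtercomap Im at_top)" by simp
    from filterlim_compose[OF this filterlim_of_nat_mult_Im[OF N0]] show ?thesis by (simp add: F_def[abs_def])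
  qed
  ultimately obtain b' where "b' 0 = 0" "q_expansion b' F" using fourier_expansion_exists by blast
  then obtain C where C: "norm (F z) \<le> C * exp (- 2 * pi * Im z)" if "Im z \<ge> 1 / (5 * real N)" for z
    using q_expansion_exp_decay[of b' F "1 / (5 * real N)"] N0 by auto
  obtain K where K: "y ^ k * exp (- (2 * pi / real N * y)) \<le> K" if "y \<ge> 0" for y
    using power_times_exp_bounded[of "2 * pi / real N" k] N0 k0 by auto
  have C0: "C \<ge> 0"
  proof -
    have "0 \<le> norm (F \<i>)" by simp
    also have "\<dots> \<le> C * exp (- 2 * pi)" using C[of \<i>] N0 by simp
    finally show ?thesis by (simp add: zero_le_mult_iff)
  qed
  have "norm (slash4 a b c d z) * Im z ^ k \<le> C * K" if z: "Im z \<ge> 1 / 5" for z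
  proof -
    have "slash4 a b c d z = F (z / of_nat N)" using N0 by (simp add: F_def)
    moreover have "norm (F (z / of_nat N)) \<le> C * exp (- 2 * pi * Im (z / of_nat N))"
      by (rule C) (use z N0 in \<open>simp add: field_simps\<close>)
    ultimately have "norm (slash4 a b c d z) \<le> C * exp (- (2 * pi / real N * Im z))" by (simp add: mult_ac)
    then have "norm (slash4 a b c d z) * Im z ^ k \<le> C * exp (- (2 * pi / real N * Im z)) * Im z ^ k"
      by (rule mult_right_mono) (use z in simp)
    also have "\<dots> = C * (Im z ^ k * exp (- (2 * pi / real N * Im z)))" by (simp add: mult_ac)
    also have "\<dots> \<le> C * K" using K[of "Im z"] z C0 by (intro mult_left_mono) auto
    finally show ?thesis .
  qed
  then show ?thesis by blast
qed

text \<open>Only finitely many residue classes of matrices modulo N occur; \<open>R\<close> holds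
  one representative or more of each, and the sum of their bounds serves for all.\<close>

lemma translates_uniformly_bounded:
  "\<exists>B. \<forall>a b c d z. a * d - b * c = 1 \<longrightarrow> Im z \<ge> 1 / 5 \<longrightarrow> norm (slash4 a b c d z) * Im z ^ k \<le> B"
proof -
  define S :: "(int \<times> int \<times> int \<times> int) set" where "S = {(a, b, c, d). a * d - b * c = 1}"
  define cls where "cls = (\<lambda>(a, b, c, d). (a mod int N, b mod int N, c mod int N, d mod int N))"
  define bound where "bound = (\<lambda>(a, b, c, d) B. \<forall>z. Im z \<ge> 1 / 5 \<longrightarrow> norm (slash4 a b c d z) * Im z ^ k \<le> B)"
  have "\<exists>B. bound \<gamma> B" if "\<gamma> \<in> S" for \<gamma>
    using that slash4_bound by (auto simp: S_def bound_def)
  then obtain Bd where Bd: "bound \<gamma> (Bd \<gamma>)" if "\<gamma> \<in> S" for \<gamma> by metis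
  have "cls ` S \<subseteq> {0..<int N} \<times> {0..<int N} \<times> {0..<int N} \<times> {0..<int N}" using N0 by (auto simp: cls_def)
  then have "finite (cls ` S)" by (rule finite_subset) simp
  then obtain R where R: "R \<subseteq> S" "finite R" "cls ` S = cls ` R" using finite_subset_image[of "cls ` S" cls S] by blast
  have "norm (slash4 a b c d z) * Im z ^ k \<le> (\<Sum>\<gamma>\<in>R. \<bar>Bd \<gamma>\<bar>)" if det: "a * d - b * c = 1" and z: "Im z \<ge> 1 / 5" for a b c d z
  proof -
    have "cls (a, b, c, d) \<in> cls ` R" using det R(3) by (auto simp: S_def)
    then obtain a' b' c' d' where r: "(a', b', c', d') \<in> R" and e: "cls (a, b, c, d) = cls (a', b', c', d')" by auto
    have r': "(a', b', c', d') \<in> S" using r R by auto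
    have "slash4 a b c d z = slash4 a' b' c' d' z"
      by (rule slash4_cong) (use e r' det z in \<open>auto simp: cls_def S_def\<close>)
    then have "norm (slash4 a b c d z) * Im z ^ k \<le> Bd (a', b', c', d')" using Bd[OF r'] z by (simp add: bound_def)
    also have "\<dots> \<le> \<bar>Bd (a', b', c', d')\<bar>" by simp
    also have "\<dots> \<le> (\<Sum>\<gamma>\<in>R. \<bar>Bd \<gamma>\<bar>)" by (rule member_le_sum[OF r]) (use R in auto)
    finally show ?thesis .
  qed
  then show ?thesis by blast
qed

text \<open>Move z to a point w with Im w >= 1/5 and return by the inverse matrix: the automorphy
  factor in Im z cancels that in \<open>slash4\<close>, so the quantity equals the bounded one at
  w.\<close>

lemma invariant_bounded:
  "\<exists>B. \<forall>z. Im z > 0 \<longrightarrow> norm (f z) ^ 4 * Im z ^ k \<le> B"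
proof -
  obtain B where B: "norm (slash4 a b c d z) * Im z ^ k \<le> B" if "a * d - b * c = 1" "Im z \<ge> 1 / 5" for a b c d z
    using translates_uniformly_bounded by blast
  have "norm (f z) ^ 4 * Im z ^ k \<le> B" if z: "Im z > 0" for z
  proof -
    obtain a b c d where det: "a * d - b * c = (1::int)" and hi: "Im (moebius_action a b c d z) \<ge> 1 / 5"
      using exists_SL2_translate_high[OF z] by blast
    define w where "w = moebius_action a b c d z"
    have det': "d * a - (- b) * (- c) = 1" using det by (simp add: mult.commute)
    have nz: "of_int c * z + of_int d \<noteq> 0" by (rule moebius_action_denom_nonzero[OF det z])
    have "moebius_action d (- b) (- c) a w = moebius_action (d * a + - b * c) (d * b + - b * d) (- c * a + a * c) (- c * b + a * d) z"
      unfolding w_def by (rule moebius_action_compose[OF nz])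
    also have "\<dots> = z" using det by (simp add: moebius_action_def algebra_simps)
    finally have zw: "moebius_action d (- b) (- c) a w = z" .
    have w: "Im w > 0" using hi w_def by simp
    have nzw: "of_int (- c) * w + of_int a \<noteq> 0" by (rule moebius_action_denom_nonzero[OF det' w])
    have "Im z = Im w / (norm (of_int (- c) * w + of_int a))\<^sup>2" using Im_moebius_action[OF det', of w] unfolding zw .
    then have "norm (f z) ^ 4 * Im z ^ k = norm (slash4 d (- b) (- c) a w) * Im w ^ k"
      unfolding slash4_def zw by (simp add: norm_divide norm_power power_divide power_mult)
    also have "\<dots> \<le> B" by (rule B[OF det']) (use hi w_def in simp)
    finally show ?thesis .
  qed
  then show ?thesis by blast
qed

end

section \<open>Mean square bounds for coefficients\<close>

text \<open>Orthogonality of the P-th roots of unity: a geometric sum of a nontrivial root over a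
  full period vanishes.\<close>

lemma finite_parseval:
  fixes c :: "nat \<Rightarrow> complex"
  assumes P: "P > 0"
  shows "(\<Sum>j<P. (norm (\<Sum>n<P. c n * exp (2 * of_real pi * \<i> * of_nat n / of_nat P) ^ j))\<^sup>2) = real P * (\<Sum>n<P. (norm (c n))\<^sup>2)"
proof -
  define \<zeta> where "\<zeta> n = exp (2 * of_real pi * \<i> * of_nat n / of_nat P)" for n
  have nz: "norm (\<zeta> n) = 1" for n unfolding \<zeta>_def norm_exp_eq_Re by (simp add: Re_divide_of_nat)
  have zP: "\<zeta> n ^ P = 1" for n
  proof -
    have "\<zeta> n ^ P = exp (2 * of_real pi * \<i> * of_nat n)" unfolding \<zeta>_def exp_of_nat_mult[symmetric] using P by simp
    then show ?thesis by (auto simp: exp_eq_1 intro!: exI[of _ "int n"])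
  qed
  have orth: "(\<Sum>j<P. (\<zeta> n * cnj (\<zeta> m)) ^ j) = (if n = m then of_nat P else 0)" if "n < P" "m < P" for n m
  proof (cases "n = m")
    case True
    have "\<zeta> n * cnj (\<zeta> n) = 1" using nz[of n] by (simp add: complex_norm_square[symmetric])
    then show ?thesis using True by simp
  next
    case False
    have "\<zeta> n \<noteq> \<zeta> m"
      unfolding \<zeta>_def using complex_root_unity_eq[of P n m] P that False by simp
    moreover have "\<zeta> n * cnj (\<zeta> m) = 1 \<Longrightarrow> \<zeta> n = \<zeta> m"
    proof -
      assume 1: "\<zeta> n * cnj (\<zeta> m) = 1"
      have "cnj (\<zeta> m) * \<zeta> m = 1" using nz[of m] by (simp add: complex_norm_square[symmetric] mult.commute)
      then have "\<zeta> n = \<zeta> n * (cnj (\<zeta> m) * \<zeta> m)" by simp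
      also have "\<dots> = \<zeta> m" using 1 by (simp add: mult.assoc[symmetric])
      finally show ?thesis .
    qed
    ultimately have "\<zeta> n * cnj (\<zeta> m) \<noteq> 1" by blast
    moreover have "(\<zeta> n * cnj (\<zeta> m)) ^ P = 1" using zP by (simp add: power_mult_distrib flip: complex_cnj_power)
    ultimately show ?thesis using False by (simp add: sum_gp_strict)
  qed
  have "complex_of_real (\<Sum>j<P. (norm (\<Sum>n<P. c n * \<zeta> n ^ j))\<^sup>2) =
      (\<Sum>j<P. \<Sum>n<P. \<Sum>m<P. c n * cnj (c m) * (\<zeta> n * cnj (\<zeta> m)) ^ j)"
    unfolding of_real_sum complex_norm_square cnj_sum sum_product
    by (intro sum.cong refl) (simp add: power_mult_distrib mult_ac)
  also have "\<dots> = (\<Sum>n<P. \<Sum>j<P. \<Sum>m<P. c n * cnj (c m) * (\<zeta> n * cnj (\<zeta> m)) ^ j)"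
    by (rule sum.swap)
  also have "\<dots> = (\<Sum>n<P. \<Sum>m<P. \<Sum>j<P. c n * cnj (c m) * (\<zeta> n * cnj (\<zeta> m)) ^ j)"
    by (intro sum.cong refl sum.swap)
  also have "\<dots> = (\<Sum>n<P. \<Sum>m<P. if n = m then c n * cnj (c m) * of_nat P else 0)"
    by (intro sum.cong refl) (simp add: sum_distrib_left[symmetric] orth)
  also have "\<dots> = (\<Sum>n<P. c n * cnj (c n) * of_nat P)" by (intro sum.cong refl) simp
  also have "\<dots> = complex_of_real (real P * (\<Sum>n<P. (norm (c n))\<^sup>2))"
    unfolding of_real_mult of_real_sum complex_norm_square by (simp add: sum_distrib_left mult_ac)
  finally show ?thesis unfolding \<zeta>_def of_real_eq_iff .
qed

text \<open>
  Averaging over the points \<open>j/P + \<i>y\<close> with \<open>P \<rightarrow> \<infinity>\<close> gives Bessel's inequality without integration.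
\<close>
lemma q_expansion_bessel:
  assumes q: "q_expansion b F" and y: "y > 0" and C: "\<And>z. Im z = y \<Longrightarrow> (norm (F z))\<^sup>2 \<le> C"
  shows "(\<Sum>n<X. (norm (b n))\<^sup>2 * exp (- 4 * pi * y * real n)) \<le> C"
proof -
  define c where "c n = b n * of_real (exp (- 2 * pi * y) ^ n)" for n
  have sc: "summable (\<lambda>n. norm (c n))" using q_expansion_abs_summable[OF q y] by (simp add: c_def norm_mult norm_power)
  have c2: "(norm (c n))\<^sup>2 = (norm (b n))\<^sup>2 * exp (- 4 * pi * y * real n)" for n
  proof -
    have "(exp (- 2 * pi * y) ^ n)\<^sup>2 = exp (- 4 * pi * y * real n)"
      by (simp add: exp_of_nat_mult[symmetric] power2_eq_square exp_add[symmetric])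
    then show ?thesis by (simp add: c_def norm_mult norm_power power_mult_distrib)
  qed
  have C0: "C \<ge> 0" using C[of "\<i> * of_real y"] by (simp add: order_trans[OF zero_le_power2])
  define S where "S = (\<Sum>n<X. (norm (c n))\<^sup>2)"
  have S0: "S \<ge> 0" by (simp add: S_def sum_nonneg)
  have "sqrt S \<le> sqrt C + r" if r: "r > 0" for r
  proof -
    obtain N where N: "norm (\<Sum>i. norm (c (i + n))) < r" if "n \<ge> N" for n
      using suminf_exist_split[OF r sc] by blast
    \<comment> \<open>Beyond \<open>N\<close> the tail is below r at every sample point
      simultaneously, and beyond \<open>X\<close> the required partial sum is part of the Parseval
      identity.\<close>
    define P where "P = Max {N, X, 1}"
    have P: "P \<ge> N" "P \<ge> X" "P > 0" by (auto simp: P_def)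
    have pt: "(norm (\<Sum>n<P. c n * exp (2 * of_real pi * \<i> * of_nat n / of_nat P) ^ j))\<^sup>2 \<le> (sqrt C + r)\<^sup>2" for j
    proof -
      define z where "z = of_real (real j / real P) + \<i> * of_real y"
      have im: "Im z = y" by (simp add: z_def)
      define e where "e n = exp (2 * of_real pi * \<i> * of_nat n / of_nat P :: complex) ^ j" for n
      have ne: "norm (e n) = 1" for n unfolding e_def norm_power norm_exp_eq_Re by (simp add: Re_divide_of_nat)
      have t: "b n * exp (2 * of_real pi * \<i> * of_nat n * z) = c n * e n" for n
      proof -
        have "2 * of_real pi * \<i> * of_nat n * z = of_nat n * of_real (- 2 * pi * y) + of_nat j * (2 * of_real pi * \<i> * of_nat n / of_nat P)"
          unfolding z_def by (simp add: algebra_simps)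
        then show ?thesis unfolding c_def e_def by (simp only: exp_add exp_of_nat_mult exp_of_real of_real_power mult.assoc)
      qed
      have F: "(\<lambda>n. c n * e n) sums F z" using q y im unfolding q_expansion_def by (auto simp flip: t)
      have se: "summable (\<lambda>n. norm (c n * e n))" using sc by (simp add: norm_mult ne)
      have "F z = (\<Sum>n. c (n + P) * e (n + P)) + (\<Sum>n<P. c n * e n)"
        using F suminf_split_initial_segment[of "\<lambda>n. c n * e n" P] by (simp add: sums_iff)
      then have "(\<Sum>n<P. c n * e n) = F z - (\<Sum>n. c (n + P) * e (n + P))" by simp
      then have "norm (\<Sum>n<P. c n * e n) \<le> norm (F z) + norm (\<Sum>n. c (n + P) * e (n + P))"
        by (metis norm_triangle_ineq4)
      also have "norm (\<Sum>n. c (n + P) * e (n + P)) \<le> (\<Sum>n. norm (c (n + P) * e (n + P)))"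
        by (rule summable_norm) (rule summable_ignore_initial_segment[OF se])
      also have "\<dots> \<le> r" using N[OF P(1)] by (simp add: norm_mult ne)
      also have "norm (F z) \<le> sqrt C" using C[OF im] by (rule real_le_rsqrt)
      finally have "norm (\<Sum>n<P. c n * e n) \<le> sqrt C + r" by simp
      then show ?thesis unfolding e_def by (rule power_mono) simp
    qed
    have "real P * (\<Sum>n<P. (norm (c n))\<^sup>2) \<le> (\<Sum>j<P. (sqrt C + r)\<^sup>2)"
      unfolding finite_parseval[OF P(3), symmetric] by (rule sum_mono) (rule pt)
    then have "(\<Sum>n<P. (norm (c n))\<^sup>2) \<le> (sqrt C + r)\<^sup>2" using P by simp
    moreover have "S \<le> (\<Sum>n<P. (norm (c n))\<^sup>2)" unfolding S_def by (rule sum_mono2) (use P in auto)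
    ultimately have "S \<le> (sqrt C + r)\<^sup>2" by simp
    then show ?thesis using r C0 by (intro real_le_lsqrt) auto
  qed
  then have "sqrt S \<le> sqrt C" by (rule field_le_epsilon)
  then show ?thesis by (simp add: S_def c2)
qed

text \<open>Dyadic summation by blocks from 2^J to 2^(J+1): the block sums decrease geometrically
  with ratio q = 2^(\<kappa> - \<tau>).\<close>

lemma summable_of_power_partial_sums:
  fixes a :: "nat \<Rightarrow> real"
  assumes nonneg: "\<And>n. a n \<ge> 0" and part: "\<And>X. X \<ge> 1 \<Longrightarrow> (\<Sum>n<X. a n) \<le> K * real X powr \<kappa>"
    and \<tau>: "\<tau> > \<kappa>" "\<kappa> \<ge> 0"
  shows "summable (\<lambda>n. a n * real n powr (- \<tau>))"
proof (rule summableI_nonneg_bounded)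
  define q where "q = (2::real) powr (\<kappa> - \<tau>)"
  have q: "0 < q" "q < 1" using \<tau> by (auto simp: q_def intro: powr_less_one)
  have K0: "K \<ge> 0" using part[of 1] nonneg[of 0] by simp
  have dy: "(\<Sum>n<2 ^ J. a n * real n powr (- \<tau>)) \<le> K * 2 powr \<kappa> * (\<Sum>j<J. q ^ j)" for J
  proof (induction J)
    case (Suc J)
    have "(\<Sum>n<2 ^ Suc J. a n * real n powr (- \<tau>)) = (\<Sum>n<2 ^ J. a n * real n powr (- \<tau>)) + (\<Sum>n=2 ^ J..<2 ^ Suc J. a n * real n powr (- \<tau>))"
      unfolding lessThan_atLeast0 by (rule sum.atLeastLessThan_concat[symmetric]) auto
    also have "(\<Sum>n=2 ^ J..<2 ^ Suc J. a n * real n powr (- \<tau>)) \<le> (\<Sum>n=2 ^ J..<2 ^ Suc J. a n * real (2 ^ J) powr (- \<tau>))"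
    proof (intro sum_mono mult_left_mono nonneg powr_mono2')
      fix n :: nat assume "n \<in> {2 ^ J..<2 ^ Suc J}"
      then have "2 ^ J \<le> n" by simp
      then show "real (2 ^ J) \<le> real n" by (simp only: of_nat_le_iff)
    qed (use \<tau> in auto)
    also have "\<dots> = (\<Sum>n=2 ^ J..<2 ^ Suc J. a n) * real (2 ^ J) powr (- \<tau>)" by (simp add: sum_distrib_right)
    also have "(\<Sum>n=2 ^ J..<2 ^ Suc J. a n) \<le> (\<Sum>n<2 ^ Suc J. a n)" by (rule sum_mono2) (auto intro: nonneg)
    also have "(\<Sum>n<2 ^ Suc J. a n) \<le> K * real (2 ^ Suc J) powr \<kappa>" by (rule part) simp
    also have "K * real (2 ^ Suc J) powr \<kappa> * real (2 ^ J) powr (- \<tau>) = K * 2 powr \<kappa> * q ^ J"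
      by (simp add: q_def powr_realpow[symmetric] powr_powr powr_mult powr_add[symmetric] algebra_simps del: powr_realpow)
    finally show ?case using Suc by (simp add: distrib_left mult_right_mono)
  qed simp
  fix n
  show "0 \<le> a n * real n powr (- \<tau>)" by (simp add: nonneg)
  have "(\<Sum>n<n. a n * real n powr (- \<tau>)) \<le> (\<Sum>n<2 ^ n. a n * real n powr (- \<tau>))"
    by (rule sum_mono2) (auto simp: nonneg intro: less_trans less_exp)
  also have "\<dots> \<le> K * 2 powr \<kappa> * (\<Sum>j<n. q ^ j)" by (rule dy)
  also have "\<dots> \<le> K * 2 powr \<kappa> * (1 / (1 - q))"
  proof (rule mult_left_mono)
    have "(\<Sum>j<n. q ^ j) \<le> (\<Sum>j. q ^ j)" by (rule sum_le_suminf) (use q in auto)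
    then show "(\<Sum>j<n. q ^ j) \<le> 1 / (1 - q)" using q by (simp add: suminf_geometric)
  qed (use K0 in simp)
  finally show "(\<Sum>n<n. a n * real n powr (- \<tau>)) \<le> K * 2 powr \<kappa> * (1 / (1 - q))" .
qed

text \<open>Bessel's inequality at height 1/X bounds the sum of |b(n)|^2 over n < X by a multiple of
  X^\<kappa>. Splitting n^(-\<sigma>) and using uv <= u^2 + v^2 pairs this with a convergent series
  of n^(-1-\<delta>), which costs half of \<kappa> + 1.\<close>

lemma coefficients_abs_summable:
  assumes q: "q_expansion b F" and \<kappa>: "\<kappa> \<ge> 0"
    and bd: "\<And>z. Im z > 0 \<Longrightarrow> (norm (F z))\<^sup>2 \<le> M * Im z powr (- \<kappa>)"
    and \<sigma>: "\<sigma> > (\<kappa> + 1) / 2"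
  shows "summable (\<lambda>n. norm (b n) * real n powr (- \<sigma>))"
proof -
  define \<delta> where "\<delta> = \<sigma> - (\<kappa> + 1) / 2"
  have \<delta>: "\<delta> > 0" using \<sigma> by (simp add: \<delta>_def)
  have part: "(\<Sum>n<X. (norm (b n))\<^sup>2) \<le> exp (4 * pi) * M * real X powr \<kappa>" if X: "X \<ge> 1" for X
  proof -
    have y: "1 / real X > 0" using X by simp
    have "(\<Sum>n<X. (norm (b n))\<^sup>2 * exp (- 4 * pi * (1 / real X) * real n)) \<le> M * (1 / real X) powr (- \<kappa>)"
      by (rule q_expansion_bessel[OF q y]) (use bd y in metis)
    also have "(1 / real X) powr (- \<kappa>) = real X powr \<kappa>" using X by (simp add: powr_minus powr_divide)
    finally have 1: "(\<Sum>n<X. (norm (b n))\<^sup>2 * exp (- 4 * pi * (1 / real X) * real n)) \<le> M * real X powr \<kappa>" .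
    have "(\<Sum>n<X. (norm (b n))\<^sup>2 * exp (- (4 * pi))) \<le> (\<Sum>n<X. (norm (b n))\<^sup>2 * exp (- 4 * pi * (1 / real X) * real n))"
    proof (intro sum_mono mult_left_mono)
      fix n assume "n \<in> {..<X}"
      then have "real n / real X \<le> 1" by simp
      then have "4 * pi * (real n / real X) \<le> 4 * pi * 1" by (intro mult_left_mono) auto
      then show "exp (- (4 * pi)) \<le> exp (- 4 * pi * (1 / real X) * real n)" by simp
    qed auto
    with 1 have "(\<Sum>n<X. (norm (b n))\<^sup>2) * exp (- (4 * pi)) \<le> M * real X powr \<kappa>" by (simp add: sum_distrib_right)
    then show ?thesis by (simp add: exp_minus field_simps)
  qed
  have s1: "summable (\<lambda>n. (norm (b n))\<^sup>2 * real n powr (- (\<kappa> + \<delta>)))"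
    by (rule summable_of_power_partial_sums[OF _ part]) (use \<delta> \<kappa> in auto)
  have s2: "summable (\<lambda>n. real n powr (- 1 - \<delta>))" using \<delta> by (simp add: summable_real_powr_iff)
  show ?thesis
  proof (rule summable_comparison_test'[OF summable_add[OF s1 s2]])
    fix n
    define u where "u = norm (b n) * real n powr (- (\<kappa> + \<delta>) / 2)"
    define v where "v = real n powr ((- 1 - \<delta>) / 2)"
    have "- \<sigma> = - (\<kappa> + \<delta>) / 2 + (- 1 - \<delta>) / 2" by (simp add: \<delta>_def field_simps)
    then have "norm (b n) * real n powr (- \<sigma>) = u * v" unfolding u_def v_def by (simp only: powr_add mult.assoc)
    moreover have "u * v \<le> u\<^sup>2 + v\<^sup>2"
    proof -
      have "2 * u * v \<le> u\<^sup>2 + v\<^sup>2" using sum_squares_bound[of u v] .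
      moreover have "0 \<le> u * v" by (simp add: u_def v_def)
      ultimately show ?thesis by linarith
    qed
    moreover have "u\<^sup>2 = (norm (b n))\<^sup>2 * real n powr (- (\<kappa> + \<delta>))"
    proof -
      have "(real n powr (- (\<kappa> + \<delta>) / 2))\<^sup>2 = real n powr (- (\<kappa> + \<delta>) / 2 + - (\<kappa> + \<delta>) / 2)" by (simp only: powr_add power2_eq_square)
      then show ?thesis by (simp add: u_def power_mult_distrib)
    qed
    moreover have "v\<^sup>2 = real n powr (- 1 - \<delta>)"
    proof -
      have "v\<^sup>2 = real n powr ((- 1 - \<delta>) / 2 + (- 1 - \<delta>) / 2)" unfolding v_def by (simp only: powr_add power2_eq_square)
      then show ?thesis by simp
    qed
    moreover have "\<bar>u * v\<bar> = u * v" by (rule abs_of_nonneg) (simp add: u_def v_def)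
    ultimately show "norm (norm (b n) * real n powr (- \<sigma>)) \<le> (norm (b n))\<^sup>2 * real n powr (- (\<kappa> + \<delta>)) + real n powr (- 1 - \<delta>)"
      by simp
  qed
qed

section \<open>The dual form\<close>

text \<open>Both logarithms have imaginary part in (0, pi), so their difference stays on the
  principal branch. This makes the branches in the dual form consistent under z -> z + 1.\<close>

lemma Ln_divide_add_1:
  assumes "Im z > 0"
  shows "Ln ((z + 1) / z) = Ln (z + 1) - Ln z"
proof (rule Ln_unique)
  have "z \<noteq> 0" "z + 1 \<noteq> 0" using assms by (auto simp: complex_eq_iff)
  then show "exp (Ln (z + 1) - Ln z) = (z + 1) / z" by (simp add: exp_diff)
  have "Im (z + 1) > 0" using assms by simp
  from Im_Ln_pos_lt_imp[OF this] Im_Ln_pos_lt_imp[OF assms]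
  show "- pi < Im (Ln (z + 1) - Ln z)" "Im (Ln (z + 1) - Ln z) \<le> pi" by auto
qed

lemma real_powr_power:
  fixes x a :: real
  assumes "x > 0"
  shows "(x powr a) ^ n = x powr (a * real n)"
proof -
  have "x powr a > 0" using assms by simp
  then have "(x powr a) ^ n = (x powr a) powr real n" by (simp only: powr_realpow)
  then show ?thesis by (simp only: powr_powr)
qed

lemma square_bound_of_invariant_bound:
  fixes x y B :: real
  assumes "x ^ 4 * y ^ k \<le> B" "y > 0" "x \<ge> 0"
  shows "x\<^sup>2 \<le> sqrt B * y powr (- (real k / 2))"
proof (rule power2_le_imp_le)
  have "0 \<le> x ^ 4 * y ^ k" using assms by simp
  then have B: "B \<ge> 0" using assms(1) by linarith
  have "(y powr (- (real k / 2)))\<^sup>2 = y powr (- (real k / 2) + - (real k / 2))" by (simp only: powr_add power2_eq_square)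
  also have "\<dots> = 1 / y ^ k" using powr_realpow[OF assms(2), of k] by (simp add: powr_minus_divide)
  finally have e: "(sqrt B * y powr (- (real k / 2)))\<^sup>2 = B / y ^ k" using B by (simp add: power_mult_distrib)
  have "(x\<^sup>2)\<^sup>2 = x ^ 4" by simp
  also have "\<dots> \<le> B / y ^ k" using assms by (simp add: pos_le_divide_eq)
  finally show "(x\<^sup>2)\<^sup>2 \<le> (sqrt B * y powr (- (real k / 2)))\<^sup>2" unfolding e .
  show "0 \<le> sqrt B * y powr (- (real k / 2))" using B by simp
qed

context half_integral_cusp_form
begin

lemma f_periodic: "f (z + 1) = f z" if "Im z > 0"
proof -
  have "theta_multiplier 0 1 z = 1" by (simp add: theta_multiplier_def shimura_symbol_def eps_factor_def)
  moreover have "\<psi> 1 = 1" using chr by (simp add: dirichlet_character_def)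
  ultimately show ?thesis using law[of 1 1 1 0 z] that by (simp add: moebius_action_def)
qed

lemma f_vanishes: "(f \<longlongrightarrow> 0) (filtercomap Im at_top)"
  using vanishes_at_cusps[where a = 1 and b = 0 and c = 0 and d = 1] by (simp add: moebius_action_def)

lemma f_expansion: "fourier_coeffs f 0 = 0" "q_expansion (fourier_coeffs f) f"
proof -
  obtain b where "b 0 = 0" "q_expansion b f" using fourier_expansion_exists[OF hol f_periodic f_vanishes] by blast
  then show "fourier_coeffs f 0 = 0" "q_expansion (fourier_coeffs f) f" by (simp_all add: fourier_coeffs_eqI)
qed

abbreviation "fs \<equiv> dual_form k N f"

lemma Im_fricke: "Im (- 1 / (of_nat N * z)) = Im z / (real N * (norm z)\<^sup>2)"
proof -
  have "Im (- 1 / w) = Im w / (norm w)\<^sup>2" for w by (simp add: Im_divide cmod_power2)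
  then have "Im (- 1 / (of_nat N * z)) = Im (of_nat N * z) / (norm (of_nat N * z))\<^sup>2" by blast
  also have "\<dots> = Im z / (real N * (norm z)\<^sup>2)" using N0 by (simp add: norm_mult power_mult_distrib power2_eq_square)
  finally show ?thesis .
qed

lemma fricke_upper: "Im z > 0 \<Longrightarrow> Im (- 1 / (of_nat N * z)) > 0"
  unfolding Im_fricke using N0 by (auto intro!: divide_pos_pos mult_pos_pos)

lemma dual_hol: "fs holomorphic_on {z. Im z > 0}"
proof -
  have "(f \<circ> (\<lambda>z. - 1 / (of_nat N * z))) holomorphic_on {z. Im z > 0}"
    by (rule holomorphic_on_compose_gen[OF _ hol]) (use N0 fricke_upper in \<open>auto intro!: holomorphic_intros\<close>)
  moreover have "of_real (sqrt (real N)) * z \<notin> \<real>\<^sub>\<le>\<^sub>0" if "Im z > 0" for z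
    using that N0 by (auto simp: complex_nonpos_Reals_iff)
  ultimately show ?thesis unfolding dual_form_def[abs_def] o_def by (intro holomorphic_intros) auto
qed

text \<open>Under z -> -1/(Nz) translation by 1 becomes the matrix with rows (1, 0) and (-N, 1) in
  the level group. Its multiplier is the square root of (z + 1)/z, exactly the change of the power
  in front of f.\<close>

lemma dual_periodic: "fs (z + 1) = fs z" if z: "Im z > 0"
proof -
  define w where "w = - 1 / (of_nat N * z)"
  have w: "Im w > 0" unfolding w_def by (rule fricke_upper[OF z])
  have nz: "z \<noteq> 0" "z + 1 \<noteq> 0" using z by (auto simp: complex_eq_iff)
  have cw: "of_int (- int N) * w + of_int 1 = (z + 1) / z" using nz N0 by (simp add: w_def field_simps)
  have "moebius_action 1 0 (- int N) 1 w = w / ((z + 1) / z)" unfolding moebius_action_def cw by simp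
  also have "\<dots> = - 1 / (of_nat N * (z + 1))" using nz N0 by (simp add: w_def field_simps)
  finally have m: "moebius_action 1 0 (- int N) 1 w = - 1 / (of_nat N * (z + 1))" .
  have t: "theta_multiplier (- int N) 1 w = csqrt ((z + 1) / z)"
    unfolding theta_multiplier_def cw by (simp add: shimura_symbol_def eps_factor_def)
  have "\<psi> 1 = 1" using chr by (simp add: dirichlet_character_def)
  then have fl: "f (- 1 / (of_nat N * (z + 1))) = csqrt ((z + 1) / z) ^ k * f w"
    using law[of 1 1 0 "- int N" w] w unfolding m t by simp
  define L where "L = of_real (ln (sqrt (real N))) + Ln z"
  have ln: "Ln (of_real (sqrt (real N)) * u) = of_real (ln (sqrt (real N))) + Ln u" if "u \<noteq> 0" for u
    using Ln_times_of_real[of "sqrt (real N)" u] N0 that by (simp add: Ln_of_real)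
  have sq: "csqrt ((z + 1) / z) ^ k = exp (of_real (real k / 2) * (Ln (z + 1) - Ln z))"
    using nz by (simp add: csqrt_exp_Ln Ln_divide_add_1[OF z] exp_of_nat_mult[symmetric])
  have "(of_real (sqrt (real N)) * (z + 1)) powr (- of_real (real k / 2)) * csqrt ((z + 1) / z) ^ k
      = exp (- of_real (real k / 2) * (of_real (ln (sqrt (real N))) + Ln (z + 1)) + of_real (real k / 2) * (Ln (z + 1) - Ln z))"
    unfolding sq exp_add powr_def ln[OF nz(2)] using nz N0 by simp
  also have "\<dots> = exp (- of_real (real k / 2) * (of_real (ln (sqrt (real N))) + Ln z))"
    by (rule arg_cong[where f = exp]) (simp add: algebra_simps)
  also have "\<dots> = (of_real (sqrt (real N)) * z) powr (- of_real (real k / 2))"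
    unfolding powr_def ln[OF nz(1)] using nz N0 by simp
  finally show ?thesis unfolding dual_form_def fl w_def[symmetric] by (metis mult.assoc)
qed

lemma norm_dual: "norm (fs z) = (sqrt (real N) * norm z) powr (- (real k / 2)) * norm (f (- 1 / (of_nat N * z)))"
  unfolding dual_form_def norm_mult by (subst norm_powr_real_powr') (simp_all add: norm_mult)

text \<open>Up to a constant of absolute value N^(k/4) the dual form at z is the translate of f to
  the cusp 0, taken at Nz.\<close>

lemma dual_vanishes: "(fs \<longlongrightarrow> 0) (filtercomap Im at_top)"
proof -
  have "((\<lambda>z. f (moebius_action 0 (- 1) 1 0 z) / csqrt (of_int 1 * z + of_int 0) ^ k) \<longlongrightarrow> 0) (filtercomap Im at_top)"
    by (rule vanishes_at_cusps) simp
  from filterlim_compose[OF this filterlim_of_nat_mult_Im[OF N0]]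
  have "((\<lambda>z. f (- 1 / (of_nat N * z)) / csqrt (of_nat N * z) ^ k) \<longlongrightarrow> 0) (filtercomap Im at_top)"
    by (simp add: moebius_action_def)
  then have "((\<lambda>z. real N powr (real k / 4) * norm (f (- 1 / (of_nat N * z)) / csqrt (of_nat N * z) ^ k)) \<longlongrightarrow> real N powr (real k / 4) * 0) (filtercomap Im at_top)"
    by (intro tendsto_mult tendsto_const tendsto_norm_zero)
  moreover have "\<forall>\<^sub>F z in filtercomap Im at_top. real N powr (real k / 4) * norm (f (- 1 / (of_nat N * z)) / csqrt (of_nat N * z) ^ k) = norm (fs z)"
    unfolding eventually_filtercomap_at_top_dense
  proof (intro exI[of _ 0] allI impI)
    fix z :: complex assume z: "0 < Im z"
    have nz: "norm z > 0" using z by (auto simp: complex_eq_iff)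
    have "norm (csqrt (of_nat N * z) ^ k) = sqrt (real N * norm z) ^ k"
      by (simp add: norm_power norm_mult)
    also have "\<dots> = (real N * norm z) powr (real k / 2)"
      using nz N0 real_powr_power[of "real N * norm z" "1 / 2" k] by (simp add: powr_half_sqrt)
    finally have 1: "norm (csqrt (of_nat N * z) ^ k) = real N powr (real k / 2) * norm z powr (real k / 2)"
      using nz N0 by (simp add: powr_mult)
    have 2: "(sqrt (real N) * norm z) powr (- (real k / 2)) = real N powr (- (real k / 4)) * norm z powr (- (real k / 2))"
      using nz N0 by (simp add: powr_mult powr_half_sqrt[symmetric] powr_powr)
    have 3: "real N powr (real k / 4) / real N powr (real k / 2) = real N powr (- (real k / 4))"
      by (simp add: powr_diff[symmetric])
    have "real N powr (real k / 4) * norm (f (- 1 / (of_nat N * z)) / csqrt (of_nat N * z) ^ k)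
      = (real N powr (real k / 4) / real N powr (real k / 2)) * (1 / norm z powr (real k / 2)) * norm (f (- 1 / (of_nat N * z)))"
      unfolding norm_divide 1 by simp
    then show "real N powr (real k / 4) * norm (f (- 1 / (of_nat N * z)) / csqrt (of_nat N * z) ^ k) = norm (fs z)"
      unfolding norm_dual 2 3 by (simp add: powr_minus_divide)
  qed
  ultimately have "((\<lambda>z. norm (fs z)) \<longlongrightarrow> 0) (filtercomap Im at_top)"
    by (simp add: tendsto_cong)
  then show ?thesis by (rule tendsto_norm_zero_cancel)
qed

lemma dual_expansion: "fourier_coeffs fs 0 = 0" "q_expansion (fourier_coeffs fs) fs"
proof -
  obtain b where "b 0 = 0" "q_expansion b fs" using fourier_expansion_exists[OF dual_hol dual_periodic dual_vanishes] by blast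
  then show "fourier_coeffs fs 0 = 0" "q_expansion (fourier_coeffs fs) fs" by (simp_all add: fourier_coeffs_eqI)
qed

text \<open>The normalization of the dual form makes z -> -1/(Nz) preserve this quantity, so the
  bound for f transfers without a second argument for the dual form.\<close>

lemma dual_invariant: "norm (fs z) ^ 4 * Im z ^ k = norm (f (- 1 / (of_nat N * z))) ^ 4 * Im (- 1 / (of_nat N * z)) ^ k"
  if z: "Im z > 0"
proof -
  have nz: "norm z > 0" using z by (auto simp: complex_eq_iff)
  define s where "s = sqrt (real N) * norm z"
  have s: "s > 0" using nz N0 by (simp add: s_def)
  have s2: "s\<^sup>2 = real N * (norm z)\<^sup>2" by (simp add: s_def power_mult_distrib)
  have "(s powr (- (real k / 2))) ^ 4 = s powr (- (2 * real k))"
    using real_powr_power[OF s, of "- (real k / 2)" 4] by (simp add: mult.commute)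
  also have "\<dots> = 1 / s ^ (2 * k)"
    using powr_realpow[OF s, of "2 * k"] by (simp add: powr_minus_divide)
  also have "\<dots> = 1 / (real N * (norm z)\<^sup>2) ^ k" unfolding power_mult s2 ..
  finally have 1: "(s powr (- (real k / 2))) ^ 4 = 1 / (real N * (norm z)\<^sup>2) ^ k" .
  show ?thesis unfolding norm_dual s_def[symmetric] power_mult_distrib 1 Im_fricke by (simp add: power_divide power_mult_distrib)
qed

lemma coeffs_abs_summable:
  assumes "\<sigma> > (real k / 2 + 1) / 2"
  shows "summable (\<lambda>n. norm (fourier_coeffs f n) * real n powr (- \<sigma>))"
    and "summable (\<lambda>n. norm (fourier_coeffs fs n) * real n powr (- \<sigma>))"
proof -
  obtain B where B: "norm (f z) ^ 4 * Im z ^ k \<le> B" if "Im z > 0" for z using invariant_bounded by blast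
  have B': "norm (fs z) ^ 4 * Im z ^ k \<le> B" if "Im z > 0" for z
    unfolding dual_invariant[OF that] by (rule B[OF fricke_upper[OF that]])
  show "summable (\<lambda>n. norm (fourier_coeffs f n) * real n powr (- \<sigma>))"
    by (rule coefficients_abs_summable[OF f_expansion(2) _ square_bound_of_invariant_bound[OF B] assms]) auto
  show "summable (\<lambda>n. norm (fourier_coeffs fs n) * real n powr (- \<sigma>))"
    by (rule coefficients_abs_summable[OF dual_expansion(2) _ square_bound_of_invariant_bound[OF B'] assms]) auto
qed

text \<open>On the axis the argument of the power is i sqrt(N) t; its phase i^kappa is the root
  number.\<close>

lemma fricke_on_imaginary_axis:
  assumes t: "t > 0"
  shows "f (\<i> * of_real (1 / (real N * t))) = root_number k * of_real ((sqrt (real N) * t) powr (real k / 2)) * fs (\<i> * of_real t)"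
proof -
  define w where "w = of_real (sqrt (real N)) * (\<i> * of_real t)"
  have w: "w = \<i> * of_real (sqrt (real N) * t)" by (simp add: w_def)
  have s: "sqrt (real N) * t > 0" using N0 t by simp
  have w0: "w \<noteq> 0" using s unfolding w by (metis complex_i_not_zero mult_eq_0_iff of_real_eq_0_iff less_irrefl)
  have "- 1 / (of_nat N * (\<i> * of_real t)) = \<i> * of_real (1 / (real N * t))"
    using N0 t by (simp add: complex_eq_iff Re_divide Im_divide power2_eq_square)
  then have "fs (\<i> * of_real t) = w powr (- of_real (real k / 2)) * f (\<i> * of_real (1 / (real N * t)))"
    by (simp only: dual_form_def w_def)
  then have "f (\<i> * of_real (1 / (real N * t))) = w powr of_real (real k / 2) * fs (\<i> * of_real t)"
    using w0 by (simp add: powr_minus)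
  also have "w powr of_real (real k / 2) = root_number k * of_real ((sqrt (real N) * t) powr (real k / 2))"
  proof -
    have "w powr of_real (real k / 2) = of_real (sqrt (real N) * t) powr of_real (real k / 2) * exp (\<i> * of_real (pi / 2) * of_real (real k / 2))"
    proof -
      have nz: "sqrt (real N) * t \<noteq> 0" and "\<bar>sqrt (real N) * t\<bar> = sqrt (real N) * t" and "sgn (sqrt (real N) * t) = 1" using s by (simp_all only: abs_of_pos sgn_pos)
      then show ?thesis unfolding w using imaginary_powr[OF nz, of "of_real (real k / 2)"] by (simp only: mult_1)
    qed
    moreover have "root_number k = exp (\<i> * of_real (pi / 2) * of_real (real k / 2))"
      unfolding root_number_def using imaginary_powr[of 1 "of_real (real k / 2)"] by simp
    moreover have "complex_of_real (sqrt (real N) * t) powr of_real (real k / 2) = of_real ((sqrt (real N) * t) powr (real k / 2))"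
      using s by (intro powr_of_real) auto
    ultimately show ?thesis by (simp add: mult.commute)
  qed
  finally show ?thesis .
qed

lemma q_expansion_imaginary_axis:
  assumes "q_expansion b F" "t > 0"
  shows "F (\<i> * of_real t) = (\<Sum>n. b n * of_real (exp (- (2 * pi * t * real n))))"
proof -
  have "exp (2 * of_real pi * \<i> * of_nat n * (\<i> * of_real t)) = complex_of_real (exp (- (2 * pi * t * real n)))" for n
    unfolding exp_of_real[symmetric] by (rule arg_cong[where f = exp]) (simp add: algebra_simps)
  moreover have "(\<lambda>n. b n * exp (2 * of_real pi * \<i> * of_nat n * (\<i> * of_real t))) sums F (\<i> * of_real t)"
    using assms by (simp add: q_expansion_def)
  ultimately show ?thesis by (simp add: sums_iff)
qed

text \<open>The quadratic substitution turns the half-integral power t^(k/2) into the odd integral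
  power u^k, as the Gaussian moments require.\<close>

lemma theta_transformation:
  assumes u: "u > 0" and k: "k = 2 * h + 1"
  shows "(\<Sum>n. fourier_coeffs f n * of_real (exp (- (real n / u\<^sup>2)))) =
    root_number k * of_real ((2 * pi / sqrt (real N)) powr (real k / 2)) * of_real (u ^ k) *
    (\<Sum>n. fourier_coeffs fs n * of_real (exp (- ((4 * pi / sqrt (real N))\<^sup>2 / 4 * real n * u\<^sup>2))))"
proof -
  \<comment> \<open>Solves 2 pi/(N t) = 1/u^2, so that f is evaluated where its terms become
    exp(-n/u^2).\<close>
  define t where "t = 2 * pi * u\<^sup>2 / real N"
  have t: "t > 0" using u N0 by (simp add: t_def)
  have t': "1 / (real N * t) > 0" using t N0 by simp
  have 1: "2 * pi * (1 / (real N * t)) * real n = real n / u\<^sup>2" for n using N0 by (simp add: t_def)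
  have 2: "2 * pi * t * real n = (4 * pi / sqrt (real N))\<^sup>2 / 4 * real n * u\<^sup>2" for n
    by (simp add: t_def power_divide power2_eq_square)
  have "sqrt (real N) * t = 2 * pi / sqrt (real N) * u\<^sup>2"
    using N0 by (simp add: t_def field_simps flip: power2_eq_square)
  then have "(sqrt (real N) * t) powr (real k / 2) = (2 * pi / sqrt (real N)) powr (real k / 2) * (u\<^sup>2) powr (real k / 2)"
    by (simp only: powr_mult)
  also have "(u\<^sup>2) powr (real k / 2) = u ^ k"
  proof -
    have "u\<^sup>2 = u powr 2" using u by simp
    then show ?thesis using powr_realpow[OF u, of k] by (simp only: powr_powr) simp
  qed
  finally have 3: "(sqrt (real N) * t) powr (real k / 2) = (2 * pi / sqrt (real N)) powr (real k / 2) * u ^ k" .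
  show ?thesis
    using fricke_on_imaginary_axis[OF t]
    unfolding q_expansion_imaginary_axis[OF f_expansion(2) t'] q_expansion_imaginary_axis[OF dual_expansion(2) t] 1 2 3
    by (simp only: of_real_mult mult.assoc)
qed

end

theorem mainTheorem1:
  fixes k h N :: nat and \<psi> :: "int \<Rightarrow> complex" and f :: "complex \<Rightarrow> complex" and \<alpha> :: real
  assumes "k = 2 * h + 1"
    and "N > 0" and "4 dvd N"
    and "dirichlet_character N \<psi>"
    and "cusp_form k N \<psi> f"
    and "\<alpha> > 0"
  shows "\<exists>(Fst :: nat \<Rightarrow> complex \<Rightarrow> complex) (Ftw :: complex \<Rightarrow> complex).
    (\<forall>l\<le>h_star h. Fst l holomorphic_on UNIV \<and>
       (\<forall>s. Re s > 1 \<longrightarrow> Fst l s = F_star h N f \<alpha> l s)) \<and>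
    Ftw meromorphic_on UNIV \<and>
    (\<forall>s. Re s > 1 \<longrightarrow> Ftw s = standard_twist k f \<alpha> s) \<and>
    (\<forall>s. (\<forall>l\<le>h_star h. 2 * (1 - s) - 1/2 - of_nat l \<notin> \<int>\<^sub>\<le>\<^sub>0) \<longrightarrow>
       Ftw s =
         root_number k / (\<i> * of_real (sqrt (2 * pi))) *
         of_real (sqrt (real N) / (4 * pi)) powr (1 - 2 * s) *
         (\<Sum>l\<le>h_star h. of_real (a_coeff (h_star h) l) *
            Gamma (2 * (1 - s) - 1/2 - of_nat l) * Fst l (1 - s)))"
proof -
  have k: "k = 2 * h + 1" by fact
  interpret half_integral_cusp_form k N \<psi> f using assms by unfold_locales auto
  \<comment> \<open>The mean-square exponent (kappa + 1)/2 equals h/2 + 3/4 for kappa = h +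
    1/2.\<close>
  have \<sigma>: "\<sigma> > (real k / 2 + 1) / 2" if "\<sigma> > real h / 2 + 3 / 4" for \<sigma> :: real
    using that by (simp add: k field_simps)
  interpret twist_setup f h N \<alpha>
  proof unfold_locales
    show "4 * pi / sqrt (real N) > 0" using N0 by simp
    show "root_number (2 * h + 1) * of_real ((2 * pi / sqrt (real N)) powr (real (2 * h + 1) / 2)) \<noteq> 0"
      using N0 by (simp add: root_number_def)
    show "fourier_coeffs f 0 = 0" "fourier_coeffs (dual_form (2 * h + 1) N f) 0 = 0"
      using f_expansion(1) dual_expansion(1) by (simp_all only: k)
    show "summable (\<lambda>n. norm (fourier_coeffs f n) * real n powr (- \<sigma>))"
      "summable (\<lambda>n. norm (fourier_coeffs (dual_form (2 * h + 1) N f) n) * real n powr (- \<sigma>))"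
      if "\<sigma> > real h / 2 + 3 / 4" for \<sigma>
      using coeffs_abs_summable[OF \<sigma>[OF that]] by (simp_all only: k)
    show "(\<Sum>n. fourier_coeffs f n * of_real (exp (- (real n / u ^ 2)))) =
        root_number (2 * h + 1) * of_real ((2 * pi / sqrt (real N)) powr (real (2 * h + 1) / 2)) * of_real (u ^ (2 * h + 1)) *
        (\<Sum>n. fourier_coeffs (dual_form (2 * h + 1) N f) n * of_real (exp (- ((4 * pi / sqrt (real N)) ^ 2 / 4 * real n * u ^ 2))))"
      if "u > 0" for u
      using theta_transformation[OF that k] by (simp only: k)
    show "N > 0" "\<alpha> > 0" by fact+
  qed
  show ?thesis unfolding k by (rule twist_functional_equation)
qed

end
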